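(* For each $\lambda\ge2$, $\mu_\lambda$ is a compound Poisson measure on $(\mathcal D',\mathcal C_\sigma(\mathcal D'))$ whose Lévy–Khintchine representation of the Fourier transform reads as follows: $$\int_{\mathcal D'}e^{i\langle\omega,\varphi\rangle}\,\mu_\lambda(d\omega)=\exp\left[\int_{X\times\mathbb R_+}(e^{is\varphi(x)}-1)\,\sigma(dx)\,\nu_\lambda(ds)\right],\qquad\varphi\in\mathcal D,$$ where $$\nu_2(ds)=\frac{e^{-s}}{s}\,ds,\qquad \nu_\lambda=\sum_{k=1}^\infty\frac{p_\lambda^k}{k}\,\delta_{\sqrt{\lambda^2-4}\,k}\quad(\lambda>2),\qquad p_\lambda=\frac{\lambda-\sqrt{\lambda^2-4}}{\lambda+\sqrt{\lambda^2-4}} .$$ In particular, each such $\mu_\lambda$ is concentrated on the set of all Radon measures on $(X,\mathcal B(X))$ of the form $\sum_{n=1}^\infty s_n\delta_{x_n}$, $\{x_n\}\subset X$, $s_n>0$, $n\in\mathbb N$.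
   Context: Setting. $X$ is a complete, connected, oriented, non-compact $C^\infty$ Riemannian manifold; $\sigma$ is a Radon measure on $(X,\mathcal B(X))$ that is non-atomic and non-degenerate ($\sigma(O)>0$ for every non-empty open $O$). $\mathcal D=C_0^\infty(X)$ (real-valued, usual nuclear topology), $\mathcal H=L^2(X;\sigma)$, $\mathcal D'$ is the dual of $\mathcal D$ with respect to the zero space $\mathcal H$, with dual pairing $\langle\cdot,\cdot\rangle$ and cylinder $\sigma$-algebra $\mathcal C_\sigma(\mathcal D')$; a Radon measure $\omega$ on $X$ is identified with the element $\varphi\mapsto\int_X\varphi\,d\omega$ of $\mathcal D'$. $\mathbb R_+=(0,\infty)$. The subscript $\mathbb C$ denotes complexification, $\hat\otimes$ the symmetric tensor power/product, $(\cdot)^\sim$ symmetrization, $\langle\xi\rangle:=\int_X\xi\,d\sigma$. A compound Poisson measure is a probability measure on $\mathcal D'$ whose Fourier transform has the displayed form for some measure $\nu$ on $\mathbb R_+$ (the Lévy measure) with $\int_{\mathbb R_+}\min(1,s)\,\nu(ds)<\infty$. Extended Fock space. Let $A_n$ be the set of collections $\alpha_n=\{\kappa_1,\dots,\kappa_{|\alpha_n|}\}$ of loops over $\{1,\dots,n\}$: the underlying sets of the loops partition $\{1,\dots,n\}$, and a loop is an ordering of its points up to cyclic permutation (so $A_n$ has $n!$ elements); $|\kappa_j|$ is the number of points of $\kappa_j$. For $f^{(n)}\in\mathcal D_{\mathbb C}^{\hat\otimes n}$ let $f^{(n)}_{\alpha_n}(x_1,\dots,x_{|\alpha_n|})=f^{(n)}(x_1,\dots,x_1,\dots,x_{|\alpha_n|},\dots,x_{|\alpha_n|})$,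 with $x_j$ repeated $|\kappa_j|$ times. $\mathcal F^{(n)}_{\mathrm{ext}}(\mathcal H)$ is the closure of $\mathcal D_{\mathbb C}^{\hat\otimes n}$ with respect to $(f^{(n)},g^{(n)})=\sum_{\alpha_n\in A_n}\int_{X^{|\alpha_n|}}(\overline{f^{(n)}}g^{(n)})_{\alpha_n}\,d\sigma^{\otimes|\alpha_n|}$, $\mathcal F^{(0)}_{\mathrm{ext}}=\mathbb C$, and $\mathcal F_{\mathrm{ext}}(\mathcal H)=\bigoplus_{n\ge0}\mathcal F^{(n)}_{\mathrm{ext}}(\mathcal H)\,n!$ (norm squared $\sum_n\|f^{(n)}\|^2n!$). $\mathcal F_{\mathrm{fin}}(\mathcal D)$ is the dense set of finite sequences with $f^{(n)}\in\mathcal D_{\mathbb C}^{\hat\otimes n}$; $\Omega=(1,0,0,\dots)$. Operators. For $\xi\in\mathcal D$, on $\mathcal F_{\mathrm{fin}}(\mathcal D)$: $a^+(\xi)f^{(n)}=\xi\hat\otimes f^{(n)}$; $(a^0(\xi)f^{(n)})(x_1,\dots,x_n)=n(\xi(x_1)f^{(n)}(x_1,\dots,x_n))^\sim$; $a^-(\xi)=a_1^-(\xi)+a_2^-(\xi)$ with $(a_1^-(\xi)f^{(n)})(x_1,\dots,x_{n-1})=n\int_X\xi(x)f^{(n)}(x,x_1,\dots,x_{n-1})\,\sigma(dx)$, $(a_2^-(\xi)f^{(n)})(x_1,\dots,x_{n-1})=n(n-1)(\xi(x_1)f^{(n)}(x_1,x_1,x_2,\dots,x_{n-1}))^\sim$.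 For $\lambda\ge0$, $a_\lambda(\xi)=a^+(\xi)+\lambda a^0(\xi)+a^-(\xi)+c_\lambda\langle\xi\rangle\mathrm{id}$, with $c_\lambda=\lambda/2$ for $\lambda\in[0,2]$ and $c_\lambda=2/(\lambda+\sqrt{\lambda^2-4})$ for $\lambda>2$. These operators are essentially selfadjoint in $\mathcal F_{\mathrm{ext}}(\mathcal H)$ with commuting closures $a_\lambda^\sim(\xi)$. $\mu_\lambda$ and $I_\lambda$ are the unique probability measure on $(\mathcal D',\mathcal C_\sigma(\mathcal D'))$ and the unique unitary $I_\lambda:\mathcal F_{\mathrm{ext}}(\mathcal H)\to L^2(\mathcal D';\mu_\lambda)$ such that $I_\lambda\Omega=1$ and, for every $\xi\in\mathcal D$, $I_\lambda$ carries $a_\lambda^\sim(\xi)$ to multiplication by $\langle\cdot,\xi\rangle$.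
   Formalization: If λ>2 and σ(X)<∞, μ_λ gives the zero measure positive mass, so the last sentence fails literally; the formal one allows the zero measure in general and proves the literal claim (points x_n may repeat) when λ=2 or σ(X)=∞. *)

theory Defs
  imports "HOL-Probability.Probability"
begin

section \<open>Oriented Riemannian manifolds\<close>

text \<open>
  The manifold is the whole type \<open>'a\<close>, with its type-class topology (Hausdorff and second
  countable).  A chart is a pair of its domain and its coordinate map into \<open>real ^ 'n\<close>, so that
  \<open>CARD('n)\<close> is the dimension.
\<close>

type_synonym ('a, 'n) chart = "'a set \<times> ('a \<Rightarrow> real ^ 'n)"

abbreviation chart_inv :: "('a, 'n) chart \<Rightarrow> real ^ 'n \<Rightarrow> 'a" where
  "chart_inv c \<equiv> inv_into (fst c) (snd c)"

abbreviation chart_img :: "('a, 'n) chart \<Rightarrow> (real ^ 'n) set" where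
  "chart_img c \<equiv> snd c ` fst c"

fun iter_deriv :: "(real ^ 'n::finite) list \<Rightarrow> (real ^ 'n \<Rightarrow> 'b::real_normed_vector) \<Rightarrow> real ^ 'n \<Rightarrow> 'b"
  where
    "iter_deriv [] f = f"
  | "iter_deriv (v # vs) f = (\<lambda>x. frechet_derivative (iter_deriv vs f) (at x) v)"

text \<open>Meant for open \<open>S\<close>; continuity of the derivatives follows from their differentiability.\<close>

definition smooth_on :: "(real ^ 'n::finite) set \<Rightarrow> (real ^ 'n \<Rightarrow> 'b::real_normed_vector) \<Rightarrow> bool" where
  "smooth_on S f \<longleftrightarrow> (\<forall>vs. \<forall>x\<in>S. iter_deriv vs f differentiable (at x))"

definition is_chart :: "('a::topological_space, 'n::finite) chart \<Rightarrow> bool" where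
  "is_chart c \<longleftrightarrow> open (fst c) \<and> open (chart_img c) \<and>
     homeomorphism (fst c) (chart_img c) (snd c) (chart_inv c)"

abbreviation transition :: "('a, 'n) chart \<Rightarrow> ('a, 'n) chart \<Rightarrow> real ^ 'n \<Rightarrow> real ^ 'n" where
  "transition c d \<equiv> (\<lambda>y. snd d (chart_inv c y))"

text \<open>A smooth atlas in which all changes of coordinates preserve the orientation.\<close>

definition oriented_atlas :: "('a::topological_space, 'n::finite) chart set \<Rightarrow> bool" where
  "oriented_atlas \<A> \<longleftrightarrow>
     (\<forall>c\<in>\<A>. is_chart c) \<and> (\<Union>c\<in>\<A>. fst c) = UNIV \<and>
     (\<forall>c\<in>\<A>. \<forall>d\<in>\<A>. smooth_on (snd c ` (fst c \<inter> fst d)) (transition c d)) \<and>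
     (\<forall>c\<in>\<A>. \<forall>d\<in>\<A>. \<forall>x\<in>fst c \<inter> fst d.
        det (matrix (frechet_derivative (transition c d) (at (snd c x)))) > 0)"

text \<open>
  \<open>G c x u v\<close> is the inner product of the tangent vectors at \<open>x\<close> that have the components \<open>u\<close> and
  \<open>v\<close> in the chart \<open>c\<close>.
\<close>

definition riemannian_metric ::
  "('a::topological_space, 'n::finite) chart set \<Rightarrow>
   (('a, 'n) chart \<Rightarrow> 'a \<Rightarrow> real ^ 'n \<Rightarrow> real ^ 'n \<Rightarrow> real) \<Rightarrow> bool" where
  "riemannian_metric \<A> G \<longleftrightarrow>
     (\<forall>c\<in>\<A>. \<forall>x\<in>fst c. bilinear (G c x) \<and> (\<forall>u v. G c x u v = G c x v u) \<and>
        (\<forall>u. u \<noteq> 0 \<longrightarrow> G c x u u > 0)) \<and>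
     (\<forall>c\<in>\<A>. \<forall>u v. smooth_on (chart_img c) (\<lambda>y. G c (chart_inv c y) u v)) \<and>
     (\<forall>c\<in>\<A>. \<forall>d\<in>\<A>. \<forall>x\<in>fst c \<inter> fst d. \<forall>u v.
        G c x u v = G d x (frechet_derivative (transition c d) (at (snd c x)) u)
                          (frechet_derivative (transition c d) (at (snd c x)) v))"

definition piecewise_C1_path ::
  "('a::topological_space, 'n::finite) chart set \<Rightarrow> (real \<Rightarrow> 'a) \<Rightarrow> bool" where
  "piecewise_C1_path \<A> \<gamma> \<longleftrightarrow> continuous_on {0..1} \<gamma> \<and>
     (\<exists>F. finite F \<and>
        (\<forall>c\<in>\<A>. (\<lambda>t. snd c (\<gamma> t)) C1_differentiable_on {t \<in> {0<..<1} - F. \<gamma> t \<in> fst c}))"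

text \<open>The speed does not depend on the chart that is selected at \<open>\<gamma> t\<close>.\<close>

definition riemannian_speed ::
  "('a::topological_space, 'n::finite) chart set \<Rightarrow>
   (('a, 'n) chart \<Rightarrow> 'a \<Rightarrow> real ^ 'n \<Rightarrow> real ^ 'n \<Rightarrow> real) \<Rightarrow> (real \<Rightarrow> 'a) \<Rightarrow> real \<Rightarrow> real" where
  "riemannian_speed \<A> G \<gamma> t =
     (let c = (SOME c. c \<in> \<A> \<and> \<gamma> t \<in> fst c);
          v = vector_derivative (\<lambda>r. snd c (\<gamma> r)) (at t)
      in sqrt (G c (\<gamma> t) v v))"

definition riemannian_dist ::
  "('a::topological_space, 'n::finite) chart set \<Rightarrow>
   (('a, 'n) chart \<Rightarrow> 'a \<Rightarrow> real ^ 'n \<Rightarrow> real ^ 'n \<Rightarrow> real) \<Rightarrow> 'a \<Rightarrow> 'a \<Rightarrow> ennreal" where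
  "riemannian_dist \<A> G x y =
     (INF \<gamma>\<in>{\<gamma>. piecewise_C1_path \<A> \<gamma> \<and> \<gamma> 0 = x \<and> \<gamma> 1 = y}.
        \<integral>\<^sup>+t\<in>{0..1}. ennreal (riemannian_speed \<A> G \<gamma> t) \<partial>lborel)"

definition riemannian_complete ::
  "('a::topological_space, 'n::finite) chart set \<Rightarrow>
   (('a, 'n) chart \<Rightarrow> 'a \<Rightarrow> real ^ 'n \<Rightarrow> real ^ 'n \<Rightarrow> real) \<Rightarrow> bool" where
  "riemannian_complete \<A> G \<longleftrightarrow>
     (\<forall>X::nat \<Rightarrow> 'a.
        (\<forall>e>0. \<exists>N. \<forall>m\<ge>N. \<forall>n\<ge>N. riemannian_dist \<A> G (X m) (X n) < e) \<longrightarrow>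
        (\<exists>l. (\<lambda>k. riemannian_dist \<A> G (X k) l) \<longlonglongrightarrow> 0))"


section \<open>Measures on the manifold\<close>

definition radon_measure :: "'a::topological_space measure \<Rightarrow> bool" where
  "radon_measure M \<longleftrightarrow> sets M = sets borel \<and>
     (\<forall>K. compact K \<longrightarrow> emeasure M K < \<infinity>) \<and>
     (\<forall>B\<in>sets borel. emeasure M B = (SUP K\<in>{K. compact K \<and> K \<subseteq> B}. emeasure M K))"

definition atom_of :: "'a measure \<Rightarrow> 'a set \<Rightarrow> bool" where
  "atom_of M A \<longleftrightarrow> A \<in> sets M \<and> emeasure M A > 0 \<and>
     (\<forall>B\<in>sets M. B \<subseteq> A \<and> emeasure M B < emeasure M A \<longrightarrow> emeasure M B = 0)"

definition non_atomic :: "'a measure \<Rightarrow> bool" where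
  "non_atomic M \<longleftrightarrow> (\<nexists>A. atom_of M A)"

definition non_degenerate :: "'a::topological_space measure \<Rightarrow> bool" where
  "non_degenerate M \<longleftrightarrow> (\<forall>U. open U \<and> U \<noteq> {} \<longrightarrow> emeasure M U > 0)"

text \<open>The measure \<open>\<Sum>n. s n \<delta>\<^bsub>x n\<^esub>\<close> on the measurable space \<open>M\<close>.\<close>

definition dirac_series :: "'b measure \<Rightarrow> (nat \<Rightarrow> real) \<Rightarrow> (nat \<Rightarrow> 'b) \<Rightarrow> 'b measure" where
  "dirac_series M s x = distr (density (count_space UNIV) (\<lambda>n. ennreal (s n))) M x"


section \<open>Test functions and their dual\<close>

definition test_functions :: "('a::topological_space, 'n::finite) chart set \<Rightarrow> ('a \<Rightarrow> real) set" where
  "test_functions \<A> = {\<phi>. compact (closure {x. \<phi> x \<noteq> 0}) \<and>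
     (\<forall>c\<in>\<A>. smooth_on (chart_img c) (\<lambda>y. \<phi> (chart_inv c y)))}"

definition seminorm_on_tests ::
  "('a::topological_space, 'n::finite) chart set \<Rightarrow> (('a \<Rightarrow> real) \<Rightarrow> real) \<Rightarrow> bool" where
  "seminorm_on_tests \<A> p \<longleftrightarrow>
     (\<forall>\<phi>\<in>test_functions \<A>. \<forall>\<psi>\<in>test_functions \<A>. p (\<lambda>x. \<phi> x + \<psi> x) \<le> p \<phi> + p \<psi>) \<and>
     (\<forall>\<phi>\<in>test_functions \<A>. \<forall>r. p (\<lambda>x. r * \<phi> x) = \<bar>r\<bar> * p \<phi>)"

text \<open>
  The restriction of \<open>p\<close> to the test functions supported in a compact set \<open>K\<close> is bounded by a
  multiple of the maximum of finitely many of the seminorms \<open>sup {\<bar>\<partial>\<^sub>v\<^sub>s \<phi>\<bar> | x \<in> L}\<close>, with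
  derivatives in a chart around \<open>L\<close>.
\<close>

definition continuous_seminorm ::
  "('a::topological_space, 'n::finite) chart set \<Rightarrow> (('a \<Rightarrow> real) \<Rightarrow> real) \<Rightarrow> bool" where
  "continuous_seminorm \<A> p \<longleftrightarrow> seminorm_on_tests \<A> p \<and>
     (\<forall>K. compact K \<longrightarrow>
       (\<exists>\<Theta> C. finite \<Theta> \<and> (\<forall>(c, L, vs)\<in>\<Theta>. c \<in> \<A> \<and> compact L \<and> L \<subseteq> fst c) \<and>
         (\<forall>\<phi>\<in>test_functions \<A>. \<forall>B\<ge>0. (\<forall>x. x \<notin> K \<longrightarrow> \<phi> x = 0) \<longrightarrow>
           (\<forall>(c, L, vs)\<in>\<Theta>. \<forall>x\<in>L. \<bar>iter_deriv vs (\<lambda>y. \<phi> (chart_inv c y)) (snd c x)\<bar> \<le> B) \<longrightarrow>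
           p \<phi> \<le> C * B)))"

text \<open>The strict inductive limit (LF) topology of \<open>C\<^sub>0\<^sup>\<infinity>(X)\<close>.\<close>

definition test_topology :: "('a::topological_space, 'n::finite) chart set \<Rightarrow> ('a \<Rightarrow> real) topology" where
  "test_topology \<A> = topology_generated_by
     {{\<psi>\<in>test_functions \<A>. p (\<lambda>x. \<psi> x - \<phi> x) < e} | p \<phi> e.
        continuous_seminorm \<A> p \<and> \<phi> \<in> test_functions \<A> \<and> e > 0}"

text \<open>
  Functionals are made extensional, so that each one is represented by exactly one HOL function;
  the pairing \<open>\<langle>\<omega>, \<phi>\<rangle>\<close> is the application \<open>\<omega> \<phi>\<close>.
\<close>

definition dual_space ::
  "('a::topological_space, 'n::finite) chart set \<Rightarrow> (('a \<Rightarrow> real) \<Rightarrow> real) set" where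
  "dual_space \<A> = {\<omega> \<in> extensional (test_functions \<A>).
     (\<forall>\<phi>\<in>test_functions \<A>. \<forall>\<psi>\<in>test_functions \<A>. \<omega> (\<lambda>x. \<phi> x + \<psi> x) = \<omega> \<phi> + \<omega> \<psi>) \<and>
     (\<forall>\<phi>\<in>test_functions \<A>. \<forall>r. \<omega> (\<lambda>x. r * \<phi> x) = r * \<omega> \<phi>) \<and>
     continuous_map (test_topology \<A>) euclideanreal \<omega>}"

definition cylinder_algebra ::
  "('a::topological_space, 'n::finite) chart set \<Rightarrow> (('a \<Rightarrow> real) \<Rightarrow> real) measure" where
  "cylinder_algebra \<A> = sigma (dual_space \<A>)
     {{\<omega> \<in> dual_space \<A>. \<omega> \<phi> \<in> B} | \<phi> B. \<phi> \<in> test_functions \<A> \<and> B \<in> sets borel}"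

definition functional_of_measure ::
  "('a::topological_space, 'n::finite) chart set \<Rightarrow> 'a measure \<Rightarrow> ('a \<Rightarrow> real) \<Rightarrow> real" where
  "functional_of_measure \<A> M = (\<lambda>\<phi>\<in>test_functions \<A>. \<integral>x. \<phi> x \<partial>M)"


section \<open>Symmetric tensor powers\<close>

text \<open>
  A function on \<open>X\<^sup>n\<close> is a function of \<open>x :: nat \<Rightarrow> 'a\<close> that depends on \<open>x 0, \<dots>, x (n - 1)\<close> only;
  coordinates are thus numbered from 0, and for \<open>n = 0\<close> these functions are the constants.
\<close>

definition depends_on_first :: "nat \<Rightarrow> ((nat \<Rightarrow> 'a) \<Rightarrow> complex) \<Rightarrow> bool" where
  "depends_on_first n f \<longleftrightarrow> (\<forall>x y. (\<forall>i<n. x i = y i) \<longrightarrow> f x = f y)"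

fun iter_partial ::
  "(nat \<times> (real ^ 'n::finite)) list \<Rightarrow> ((nat \<Rightarrow> real ^ 'n) \<Rightarrow> complex) \<Rightarrow> (nat \<Rightarrow> real ^ 'n) \<Rightarrow> complex"
  where
    "iter_partial [] F = F"
  | "iter_partial ((i, v) # ds) F =
       (\<lambda>y. vector_derivative (\<lambda>t. iter_partial ds F (y(i := y i + t *\<^sub>R v))) (at 0))"

definition smooth_multi :: "(nat \<Rightarrow> real ^ 'n::finite) set \<Rightarrow> ((nat \<Rightarrow> real ^ 'n) \<Rightarrow> complex) \<Rightarrow> bool" where
  "smooth_multi S F \<longleftrightarrow>
     (\<forall>ds. continuous_on S (iter_partial ds F) \<and>
        (\<forall>y\<in>S. \<forall>i v. (\<lambda>t::real. iter_partial ds F (y(i := y i + t *\<^sub>R v))) differentiable (at 0)))"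

text \<open>
  The \<open>n\<close>-th symmetric tensor power of the complexified space of test functions: the complex,
  symmetric functions in \<open>C\<^sub>0\<^sup>\<infinity>(X\<^sup>n)\<close>.  Smoothness is tested in the product charts
  \<open>\<kappa> 0 \<times> \<dots> \<times> \<kappa> (n - 1)\<close>.
\<close>

definition sym_tests ::
  "('a::topological_space, 'n::finite) chart set \<Rightarrow> nat \<Rightarrow> ((nat \<Rightarrow> 'a) \<Rightarrow> complex) set" where
  "sym_tests \<A> n = {f. depends_on_first n f \<and>
     (\<forall>\<pi>. \<pi> permutes {..<n} \<longrightarrow> (\<forall>x. f (x \<circ> \<pi>) = f x)) \<and>
     (\<exists>K. compact K \<and> (\<forall>x. f x \<noteq> 0 \<longrightarrow> (\<forall>i<n. x i \<in> K))) \<and>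
     (\<forall>\<kappa>::nat \<Rightarrow> ('a, 'n) chart. (\<forall>i. \<kappa> i \<in> \<A>) \<longrightarrow>
        smooth_multi {y. \<forall>i<n. y i \<in> chart_img (\<kappa> i)} (\<lambda>y. f (\<lambda>i. chart_inv (\<kappa> i) (y i))))}"

definition symmetrize :: "nat \<Rightarrow> ((nat \<Rightarrow> 'a) \<Rightarrow> complex) \<Rightarrow> (nat \<Rightarrow> 'a) \<Rightarrow> complex" where
  "symmetrize n f = (\<lambda>x. (\<Sum>\<pi> | \<pi> permutes {..<n}. f (x \<circ> \<pi>)) / fact n)"


section \<open>The extended Fock space\<close>

text \<open>A loop is a class of non-empty lists without repetition modulo rotation.\<close>

definition loops :: "nat \<Rightarrow> nat list set set" where
  "loops n = {{rotate k xs | k. True} | xs. xs \<noteq> [] \<and> distinct xs \<and> set xs \<subseteq> {..<n}}"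

definition loop_points :: "nat list set \<Rightarrow> nat set" where
  "loop_points \<kappa> = (\<Union>xs\<in>\<kappa>. set xs)"

definition loop_collections :: "nat \<Rightarrow> nat list set set set" where
  "loop_collections n = {\<alpha>. \<alpha> \<subseteq> loops n \<and> (\<forall>i<n. \<exists>!\<kappa>. \<kappa> \<in> \<alpha> \<and> i \<in> loop_points \<kappa>)}"

text \<open>
  The function \<open>f\<^sub>\<alpha>\<close>.  Its variables are indexed by the loops of \<open>\<alpha>\<close> themselves rather than by
  \<open>1, \<dots>, |\<alpha>|\<close>, and the variable of \<open>\<kappa>\<close> is inserted at all points of \<open>\<kappa>\<close>; for symmetric \<open>f\<close> this
  agrees, up to the numbering of the loops, with repeating the \<open>j\<close>-th variable \<open>|\<kappa>\<^sub>j|\<close> times in a row.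
\<close>

definition on_loops :: "nat list set set \<Rightarrow> ((nat \<Rightarrow> 'a) \<Rightarrow> complex) \<Rightarrow> (nat list set \<Rightarrow> 'a) \<Rightarrow> complex" where
  "on_loops \<alpha> f = (\<lambda>y. f (\<lambda>i. y (THE \<kappa>. \<kappa> \<in> \<alpha> \<and> i \<in> loop_points \<kappa>)))"

definition L2 :: "'b measure \<Rightarrow> ('b \<Rightarrow> complex) set" where
  "L2 M = {h. h \<in> borel_measurable M \<and> integrable M (\<lambda>x. (cmod (h x))\<^sup>2)}"

definition ext_inner ::
  "'a measure \<Rightarrow> nat \<Rightarrow> ((nat \<Rightarrow> 'a) \<Rightarrow> complex) \<Rightarrow> ((nat \<Rightarrow> 'a) \<Rightarrow> complex) \<Rightarrow> complex" where
  "ext_inner \<sigma> n f g =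
     (\<Sum>\<alpha>\<in>loop_collections n. \<integral>y. on_loops \<alpha> (\<lambda>x. cnj (f x) * g x) y \<partial>(\<Pi>\<^sub>M \<kappa>\<in>\<alpha>. \<sigma>))"

text \<open>
  The \<open>n\<close>-particle space: the closure of \<open>sym_tests \<A> n\<close> among the functions \<open>f\<close> on \<open>X\<^sup>n\<close> for
  which all \<open>f\<^sub>\<alpha>\<close> are square integrable.  As usual for \<open>L\<^sup>2\<close> spaces, vectors are represented by
  functions, and functions at distance 0 represent the same vector.
\<close>

definition ext_space ::
  "('a::topological_space, 'n::finite) chart set \<Rightarrow> 'a measure \<Rightarrow> nat \<Rightarrow> ((nat \<Rightarrow> 'a) \<Rightarrow> complex) set" where
  "ext_space \<A> \<sigma> n = {f. depends_on_first n f \<and>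
     (\<forall>\<alpha>\<in>loop_collections n. on_loops \<alpha> f \<in> L2 (\<Pi>\<^sub>M \<kappa>\<in>\<alpha>. \<sigma>)) \<and>
     (\<exists>h. (\<forall>k. h k \<in> sym_tests \<A> n) \<and>
        (\<lambda>k. ext_inner \<sigma> n (\<lambda>x. h k x - f x) (\<lambda>x. h k x - f x)) \<longlonglongrightarrow> 0)}"

type_synonym 'a fock = "nat \<Rightarrow> (nat \<Rightarrow> 'a) \<Rightarrow> complex"

definition fock_space ::
  "('a::topological_space, 'n::finite) chart set \<Rightarrow> 'a measure \<Rightarrow> 'a fock set" where
  "fock_space \<A> \<sigma> = {f. (\<forall>n. f n \<in> ext_space \<A> \<sigma> n) \<and>
     summable (\<lambda>n. Re (ext_inner \<sigma> n (f n) (f n)) * fact n)}"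

definition fock_inner :: "'a measure \<Rightarrow> 'a fock \<Rightarrow> 'a fock \<Rightarrow> complex" where
  "fock_inner \<sigma> f g = (\<Sum>n. ext_inner \<sigma> n (f n) (g n) * fact n)"

definition fock_add :: "'a fock \<Rightarrow> 'a fock \<Rightarrow> 'a fock" where
  "fock_add f g = (\<lambda>n x. f n x + g n x)"

definition fock_scale :: "complex \<Rightarrow> 'a fock \<Rightarrow> 'a fock" where
  "fock_scale z f = (\<lambda>n x. z * f n x)"

definition fock_dist :: "'a measure \<Rightarrow> 'a fock \<Rightarrow> 'a fock \<Rightarrow> real" where
  "fock_dist \<sigma> f g =
     (let d = fock_add f (fock_scale (- 1) g) in sqrt (Re (fock_inner \<sigma> d d)))"

definition fock_fin :: "('a::topological_space, 'n::finite) chart set \<Rightarrow> 'a fock set" where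
  "fock_fin \<A> = {f. (\<forall>n. f n \<in> sym_tests \<A> n) \<and> finite {n. f n \<noteq> (\<lambda>_. 0)}}"

definition vacuum :: "'a fock" where
  "vacuum = (\<lambda>n x. if n = 0 then 1 else 0)"


section \<open>The operators\<close>

text \<open>
  The following four functions act on the \<open>n\<close>-particle component.  \<open>case_nat z x\<close> is the sequence
  \<open>z, x 0, x 1, \<dots>\<close>.
\<close>

definition creation :: "('a \<Rightarrow> real) \<Rightarrow> nat \<Rightarrow> ((nat \<Rightarrow> 'a) \<Rightarrow> complex) \<Rightarrow> (nat \<Rightarrow> 'a) \<Rightarrow> complex" where
  "creation \<xi> n f = symmetrize (Suc n) (\<lambda>x. complex_of_real (\<xi> (x 0)) * f (\<lambda>i. x (Suc i)))"

definition neutral :: "('a \<Rightarrow> real) \<Rightarrow> nat \<Rightarrow> ((nat \<Rightarrow> 'a) \<Rightarrow> complex) \<Rightarrow> (nat \<Rightarrow> 'a) \<Rightarrow> complex" where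
  "neutral \<xi> n f = (\<lambda>x. of_nat n * symmetrize n (\<lambda>x. complex_of_real (\<xi> (x 0)) * f x) x)"

definition annihilation1 ::
  "'a measure \<Rightarrow> ('a \<Rightarrow> real) \<Rightarrow> nat \<Rightarrow> ((nat \<Rightarrow> 'a) \<Rightarrow> complex) \<Rightarrow> (nat \<Rightarrow> 'a) \<Rightarrow> complex" where
  "annihilation1 \<sigma> \<xi> n f =
     (\<lambda>x. of_nat n * (\<integral>z. complex_of_real (\<xi> z) * f (case_nat z x) \<partial>\<sigma>))"

definition annihilation2 ::
  "('a \<Rightarrow> real) \<Rightarrow> nat \<Rightarrow> ((nat \<Rightarrow> 'a) \<Rightarrow> complex) \<Rightarrow> (nat \<Rightarrow> 'a) \<Rightarrow> complex" where
  "annihilation2 \<xi> n f =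
     (\<lambda>x. of_nat (n * (n - 1)) *
        symmetrize (n - 1) (\<lambda>x. complex_of_real (\<xi> (x 0)) * f (case_nat (x 0) x)) x)"

definition c_coeff :: "real \<Rightarrow> real" where
  "c_coeff l = (if l \<le> 2 then l / 2 else 2 / (l + sqrt (l\<^sup>2 - 4)))"

definition jacobi_op :: "'a measure \<Rightarrow> real \<Rightarrow> ('a \<Rightarrow> real) \<Rightarrow> 'a fock \<Rightarrow> 'a fock" where
  "jacobi_op \<sigma> l \<xi> f = (\<lambda>n x.
     (case n of 0 \<Rightarrow> 0 | Suc m \<Rightarrow> creation \<xi> m (f m) x)
     + complex_of_real l * neutral \<xi> n (f n) x
     + annihilation1 \<sigma> \<xi> (Suc n) (f (Suc n)) x + annihilation2 \<xi> (Suc n) (f (Suc n)) x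
     + complex_of_real (c_coeff l * (\<integral>z. \<xi> z \<partial>\<sigma>)) * f n x)"

text \<open>The graph of the closure of \<open>jacobi_op \<sigma> l \<xi>\<close> on \<open>fock_fin \<A>\<close>.\<close>

definition jacobi_closure ::
  "('a::topological_space, 'n::finite) chart set \<Rightarrow> 'a measure \<Rightarrow> real \<Rightarrow> ('a \<Rightarrow> real) \<Rightarrow>
   ('a fock \<times> 'a fock) set" where
  "jacobi_closure \<A> \<sigma> l \<xi> = {(f, g). f \<in> fock_space \<A> \<sigma> \<and> g \<in> fock_space \<A> \<sigma> \<and>
     (\<exists>h. (\<forall>k::nat. h k \<in> fock_fin \<A>) \<and> (\<lambda>k. fock_dist \<sigma> (h k) f) \<longlonglongrightarrow> 0 \<and>
        (\<lambda>k. fock_dist \<sigma> (jacobi_op \<sigma> l \<xi> (h k)) g) \<longlonglongrightarrow> 0)}"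

text \<open>
  Unitary operators onto \<open>L\<^sup>2(\<mu>)\<close>, acting on representatives.  Preservation of the inner product
  makes the operator well defined on classes.
\<close>

definition fock_unitary ::
  "('a::topological_space, 'n::finite) chart set \<Rightarrow> 'a measure \<Rightarrow> 'w measure \<Rightarrow>
   ('a fock \<Rightarrow> 'w \<Rightarrow> complex) \<Rightarrow> bool" where
  "fock_unitary \<A> \<sigma> \<mu> I \<longleftrightarrow>
     (\<forall>f\<in>fock_space \<A> \<sigma>. I f \<in> L2 \<mu>) \<and>
     (\<forall>f\<in>fock_space \<A> \<sigma>. \<forall>g\<in>fock_space \<A> \<sigma>. AE \<omega> in \<mu>. I (fock_add f g) \<omega> = I f \<omega> + I g \<omega>) \<and>
     (\<forall>f\<in>fock_space \<A> \<sigma>. \<forall>z. AE \<omega> in \<mu>. I (fock_scale z f) \<omega> = z * I f \<omega>) \<and>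
     (\<forall>f\<in>fock_space \<A> \<sigma>. \<forall>g\<in>fock_space \<A> \<sigma>.
        (\<integral>\<omega>. cnj (I f \<omega>) * I g \<omega> \<partial>\<mu>) = fock_inner \<sigma> f g) \<and>
     (\<forall>h\<in>L2 \<mu>. \<exists>f\<in>fock_space \<A> \<sigma>. AE \<omega> in \<mu>. I f \<omega> = h \<omega>)"

text \<open>
  The property that characterizes the pair \<open>(\<mu>\<^sub>\<lambda>, I\<^sub>\<lambda>)\<close>.  The last clause says that \<open>I\<close> maps the
  graph of the closed operator onto the graph of multiplication by \<open>\<langle>\<cdot>, \<xi>\<rangle>\<close> with its maximal
  domain, i.e. it includes the equality of the domains.
\<close>

definition spectral_pair ::
  "('a::topological_space, 'n::finite) chart set \<Rightarrow> 'a measure \<Rightarrow> real \<Rightarrow>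
   (('a \<Rightarrow> real) \<Rightarrow> real) measure \<Rightarrow> ('a fock \<Rightarrow> (('a \<Rightarrow> real) \<Rightarrow> real) \<Rightarrow> complex) \<Rightarrow> bool" where
  "spectral_pair \<A> \<sigma> l \<mu> I \<longleftrightarrow>
     prob_space \<mu> \<and> sets \<mu> = sets (cylinder_algebra \<A>) \<and>
     fock_unitary \<A> \<sigma> \<mu> I \<and> (AE \<omega> in \<mu>. I vacuum \<omega> = 1) \<and>
     (\<forall>\<xi>\<in>test_functions \<A>. \<forall>f\<in>fock_space \<A> \<sigma>. \<forall>g\<in>fock_space \<A> \<sigma>.
        (f, g) \<in> jacobi_closure \<A> \<sigma> l \<xi> \<longleftrightarrow>
        (AE \<omega> in \<mu>. I g \<omega> = complex_of_real (\<omega> \<xi>) * I f \<omega>))"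


section \<open>Compound Poisson measures\<close>

abbreviation borel_pos :: "real measure" where
  "borel_pos \<equiv> restrict_space borel {0<..}"

definition levy_measure :: "real measure \<Rightarrow> bool" where
  "levy_measure \<nu> \<longleftrightarrow> sets \<nu> = sets borel_pos \<and> (\<integral>\<^sup>+s. ennreal (min 1 s) \<partial>\<nu>) < \<infinity>"

definition levy_khintchine ::
  "('a::topological_space, 'n::finite) chart set \<Rightarrow> 'a measure \<Rightarrow> real measure \<Rightarrow>
   (('a \<Rightarrow> real) \<Rightarrow> real) measure \<Rightarrow> bool" where
  "levy_khintchine \<A> \<sigma> \<nu> \<mu> \<longleftrightarrow>
     (\<forall>\<phi>\<in>test_functions \<A>.
        (\<integral>\<omega>. exp (\<i> * complex_of_real (\<omega> \<phi>)) \<partial>\<mu>) =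
        exp (\<integral>z. (exp (\<i> * complex_of_real (snd z * \<phi> (fst z))) - 1) \<partial>(\<sigma> \<Otimes>\<^sub>M \<nu>)))"

definition compound_poisson ::
  "('a::topological_space, 'n::finite) chart set \<Rightarrow> 'a measure \<Rightarrow>
   (('a \<Rightarrow> real) \<Rightarrow> real) measure \<Rightarrow> bool" where
  "compound_poisson \<A> \<sigma> \<mu> \<longleftrightarrow> prob_space \<mu> \<and> sets \<mu> = sets (cylinder_algebra \<A>) \<and>
     (\<exists>\<nu>. levy_measure \<nu> \<and> levy_khintchine \<A> \<sigma> \<nu> \<mu>)"

definition p_coeff :: "real \<Rightarrow> real" where
  "p_coeff l = (l - sqrt (l\<^sup>2 - 4)) / (l + sqrt (l\<^sup>2 - 4))"

text \<open>For \<open>l > 2\<close>, the summand with index \<open>k\<close> below is the one with index \<open>k + 1\<close> of a series that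
  starts at 1.\<close>

definition nu :: "real \<Rightarrow> real measure" where
  "nu l = (if l = 2
     then density (restrict_space lborel {0<..}) (\<lambda>s. ennreal (exp (- s) / s))
     else dirac_series borel_pos (\<lambda>k. p_coeff l ^ Suc k / real (Suc k))
            (\<lambda>k. sqrt (l\<^sup>2 - 4) * real (Suc k)))"

text \<open>
  The functionals given by Radon measures \<open>\<Sum>n. s n \<delta>\<^bsub>x n\<^esub>\<close> with \<open>s n > 0\<close>.  The points \<open>x n\<close>
  may repeat, so finite non-empty sums are included.  The zero measure is not; if \<open>\<sigma>\<close> and \<open>nu l\<close> are
  both finite, i.e. \<open>l > 2\<close> and \<open>\<sigma> UNIV < \<infinity>\<close>, the compound Poisson measure charges it.
\<close>

definition discrete_radon ::
  "('a::topological_space, 'n::finite) chart set \<Rightarrow> (('a \<Rightarrow> real) \<Rightarrow> real) set" where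
  "discrete_radon \<A> = {functional_of_measure \<A> (dirac_series borel s x) | s x.
     (\<forall>n. s n > 0) \<and> radon_measure (dirac_series borel s x)}"

end

theory Submission
  imports Defs "HOL-Complex_Analysis.Complex_Analysis"
begin

text \<open>
  Let \<open>u' = 1 + \<lambda>u + u\<^sup>2\<close>, \<open>u(0) = 0\<close>, and let \<open>L\<close> be given by \<open>L(0) = 1\<close> and
  \<open>L'(t) / L(t) = \<integral> \<xi>(x) (c\<^sub>\<lambda> + u(t\<xi>(x))) \<sigma>(dx)\<close>.  As formal power series in \<open>t\<close>, the \<open>n\<close>-particle component of
  \<open>\<Sum>\<^sub>k a\<^sub>\<lambda>(\<xi>)\<^sup>k \<Omega> t\<^sup>k / k!\<close> is then \<open>L(t) \<Prod>\<^sub>i u(t\<xi>(x\<^sub>i)) / n!\<close>, so that \<open>L\<close> generates the moments of \<open>\<langle>\<cdot>, \<xi>\<rangle>\<close>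
  under \<open>\<mu>\<^sub>\<lambda>\<close>.  Since \<open>\<integral> s e\<^sup>t\<^sup>s \<nu>\<^sub>\<lambda>(ds)\<close> solves the same Riccati equation as \<open>c\<^sub>\<lambda> + u\<close>, these are the moments
  of the compound Poisson law, and by exponential integrability and the identity theorem they
  determine the Fourier transform.

  For the concentration, a Poisson cloud with intensity \<open>\<sigma> \<otimes> \<nu>\<^sub>\<lambda>\<close> gives the pairings with a countable
  dense set of test functions the same joint law as \<open>\<mu>\<^sub>\<lambda>\<close>.  Measurability of the set of discrete
  measures is avoided: inner regularity on a Polish space of clouds provides compact sets of
  almost full measure, whose images under the pairings are compact, hence measurable.
\<close>

section \<open>Powers of the Jacobi operators applied to the vacuum\<close>

text \<open>Formal series suffice because each power of the operator applied to the vacuum has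
  finitely many components: all identities are between coefficients, and no convergence in the Fock
  space is involved. The constant c of the operator is a root of c^2 - l c + 1 = 0. Hence w = c + u
  solves w' = w^2 + (l - 2c) w, without constant term, and this equation is solved by 1 / (1 - t)
  for l = 2 and by D p e^(Dt) / (1 - p e^(Dt)), D = sqrt (l^2 - 4), for l > 2, which are the
  integrals of s e^(ts) against \<open>nu l\<close>. The intensity may have infinite mass, so
  exponentials are integrated only after subtracting 1, and integrability is imposed on |g|
  e^(e|g|), which is small where g is small. Fourier transforms control countably many pairings.
  Recovering a whole functional from them needs sequential density in the inductive limit topology,
  where approximants must share a compact support. An almost everywhere statement asks only for a
  measurable null set around the exceptions. A cloud of finite intensity is empty with positive
  probability; this is where the zero functional comes from.\<close>

definition fps_rescale :: "complex \<Rightarrow> complex fps \<Rightarrow> complex fps" where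
  "fps_rescale r f = Abs_fps (\<lambda>j. fps_nth f j * r ^ j)"

lemma fps_rescale_nth [simp]: "fps_nth (fps_rescale r f) j = fps_nth f j * r ^ j"
  by (simp add: fps_rescale_def)

lemma fps_rescale_add: "fps_rescale r (f + g) = fps_rescale r f + fps_rescale r g"
  by (rule fps_ext) (simp add: algebra_simps)

lemma fps_rescale_one: "fps_rescale r 1 = 1"
  by (rule fps_ext) simp

lemma fps_rescale_const: "fps_rescale r (fps_const c) = fps_const c"
  by (rule fps_ext) simp

lemma fps_rescale_mult: "fps_rescale r (f * g) = fps_rescale r f * fps_rescale r g"
proof (rule fps_ext)
  fix n
  have "fps_nth f i * fps_nth g (n - i) * r ^ n = fps_nth f i * r ^ i * (fps_nth g (n - i) * r ^ (n - i))"
    if "i \<in> {0..n}" for i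
  proof -
    have "r ^ n = r ^ i * r ^ (n - i)" using that by (simp flip: power_add)
    then show ?thesis by simp
  qed
  then show "fps_nth (fps_rescale r (f * g)) n = fps_nth (fps_rescale r f * fps_rescale r g) n"
    unfolding fps_mult_nth fps_rescale_nth sum_distrib_right by (rule sum.cong[OF refl])
qed

lemma fps_deriv_rescale: "fps_deriv (fps_rescale r f) = fps_const r * fps_rescale r (fps_deriv f)"
  by (rule fps_ext) (simp add: algebra_simps)

lemma fps_deriv_prod_set:
  fixes U :: "'i \<Rightarrow> complex fps"
  assumes "finite A"
  shows "fps_deriv (\<Prod>i\<in>A. U i) = (\<Sum>i\<in>A. fps_deriv (U i) * (\<Prod>j\<in>A - {i}. U j))"
  using assms
proof (induction A)
  case empty
  then show ?case by simp
next
  case (insert a A)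
  have *: "fps_deriv (U i) * (\<Prod>j\<in>insert a A - {i}. U j) = U a * (fps_deriv (U i) * (\<Prod>j\<in>A - {i}. U j))"
    if "i \<in> A" for i
  proof -
    have "insert a A - {i} = insert a (A - {i})" "a \<notin> A - {i}" using insert that by auto
    then show ?thesis using insert by simp
  qed
  have "(\<Sum>i\<in>A. fps_deriv (U i) * (\<Prod>j\<in>insert a A - {i}. U j)) =
      U a * (\<Sum>i\<in>A. fps_deriv (U i) * (\<Prod>j\<in>A - {i}. U j))"
    unfolding sum_distrib_left by (rule sum.cong[OF refl *])
  moreover have "insert a A - {a} = A" using insert by auto
  ultimately show ?case using insert by (simp add: algebra_simps)
qed

text \<open>
  The \<open>n\<close>-particle component of the \<open>k\<close>-th power of the Jacobi operator applied to the vacuum.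
\<close>

definition particle_fun ::
  "complex fps \<Rightarrow> complex fps \<Rightarrow> ('a \<Rightarrow> real) \<Rightarrow> nat \<Rightarrow> 'a fock" where
  "particle_fun L u \<xi> k n x =
     fact k / fact n * fps_nth (L * (\<Prod>i<n. fps_rescale (complex_of_real (\<xi> (x i))) u)) k"

text \<open>The factor \<open>fact (Suc k)\<close> turns the coefficient of index
  \<open>Suc k\<close> into the one of index \<open>k\<close> of the derivative. The Riccati
  equation splits the derivative of each factor \<open>U i\<close> into \<open>1\<close>,
  \<open>lam * U i\<close> and \<open>(U i)\<^sup>2\<close>, the contributions of creation, neutral
  operator and second annihilation; \<open>V'\<close> stands for the first annihilation together
  with the scalar term.\<close>

lemma particle_fun_Suc:
  fixes \<xi> :: "'a \<Rightarrow> real" and x :: "nat \<Rightarrow> 'a" and u :: "complex fps"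
  defines "U \<equiv> \<lambda>i. fps_rescale (complex_of_real (\<xi> (x i))) u"
  assumes L: "fps_deriv L = L * V'" and u: "fps_deriv u = 1 + fps_const lam * u + u\<^sup>2"
  shows "particle_fun L u \<xi> (Suc k) n x = fact k / fact n *
     (fps_nth (L * V' * (\<Prod>i<n. U i)) k +
      fps_nth (\<Sum>i<n. L * (fps_const (\<xi> (x i)) * 1 * (\<Prod>j\<in>{..<n} - {i}. U j))) k +
      lam * fps_nth (\<Sum>i<n. L * (fps_const (\<xi> (x i)) * U i * (\<Prod>j\<in>{..<n} - {i}. U j))) k +
      fps_nth (\<Sum>i<n. L * (fps_const (\<xi> (x i)) * (U i)\<^sup>2 * (\<Prod>j\<in>{..<n} - {i}. U j))) k)"
proof -
  have dU: "fps_deriv (U i) = fps_const (\<xi> (x i)) * (1 + fps_const lam * U i + (U i)\<^sup>2)" for i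
    unfolding U_def fps_deriv_rescale u fps_rescale_add fps_rescale_one
      power2_eq_square fps_rescale_mult fps_rescale_const by simp
  have "fps_deriv (L * (\<Prod>i<n. U i)) = L * V' * (\<Prod>i<n. U i) +
      (\<Sum>i<n. L * (fps_const (\<xi> (x i)) * 1 * (\<Prod>j\<in>{..<n} - {i}. U j))) +
      fps_const lam * (\<Sum>i<n. L * (fps_const (\<xi> (x i)) * U i * (\<Prod>j\<in>{..<n} - {i}. U j))) +
      (\<Sum>i<n. L * (fps_const (\<xi> (x i)) * (U i)\<^sup>2 * (\<Prod>j\<in>{..<n} - {i}. U j)))"
  proof -
    have "L * (fps_deriv (U i) * (\<Prod>j\<in>{..<n} - {i}. U j)) =
        L * (fps_const (\<xi> (x i)) * 1 * (\<Prod>j\<in>{..<n} - {i}. U j)) +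
        fps_const lam * (L * (fps_const (\<xi> (x i)) * U i * (\<Prod>j\<in>{..<n} - {i}. U j))) +
        L * (fps_const (\<xi> (x i)) * (U i)\<^sup>2 * (\<Prod>j\<in>{..<n} - {i}. U j))" for i
      unfolding dU by (simp add: algebra_simps)
    then have "L * fps_deriv (\<Prod>i<n. U i) =
        (\<Sum>i<n. L * (fps_const (\<xi> (x i)) * 1 * (\<Prod>j\<in>{..<n} - {i}. U j))) +
        fps_const lam * (\<Sum>i<n. L * (fps_const (\<xi> (x i)) * U i * (\<Prod>j\<in>{..<n} - {i}. U j))) +
        (\<Sum>i<n. L * (fps_const (\<xi> (x i)) * (U i)\<^sup>2 * (\<Prod>j\<in>{..<n} - {i}. U j)))"
      unfolding fps_deriv_prod_set[OF finite_lessThan] sum_distrib_left by (simp only: sum.distrib)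
    then show ?thesis unfolding fps_deriv_mult L by (simp only: ac_simps)
  qed
  then have "fps_nth (fps_deriv (L * (\<Prod>i<n. U i))) k =
     (fps_nth (L * V' * (\<Prod>i<n. U i)) k +
      fps_nth (\<Sum>i<n. L * (fps_const (\<xi> (x i)) * 1 * (\<Prod>j\<in>{..<n} - {i}. U j))) k +
      lam * fps_nth (\<Sum>i<n. L * (fps_const (\<xi> (x i)) * U i * (\<Prod>j\<in>{..<n} - {i}. U j))) k +
      fps_nth (\<Sum>i<n. L * (fps_const (\<xi> (x i)) * (U i)\<^sup>2 * (\<Prod>j\<in>{..<n} - {i}. U j))) k)"
    by (simp only: fps_add_nth fps_mult_left_const_nth)
  moreover have "particle_fun L u \<xi> (Suc k) n x = fact k / fact n * fps_nth (fps_deriv (L * (\<Prod>i<n. U i))) k"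
    unfolding particle_fun_def U_def fps_deriv_nth by simp
  ultimately show ?thesis by simp
qed

text \<open>Composition with the transposition of 0 and \<open>i\<close> shows that evaluating at
  \<open>i\<close> instead of 0 gives the same sum; averaging over \<open>i\<close> then lets every
  permutation run through all values of \<open>h\<close>.\<close>

lemma sum_permutes_fixed_index:
  fixes h :: "nat \<Rightarrow> complex"
  assumes "n > 0"
  shows "(\<Sum>\<pi> | \<pi> permutes {..<n}. h (\<pi> 0)) = fact n / of_nat n * (\<Sum>i<n. h i)"
proof -
  let ?P = "{\<pi>. \<pi> permutes {..<n}}"
  have eq: "(\<Sum>\<pi>\<in>?P. h (\<pi> i)) = (\<Sum>\<pi>\<in>?P. h (\<pi> 0))" if "i < n" for i
  proof -
    have t: "Transposition.transpose 0 i permutes {..<n}" using that assms by (intro permutes_swap_id) auto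
    show ?thesis
      using sum_permutations_compose_right[OF t, of "\<lambda>p. h (p i)"] by simp
  qed
  have "of_nat n * (\<Sum>\<pi>\<in>?P. h (\<pi> 0)) = (\<Sum>i<n. \<Sum>\<pi>\<in>?P. h (\<pi> i))"
  proof -
    have "(\<Sum>i<n. \<Sum>\<pi>\<in>?P. h (\<pi> i)) = (\<Sum>i<n. \<Sum>\<pi>\<in>?P. h (\<pi> 0))"
      by (rule sum.cong[OF refl], rule eq) simp
    then show ?thesis by simp
  qed
  also have "\<dots> = (\<Sum>\<pi>\<in>?P. \<Sum>i<n. h (\<pi> i))" by (rule sum.swap)
  also have "\<dots> = (\<Sum>\<pi>\<in>?P. \<Sum>i<n. h i)"
  proof (rule sum.cong[OF refl])
    fix \<pi> assume "\<pi> \<in> ?P"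
    then have "\<pi> permutes {..<n}" by simp
    from sum.permute[OF this, of h] show "(\<Sum>i<n. h (\<pi> i)) = (\<Sum>i<n. h i)" by simp
  qed
  also have "\<dots> = fact n * (\<Sum>i<n. h i)" by (simp add: card_permutations[OF refl])
  finally show ?thesis using assms by (simp add: field_simps)
qed

text \<open>Each permuted term depends on \<pi> only through \<open>\<pi> 0\<close>, because the
  remaining factors form the product over the complement of that index. In use, \<open>T\<close>
  extracts a coefficient and \<open>B\<close> is the factor that carries \<xi>.\<close>

lemma symmetrize_product:
  fixes T :: "complex fps \<Rightarrow> complex"
  assumes "n > 0"
  shows "symmetrize n (\<lambda>x. T (B (x 0) * (\<Prod>i\<in>{1..<n}. C (x i)))) x =
    (\<Sum>i<n. T (B (x i) * (\<Prod>j\<in>{..<n} - {i}. C (x j)))) / of_nat n"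
proof -
  define h where "h i = T (B (x i) * (\<Prod>j\<in>{..<n} - {i}. C (x j)))" for i
  have "T (B ((x \<circ> \<pi>) 0) * (\<Prod>i\<in>{1..<n}. C ((x \<circ> \<pi>) i))) = h (\<pi> 0)" if p: "\<pi> permutes {..<n}" for \<pi>
  proof -
    have "bij_betw \<pi> ({..<n} - {0}) ({..<n} - {\<pi> 0})"
      using permutes_imp_bij[OF p] permutes_inj[OF p] assms
      by (intro bij_betw_DiffI) (auto simp: bij_betw_def inj_on_def)
    moreover have "{1..<n} = {..<n} - {0}" by auto
    ultimately have "(\<Prod>i\<in>{1..<n}. C (x (\<pi> i))) = (\<Prod>j\<in>{..<n} - {\<pi> 0}. C (x j))"
      using prod.reindex_bij_betw[of \<pi> "{..<n} - {0}" "{..<n} - {\<pi> 0}" "\<lambda>j. C (x j)"] by simp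
    then show ?thesis by (simp add: h_def)
  qed
  then have "(\<Sum>\<pi> | \<pi> permutes {..<n}. T (B ((x \<circ> \<pi>) 0) * (\<Prod>i\<in>{1..<n}. C ((x \<circ> \<pi>) i))))
     = (\<Sum>\<pi> | \<pi> permutes {..<n}. h (\<pi> 0))" by (intro sum.cong) auto
  then show ?thesis using assms unfolding symmetrize_def sum_permutes_fixed_index[OF assms]
    by (simp add: h_def)
qed

section \<open>The moment problem under exponential integrability\<close>

text \<open>The bound does not depend on \<open>n\<close>; it makes the integrals of the partial
  sums of an exponential series without constant term uniformly bounded.\<close>

lemma exp_partial_sum_le:
  fixes a :: real
  assumes "0 \<le> a"
  shows "(\<Sum>k<n. a ^ Suc k / fact (Suc k)) \<le> a * exp a"
proof -
  have "a ^ Suc k / fact (Suc k) \<le> a * (a ^ k / fact k)" for k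
  proof -
    have "a ^ Suc k / fact (Suc k) \<le> a ^ Suc k / fact k"
      using assms by (intro divide_left_mono mult_pos_pos) (auto simp: fact_mono)
    then show ?thesis by simp
  qed
  then have "(\<Sum>k<n. a ^ Suc k / fact (Suc k)) \<le> (\<Sum>k<n. a * (a ^ k / fact k))"
    by (intro sum_mono)
  also have "\<dots> = a * (\<Sum>k<n. a ^ k / fact k)" by (simp add: sum_distrib_left)
  also have "\<dots> \<le> a * exp a"
  proof (intro mult_left_mono assms)
    have *: "(\<lambda>k. a ^ k / fact k) sums exp a" using exp_converges[of a] by (simp add: divide_inverse mult_ac)
    show "(\<Sum>k<n. a ^ k / fact k) \<le> exp a" using assms
      using sum_le_suminf[OF sums_summable[OF *], of "{..<n}"] sums_unique[OF *] by simp
  qed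
  finally show ?thesis .
qed

section \<open>Exponential integrals over a possibly infinite measure\<close>

context
  fixes M :: "'b measure" and g :: "'b \<Rightarrow> real" and e :: real
  assumes g[measurable]: "g \<in> borel_measurable M"
    and int: "integrable M (\<lambda>x. \<bar>g x\<bar> * exp (e * \<bar>g x\<bar>))"
begin

lemma integrable_exp_scaled_abs:
  assumes "r < e"
  shows "integrable M (\<lambda>x. \<bar>g x\<bar> * exp (r * \<bar>g x\<bar>))"
  by (rule Bochner_Integration.integrable_bound[OF int]) (use assms in \<open>auto intro!: mult_left_mono mult_right_mono\<close>)

lemma integrable_power_of_exp:
  assumes "e > 0"
  shows "integrable M (\<lambda>x. g x ^ Suc n)"
proof (rule Bochner_Integration.integrable_bound[where f="\<lambda>x. fact n / e ^ n * (\<bar>g x\<bar> * exp (e * \<bar>g x\<bar>))"])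
  show "AE x in M. norm (g x ^ Suc n) \<le> norm (fact n / e ^ n * (\<bar>g x\<bar> * exp (e * \<bar>g x\<bar>)))"
  proof (rule AE_I2)
    fix x
    have *: "(\<lambda>k. (e * \<bar>g x\<bar>) ^ k / fact k) sums exp (e * \<bar>g x\<bar>)"
      using exp_converges[of "e * \<bar>g x\<bar>"] by (simp add: divide_inverse mult_ac)
    have "(\<Sum>k\<in>{n}. (e * \<bar>g x\<bar>) ^ k / fact k) \<le> exp (e * \<bar>g x\<bar>)"
      using assms sum_le_suminf[OF sums_summable[OF *], of "{n}"] sums_unique[OF *] by simp
    then have "\<bar>g x\<bar> * (e * \<bar>g x\<bar>) ^ n / fact n \<le> \<bar>g x\<bar> * exp (e * \<bar>g x\<bar>)"
      by (simp flip: times_divide_eq_right add: mult_left_mono)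
    then show "norm (g x ^ Suc n) \<le> norm (fact n / e ^ n * (\<bar>g x\<bar> * exp (e * \<bar>g x\<bar>)))"
      using assms by (simp add: power_mult_distrib power_abs abs_mult field_simps)
  qed
qed (use int in auto)

text \<open>Expansion about a point of the imaginary axis: \<open>exp (\<i> * s * g x)\<close> has
  modulus 1 there, so the radius \<open>e\<close> is the same for all \<open>s\<close>. Termwise
  integration is legitimate because the sums of the norms are dominated by the integrable function
  \<open>cmod h * (\<bar>g x\<bar> * exp (cmod h * \<bar>g x\<bar>))\<close>.\<close>

lemma exp_integral_series:
  fixes s :: real and h :: complex
  assumes h: "cmod h < e"
  shows "integrable M (\<lambda>x. exp ((\<i> * s + h) * g x) - 1)"
    and "(\<lambda>n. (\<integral>x. exp (\<i> * s * g x) * complex_of_real (g x) ^ Suc n \<partial>M) / fact (Suc n) * h ^ Suc n)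
      sums ((\<integral>x. exp ((\<i> * s + h) * g x) - 1 \<partial>M) - (\<integral>x. exp (\<i> * s * g x) - 1 \<partial>M))"
proof -
  have e: "e > 0" using h norm_ge_zero[of h] by linarith
  let ?f = "\<lambda>n x. exp (\<i> * s * g x) * ((h * g x) ^ Suc n / fact (Suc n))"
  have nf: "norm (?f n x) = (cmod h * \<bar>g x\<bar>) ^ Suc n / fact (Suc n)" for n x
    by (simp add: norm_mult norm_divide norm_power del: power_Suc fact_Suc)
  have sg: "integrable M (\<lambda>x. g x ^ Suc n)" for n by (rule integrable_power_of_exp[OF e])
  have ifn: "integrable M (?f n)" for n
  proof (rule Bochner_Integration.integrable_bound[where f="\<lambda>x. cmod h ^ Suc n / fact (Suc n) * \<bar>g x ^ Suc n\<bar>"])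
    show "integrable M (\<lambda>x. cmod h ^ Suc n / fact (Suc n) * \<bar>g x ^ Suc n\<bar>)"
      using sg[of n] by (intro integrable_mult_right integrable_abs)
    show "AE x in M. norm (?f n x) \<le> norm (cmod h ^ Suc n / fact (Suc n) * \<bar>g x ^ Suc n\<bar>)"
      unfolding nf by (intro AE_I2) (simp add: power_mult_distrib power_abs abs_mult mult_ac del: fact_Suc)
  qed simp
  have sums: "(\<lambda>n. ?f n x) sums (exp ((\<i> * s + h) * g x) - exp (\<i> * s * g x))" for x
  proof -
    have "(\<lambda>n. (h * g x) ^ n / fact n) sums exp (h * g x)"
      using exp_converges[of "h * g x"] by (simp add: scaleR_conv_of_real divide_inverse mult_ac)
    then have "(\<lambda>n. (h * g x) ^ Suc n / fact (Suc n)) sums (exp (h * g x) - 1)"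
      by (subst sums_Suc_iff) simp
    from sums_mult[OF this, of "exp (\<i> * s * g x)"] show ?thesis
      by (simp add: algebra_simps exp_add)
  qed
  have snorm: "summable (\<lambda>n. norm (?f n x))" for x
    unfolding nf using summable_exp_generic[of "cmod h * \<bar>g x\<bar>"]
    by (subst summable_Suc_iff) (simp add: divide_inverse mult_ac)
  have sint: "summable (\<lambda>n. \<integral>x. norm (?f n x) \<partial>M)"
  proof (rule summableI_nonneg_bounded)
    fix n
    have "(\<Sum>k<n. \<integral>x. norm (?f k x) \<partial>M) = (\<integral>x. (\<Sum>k<n. norm (?f k x)) \<partial>M)"
      by (rule Bochner_Integration.integral_sum[symmetric]) (use ifn in auto)
    also have "\<dots> \<le> (\<integral>x. cmod h * (\<bar>g x\<bar> * exp (cmod h * \<bar>g x\<bar>)) \<partial>M)"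
    proof (rule integral_mono)
      show "(\<Sum>k<n. norm (?f k x)) \<le> cmod h * (\<bar>g x\<bar> * exp (cmod h * \<bar>g x\<bar>))" for x
        unfolding nf using exp_partial_sum_le[of "cmod h * \<bar>g x\<bar>" n] by (simp add: mult_ac)
    qed (use ifn integrable_exp_scaled_abs[OF h] in auto)
    finally show "(\<Sum>k<n. \<integral>x. norm (?f k x) \<partial>M) \<le> (\<integral>x. cmod h * (\<bar>g x\<bar> * exp (cmod h * \<bar>g x\<bar>)) \<partial>M)" .
  qed simp
  have i0: "integrable M (\<lambda>x. exp (\<i> * s * g x) - 1)"
  proof (rule Bochner_Integration.integrable_bound[where f="\<lambda>x. \<bar>s\<bar> * \<bar>g x\<bar>"])
    show "integrable M (\<lambda>x. \<bar>s\<bar> * \<bar>g x\<bar>)" using sg[of 0] by simp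
    show "AE x in M. norm (exp (\<i> * s * g x) - 1) \<le> norm (\<bar>s\<bar> * \<bar>g x\<bar>)"
    proof (rule AE_I2)
      fix x
      have "cmod (exp (\<i> * of_real (s * g x)) - 1) \<le> \<bar>s * g x\<bar>"
        using iexp_approx1[of "s * g x" 0] by simp
      then show "norm (exp (\<i> * s * g x) - 1) \<le> norm (\<bar>s\<bar> * \<bar>g x\<bar>)" by (simp add: abs_mult mult.assoc)
    qed
  qed simp
  have isum: "integrable M (\<lambda>x. exp ((\<i> * s + h) * g x) - exp (\<i> * s * g x))"
    and ssum: "(\<lambda>n. \<integral>x. ?f n x \<partial>M) sums (\<integral>x. exp ((\<i> * s + h) * g x) - exp (\<i> * s * g x) \<partial>M)"
    using integrable_suminf[OF ifn AE_I2[OF snorm] sint] sums_integral[OF ifn AE_I2[OF snorm] sint]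
    unfolding sums_unique[OF sums, symmetric] by blast+
  show i1: "integrable M (\<lambda>x. exp ((\<i> * s + h) * g x) - 1)"
    using Bochner_Integration.integrable_add[OF isum i0] by simp
  have "(\<integral>x. ?f n x \<partial>M) = (\<integral>x. exp (\<i> * s * g x) * complex_of_real (g x) ^ Suc n \<partial>M) / fact (Suc n) * h ^ Suc n" for n
  proof -
    have "?f n = (\<lambda>x. exp (\<i> * s * g x) * complex_of_real (g x) ^ Suc n * (h ^ Suc n / fact (Suc n)))"
      by (rule ext) (simp add: power_mult_distrib del: fact_Suc power_Suc)
    then have "integral\<^sup>L M (?f n) = (\<integral>x. exp (\<i> * s * g x) * complex_of_real (g x) ^ Suc n * (h ^ Suc n / fact (Suc n)) \<partial>M)"
      by (simp only:)
    also have "\<dots> = (\<integral>x. exp (\<i> * s * g x) * complex_of_real (g x) ^ Suc n \<partial>M) * (h ^ Suc n / fact (Suc n))"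
      by (rule Bochner_Integration.integral_mult_left_zero)
    finally show ?thesis by (simp only: times_divide_eq_left times_divide_eq_right)
  qed
  moreover have "(\<integral>x. exp ((\<i> * s + h) * g x) - exp (\<i> * s * g x) \<partial>M) =
     (\<integral>x. exp ((\<i> * s + h) * g x) - 1 \<partial>M) - (\<integral>x. exp (\<i> * s * g x) - 1 \<partial>M)"
    using i0 i1 by (subst Bochner_Integration.integral_diff[symmetric]) auto
  ultimately show "(\<lambda>n. (\<integral>x. exp (\<i> * s * g x) * complex_of_real (g x) ^ Suc n \<partial>M) / fact (Suc n) * h ^ Suc n)
      sums ((\<integral>x. exp ((\<i> * s + h) * g x) - 1 \<partial>M) - (\<integral>x. exp (\<i> * s * g x) - 1 \<partial>M))"
    using ssum by (simp only:)
qed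

text \<open>The strip is the union of the discs of radius \<open>e\<close> centred on the imaginary
  axis, and on each of them the integral is a power series.\<close>

lemma exp_integral_holomorphic:
  "(\<lambda>z. \<integral>x. exp (z * g x) - 1 \<partial>M) holomorphic_on {z. \<bar>Re z\<bar> < e}" (is "?F holomorphic_on ?S")
proof -
  have "open ?S" by (intro open_Collect_less continuous_intros)
  moreover have "?F field_differentiable (at z)" if z: "z \<in> ?S" for z
  proof -
    let ?s = "Im z"
    \<comment> \<open>Only the constant coefficient contains the subtracted 1, without which that
      integrand need not be integrable.\<close>
    let ?a = "\<lambda>n. if n = 0 then ?F (\<i> * ?s) else (\<integral>x. exp (\<i> * ?s * g x) * complex_of_real (g x) ^ n \<partial>M) / fact n"
    have "?F holomorphic_on ball (\<i> * ?s) e"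
    proof (rule power_series_holomorphic[where a="?a"])
      fix w assume w: "w \<in> ball (\<i> * ?s) e"
      have "(\<lambda>n. ?a (Suc n) * (w - \<i> * ?s) ^ Suc n) sums (?F w - ?F (\<i> * ?s))"
        using exp_integral_series(2)[of "w - \<i> * ?s" ?s] w by (simp add: dist_norm norm_minus_commute)
      then have "(\<lambda>n. ?a n * (w - \<i> * ?s) ^ n) sums (?F w - ?F (\<i> * ?s) + ?a 0 * (w - \<i> * ?s) ^ 0)"
        by (rule sums_Suc)
      then show "(\<lambda>n. ?a n * (w - \<i> * ?s) ^ n) sums ?F w" by simp
    qed
    moreover have "z \<in> ball (\<i> * ?s) e"
    proof -
      have "\<i> * ?s - z = - complex_of_real (Re z)" by (simp add: complex_eq_iff)
      then show ?thesis using z by (simp add: dist_norm)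
    qed
    ultimately show ?thesis using holomorphic_on_imp_differentiable_at open_ball by blast
  qed
  ultimately show ?thesis by (simp add: holomorphic_on_open field_differentiable_def)
qed

text \<open>The constant coefficient is prescribed separately: the integral vanishes at
  \<open>z = 0\<close>, whereas the zeroth moment of \<open>g\<close> would involve the total mass
  of \<open>M\<close>.\<close>

lemma exp_integral_fps_expansion:
  assumes "e > 0"
  shows "(\<lambda>z. \<integral>x. exp (z * g x) - 1 \<partial>M) has_fps_expansion
    Abs_fps (\<lambda>n. if n = 0 then 0 else complex_of_real (\<integral>x. g x ^ n \<partial>M) / fact n)" (is "?F has_fps_expansion ?A")
proof (rule has_fps_expansionI)
  have "eventually (\<lambda>u. u \<in> ball 0 e) (nhds (0::complex))"
    using assms by (intro eventually_nhds_in_open) auto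
  then show "eventually (\<lambda>u. (\<lambda>n. fps_nth ?A n * u ^ n) sums ?F u) (nhds 0)"
  proof eventually_elim
    case (elim u)
    have "complex_of_real (\<integral>x. g x ^ Suc n \<partial>M) = (\<integral>x. complex_of_real (g x) ^ Suc n \<partial>M)" for n
      by (simp flip: of_real_power integral_complex_of_real del: power_Suc)
    then have "(\<lambda>n. fps_nth ?A (Suc n) * u ^ Suc n) sums ?F u"
      using exp_integral_series(2)[of u 0] elim by (simp del: power_Suc fact_Suc)
    then have "(\<lambda>n. fps_nth ?A n * u ^ n) sums (?F u + fps_nth ?A 0 * u ^ 0)"
      by (rule sums_Suc)
    then show ?case by simp
  qed
qed

end

text \<open>Both sides extend to the strip around the imaginary axis as \<open>1 + ?F z\<close> and
  \<open>exp (?G z)\<close>, with the same Taylor coefficients at 0; the identity theorem on the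
  connected strip then gives equality at \<open>\<i>\<close>. For \<open>X\<close> nothing but the
  moments is given, so its exponential integrability is first extracted from their growth.\<close>

theorem fourier_transform_from_moments:
  fixes X :: "'w \<Rightarrow> real" and g :: "'b \<Rightarrow> real"
  assumes P: "prob_space P" and X[measurable]: "X \<in> borel_measurable P"
    and iX: "\<And>n. integrable P (\<lambda>x. X x ^ n)"
    and g[measurable]: "g \<in> borel_measurable M" and e: "e > 0"
    and int: "integrable M (\<lambda>x. \<bar>g x\<bar> * exp (e * \<bar>g x\<bar>))"
    and mom: "\<And>n. complex_of_real (\<integral>x. X x ^ n \<partial>P) = fact n * fps_nth (fps_exp 1 oo
      Abs_fps (\<lambda>n. if n = 0 then 0 else complex_of_real (\<integral>x. g x ^ n \<partial>M) / fact n)) n"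
  shows "(\<integral>x. exp (\<i> * complex_of_real (X x)) \<partial>P) = exp (\<integral>x. exp (\<i> * complex_of_real (g x)) - 1 \<partial>M)"
proof -
  interpret prob_space P by fact
  define V where "V = Abs_fps (\<lambda>n. if n = 0 then 0 else complex_of_real (\<integral>x. g x ^ n \<partial>M) / fact n)"
  define L where "L = fps_exp 1 oo V"
  have Lfun: "(exp \<circ> (\<lambda>z. \<integral>x. exp (z * g x) - 1 \<partial>M)) has_fps_expansion L"
    unfolding L_def using exp_integral_fps_expansion[OF g int e, folded V_def]
    by (rule has_fps_expansion_compose[OF has_fps_expansion_exp[of 1, simplified]]) (simp add: V_def)
  have mom': "complex_of_real (\<integral>x. X x ^ n \<partial>P) / fact n = fps_nth L n" for n
    using mom[of n] by (simp add: L_def V_def)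
  have "fps_conv_radius L > 0" using Lfun by (simp add: has_fps_expansion_def)
  then obtain d0 :: real where d0: "d0 > 0" "ereal d0 < fps_conv_radius L"
    by (metis ereal_dense2 less_ereal.simps(1) zero_ereal_def)
  \<comment> \<open>Half of \<open>d0\<close> is given up in order to absorb the factor
    \<open>\<bar>X x\<bar>\<close> into the exponential; the minimum with \<open>e\<close> keeps the
    integral of \<open>g\<close> on its own strip.\<close>
  define d where "d = min (d0 / 2) e"
  have d: "d > 0" "d \<le> d0 / 2" "d \<le> e" using d0 e by (auto simp: d_def)
  have sL: "summable (\<lambda>n. norm (fps_nth L n * complex_of_real d0 ^ n))"
    by (rule abs_summable_in_conv_radius) (use d0 in \<open>simp add: fps_conv_radius_def\<close>)
  \<comment> \<open>Even moments are nonnegative, so the absolute convergence of \<open>L\<close> at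
    \<open>d0\<close> controls them. They are the moments in the series of \<open>cosh\<close>,
    which dominates both tails of \<open>X\<close>.\<close>
  have ev: "summable (\<lambda>k. d0 ^ (2 * k) * (\<integral>x. X x ^ (2 * k) \<partial>P) / fact (2 * k))"
  proof -
    have "summable (\<lambda>k. norm (fps_nth L (2 * k) * complex_of_real d0 ^ (2 * k)))"
    proof -
      let ?a = "\<lambda>n. norm (fps_nth L n * complex_of_real d0 ^ n)"
      have "summable (\<lambda>n. if even n then ?a n else 0)"
        by (rule summable_comparison_test'[OF sL]) auto
      then show ?thesis
        using summable_mono_reindex[of "\<lambda>k. 2 * k" "\<lambda>n. if even n then ?a n else 0"]
        by (simp add: strict_mono_def image_iff) (metis evenE)
    qed
    moreover have "norm (fps_nth L (2 * k) * complex_of_real d0 ^ (2 * k)) =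
       d0 ^ (2 * k) * (\<integral>x. X x ^ (2 * k) \<partial>P) / fact (2 * k)" for k
    proof -
      have "(\<integral>x. X x ^ (2 * k) \<partial>P) \<ge> 0" by (intro integral_nonneg_AE AE_I2) simp
      then show ?thesis
        by (simp flip: mom' add: norm_mult norm_divide norm_power power_mult_distrib d0 less_imp_le)
    qed
    ultimately show ?thesis by simp
  qed
  have cosh_nn: "(\<integral>\<^sup>+x. ennreal (cosh (d0 * X x)) \<partial>P) < \<infinity>"
  proof -
    have "ennreal (cosh (d0 * X x)) = (\<Sum>k. ennreal (d0 ^ (2 * k) * X x ^ (2 * k) / fact (2 * k)))" for x
    proof -
      have "(\<lambda>n. if even n then (d0 * X x) ^ n /\<^sub>R fact n else 0) sums cosh (d0 * X x)"
        by (rule cosh_converges)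
      then have "(\<lambda>k. (\<lambda>n. if even n then (d0 * X x) ^ n /\<^sub>R fact n else 0) (2 * k)) sums cosh (d0 * X x)"
        by (subst sums_mono_reindex) (auto simp: strict_mono_def elim!: oddE evenE)
      then have "(\<lambda>k. d0 ^ (2 * k) * X x ^ (2 * k) / fact (2 * k)) sums cosh (d0 * X x)"
        by (simp add: power_mult_distrib divide_inverse mult_ac)
      then show ?thesis
        by (subst suminf_ennreal2) (auto simp: sums_iff power_mult)
    qed
    then have "(\<integral>\<^sup>+x. ennreal (cosh (d0 * X x)) \<partial>P) =
        (\<Sum>k. \<integral>\<^sup>+x. ennreal (d0 ^ (2 * k) * X x ^ (2 * k) / fact (2 * k)) \<partial>P)"
      by (simp add: nn_integral_suminf)
    also have "\<dots> = (\<Sum>k. ennreal (d0 ^ (2 * k) * (\<integral>x. X x ^ (2 * k) \<partial>P) / fact (2 * k)))"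
    proof (intro suminf_cong)
      fix k
      have "integrable P (\<lambda>x. d0 ^ (2 * k) * X x ^ (2 * k) / fact (2 * k))" using iX[of "2 * k"] by simp
      then show "(\<integral>\<^sup>+x. ennreal (d0 ^ (2 * k) * X x ^ (2 * k) / fact (2 * k)) \<partial>P) =
          ennreal (d0 ^ (2 * k) * (\<integral>x. X x ^ (2 * k) \<partial>P) / fact (2 * k))"
        by (subst nn_integral_eq_integral) (auto simp: power_mult)
    qed
    also have "\<dots> = ennreal (\<Sum>k. d0 ^ (2 * k) * (\<integral>x. X x ^ (2 * k) \<partial>P) / fact (2 * k))"
      by (rule suminf_ennreal2[OF _ ev]) (auto simp: power_mult intro!: mult_nonneg_nonneg divide_nonneg_nonneg integral_nonneg_AE)
    finally show ?thesis by simp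
  qed
  have icosh: "integrable P (\<lambda>x. cosh (d0 * X x))"
    by (rule integrableI_nonneg) (use cosh_nn in \<open>auto simp: cosh_def\<close>)
  have iXd: "integrable P (\<lambda>x. \<bar>X x\<bar> * exp (d * \<bar>X x\<bar>))"
  proof (rule Bochner_Integration.integrable_bound[where f="\<lambda>x. 4 / d0 * cosh (d0 * X x)"])
    show "AE x in P. norm (\<bar>X x\<bar> * exp (d * \<bar>X x\<bar>)) \<le> norm (4 / d0 * cosh (d0 * X x))"
    proof (rule AE_I2)
      fix x
      have "d0 / 2 * \<bar>X x\<bar> \<le> exp (d0 / 2 * \<bar>X x\<bar>)" using exp_ge_add_one_self[of "d0 / 2 * \<bar>X x\<bar>"] by linarith
      then have "\<bar>X x\<bar> \<le> 2 / d0 * exp (d0 / 2 * \<bar>X x\<bar>)" using d0 by (simp add: field_simps)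
      moreover have "exp (d * \<bar>X x\<bar>) \<le> exp (d0 / 2 * \<bar>X x\<bar>)" using mult_right_mono[OF d(2), of "\<bar>X x\<bar>"] by simp
      ultimately have "\<bar>X x\<bar> * exp (d * \<bar>X x\<bar>) \<le> 2 / d0 * exp (d0 / 2 * \<bar>X x\<bar>) * exp (d0 / 2 * \<bar>X x\<bar>)"
        using d0 by (intro mult_mono) auto
      also have "\<dots> = 2 / d0 * exp (d0 * \<bar>X x\<bar>)" by (simp flip: exp_add)
      also have "exp (d0 * \<bar>X x\<bar>) \<le> 2 * cosh (d0 * X x)"
        by (cases "X x \<ge> 0") (auto simp: cosh_def)
      then have "2 / d0 * exp (d0 * \<bar>X x\<bar>) \<le> 2 / d0 * (2 * cosh (d0 * X x))"
        using d0 by (intro mult_left_mono) auto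
      finally show "norm (\<bar>X x\<bar> * exp (d * \<bar>X x\<bar>)) \<le> norm (4 / d0 * cosh (d0 * X x))"
        using d0 by (simp add: abs_mult)
    qed
  qed (use icosh in auto)
  have intd: "integrable M (\<lambda>x. \<bar>g x\<bar> * exp (d * \<bar>g x\<bar>))"
    by (rule Bochner_Integration.integrable_bound[OF int])
       (use d in \<open>auto intro!: mult_left_mono mult_right_mono\<close>)
  let ?F = "\<lambda>z::complex. \<integral>x. exp (z * X x) - 1 \<partial>P" and ?G = "\<lambda>z::complex. \<integral>x. exp (z * g x) - 1 \<partial>M"
  define D where "D z = 1 + ?F z - exp (?G z)" for z
  let ?S = "{z. \<bar>Re z\<bar> < d}"
  have "(\<lambda>z. 1 + ?F z) has_fps_expansion (1 +
      Abs_fps (\<lambda>n. if n = 0 then 0 else complex_of_real (\<integral>x. X x ^ n \<partial>P) / fact n))"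
    by (intro fps_expansion_intros exp_integral_fps_expansion[OF X iXd d(1)])
  moreover have "1 + Abs_fps (\<lambda>n. if n = 0 then 0 else complex_of_real (\<integral>x. X x ^ n \<partial>P) / fact n) = L"
  proof (rule fps_ext)
    fix n
    show "fps_nth (1 + Abs_fps (\<lambda>n. if n = 0 then 0 else complex_of_real (\<integral>x. X x ^ n \<partial>P) / fact n)) n = fps_nth L n"
      using mom'[of n] by (auto simp: L_def V_def prob_space)
  qed
  ultimately have "D has_fps_expansion (L - L)"
    unfolding D_def using Lfun by (intro fps_expansion_intros) (auto simp: o_def)
  moreover have "D holomorphic_on ?S"
    unfolding D_def
    by (intro holomorphic_intros exp_integral_holomorphic[OF X iXd] exp_integral_holomorphic[OF g intd])
  moreover have "open ?S" by (intro open_Collect_less continuous_intros)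
  moreover have "connected ?S"
  proof (rule convex_connected)
    have "?S = {z. Re z < d} \<inter> {z. Re z > - d}" by auto
    then show "convex ?S" by (simp add: convex_Int convex_halfspace_Re_lt convex_halfspace_Re_gt)
  qed
  ultimately have "D \<i> = 0"
    using d by (intro has_fps_expansion_0_analytic_continuation[of D ?S]) auto
  moreover have "?F \<i> = (\<integral>x. exp (\<i> * X x) \<partial>P) - 1"
  proof -
    have "integrable P (\<lambda>x. exp (\<i> * complex_of_real (X x)))"
      by (rule integrable_const_bound[of _ 1]) auto
    then show ?thesis by (simp add: prob_space)
  qed
  ultimately show ?thesis by (simp add: D_def)
qed

section \<open>Calculus of test functions\<close>

lemma frechet_derivative_cong_open:
  assumes "open S" "x \<in> S" and eq: "\<And>y. y \<in> S \<Longrightarrow> f y = g y"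
  shows "frechet_derivative f (at x) = frechet_derivative g (at x)"
proof -
  have "(f has_derivative D) (at x) \<longleftrightarrow> (g has_derivative D) (at x)" for D
    using has_derivative_transform_within_open[OF _ assms(1,2), of f D UNIV g]
      has_derivative_transform_within_open[OF _ assms(1,2), of g D UNIV f] eq by auto
  then show ?thesis by (simp add: frechet_derivative_def)
qed

lemma differentiable_cong_open:
  assumes "open S" "x \<in> S" "\<And>y. y \<in> S \<Longrightarrow> f y = g y" "f differentiable (at x)"
  shows "g differentiable (at x)"
  using assms(4) has_derivative_transform_within_open[OF _ assms(1,2), of f _ UNIV g] assms(3)
  by (auto simp: differentiable_def)

lemma frechet_derivative_eqI:
  "(f has_derivative D) (at x) \<Longrightarrow> frechet_derivative f (at x) v = D v"
  using frechet_derivative_at[of f D x] by simp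

lemma frechet_derivative_add:
  assumes "f differentiable (at x)" "g differentiable (at x)"
  shows "frechet_derivative (\<lambda>x. f x + g x) (at x) v = frechet_derivative f (at x) v + frechet_derivative g (at x) v"
  using assms unfolding frechet_derivative_works by (intro frechet_derivative_eqI has_derivative_add)

lemma frechet_derivative_mult:
  fixes f g :: "'a::real_normed_vector \<Rightarrow> real"
  assumes "f differentiable (at x)" "g differentiable (at x)"
  shows "frechet_derivative (\<lambda>x. f x * g x) (at x) v = f x * frechet_derivative g (at x) v + frechet_derivative f (at x) v * g x"
  using assms unfolding frechet_derivative_works by (intro frechet_derivative_eqI has_derivative_mult)

lemma iter_deriv_append: "iter_deriv (ws @ vs) f = iter_deriv ws (iter_deriv vs f)"
  by (induction ws) auto

lemma smooth_on_iter_deriv: "smooth_on S f \<Longrightarrow> smooth_on S (iter_deriv vs f)"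
  unfolding smooth_on_def by (metis iter_deriv_append)

lemma smooth_on_differentiable: "smooth_on S f \<Longrightarrow> x \<in> S \<Longrightarrow> f differentiable (at x)"
  unfolding smooth_on_def by (metis iter_deriv.simps(1))

lemma smooth_on_continuous: "smooth_on S f \<Longrightarrow> continuous_on S f"
  using smooth_on_differentiable differentiable_imp_continuous_within
  by (metis continuous_at_imp_continuous_on)

lemma iter_deriv_cong_open:
  assumes "open S" and eq: "\<And>y. y \<in> S \<Longrightarrow> f y = g y" and "x \<in> S"
  shows "iter_deriv vs f x = iter_deriv vs g x"
  using assms(3)
proof (induction vs arbitrary: x)
  case Nil
  then show ?case using eq by simp
next
  case (Cons v vs)
  then show ?case
    using frechet_derivative_cong_open[OF assms(1) Cons.prems, of "iter_deriv vs f" "iter_deriv vs g"] by simp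
qed

text \<open>This replaces explicit formulas for higher derivatives: it suffices to exhibit a class
  of differentiable functions that a single differentiation does not leave. Equality on
  \<open>S\<close> is enough, since \<open>S\<close> is open and derivatives are local.\<close>

lemma smooth_on_coinduct:
  assumes S: "open S" and "C f"
    and d: "\<And>g x. C g \<Longrightarrow> x \<in> S \<Longrightarrow> g differentiable (at x)"
    and D: "\<And>g v. C g \<Longrightarrow> \<exists>h. C h \<and> (\<forall>x\<in>S. frechet_derivative g (at x) v = h x)"
  shows "smooth_on S f"
proof -
  have "\<exists>h. C h \<and> (\<forall>x\<in>S. iter_deriv vs f x = h x)" for vs
  proof (induction vs)
    case Nil
    then show ?case using assms(2) by auto
  next
    case (Cons v vs)
    then obtain h where h: "C h" "\<And>x. x \<in> S \<Longrightarrow> iter_deriv vs f x = h x" by auto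
    obtain h' where "C h'" "\<And>x. x \<in> S \<Longrightarrow> frechet_derivative h (at x) v = h' x" using D[OF h(1)] by blast
    then show ?case using frechet_derivative_cong_open[OF S, of _ "iter_deriv vs f" h] h(2)
      by (intro exI[of _ h']) simp
  qed
  then show ?thesis unfolding smooth_on_def
    using differentiable_cong_open[OF S] d by metis
qed

lemma smooth_on_const: "open S \<Longrightarrow> smooth_on S (\<lambda>_. c)"
proof (rule smooth_on_coinduct[where C="\<lambda>f. \<exists>c. f = (\<lambda>_. c)"])
  fix g :: "real ^ 'a \<Rightarrow> 'b" and v assume "\<exists>c. g = (\<lambda>_. c)"
  then show "\<exists>h. (\<exists>c. h = (\<lambda>_. c)) \<and> (\<forall>x\<in>S. frechet_derivative g (at x) v = h x)"
    by (intro exI[of _ "\<lambda>_. 0"]) auto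
qed auto

text \<open>The derivative of a product is a sum of products; closing under both operations yields a
  class that is stable under differentiation, as the coinduction demands.\<close>

inductive smooth_alg :: "(real ^ 'n::finite) set \<Rightarrow> (real ^ 'n \<Rightarrow> real) \<Rightarrow> bool" for S where
  base: "smooth_on S f \<Longrightarrow> smooth_alg S f"
| add: "smooth_alg S f \<Longrightarrow> smooth_alg S g \<Longrightarrow> smooth_alg S (\<lambda>x. f x + g x)"
| mult: "smooth_alg S f \<Longrightarrow> smooth_alg S g \<Longrightarrow> smooth_alg S (\<lambda>x. f x * g x)"

lemma smooth_alg_smooth_on:
  fixes S :: "(real ^ 'n::finite) set"
  assumes "open S" "smooth_alg S f"
  shows "smooth_on S f"
proof (rule smooth_on_coinduct[where C="smooth_alg S"])
  have d: "g differentiable (at x)" if "smooth_alg S g" "x \<in> S" for g x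
    using that by (induction) (auto intro: smooth_on_differentiable differentiable_add differentiable_mult)
  then show "\<And>g x. smooth_alg S g \<Longrightarrow> x \<in> S \<Longrightarrow> g differentiable (at x)" .
  show "\<exists>h. smooth_alg S h \<and> (\<forall>x\<in>S. frechet_derivative g (at x) v = h x)" if "smooth_alg S g" for g v
    using that
  proof induction
    case (base f)
    then have "smooth_alg S (iter_deriv [v] f)" by (intro smooth_alg.base smooth_on_iter_deriv)
    then show ?case by auto
  next
    case (add f g)
    then obtain f' g' where h: "smooth_alg S f'" "smooth_alg S g'"
      "\<And>x. x \<in> S \<Longrightarrow> frechet_derivative f (at x) v = f' x" "\<And>x. x \<in> S \<Longrightarrow> frechet_derivative g (at x) v = g' x"
      by blast
    have "frechet_derivative (\<lambda>x. f x + g x) (at x) v = f' x + g' x" if "x \<in> S" for x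
      using frechet_derivative_add[OF d[OF add(1) that] d[OF add(2) that]] h that by simp
    then show ?case using smooth_alg.add[OF h(1,2)] by (intro exI[of _ "\<lambda>x. f' x + g' x"] conjI ballI)
  next
    case (mult f g)
    then obtain f' g' where h: "smooth_alg S f'" "smooth_alg S g'"
      "\<And>x. x \<in> S \<Longrightarrow> frechet_derivative f (at x) v = f' x" "\<And>x. x \<in> S \<Longrightarrow> frechet_derivative g (at x) v = g' x"
      by blast
    have "frechet_derivative (\<lambda>x. f x * g x) (at x) v = f x * g' x + f' x * g x" if "x \<in> S" for x
      using frechet_derivative_mult[OF d[OF mult(1) that] d[OF mult(2) that]] h that by simp
    then show ?case using smooth_alg.add[OF smooth_alg.mult[OF mult(1) h(2)] smooth_alg.mult[OF h(1) mult(2)]]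
      by (intro exI[of _ "\<lambda>x. f x * g' x + f' x * g x"] conjI ballI)
  qed
qed (use assms in auto)

lemma smooth_on_add:
  fixes f g :: "real ^ 'n::finite \<Rightarrow> real"
  assumes "open S" "smooth_on S f" "smooth_on S g"
  shows "smooth_on S (\<lambda>x. f x + g x)"
  by (rule smooth_alg_smooth_on[OF assms(1) smooth_alg.add[OF smooth_alg.base[OF assms(2)] smooth_alg.base[OF assms(3)]]])

lemma smooth_on_mult:
  fixes f g :: "real ^ 'n::finite \<Rightarrow> real"
  assumes "open S" "smooth_on S f" "smooth_on S g"
  shows "smooth_on S (\<lambda>x. f x * g x)"
  by (rule smooth_alg_smooth_on[OF assms(1) smooth_alg.mult[OF smooth_alg.base[OF assms(2)] smooth_alg.base[OF assms(3)]]])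

lemma smooth_on_nth:
  fixes f :: "real ^ 'n::finite \<Rightarrow> real ^ 'm"
  assumes "open S" "smooth_on S f"
  shows "smooth_on S (\<lambda>x. f x $ i)"
proof (rule smooth_on_coinduct[where C="\<lambda>g. \<exists>f :: real ^ 'n \<Rightarrow> real ^ 'm. smooth_on S f \<and> g = (\<lambda>x. f x $ i)"])
  have hd: "((\<lambda>x. h x $ i) has_derivative (\<lambda>w. frechet_derivative h (at x) w $ i)) (at x)"
    if "smooth_on S h" "x \<in> S" for h :: "real ^ 'n \<Rightarrow> real ^ 'm" and x
    using smooth_on_differentiable[OF that] unfolding frechet_derivative_works
    by (rule bounded_linear.has_derivative[OF bounded_linear_vec_nth])
  show "g differentiable (at x)" if ex: "\<exists>f :: real ^ 'n \<Rightarrow> real ^ 'm. smooth_on S f \<and> g = (\<lambda>x. f x $ i)" "x \<in> S"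
    for g and x
  proof -
    obtain f :: "real ^ 'n \<Rightarrow> real ^ 'm" where "smooth_on S f" "g = (\<lambda>x. f x $ i)" using ex by blast
    then show ?thesis using hd[of f x] that(2) unfolding differentiable_def by blast
  qed
  show "\<exists>h. (\<exists>f :: real ^ 'n \<Rightarrow> real ^ 'm. smooth_on S f \<and> h = (\<lambda>x. f x $ i)) \<and> (\<forall>x\<in>S. frechet_derivative g (at x) v = h x)"
    if ex: "\<exists>f :: real ^ 'n \<Rightarrow> real ^ 'm. smooth_on S f \<and> g = (\<lambda>x. f x $ i)" for g v
  proof -
    obtain f :: "real ^ 'n \<Rightarrow> real ^ 'm" where f: "smooth_on S f" "g = (\<lambda>x. f x $ i)" using ex by blast
    show ?thesis
      using smooth_on_iter_deriv[OF f(1), of "[v]"] frechet_derivative_eqI[OF hd[OF f(1)], of _ v]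
      by (intro exI[of _ "\<lambda>x. iter_deriv [v] f x $ i"]) (auto simp: f(2))
  qed
qed (use assms in auto)

lemma iter_deriv_add:
  fixes f g :: "real ^ 'n::finite \<Rightarrow> real"
  assumes "open S" "smooth_on S f" "smooth_on S g" "x \<in> S"
  shows "iter_deriv vs (\<lambda>x. f x + g x) x = iter_deriv vs f x + iter_deriv vs g x"
  using assms(4)
proof (induction vs arbitrary: x)
  case (Cons v vs)
  have "iter_deriv (v # vs) (\<lambda>x. f x + g x) x = frechet_derivative (\<lambda>x. iter_deriv vs f x + iter_deriv vs g x) (at x) v"
    using frechet_derivative_cong_open[OF assms(1) Cons.prems Cons.IH] by simp
  also have "\<dots> = iter_deriv (v # vs) f x + iter_deriv (v # vs) g x"
    using frechet_derivative_add[OF smooth_on_differentiable[OF smooth_on_iter_deriv[OF assms(2), of vs] Cons.prems]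
      smooth_on_differentiable[OF smooth_on_iter_deriv[OF assms(3), of vs] Cons.prems]] by simp
  finally show ?case .
qed simp

lemma iter_deriv_cmult:
  fixes f :: "real ^ 'n::finite \<Rightarrow> real"
  assumes "open S" "smooth_on S f" "x \<in> S"
  shows "iter_deriv vs (\<lambda>x. r * f x) x = r * iter_deriv vs f x"
  using assms(3)
proof (induction vs arbitrary: x)
  case (Cons v vs)
  have "iter_deriv (v # vs) (\<lambda>x. r * f x) x = frechet_derivative (\<lambda>x. r * iter_deriv vs f x) (at x) v"
    using frechet_derivative_cong_open[OF assms(1) Cons.prems Cons.IH] by simp
  also have "\<dots> = r * iter_deriv (v # vs) f x"
    using frechet_derivative_mult[OF differentiable_const[of r]
      smooth_on_differentiable[OF smooth_on_iter_deriv[OF assms(2), of vs] Cons.prems]] by simp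
  finally show ?case .
qed simp

section \<open>Derivatives under a change of coordinates\<close>

context
  fixes S U :: "(real ^ 'n::finite) set" and T :: "real ^ 'n \<Rightarrow> real ^ 'n"
begin

text \<open>By the chain rule, the iterated derivatives of \<open>f \<circ> T\<close> have this form as operators in \<open>f\<close>.\<close>

inductive chain_op :: "((real ^ 'n \<Rightarrow> real) \<Rightarrow> real ^ 'n \<Rightarrow> real) \<Rightarrow> bool" where
  base: "smooth_on S a \<Longrightarrow> chain_op (\<lambda>f x. a x * iter_deriv (map (\<lambda>i. axis i 1) is) f (T x))"
| add: "chain_op P \<Longrightarrow> chain_op Q \<Longrightarrow> chain_op (\<lambda>f x. P f x + Q f x)"

lemma chain_op_sum:
  assumes "open S" "finite J" "\<And>j. j \<in> J \<Longrightarrow> chain_op (P j)"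
  shows "chain_op (\<lambda>f x. \<Sum>j\<in>J. P j f x)"
  using assms(2,3)
proof (induction J)
  case empty
  show ?case using chain_op.base[OF smooth_on_const[OF assms(1), of 0], of "[]"] by simp
next
  case (insert j J)
  then show ?case using chain_op.add[of "P j" "\<lambda>f x. \<Sum>j\<in>J. P j f x"] by simp
qed

text \<open>The operator \<open>Q\<close> is the same for all \<open>f\<close>, and this uniformity
  later turns into estimates with constants that do not depend on the function. To stay within the
  class, the derivative along the image of \<open>v\<close> under the differential of
  \<open>T\<close> is expanded in coordinate directions.\<close>

lemma chain_op_deriv:
  assumes S: "open S" and T: "smooth_on S T" and TU: "T ` S \<subseteq> U" and "chain_op P"
  shows "\<exists>Q. chain_op Q \<and> (\<forall>f. smooth_on U f \<longrightarrow> (\<forall>x\<in>S. (P f) differentiable (at x) \<and>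
    frechet_derivative (P f) (at x) v = Q f x))"
  using assms(4)
proof induction
  case (base a "is")
  let ?ws = "map (\<lambda>i. axis i 1) is :: (real ^ 'n) list"
  define Q where "Q f x = iter_deriv [v] a x * iter_deriv ?ws f (T x) +
      (\<Sum>i\<in>UNIV. (a x * iter_deriv [v] T x $ i) * iter_deriv (map (\<lambda>i. axis i 1) (i # is)) f (T x))" for f x
  have "chain_op Q"
    unfolding Q_def
    by (intro chain_op.add chain_op_sum chain_op.base S smooth_on_mult smooth_on_nth smooth_on_iter_deriv base T finite)
  moreover have "(\<lambda>x. a x * iter_deriv ?ws f (T x)) differentiable (at x) \<and>
      frechet_derivative (\<lambda>x. a x * iter_deriv ?ws f (T x)) (at x) v = Q f x"
    if f: "smooth_on U f" and x: "x \<in> S" for f x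
  proof -
    let ?G = "iter_deriv ?ws f"
    have dG: "(?G has_derivative frechet_derivative ?G (at (T x))) (at (T x))"
      using smooth_on_differentiable[OF smooth_on_iter_deriv[OF f], of "T x"] x TU
      unfolding frechet_derivative_works by blast
    have dT: "(T has_derivative frechet_derivative T (at x)) (at x)"
      using smooth_on_differentiable[OF T x] unfolding frechet_derivative_works .
    have da: "(a has_derivative frechet_derivative a (at x)) (at x)"
      using smooth_on_differentiable[OF base x] unfolding frechet_derivative_works .
    have lin: "frechet_derivative ?G (at (T x)) w = (\<Sum>i\<in>UNIV. w $ i * frechet_derivative ?G (at (T x)) (axis i 1))" for w
    proof -
      interpret linear "frechet_derivative ?G (at (T x))" using dG by (rule has_derivative_linear)
      have "w = (\<Sum>i\<in>UNIV. w $ i *\<^sub>R axis i 1)"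
        using basis_expansion[of w] by (simp add: scalar_mult_eq_scaleR)
      then have "frechet_derivative ?G (at (T x)) w = frechet_derivative ?G (at (T x)) (\<Sum>i\<in>UNIV. w $ i *\<^sub>R axis i 1)"
        by (rule arg_cong)
      then show ?thesis by (simp only: sum scale real_scaleR_def)
    qed
    have D: "((\<lambda>x. a x * ?G (T x)) has_derivative (\<lambda>w. a x * frechet_derivative ?G (at (T x)) (frechet_derivative T (at x) w)
        + frechet_derivative a (at x) w * ?G (T x))) (at x)"
      by (intro has_derivative_mult da) (use has_derivative_compose[OF dT dG] in simp)
    then have "frechet_derivative (\<lambda>x. a x * ?G (T x)) (at x) v = a x * frechet_derivative ?G (at (T x)) (frechet_derivative T (at x) v)
        + frechet_derivative a (at x) v * ?G (T x)" by (rule frechet_derivative_eqI)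
    also have "\<dots> = Q f x"
      unfolding Q_def lin[of "frechet_derivative T (at x) v"] by (simp add: sum_distrib_left mult.assoc)
    finally show ?thesis using D by (auto simp: differentiable_def)
  qed
  ultimately show ?case by blast
next
  case (add P Q)
  then obtain P' Q' where h: "chain_op P'" "chain_op Q'"
    "\<And>f x. smooth_on U f \<Longrightarrow> x \<in> S \<Longrightarrow> (P f) differentiable (at x) \<and> frechet_derivative (P f) (at x) v = P' f x"
    "\<And>f x. smooth_on U f \<Longrightarrow> x \<in> S \<Longrightarrow> (Q f) differentiable (at x) \<and> frechet_derivative (Q f) (at x) v = Q' f x"
    by blast
  have "(\<lambda>x. P f x + Q f x) differentiable (at x) \<and> frechet_derivative (\<lambda>x. P f x + Q f x) (at x) v = P' f x + Q' f x"
    if "smooth_on U f" "x \<in> S" for f x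
  proof -
    have "P f differentiable (at x)" "Q f differentiable (at x)" using h(3,4)[OF that] by auto
    then show ?thesis using h(3,4)[OF that] frechet_derivative_add[of "P f" x "Q f" v] by simp
  qed
  then show ?case using chain_op.add[OF h(1,2)] by (intro exI[of _ "\<lambda>f x. P' f x + Q' f x"] conjI allI impI ballI) auto
qed

lemma iter_deriv_compose:
  assumes S: "open S" and T: "smooth_on S T" and TU: "T ` S \<subseteq> U"
  shows "\<exists>P. chain_op P \<and> (\<forall>f. smooth_on U f \<longrightarrow> (\<forall>x\<in>S. iter_deriv vs (\<lambda>x. f (T x)) x = P f x))"
proof (induction vs)
  case Nil
  show ?case using chain_op.base[OF smooth_on_const[OF S, of 1], of "[]"]
    by (intro exI[of _ "\<lambda>f x. 1 * iter_deriv (map (\<lambda>i. axis i 1) []) f (T x)"]) simp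
next
  case (Cons v vs)
  then obtain P where P: "chain_op P" "\<And>f x. smooth_on U f \<Longrightarrow> x \<in> S \<Longrightarrow> iter_deriv vs (\<lambda>x. f (T x)) x = P f x"
    by blast
  obtain Q where Q: "chain_op Q" "\<And>f x. smooth_on U f \<Longrightarrow> x \<in> S \<Longrightarrow> frechet_derivative (P f) (at x) v = Q f x"
    using chain_op_deriv[OF S T TU P(1), of v] by blast
  show ?case
  proof (intro exI[of _ Q] conjI allI impI ballI Q(1))
    fix f :: "real ^ 'n \<Rightarrow> real" and x assume f: "smooth_on U f" and x: "x \<in> S"
    show "iter_deriv (v # vs) (\<lambda>x. f (T x)) x = Q f x"
      using frechet_derivative_cong_open[OF S x P(2)[OF f]] Q(2)[OF f x] by simp
  qed
qed

text \<open>The coefficient functions are bounded on the compact set \<open>K\<close>, and only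
  finitely many coordinate derivatives occur. With \<open>iter_deriv_compose\<close> this controls a
  derivative in one chart by derivatives in another one.\<close>

lemma chain_op_bound:
  assumes "chain_op P" "compact K" "K \<subseteq> S"
  shows "\<exists>C\<ge>0. \<exists>W. finite W \<and> (\<forall>f B. B \<ge> 0 \<longrightarrow>
    (\<forall>is\<in>W. \<forall>x\<in>K. \<bar>iter_deriv (map (\<lambda>i. axis i 1) is) f (T x)\<bar> \<le> B) \<longrightarrow> (\<forall>x\<in>K. \<bar>P f x\<bar> \<le> C * B))"
  using assms(1)
proof induction
  case (base a "is")
  have "compact (a ` K)"
    using smooth_on_continuous[OF base] assms by (intro compact_continuous_image) (auto intro: continuous_on_subset)
  then have "bounded (a ` K)" by (rule compact_imp_bounded)
  then obtain C where "\<forall>x\<in>K. \<bar>a x\<bar> \<le> C" by (auto simp: bounded_iff)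
  then have C: "\<And>x. x \<in> K \<Longrightarrow> \<bar>a x\<bar> \<le> C" by blast
  show ?case
  proof (intro exI[of _ "max C 0"] exI[of _ "{is}"] conjI allI impI ballI)
    fix f :: "real ^ 'n \<Rightarrow> real" and B x
    assume B: "0 \<le> B" and x: "x \<in> K"
      and f: "\<forall>is\<in>{is}. \<forall>x\<in>K. \<bar>iter_deriv (map (\<lambda>i. axis i 1) is) f (T x)\<bar> \<le> B"
    show "\<bar>a x * iter_deriv (map (\<lambda>i. axis i 1) is) f (T x)\<bar> \<le> max C 0 * B"
      unfolding abs_mult using C[OF x] f x B by (intro mult_mono) auto
  qed auto
next
  case (add P Q)
  then obtain C W C' W' where h: "C \<ge> 0" "finite W" "C' \<ge> 0" "finite W'"
    "\<And>f B x. B \<ge> 0 \<Longrightarrow> (\<forall>is\<in>W. \<forall>x\<in>K. \<bar>iter_deriv (map (\<lambda>i. axis i 1) is) f (T x)\<bar> \<le> B) \<Longrightarrow> x \<in> K \<Longrightarrow> \<bar>P f x\<bar> \<le> C * B"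
    "\<And>f B x. B \<ge> 0 \<Longrightarrow> (\<forall>is\<in>W'. \<forall>x\<in>K. \<bar>iter_deriv (map (\<lambda>i. axis i 1) is) f (T x)\<bar> \<le> B) \<Longrightarrow> x \<in> K \<Longrightarrow> \<bar>Q f x\<bar> \<le> C' * B"
    by metis
  show ?case
  proof (intro exI[of _ "C + C'"] exI[of _ "W \<union> W'"] conjI allI impI ballI)
    fix f :: "real ^ 'n \<Rightarrow> real" and B x
    assume B: "0 \<le> B" and x: "x \<in> K"
      and f: "\<forall>is\<in>W \<union> W'. \<forall>x\<in>K. \<bar>iter_deriv (map (\<lambda>i. axis i 1) is) f (T x)\<bar> \<le> B"
    have "\<bar>P f x\<bar> \<le> C * B" by (rule h(5)[OF B _ x]) (use f in blast)
    moreover have "\<bar>Q f x\<bar> \<le> C' * B" by (rule h(6)[OF B _ x]) (use f in blast)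
    ultimately show "\<bar>P f x + Q f x\<bar> \<le> (C + C') * B" by (simp add: algebra_simps)
  qed (use h in auto)
qed

end

section \<open>Test functions on the manifold\<close>

context
  fixes \<A> :: "('a::{t2_space, second_countable_topology}, 'n::finite) chart set"
  assumes atlas: "oriented_atlas \<A>"
begin

lemma atlas_chart:
  assumes "c \<in> \<A>"
  shows "open (fst c)" "open (chart_img c)" "\<And>x. x \<in> fst c \<Longrightarrow> chart_inv c (snd c x) = x"
    "continuous_on (fst c) (snd c)" "continuous_on (chart_img c) (chart_inv c)" "inj_on (snd c) (fst c)"
    "\<And>y. y \<in> chart_img c \<Longrightarrow> chart_inv c y \<in> fst c" "\<And>y. y \<in> chart_img c \<Longrightarrow> snd c (chart_inv c y) = y"
proof -
  have "is_chart c" using atlas assms by (auto simp: oriented_atlas_def)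
  then have h: "open (fst c)" "open (chart_img c)" "homeomorphism (fst c) (chart_img c) (snd c) (chart_inv c)"
    by (auto simp: is_chart_def)
  then show "open (fst c)" "open (chart_img c)" "\<And>x. x \<in> fst c \<Longrightarrow> chart_inv c (snd c x) = x"
    "continuous_on (fst c) (snd c)" "continuous_on (chart_img c) (chart_inv c)"
    by (auto simp: homeomorphism_def)
  then show "inj_on (snd c) (fst c)" by (metis inj_on_inverseI)
  show "\<And>y. y \<in> chart_img c \<Longrightarrow> chart_inv c y \<in> fst c" "\<And>y. y \<in> chart_img c \<Longrightarrow> snd c (chart_inv c y) = y"
    using h(3) by (auto simp: homeomorphism_def)
qed

lemma atlas_cover: "\<exists>c\<in>\<A>. x \<in> fst c"
  using atlas by (auto simp: oriented_atlas_def)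

lemma chart_image_open:
  assumes "c \<in> \<A>" "open V" "V \<subseteq> fst c"
  shows "open (snd c ` V)"
proof -
  have "snd c ` V = chart_img c \<inter> chart_inv c -` V"
    using assms(3) atlas_chart[OF assms(1)] by (auto simp: image_iff) 
  moreover have "open (chart_img c \<inter> chart_inv c -` V)"
    using atlas_chart[OF assms(1)] assms(2) by (auto intro: continuous_open_preimage)
  ultimately show ?thesis by simp
qed

lemma chart_inv_image_open:
  assumes "c \<in> \<A>" "open V" "V \<subseteq> chart_img c"
  shows "open (chart_inv c ` V)"
proof -
  have "chart_inv c ` V = fst c \<inter> snd c -` V"
  proof (intro set_eqI iffI)
    fix x assume "x \<in> fst c \<inter> snd c -` V"
    then have "snd c x \<in> V" "chart_inv c (snd c x) = x" using atlas_chart(3)[OF assms(1)] by auto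
    then show "x \<in> chart_inv c ` V" by (metis image_eqI)
  qed (use assms(3) atlas_chart[OF assms(1)] in auto)
  moreover have "open (fst c \<inter> snd c -` V)"
    using atlas_chart[OF assms(1)] assms(2) by (auto intro: continuous_open_preimage)
  ultimately show ?thesis by simp
qed

text \<open>The closed coordinate balls give compact sets inside charts whose interiors cover the
  manifold, and second countability leaves countably many of them. Every compact set is covered by
  finitely many, so they also serve as an exhaustion.\<close>

lemma countable_compact_charts:
  "\<exists>(cc :: nat \<Rightarrow> ('a, 'n) chart) (L :: nat \<Rightarrow> 'a set). (\<forall>m. cc m \<in> \<A>) \<and> (\<forall>m. compact (L m)) \<and>
    (\<forall>m. L m \<subseteq> fst (cc m)) \<and> (\<Union>m. interior (L m)) = UNIV"
proof -
  define F where "F = {interior L | L. compact L \<and> (\<exists>c\<in>\<A>. L \<subseteq> fst c)}"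
  have "x \<in> \<Union>F" for x
  proof -
    obtain c where c: "c \<in> \<A>" "x \<in> fst c" using atlas_cover by blast
    then have "snd c x \<in> chart_img c" by blast
    then obtain r where r: "r > 0" "cball (snd c x) r \<subseteq> chart_img c"
      using atlas_chart(2)[OF c(1)] open_contains_cball by metis
    let ?L = "chart_inv c ` cball (snd c x) r"
    have "compact ?L"
      by (rule compact_continuous_image) (use r atlas_chart(5)[OF c(1)] in \<open>auto intro: continuous_on_subset\<close>)
    moreover have "?L \<subseteq> fst c" using r(2) atlas_chart(7)[OF c(1)] by blast
    moreover have "x \<in> interior ?L"
    proof (rule interiorI)
      have "ball (snd c x) r \<subseteq> chart_img c" using r(2) ball_subset_cball by blast
      then show "open (chart_inv c ` ball (snd c x) r)"
        by (rule chart_inv_image_open[OF c(1) open_ball])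
      show "x \<in> chart_inv c ` ball (snd c x) r" using r(1) atlas_chart(3)[OF c] by (metis centre_in_ball image_eqI)
      show "chart_inv c ` ball (snd c x) r \<subseteq> ?L" by (intro image_mono ball_subset_cball)
    qed
    ultimately show ?thesis using c(1) unfolding F_def by blast
  qed
  then have UF: "\<Union>F = UNIV" by blast
  obtain F' where F': "F' \<subseteq> F" "countable F'" "\<Union>F' = \<Union>F"
    by (rule Lindelof[of F]) (auto simp: F_def)
  have "F' \<noteq> {}" using F'(3) UF by auto
  define G where "G = from_nat_into F'"
  have G: "G m \<in> F" for m using from_nat_into[OF \<open>F' \<noteq> {}\<close>] F'(1) by (auto simp: G_def)
  have "range G = F'" unfolding G_def by (rule range_from_nat_into) fact+
  then have UG: "(\<Union>m. G m) = UNIV" using F'(3) UF by simp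
  have "\<forall>m. \<exists>L c. G m = interior L \<and> compact L \<and> c \<in> \<A> \<and> L \<subseteq> fst c"
    using G unfolding F_def by blast
  then obtain L cc where "\<And>m. G m = interior (L m) \<and> compact (L m) \<and> cc m \<in> \<A> \<and> L m \<subseteq> fst (cc m)"
    by metis
  then show ?thesis using UG by (intro exI[of _ cc] exI[of _ L]) auto
qed

lemma test_continuous:
  assumes "\<phi> \<in> test_functions \<A>"
  shows "continuous_on UNIV \<phi>"
proof -
  have "continuous (at x) \<phi>" for x
  proof -
    obtain c where c: "c \<in> \<A>" "x \<in> fst c" using atlas_cover by blast
    have "smooth_on (chart_img c) (\<lambda>y. \<phi> (chart_inv c y))" using assms c unfolding test_functions_def by blast
    then have "continuous_on (chart_img c) (\<lambda>y. \<phi> (chart_inv c y))" by (rule smooth_on_continuous)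
    then have "continuous_on (fst c) (\<lambda>x. \<phi> (chart_inv c (snd c x)))"
      by (rule continuous_on_compose2[OF _ atlas_chart(4)[OF c(1)]]) simp
    then have "continuous_on (fst c) \<phi>"
      by (rule continuous_on_eq) (simp add: atlas_chart(3)[OF c(1)])
    then show ?thesis using c(2) continuous_on_eq_continuous_at[OF atlas_chart(1)[OF c(1)]] by blast
  qed
  then show ?thesis by (simp add: continuous_at_imp_continuous_on)
qed

lemma test_measurable: "\<phi> \<in> test_functions \<A> \<Longrightarrow> \<phi> \<in> borel_measurable borel"
  by (intro borel_measurable_continuous_onI test_continuous)

lemma test_bounded_support:
  assumes "\<phi> \<in> test_functions \<A>"
  shows "\<exists>K C. compact K \<and> (\<forall>x. x \<notin> K \<longrightarrow> \<phi> x = 0) \<and> C \<ge> 0 \<and> (\<forall>x. \<bar>\<phi> x\<bar> \<le> C)"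
proof -
  let ?K = "closure {x. \<phi> x \<noteq> 0}"
  have K: "compact ?K" using assms unfolding test_functions_def mem_Collect_eq by (rule conjunct1)
  have z: "\<phi> x = 0" if "x \<notin> ?K" for x using that closure_subset[of "{x. \<phi> x \<noteq> 0}"] by blast
  have "compact (\<phi> ` ?K)"
    by (rule compact_continuous_image[OF continuous_on_subset[OF test_continuous[OF assms]] K]) simp
  then have "bounded (\<phi> ` ?K)" by (rule compact_imp_bounded)
  then obtain C where "\<forall>y\<in>\<phi> ` ?K. \<bar>y\<bar> \<le> C" unfolding bounded_real by blast
  then have C: "\<And>x. x \<in> ?K \<Longrightarrow> \<bar>\<phi> x\<bar> \<le> C" by blast
  have "\<bar>\<phi> x\<bar> \<le> max C 0" for x
  proof (cases "x \<in> ?K")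
    case True
    then show ?thesis using C[of x] by linarith
  next
    case False
    then show ?thesis using z[of x] by simp
  qed
  then show ?thesis using K z max.cobounded2[of 0 C] by blast
qed

lemma test_functionI:
  assumes "compact K" "\<And>x. x \<notin> K \<Longrightarrow> \<phi> x = 0"
    "\<And>c. c \<in> \<A> \<Longrightarrow> smooth_on (chart_img c) (\<lambda>y. \<phi> (chart_inv c y))"
  shows "\<phi> \<in> test_functions \<A>"
proof -
  have "closure {x. \<phi> x \<noteq> 0} \<subseteq> K"
    using assms(2) by (intro closure_minimal compact_imp_closed[OF assms(1)]) auto
  then have "compact (closure {x. \<phi> x \<noteq> 0})"
    using compact_Int_closed[OF assms(1), of "closure {x. \<phi> x \<noteq> 0}"] by (simp add: Int_absorb1)
  then show ?thesis using assms(3) unfolding test_functions_def by blast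
qed

lemma test_smooth: "\<phi> \<in> test_functions \<A> \<Longrightarrow> c \<in> \<A> \<Longrightarrow> smooth_on (chart_img c) (\<lambda>y. \<phi> (chart_inv c y))"
  unfolding test_functions_def by blast

lemma test_add:
  assumes "\<phi> \<in> test_functions \<A>" "\<psi> \<in> test_functions \<A>"
  shows "(\<lambda>x. \<phi> x + \<psi> x) \<in> test_functions \<A>"
proof -
  obtain K C where K: "compact K" "\<And>x. x \<notin> K \<Longrightarrow> \<phi> x = 0" "C \<ge> 0" "\<And>x. \<bar>\<phi> x\<bar> \<le> C"
    using test_bounded_support[OF assms(1)] by blast
  obtain K' C' where K': "compact K'" "\<And>x. x \<notin> K' \<Longrightarrow> \<psi> x = 0" "C' \<ge> 0" "\<And>x. \<bar>\<psi> x\<bar> \<le> C'"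
    using test_bounded_support[OF assms(2)] by blast
  show ?thesis
  proof (rule test_functionI)
    show "compact (K \<union> K')" by (rule compact_Un[OF K(1) K'(1)])
    show "\<phi> x + \<psi> x = 0" if "x \<notin> K \<union> K'" for x using that K(2)[of x] K'(2)[of x] by simp
    show "smooth_on (chart_img c) (\<lambda>y. \<phi> (chart_inv c y) + \<psi> (chart_inv c y))" if "c \<in> \<A>" for c
      by (rule smooth_on_add[OF atlas_chart(2)[OF that] test_smooth[OF assms(1) that] test_smooth[OF assms(2) that]])
  qed
qed

lemma test_mult:
  assumes "\<phi> \<in> test_functions \<A>" "\<psi> \<in> test_functions \<A>"
  shows "(\<lambda>x. \<phi> x * \<psi> x) \<in> test_functions \<A>"
proof -
  obtain K C where K: "compact K" "\<And>x. x \<notin> K \<Longrightarrow> \<phi> x = 0" "C \<ge> 0" "\<And>x. \<bar>\<phi> x\<bar> \<le> C"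
    using test_bounded_support[OF assms(1)] by blast
  show ?thesis
  proof (rule test_functionI[OF K(1)])
    show "\<phi> x * \<psi> x = 0" if "x \<notin> K" for x using K(2)[OF that] by simp
    show "smooth_on (chart_img c) (\<lambda>y. \<phi> (chart_inv c y) * \<psi> (chart_inv c y))" if "c \<in> \<A>" for c
      by (rule smooth_on_mult[OF atlas_chart(2)[OF that] test_smooth[OF assms(1) that] test_smooth[OF assms(2) that]])
  qed
qed

lemma test_scale:
  assumes "\<phi> \<in> test_functions \<A>"
  shows "(\<lambda>x. r * \<phi> x) \<in> test_functions \<A>"
proof -
  obtain K C where K: "compact K" "\<And>x. x \<notin> K \<Longrightarrow> \<phi> x = 0" "C \<ge> 0" "\<And>x. \<bar>\<phi> x\<bar> \<le> C"
    using test_bounded_support[OF assms(1)] by blast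
  show ?thesis
  proof (rule test_functionI[OF K(1)])
    show "r * \<phi> x = 0" if "x \<notin> K" for x using K(2)[OF that] by simp
    show "smooth_on (chart_img c) (\<lambda>y. r * \<phi> (chart_inv c y))" if "c \<in> \<A>" for c
      by (rule smooth_on_mult[OF atlas_chart(2)[OF that] smooth_on_const[OF atlas_chart(2)[OF that]] test_smooth[OF assms(1) that]])
  qed
qed

lemma test_zero: "(\<lambda>x. 0) \<in> test_functions \<A>"
  by (rule test_functionI[OF compact_empty refl smooth_on_const[OF atlas_chart(2)]])

lemma test_diff:
  "\<phi> \<in> test_functions \<A> \<Longrightarrow> \<psi> \<in> test_functions \<A> \<Longrightarrow> (\<lambda>x. \<phi> x - \<psi> x) \<in> test_functions \<A>"
  using test_add[of \<phi> "\<lambda>x. -1 * \<psi> x"] test_scale[of \<psi> "-1"] by simp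

lemma test_power: "\<phi> \<in> test_functions \<A> \<Longrightarrow> (\<lambda>x. \<phi> x ^ Suc k) \<in> test_functions \<A>"
  by (induction k) (simp_all add: test_mult)

lemma test_sum:
  "(\<And>j. j < (m::nat) \<Longrightarrow> \<phi> j \<in> test_functions \<A>) \<Longrightarrow> (\<lambda>x. \<Sum>j<m. \<phi> j x) \<in> test_functions \<A>"
  by (induction m) (simp_all add: test_zero test_add)

end

section \<open>Uniqueness of joint laws\<close>

text \<open>After division by its total mass \<open>m\<close>, the density \<open>h\<close> defines
  a probability measure whose image under \<open>X\<close> has the given transform as characteristic
  function, up to the factor \<open>m\<close>; Levy uniqueness applies. The lower bound 1 secures
  \<open>m > 0\<close>, and the frequency 0 shows that both sides have the same mass.\<close>

lemma weighted_fourier_unique_pos: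
  fixes X :: "'p \<Rightarrow> real" and Y :: "'q \<Rightarrow> real" and h :: "'p \<Rightarrow> real" and h' :: "'q \<Rightarrow> real"
  assumes P: "prob_space P" and Q: "prob_space Q"
    and [measurable]: "X \<in> borel_measurable P" "Y \<in> borel_measurable Q"
      "h \<in> borel_measurable P" "h' \<in> borel_measurable Q"
    and h: "\<And>x. 1 \<le> h x" "\<And>x. h x \<le> C" and h': "\<And>x. 1 \<le> h' x" "\<And>x. h' x \<le> C"
    and F: "\<And>s. (\<integral>x. complex_of_real (h x) * exp (\<i> * of_real (s * X x)) \<partial>P) =
      (\<integral>x. complex_of_real (h' x) * exp (\<i> * of_real (s * Y x)) \<partial>Q)"
    and B: "B \<in> sets borel"
  shows "(\<integral>x. h x * indicator B (X x) \<partial>P) = (\<integral>x. h' x * indicator B (Y x) \<partial>Q)"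
proof -
  interpret P: prob_space P by fact
  interpret Q: prob_space Q by fact
  have nn: "0 \<le> h x" "0 \<le> h' y" for x y using h(1)[of x] h'(1)[of y] by linarith+
  have ih: "integrable P h" "integrable Q h'"
    using h h' nn by (auto intro!: P.integrable_const_bound[of _ C] Q.integrable_const_bound[of _ C])
  define m where "m = (\<integral>x. h x \<partial>P)"
  have m1: "m \<ge> 1" using P.integral_ge_const[OF ih(1), of 1] h by (simp add: m_def)
  have mQ: "(\<integral>x. h' x \<partial>Q) = m"
    using F[of 0] ih by (simp add: m_def)
  define P' where "P' = distr (density P (\<lambda>x. ennreal (h x / m))) borel X"
  define Q' where "Q' = distr (density Q (\<lambda>x. ennreal (h' x / m))) borel Y"
  have rd: "real_distribution P'" "real_distribution Q'"
  proof -
    have "emeasure (density P (\<lambda>x. ennreal (h x / m))) (space P) = ennreal (\<integral>x. h x / m \<partial>P)"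
      using ih nn m1 by (subst emeasure_density) (auto simp: nn_integral_eq_integral intro!: nn_integral_cong)
    then have "emeasure (density P (\<lambda>x. ennreal (h x / m))) (space P) = 1"
      using m1 by (simp flip: m_def)
    then have "prob_space (density P (\<lambda>x. ennreal (h x / m)))" by (intro prob_spaceI) simp
    then show "real_distribution P'" unfolding P'_def
      by (rule prob_space.real_distribution_distr) simp
    have "emeasure (density Q (\<lambda>x. ennreal (h' x / m))) (space Q) = ennreal (\<integral>x. h' x / m \<partial>Q)"
      using ih nn m1 by (subst emeasure_density) (auto simp: nn_integral_eq_integral intro!: nn_integral_cong)
    then have "emeasure (density Q (\<lambda>x. ennreal (h' x / m))) (space Q) = 1"
      using m1 by (simp add: mQ)
    then have "prob_space (density Q (\<lambda>x. ennreal (h' x / m)))" by (intro prob_spaceI) simp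
    then show "real_distribution Q'" unfolding Q'_def
      by (rule prob_space.real_distribution_distr) simp
  qed
  have cP: "char P' s = (\<integral>x. complex_of_real (h x) * exp (\<i> * of_real (s * X x)) \<partial>P) / m" for s
    unfolding P'_def char_def using nn m1
    by (subst integral_distr, simp, simp, subst integral_density)
       (auto simp: scaleR_conv_of_real divide_inverse mult_ac)
  have cQ: "char Q' s = (\<integral>x. complex_of_real (h' x) * exp (\<i> * of_real (s * Y x)) \<partial>Q) / m" for s
    unfolding Q'_def char_def using nn m1
    by (subst integral_distr, simp, simp, subst integral_density)
       (auto simp: scaleR_conv_of_real divide_inverse mult_ac)
  have "P' = Q'" by (rule Levy_uniqueness[OF rd]) (rule ext, simp only: cP cQ F)
  moreover have "(\<integral>x. indicator B x \<partial>P') = (\<integral>x. h x * indicator B (X x) \<partial>P) / m"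
    unfolding P'_def using nn m1 B
    by (subst integral_distr, simp, simp, subst integral_density)
       (auto simp: divide_inverse mult_ac)
  moreover have "(\<integral>x. indicator B x \<partial>Q') = (\<integral>x. h' x * indicator B (Y x) \<partial>Q) / m"
    unfolding Q'_def using nn m1 B
    by (subst integral_distr, simp, simp, subst integral_density)
       (auto simp: divide_inverse mult_ac)
  ultimately show ?thesis using m1 by simp
qed

lemma weighted_fourier_unique_real:
  fixes X :: "'p \<Rightarrow> real" and Y :: "'q \<Rightarrow> real" and h :: "'p \<Rightarrow> real" and h' :: "'q \<Rightarrow> real"
  assumes P: "prob_space P" and Q: "prob_space Q"
    and [measurable]: "X \<in> borel_measurable P" "Y \<in> borel_measurable Q"
      "h \<in> borel_measurable P" "h' \<in> borel_measurable Q"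
    and h: "\<And>x. \<bar>h x\<bar> \<le> 1" and h': "\<And>x. \<bar>h' x\<bar> \<le> 1"
    and F1: "\<And>s. (\<integral>x. exp (\<i> * complex_of_real (s * X x)) \<partial>P) = (\<integral>x. exp (\<i> * complex_of_real (s * Y x)) \<partial>Q)"
    and F: "\<And>s. (\<integral>x. complex_of_real (h x) * exp (\<i> * of_real (s * X x)) \<partial>P) =
      (\<integral>x. complex_of_real (h' x) * exp (\<i> * of_real (s * Y x)) \<partial>Q)"
    and B[measurable]: "B \<in> sets borel"
  shows "(\<integral>x. h x * indicator B (X x) \<partial>P) = (\<integral>x. h' x * indicator B (Y x) \<partial>Q)"
proof -
  interpret P: prob_space P by fact
  interpret Q: prob_space Q by fact
  have iP: "integrable P (\<lambda>x. complex_of_real (h x) * exp (\<i> * of_real (s * X x)))"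
     "integrable P (\<lambda>x. exp (\<i> * complex_of_real (s * X x)))" for s
    using h by (auto intro!: P.integrable_const_bound[of _ 1] simp: norm_mult)
  have iQ: "integrable Q (\<lambda>x. complex_of_real (h' x) * exp (\<i> * of_real (s * Y x)))"
     "integrable Q (\<lambda>x. exp (\<i> * complex_of_real (s * Y x)))" for s
    using h' by (auto intro!: Q.integrable_const_bound[of _ 1] simp: norm_mult)
  have bP: "integrable P (\<lambda>x. h x * indicator B (X x))" "integrable P (\<lambda>x. indicator B (X x) :: real)"
    using h by (auto intro!: P.integrable_const_bound[of _ 1] simp: abs_mult indicator_def)
  have bQ: "integrable Q (\<lambda>x. h' x * indicator B (Y x))" "integrable Q (\<lambda>x. indicator B (Y x) :: real)"
    using h' by (auto intro!: Q.integrable_const_bound[of _ 1] simp: abs_mult indicator_def)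
  \<comment> \<open>Adding 2 moves a weight from [-1, 1] into [1, 3]; the surplus constant is
    subtracted again by means of the weight 1.\<close>
  have a: "(\<integral>x. (h x + 2) * indicator B (X x) \<partial>P) = (\<integral>x. (h' x + 2) * indicator B (Y x) \<partial>Q)"
  proof (rule weighted_fourier_unique_pos[OF P Q, where C=3])
    show "1 \<le> h x + 2" "h x + 2 \<le> 3" for x using h[of x] by (auto simp: abs_le_iff)
    show "1 \<le> h' x + 2" "h' x + 2 \<le> 3" for x using h'[of x] by (auto simp: abs_le_iff)
    show "(\<integral>x. complex_of_real (h x + 2) * exp (\<i> * of_real (s * X x)) \<partial>P) =
      (\<integral>x. complex_of_real (h' x + 2) * exp (\<i> * of_real (s * Y x)) \<partial>Q)" for s
      using F[of s] F1[of s] iP[of s] iQ[of s] by (simp add: ring_distribs)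
  qed (use B in auto)
  have b: "(\<integral>x. (1::real) * indicator B (X x) \<partial>P) = (\<integral>x. 1 * indicator B (Y x) \<partial>Q)"
    by (rule weighted_fourier_unique_pos[OF P Q, where C=1 and h="\<lambda>_. 1" and h'="\<lambda>_. 1"]) (use F1 B in auto)
  from a b bP bQ show ?thesis by (simp add: ring_distribs)
qed

lemma weighted_fourier_unique:
  fixes X :: "'p \<Rightarrow> real" and Y :: "'q \<Rightarrow> real" and h :: "'p \<Rightarrow> complex" and h' :: "'q \<Rightarrow> complex"
  assumes P: "prob_space P" and Q: "prob_space Q"
    and [measurable]: "X \<in> borel_measurable P" "Y \<in> borel_measurable Q"
      "h \<in> borel_measurable P" "h' \<in> borel_measurable Q"
    and h: "\<And>x. norm (h x) \<le> 1" and h': "\<And>x. norm (h' x) \<le> 1"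
    and F1: "\<And>s. (\<integral>x. exp (\<i> * complex_of_real (s * X x)) \<partial>P) = (\<integral>x. exp (\<i> * complex_of_real (s * Y x)) \<partial>Q)"
    and F: "\<And>s. (\<integral>x. h x * exp (\<i> * of_real (s * X x)) \<partial>P) = (\<integral>x. h' x * exp (\<i> * of_real (s * Y x)) \<partial>Q)"
    and B[measurable]: "B \<in> sets borel"
  shows "(\<integral>x. h x * indicator B (X x) \<partial>P) = (\<integral>x. h' x * indicator B (Y x) \<partial>Q)"
proof -
  interpret P: prob_space P by fact
  interpret Q: prob_space Q by fact
  have [measurable]: "(\<lambda>x. cnj (h x)) \<in> borel_measurable P" "(\<lambda>x. cnj (h' x)) \<in> borel_measurable Q"
    by (intro borel_measurable_continuous_on[where f=cnj] continuous_intros; simp)+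
  have iP: "integrable P (\<lambda>x. h x * exp (\<i> * of_real (s * X x)))"
     "integrable P (\<lambda>x. cnj (h x) * exp (\<i> * of_real (s * X x)))"
     "integrable P (\<lambda>x. h x * indicator B (X x))" for s
    using h by (auto intro!: P.integrable_const_bound[of _ 1] simp: norm_mult indicator_def)
  have iQ: "integrable Q (\<lambda>x. h' x * exp (\<i> * of_real (s * Y x)))"
    "integrable Q (\<lambda>x. cnj (h' x) * exp (\<i> * of_real (s * Y x)))"
     "integrable Q (\<lambda>x. h' x * indicator B (Y x))" for s
    using h' by (auto intro!: Q.integrable_const_bound[of _ 1] simp: norm_mult indicator_def)
  \<comment> \<open>Conjugation reverses the sign of the frequency, so the hypothesis at
    \<open>-s\<close> yields the conjugate weight at \<open>s\<close>, and with it the real and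
    imaginary parts.\<close>
  have cF: "(\<integral>x. cnj (h x) * exp (\<i> * of_real (s * X x)) \<partial>P) = (\<integral>x. cnj (h' x) * exp (\<i> * of_real (s * Y x)) \<partial>Q)" for s
  proof -
    have "(\<integral>x. cnj (h x * exp (\<i> * of_real ((-s) * X x))) \<partial>P) = (\<integral>x. cnj (h' x * exp (\<i> * of_real ((-s) * Y x))) \<partial>Q)"
      using arg_cong[OF F[of "-s"], of cnj] unfolding Bochner_Integration.integral_cnj[symmetric] .
    then show ?thesis by (simp add: exp_cnj)
  qed
  obtain K where rc: "complex_of_real (Re z) = (z + cnj z) / 2" "complex_of_real (Im z) = K * (z - cnj z)" for z
    by (rule that[of "- \<i> / 2"]) (auto simp: complex_eq_iff)
  have R: "(\<integral>x. Re (h x) * indicator B (X x) \<partial>P) = (\<integral>x. Re (h' x) * indicator B (Y x) \<partial>Q)"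
  proof (rule weighted_fourier_unique_real[OF P Q _ _ _ _ _ _ F1 _ B])
    show "\<bar>Re (h x)\<bar> \<le> 1" for x using h[of x] abs_Re_le_cmod[of "h x"] by linarith
    show "\<bar>Re (h' x)\<bar> \<le> 1" for x using h'[of x] abs_Re_le_cmod[of "h' x"] by linarith
    show "(\<integral>x. complex_of_real (Re (h x)) * exp (\<i> * of_real (s * X x)) \<partial>P) =
      (\<integral>x. complex_of_real (Re (h' x)) * exp (\<i> * of_real (s * Y x)) \<partial>Q)" for s
      unfolding rc using F[of s] cF[of s] iP(1,2)[of s] iQ(1,2)[of s]
      by (simp add: add_divide_distrib ring_distribs)
  qed auto
  have I: "(\<integral>x. Im (h x) * indicator B (X x) \<partial>P) = (\<integral>x. Im (h' x) * indicator B (Y x) \<partial>Q)"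
  proof (rule weighted_fourier_unique_real[OF P Q _ _ _ _ _ _ F1 _ B])
    show "\<bar>Im (h x)\<bar> \<le> 1" for x using h[of x] abs_Im_le_cmod[of "h x"] by linarith
    show "\<bar>Im (h' x)\<bar> \<le> 1" for x using h'[of x] abs_Im_le_cmod[of "h' x"] by linarith
    show "(\<integral>x. complex_of_real (Im (h x)) * exp (\<i> * of_real (s * X x)) \<partial>P) =
      (\<integral>x. complex_of_real (Im (h' x)) * exp (\<i> * of_real (s * Y x)) \<partial>Q)" for s
      unfolding rc using F[of s] cF[of s] iP(1,2)[of s] iQ(1,2)[of s]
      by (simp add: ring_distribs mult.assoc)
  qed auto
  have Re': "Re (indicator B y) = indicator B y" "Im (indicator B y) = 0" for y
    by (auto simp: indicator_def)
  show ?thesis using R I iP(3) iQ(3)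
    by (simp add: complex_eq_iff Re' flip: integral_Re integral_Im)
qed

text \<open>Exponentials are exchanged for indicators one coordinate at a time. The indicators
  obtained so far and the exponentials still present form a complex weight of modulus at most 1, so
  each exchange is an instance of the one-dimensional uniqueness theorem; finite-dimensional boxes
  then determine the law.\<close>

lemma fourier_unique_sequence:
  fixes X :: "nat \<Rightarrow> 'p \<Rightarrow> real" and Y :: "nat \<Rightarrow> 'q \<Rightarrow> real"
  assumes P: "prob_space P" and Q: "prob_space Q"
    and X[measurable]: "\<And>j. X j \<in> borel_measurable P" and Y[measurable]: "\<And>j. Y j \<in> borel_measurable Q"
    and F: "\<And>m t. (\<integral>x. exp (\<i> * complex_of_real (\<Sum>j<m. t j * X j x)) \<partial>P) =
      (\<integral>x. exp (\<i> * complex_of_real (\<Sum>j<m. t j * Y j x)) \<partial>Q)"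
  shows "distr P (\<Pi>\<^sub>M j\<in>UNIV. borel) (\<lambda>x j. X j x) = distr Q (\<Pi>\<^sub>M j\<in>UNIV. borel) (\<lambda>x j. Y j x)"
proof -
  interpret P: prob_space P by fact
  interpret Q: prob_space Q by fact
  have main: "\<forall>B t m. (\<forall>j. B j \<in> sets borel) \<longrightarrow> (\<integral>x. (\<Prod>j<k. indicator (B j) (X j x)) * exp (\<i> * complex_of_real (\<Sum>j\<in>{k..<m}. t j * X j x)) \<partial>P) =
      (\<integral>x. (\<Prod>j<k. indicator (B j) (Y j x)) * exp (\<i> * complex_of_real (\<Sum>j\<in>{k..<m}. t j * Y j x)) \<partial>Q)" for k
  proof (induction k)
    case 0
    then show ?case using F by (simp add: lessThan_atLeast0)
  next
    case (Suc k)
    show ?case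
    proof (intro allI impI)
    fix B :: "nat \<Rightarrow> real set" and t :: "nat \<Rightarrow> real" and m :: nat
    assume "\<forall>j. B j \<in> sets borel"
    then have B[measurable]: "\<And>j. B j \<in> sets borel" by blast
    let ?h = "\<lambda>x. (\<Prod>j<k. indicator (B j) (X j x)) * exp (\<i> * complex_of_real (\<Sum>j\<in>{Suc k..<m}. t j * X j x))"
    let ?h' = "\<lambda>x. (\<Prod>j<k. indicator (B j) (Y j x)) * exp (\<i> * complex_of_real (\<Sum>j\<in>{Suc k..<m}. t j * Y j x))"
    have pb: "norm (\<Prod>j<k. indicator (C j) (z j) :: complex) \<le> 1" for C :: "nat \<Rightarrow> real set" and z
      by (rule order_trans[OF norm_prod_le], rule prod_le_1) (auto simp: indicator_def)
    have "(\<integral>x. ?h x * indicator (B k) (X k x) \<partial>P) = (\<integral>x. ?h' x * indicator (B k) (Y k x) \<partial>Q)"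
    proof (rule weighted_fourier_unique[OF P Q])
      fix s :: real
      show "(\<integral>x. exp (\<i> * complex_of_real (s * X k x)) \<partial>P) = (\<integral>x. exp (\<i> * complex_of_real (s * Y k x)) \<partial>Q)"
        using Suc.IH[rule_format, of "\<lambda>_. UNIV" "\<lambda>_. s" "Suc k"] by simp
      \<comment> \<open>The frequency of coordinate \<open>k\<close> becomes the free variable
        \<open>s\<close>. The maximum with \<open>Suc k\<close> ensures that this coordinate occurs
        in the sum even if \<open>m \<le> k\<close>.\<close>
      let ?t = "\<lambda>j. if j = k then s else t j"
      have e: "(\<Sum>j\<in>{k..<max (Suc k) m}. ?t j * z j) = s * z k + (\<Sum>j\<in>{Suc k..<m}. t j * z j)" for z
      proof -
        have "{k..<max (Suc k) m} = insert k {Suc k..<m}" by auto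
        moreover have "(\<Sum>j\<in>{Suc k..<m}. ?t j * z j) = (\<Sum>j\<in>{Suc k..<m}. t j * z j)"
          by (rule sum.cong) auto
        ultimately show ?thesis by simp
      qed
      show "(\<integral>x. ?h x * exp (\<i> * complex_of_real (s * X k x)) \<partial>P) = (\<integral>x. ?h' x * exp (\<i> * complex_of_real (s * Y k x)) \<partial>Q)"
        using Suc.IH[rule_format, of B ?t "max (Suc k) m", OF B] unfolding e
        by (simp add: of_real_add distrib_left exp_add mult_ac)
    qed (auto simp: norm_mult pb)
    then show "(\<integral>x. (\<Prod>j<Suc k. indicator (B j) (X j x)) * exp (\<i> * complex_of_real (\<Sum>j\<in>{Suc k..<m}. t j * X j x)) \<partial>P) =
      (\<integral>x. (\<Prod>j<Suc k. indicator (B j) (Y j x)) * exp (\<i> * complex_of_real (\<Sum>j\<in>{Suc k..<m}. t j * Y j x)) \<partial>Q)"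
      by (simp add: mult_ac)
    qed
  qed
  have fin: "(\<integral>x. (\<Prod>j<k. indicator (B j) (X j x)) \<partial>P) = (\<integral>x. (\<Prod>j<k. indicator (B j) (Y j x) :: complex) \<partial>Q)"
    if "\<And>j. B j \<in> sets borel" for B k
    using main[of k, rule_format, of B "\<lambda>_. 0" k] that by simp
  \<comment> \<open>Coordinates outside \<open>J\<close> are tested against \<open>UNIV\<close>, so
    that the product runs over an initial segment of the indices as in \<open>main\<close>.\<close>
  have repr: "complex_of_real (measure (distr M (\<Pi>\<^sub>M j\<in>UNIV. borel) (\<lambda>x j. Z j x)) (prod_emb UNIV (\<lambda>_. borel) J (Pi\<^sub>E J A)))
     = (\<integral>x. (\<Prod>j<k. indicator (if j \<in> J then A j else UNIV) (Z j x)) \<partial>M)"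
    if M: "prob_space M" and Z[measurable]: "\<And>j. Z j \<in> borel_measurable M"
      and J: "finite J" "J \<subseteq> {..<k}" and A: "\<And>j. j \<in> J \<Longrightarrow> A j \<in> sets borel"
    for M :: "'m measure" and Z :: "nat \<Rightarrow> 'm \<Rightarrow> real" and J A k
  proof -
    interpret prob_space M by fact
    define S where "S = {x \<in> space M. \<forall>j\<in>J. Z j x \<in> A j}"
    have S[measurable]: "S \<in> sets M"
      unfolding S_def using J(1) A by (intro sets.sets_Collect_finite_All) (auto intro!: measurable_sets_Collect[OF Z])
    have "measure (distr M (\<Pi>\<^sub>M j\<in>UNIV. borel) (\<lambda>x j. Z j x)) (prod_emb UNIV (\<lambda>_. borel) J (Pi\<^sub>E J A)) = measure M S"
    proof (subst measure_distr)
      show "(\<lambda>x j. Z j x) \<in> measurable M (\<Pi>\<^sub>M j\<in>UNIV. borel)"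
        by (rule measurable_PiM_single') auto
      show "prod_emb UNIV (\<lambda>_. borel) J (Pi\<^sub>E J A) \<in> sets (\<Pi>\<^sub>M j\<in>UNIV. borel)"
        using J(1) A by (intro sets_PiM_I) auto
      have "(\<lambda>x j. Z j x) -` prod_emb UNIV (\<lambda>_. borel) J (Pi\<^sub>E J A) \<inter> space M = S"
        by (auto simp: S_def prod_emb_def PiE_iff)
      then show "measure M ((\<lambda>x j. Z j x) -` prod_emb UNIV (\<lambda>_. borel) J (Pi\<^sub>E J A) \<inter> space M) = measure M S"
        by simp
    qed
    also have "complex_of_real (measure M S) = (\<integral>x. complex_of_real (indicator S x) \<partial>M)"
      using sets.sets_into_space[OF S] by (simp add: Int_absorb2)
    also have "\<dots> = (\<integral>x. (\<Prod>j<k. indicator (if j \<in> J then A j else UNIV) (Z j x)) \<partial>M)"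
    proof (rule Bochner_Integration.integral_cong[OF refl])
      fix x assume x: "x \<in> space M"
      show "complex_of_real (indicator S x) = (\<Prod>j<k. indicator (if j \<in> J then A j else UNIV) (Z j x))"
      proof (cases "x \<in> S")
        case True
        then show ?thesis by (auto simp: S_def intro!: prod.neutral[symmetric])
      next
        case False
        then obtain j where "j \<in> J" "Z j x \<notin> A j" using x by (auto simp: S_def)
        then have "(\<Prod>j<k. indicator (if j \<in> J then A j else UNIV) (Z j x) :: complex) = 0"
          using J(2) by (intro prod_zero) (auto intro!: bexI[of _ j])
        then show ?thesis using False by simp
      qed
    qed
    finally show ?thesis .
  qed
  interpret dP: prob_space "distr P (\<Pi>\<^sub>M j\<in>UNIV. borel) (\<lambda>x j. X j x)"
    by (rule P.prob_space_distr, rule measurable_PiM_single') auto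
  interpret dQ: prob_space "distr Q (\<Pi>\<^sub>M j\<in>UNIV. borel) (\<lambda>x j. Y j x)"
    by (rule Q.prob_space_distr, rule measurable_PiM_single') auto
  show ?thesis
  proof (rule measure_eqI_PiM_infinite[where M="\<lambda>_. borel" and I=UNIV])
    fix A :: "nat \<Rightarrow> real set" and J :: "nat set"
    assume J: "finite J" "J \<subseteq> UNIV" and A: "\<And>i. i \<in> J \<Longrightarrow> A i \<in> sets borel"
    obtain k where k: "J \<subseteq> {..<k}" using J(1) by (meson finite_nat_set_iff_bounded lessThan_iff subsetI)
    have rP: "complex_of_real (dP.prob (prod_emb UNIV (\<lambda>_. borel) J (Pi\<^sub>E J A))) =
        (\<integral>x. (\<Prod>j<k. indicator (if j \<in> J then A j else UNIV) (X j x)) \<partial>P)"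
      by (rule repr[OF P X J(1) k]) (rule A)
    have rQ: "complex_of_real (dQ.prob (prod_emb UNIV (\<lambda>_. borel) J (Pi\<^sub>E J A))) =
        (\<integral>x. (\<Prod>j<k. indicator (if j \<in> J then A j else UNIV) (Y j x)) \<partial>Q)"
      by (rule repr[OF Q Y J(1) k]) (rule A)
    have "complex_of_real (dP.prob (prod_emb UNIV (\<lambda>_. borel) J (Pi\<^sub>E J A))) =
      complex_of_real (dQ.prob (prod_emb UNIV (\<lambda>_. borel) J (Pi\<^sub>E J A)))"
      unfolding rP rQ by (rule fin) (use A in auto)
    then show "emeasure (distr P (\<Pi>\<^sub>M j\<in>UNIV. borel) (\<lambda>x j. X j x)) (prod_emb UNIV (\<lambda>_. borel) J (Pi\<^sub>E J A)) =
      emeasure (distr Q (\<Pi>\<^sub>M j\<in>UNIV. borel) (\<lambda>x j. Y j x)) (prod_emb UNIV (\<lambda>_. borel) J (Pi\<^sub>E J A))"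
      by (simp add: dP.emeasure_eq_measure dQ.emeasure_eq_measure)
  qed (auto intro: dP.finite_measure_axioms)
qed

section \<open>Discrete measures\<close>

definition weighted_diracs :: "('i \<Rightarrow> real) \<Rightarrow> ('i \<Rightarrow> 'a::topological_space) \<Rightarrow> 'a measure" where
  "weighted_diracs a x = distr (density (count_space UNIV) (\<lambda>i. ennreal (a i))) borel x"

lemma sets_weighted_diracs [simp, measurable_cong]: "sets (weighted_diracs a x) = sets borel"
  by (simp add: weighted_diracs_def)

lemma nn_integral_weighted_diracs:
  assumes [measurable]: "f \<in> borel_measurable borel"
  shows "(\<integral>\<^sup>+y. f y \<partial>weighted_diracs a x) = (\<integral>\<^sup>+i. ennreal (a i) * f (x i) \<partial>count_space UNIV)"
  unfolding weighted_diracs_def by (simp add: nn_integral_distr nn_integral_density)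

lemma emeasure_weighted_diracs:
  assumes "B \<in> sets borel"
  shows "emeasure (weighted_diracs a x) B = (\<integral>\<^sup>+i. ennreal (a i) * indicator B (x i) \<partial>count_space UNIV)"
  using nn_integral_weighted_diracs[of "indicator B" a x] assms by simp

lemma integral_weighted_diracs:
  fixes f :: "'a::topological_space \<Rightarrow> real"
  assumes [measurable]: "f \<in> borel_measurable borel" and a: "\<And>i. a i \<ge> 0"
  shows "(\<integral>y. f y \<partial>weighted_diracs a x) = (\<integral>i. a i * f (x i) \<partial>count_space UNIV)"
    "integrable (weighted_diracs a x) f \<longleftrightarrow> integrable (count_space UNIV) (\<lambda>i. a i * f (x i))"
proof -
  show "(\<integral>y. f y \<partial>weighted_diracs a x) = (\<integral>i. a i * f (x i) \<partial>count_space UNIV)"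
    unfolding weighted_diracs_def using a
    by (subst integral_distr, simp, simp, subst integral_density) auto
  show "integrable (weighted_diracs a x) f \<longleftrightarrow> integrable (count_space UNIV) (\<lambda>i. a i * f (x i))"
    unfolding weighted_diracs_def using a
    by (subst integrable_distr_eq, simp, simp, subst integrable_density) auto
qed

lemma dirac_series_weighted_diracs: "dirac_series borel s x = weighted_diracs s x"
  by (simp add: dirac_series_def weighted_diracs_def)

lemma nn_integral_count_space_nat_nat:
  "(\<integral>\<^sup>+p. f p \<partial>count_space (UNIV :: (nat \<times> nat) set)) = (\<Sum>i. \<Sum>k. f (i, k))"
  by (simp add: nn_integral_fst_count_space[symmetric] nn_integral_count_space_nat)

lemma integral_count_space_nat_nat:
  fixes f :: "nat \<times> nat \<Rightarrow> real"
  assumes "integrable (count_space UNIV) f"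
  shows "(\<integral>p. f p \<partial>count_space UNIV) = (\<Sum>i. \<Sum>k. f (i, k))"
proof -
  let ?C = "count_space (UNIV :: nat set)"
  interpret pair_sigma_finite ?C ?C
    by (intro pair_sigma_finite.intro sigma_finite_measure_count_space)
  have C: "?C \<Otimes>\<^sub>M ?C = count_space UNIV"
    using pair_measure_countable[of "UNIV :: nat set" "UNIV :: nat set"] by simp
  have i: "integrable (?C \<Otimes>\<^sub>M ?C) f" using assms by (simp add: C)
  have "(\<integral>p. f p \<partial>count_space UNIV) = (\<integral>p. f p \<partial>(?C \<Otimes>\<^sub>M ?C))" by (simp add: C)
  also have "\<dots> = (\<integral>i. \<integral>k. f (i, k) \<partial>?C \<partial>?C)" by (rule integral_fst'[OF i, symmetric])
  also have "\<dots> = (\<Sum>i. \<integral>k. f (i, k) \<partial>?C)"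
    by (rule integral_count_space_nat[OF integrable_fst'[OF i]])
  also have "\<dots> = (\<Sum>i. \<Sum>k. f (i, k))"
  proof (intro suminf_cong integral_count_space_nat)
    fix i
    show "integrable ?C (\<lambda>k. f (i, k))"
      using AE_integrable_fst'[OF i] by (simp add: AE_count_space)
  qed
  finally show ?thesis .
qed

text \<open>
  Each point is repeated infinitely often with weights \<open>a / 2 ^ Suc k\<close>, so that finitely many points also
  yield an infinite sequence.
\<close>

lemma weighted_diracs_eq_dirac_series:
  fixes a :: "'i::countable \<Rightarrow> real" and x :: "'i \<Rightarrow> 'a::topological_space"
  assumes a: "\<And>i. a i \<ge> 0" and j: "a j > 0"
  shows "\<exists>s y. (\<forall>n. s n > 0) \<and> weighted_diracs a x = dirac_series borel s y"
proof -
  define J where "J = {i. a i > 0}"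
  have inf: "infinite (J \<times> (UNIV :: nat set))" using j by (auto simp: J_def finite_cartesian_product_iff)
  define f where "f = from_nat_into (J \<times> (UNIV :: nat set))"
  have f: "bij_betw f UNIV (J \<times> UNIV)" unfolding f_def by (rule bij_betw_from_nat_into[OF _ inf]) simp
  define s where "s n = a (fst (f n)) * (1 / 2) ^ Suc (snd (f n))" for n
  define y where "y n = x (fst (f n))" for n
  have "s n > 0" for n
  proof -
    have "f n \<in> J \<times> UNIV" using f by (auto simp: bij_betw_def)
    then show ?thesis unfolding s_def J_def by (intro mult_pos_pos zero_less_power) auto
  qed
  moreover have "weighted_diracs a x = weighted_diracs s y"
  proof (rule measure_eqI)
    fix B assume "B \<in> sets (weighted_diracs a x)"
    then have B: "B \<in> sets borel" by simp
    define F where "F p = ennreal (a (fst p) * (1 / 2) ^ Suc (snd p)) * indicator B (x (fst p))" for p :: "'i \<times> nat"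
    have "emeasure (weighted_diracs s y) B = (\<integral>\<^sup>+n. F (f n) \<partial>count_space UNIV)"
      unfolding emeasure_weighted_diracs[OF B] by (simp add: F_def s_def y_def)
    also have "\<dots> = (\<integral>\<^sup>+p. F p \<partial>count_space (J \<times> UNIV))" by (rule nn_integral_bij_count_space[OF f])
    also have "\<dots> = (\<integral>\<^sup>+p. F p * indicator (J \<times> UNIV) p \<partial>count_space UNIV)"
      by (subst nn_integral_count_space_indicator) auto
    also have "\<dots> = (\<integral>\<^sup>+i. \<integral>\<^sup>+k. F (i, k) * indicator (J \<times> UNIV) (i, k) \<partial>count_space UNIV \<partial>count_space UNIV)"
      by (rule nn_integral_fst_count_space[symmetric])
    also have "\<dots> = (\<integral>\<^sup>+i. ennreal (a i) * indicator B (x i) \<partial>count_space UNIV)"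
    proof (rule nn_integral_cong)
      fix i
      have half: "(\<Sum>k. ennreal ((1 / 2) ^ Suc k)) = 1"
      proof -
        have "(\<lambda>k. (1 / 2 :: real) ^ Suc k) sums 1" by (rule power_half_series)
        then show ?thesis by (subst suminf_ennreal2) (auto simp: sums_iff)
      qed
      show "(\<integral>\<^sup>+k. F (i, k) * indicator (J \<times> UNIV) (i, k) \<partial>count_space UNIV) = ennreal (a i) * indicator B (x i)"
      proof (cases "i \<in> J")
        case True
        have "F (i, k) * indicator (J \<times> UNIV) (i, k) = ennreal (a i) * indicator B (x i) * ennreal ((1 / 2) ^ Suc k)" for k
          using True a[of i] unfolding F_def by (simp only: fst_conv snd_conv ennreal_mult' indicator_simps mem_Times_iff) (simp add: mult_ac)
        then have "(\<integral>\<^sup>+k. F (i, k) * indicator (J \<times> UNIV) (i, k) \<partial>count_space UNIV) =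
            (\<Sum>k. ennreal (a i) * indicator B (x i) * ennreal ((1 / 2) ^ Suc k))"
          by (simp only: nn_integral_count_space_nat)
        also have "\<dots> = ennreal (a i) * indicator B (x i) * (\<Sum>k. ennreal ((1 / 2) ^ Suc k))" by (rule ennreal_suminf_cmult)
        finally show ?thesis unfolding half by simp
      next
        case False
        then have "a i = 0" using a[of i] by (simp add: J_def)
        then show ?thesis by (simp add: F_def)
      qed
    qed
    also have "\<dots> = emeasure (weighted_diracs a x) B" by (rule emeasure_weighted_diracs[OF B, symmetric])
    finally show "emeasure (weighted_diracs a x) B = emeasure (weighted_diracs s y) B" ..
  qed simp
  ultimately show ?thesis unfolding dirac_series_weighted_diracs by blast
qed

text \<open>Inner regularity is automatic: the partial sums of the mass of \<open>B\<close> are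
  carried by finitely many atoms in \<open>B\<close>, and a finite set is compact. What remains to
  be supplied is finiteness on compact sets.\<close>

lemma radon_dirac_series:
  fixes x :: "nat \<Rightarrow> 'a::t2_space"
  assumes fin: "\<And>K. compact K \<Longrightarrow> emeasure (dirac_series borel s x) K < \<infinity>"
  shows "radon_measure (dirac_series borel s x)"
  unfolding radon_measure_def
proof (intro conjI allI impI ballI)
  let ?M = "dirac_series borel s x"
  show "sets ?M = sets borel" by (simp add: dirac_series_weighted_diracs)
  show "emeasure ?M K < \<infinity>" if "compact K" for K using that by (rule fin)
  fix B :: "'a set" assume B: "B \<in> sets borel"
  let ?S = "SUP K\<in>{K. compact K \<and> K \<subseteq> B}. emeasure ?M K"
  have em: "emeasure ?M C = (\<Sum>n. ennreal (s n) * indicator C (x n))" if "C \<in> sets borel" for C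
    unfolding dirac_series_weighted_diracs emeasure_weighted_diracs[OF that] nn_integral_count_space_nat ..
  show "emeasure ?M B = ?S"
  proof (rule antisym)
    have "(\<Sum>n<N. ennreal (s n) * indicator B (x n)) \<le> ?S" for N
    proof -
      let ?K = "x ` {n. n < N \<and> x n \<in> B}"
      have K: "compact ?K" "?K \<subseteq> B" by (auto intro: finite_imp_compact)
      have "(\<Sum>n<N. ennreal (s n) * indicator B (x n)) = (\<Sum>n<N. ennreal (s n) * indicator ?K (x n))"
        by (rule sum.cong) (auto simp: indicator_def)
      also have "\<dots> \<le> (\<Sum>n. ennreal (s n) * indicator ?K (x n))" by (rule sum_le_suminf) auto
      also have "\<dots> = emeasure ?M ?K" by (rule em[symmetric]) (use compact_imp_closed[OF K(1)] in auto)
      also have "\<dots> \<le> ?S" using K by (intro SUP_upper) auto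
      finally show ?thesis .
    qed
    then have "(SUP N. \<Sum>n<N. ennreal (s n) * indicator B (x n)) \<le> ?S" by (intro SUP_least)
    then show "emeasure ?M B \<le> ?S" unfolding em[OF B] suminf_eq_SUP .
    show "?S \<le> emeasure ?M B"
      using B by (intro SUP_least emeasure_mono) (auto simp: dirac_series_weighted_diracs)
  qed
qed

section \<open>Transfer of almost sure properties\<close>

text \<open>The set of good \<omega> is a projection and may fail to be measurable; moreover
  \<open>Z\<close> is only measurable, so it need not map compact sets to compact sets. Passing to
  the graph of \<open>Z\<close> repairs this: the graph is approximated from inside by compact sets,
  and \<open>snd\<close> is continuous on them. The equality of laws carries the mass of the compact
  images over to \<mu>.\<close>

lemma AE_exists_of_equal_law:
  fixes Z :: "nat \<Rightarrow> 'p::{second_countable_topology, complete_space} \<Rightarrow> real" and Y :: "nat \<Rightarrow> 'q \<Rightarrow> real"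
  assumes P: "prob_space P" and sP: "sets P = sets borel" and Z: "\<And>j. Z j \<in> borel_measurable P"
    and Q: "prob_space \<mu>" and Y: "\<And>j. Y j \<in> borel_measurable \<mu>" and G: "AE d in P. G d"
    and law: "distr P (\<Pi>\<^sub>M j\<in>UNIV. borel) (\<lambda>x j. Z j x) = distr \<mu> (\<Pi>\<^sub>M j\<in>UNIV. borel) (\<lambda>x j. Y j x)"
  shows "AE \<omega> in \<mu>. \<exists>d. G d \<and> (\<forall>j. Y j \<omega> = Z j d)"
proof -
  interpret P: prob_space P by fact
  interpret Q: prob_space \<mu> by fact
  have spP: "space P = UNIV" using sets_eq_imp_space_eq[OF sP] by simp
  have sB: "sets (\<Pi>\<^sub>M j\<in>(UNIV::nat set). (borel :: real measure)) = sets borel" by (rule sets_PiM_equal_borel)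
  obtain N where N: "{d \<in> space P. \<not> G d} \<subseteq> N" "emeasure P N = 0" "N \<in> sets P" using AE_E[OF G] .
  have Zm: "(\<lambda>d j. Z j d) \<in> measurable P (\<Pi>\<^sub>M j\<in>UNIV. borel)" by (intro measurable_PiM_single') (auto intro: Z)
  have Ym: "(\<lambda>d j. Y j d) \<in> measurable \<mu> (\<Pi>\<^sub>M j\<in>UNIV. borel)" by (intro measurable_PiM_single') (auto intro: Y)
  have Zb: "(\<lambda>d j. Z j d) \<in> borel_measurable P" using Zm measurable_cong_sets[OF refl sB] by blast
  define J where "J d = (d, \<lambda>j. Z j d)" for d
  have "(\<lambda>d. d) \<in> borel_measurable P" by (rule measurable_ident_sets[OF sP])
  then have Jm: "J \<in> borel_measurable P" unfolding J_def using Zb by (rule borel_measurable_Pair)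
  \<comment> \<open>The graph is taken over the complement of the measurable null set
    \<open>N\<close>, because \<open>G\<close> itself may define a set that is not
    measurable.\<close>
  define \<Gamma> where "\<Gamma> = {x. fst x \<notin> N \<and> (\<forall>j. snd x j = Z j (fst x))}"
  have Zbb: "Z j \<in> borel_measurable borel" for j using Z measurable_cong_sets[OF sP refl] by blast
  have f: "(\<lambda>x :: 'p \<times> (nat \<Rightarrow> real). fst x) \<in> borel_measurable borel"
    by (intro borel_measurable_continuous_onI continuous_intros)
  have s: "(\<lambda>x :: 'p \<times> (nat \<Rightarrow> real). snd x j) \<in> borel_measurable borel" for j
    by (rule borel_measurable_continuous_onI, rule continuous_on_product_then_coordinatewise,
      rule continuous_on_snd, rule continuous_on_id)
  have G1: "{x :: 'p \<times> (nat \<Rightarrow> real). fst x \<notin> N} \<in> sets borel"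
  proof -
    have "- N \<in> sets borel" using N(3) by (simp add: sP)
    from measurable_sets[OF f this] show ?thesis by (simp add: vimage_def)
  qed
  have G2: "{x :: 'p \<times> (nat \<Rightarrow> real). snd x j = Z j (fst x)} \<in> sets borel" for j
    using borel_measurable_eq[OF s measurable_compose[OF f Zbb]] by simp
  have "\<Gamma> = {x. fst x \<notin> N} \<inter> (\<Inter>j. {x. snd x j = Z j (fst x)})" by (auto simp: \<Gamma>_def)
  then have \<Gamma>: "\<Gamma> \<in> sets borel" using G1 G2 by (simp add: sets.countable_INT')
  define D where "D = distr P borel J"
  interpret D: prob_space D unfolding D_def by (rule P.prob_space_distr[OF Jm])
  have sD: "sets D = sets borel" by (simp add: D_def)
  have "emeasure D \<Gamma> = emeasure P (J -` \<Gamma> \<inter> space P)" unfolding D_def by (rule emeasure_distr[OF Jm \<Gamma>])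
  also have "J -` \<Gamma> \<inter> space P = space P - N" by (auto simp: J_def \<Gamma>_def)
  also have "emeasure P (space P - N) = 1"
    by (rule trans[OF emeasure_Diff_null_set[OF null_setsI[OF N(2,3)] sets.top] P.emeasure_space_1])
  finally have D\<Gamma>: "emeasure D \<Gamma> = 1" .
  have approx: "\<exists>A\<in>sets \<mu>. emeasure \<mu> A > r \<and> (\<forall>\<omega>\<in>A. \<exists>d. G d \<and> (\<forall>j. Y j \<omega> = Z j d))" if r: "r < 1" for r
  proof -
    have "emeasure D \<Gamma> = (SUP K\<in>{K. K \<subseteq> \<Gamma> \<and> compact K}. emeasure D K)"
      by (rule inner_regular[OF sD _ \<Gamma>]) (simp add: D.emeasure_eq_measure)
    then have "r < (SUP K\<in>{K. K \<subseteq> \<Gamma> \<and> compact K}. emeasure D K)" using r by (simp add: D\<Gamma>)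
    then obtain K where K: "K \<subseteq> \<Gamma>" "compact K" "r < emeasure D K" unfolding less_SUP_iff by blast
    have "compact (snd ` K)" by (intro compact_continuous_image K(2) continuous_intros)
    then have C: "snd ` K \<in> sets (\<Pi>\<^sub>M j\<in>(UNIV::nat set). (borel :: real measure))"
      unfolding sB by (intro borel_closed compact_imp_closed)
    let ?A = "(\<lambda>d j. Y j d) -` (snd ` K) \<inter> space \<mu>"
    have "r < emeasure D K" by fact
    also have "\<dots> = emeasure P (J -` K \<inter> space P)"
      unfolding D_def using compact_imp_closed[OF K(2)] by (intro emeasure_distr[OF Jm]) auto
    also have "\<dots> \<le> emeasure P ((\<lambda>d j. Z j d) -` (snd ` K) \<inter> space P)"
      by (rule emeasure_mono[OF _ measurable_sets[OF Zm C]]) (force simp: J_def)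
    also have "\<dots> = emeasure (distr P (\<Pi>\<^sub>M j\<in>UNIV. borel) (\<lambda>x j. Z j x)) (snd ` K)"
      by (rule emeasure_distr[OF Zm C, symmetric])
    also have "\<dots> = emeasure \<mu> ?A" unfolding law by (rule emeasure_distr[OF Ym C])
    finally have "r < emeasure \<mu> ?A" .
    moreover have "\<exists>d. G d \<and> (\<forall>j. Y j \<omega> = Z j d)" if "\<omega> \<in> ?A" for \<omega>
    proof -
      from that obtain x where x: "x \<in> K" "(\<lambda>j. Y j \<omega>) = snd x" by blast
      then have "x \<in> \<Gamma>" using K(1) by blast
      then have "fst x \<notin> N" "\<forall>j. snd x j = Z j (fst x)" by (simp_all add: \<Gamma>_def)
      moreover from this have "G (fst x)" using N(1) spP by blast
      moreover have "Y j \<omega> = snd x j" for j using fun_cong[OF x(2)] .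
      ultimately show ?thesis by (intro exI[of _ "fst x"]) simp
    qed
    ultimately show ?thesis using measurable_sets[OF Ym C] by blast
  qed
  have "\<forall>n::nat. \<exists>A. A \<in> sets \<mu> \<and> emeasure \<mu> A > ennreal (1 - 1 / real (Suc n)) \<and> (\<forall>\<omega>\<in>A. \<exists>d. G d \<and> (\<forall>j. Y j \<omega> = Z j d))"
  proof
    fix n :: nat
    have "ennreal (1 - 1 / real (Suc n)) < 1" unfolding ennreal_1[symmetric] by (subst ennreal_less_iff) auto
    from approx[OF this] show "\<exists>A. A \<in> sets \<mu> \<and> emeasure \<mu> A > ennreal (1 - 1 / real (Suc n)) \<and> (\<forall>\<omega>\<in>A. \<exists>d. G d \<and> (\<forall>j. Y j \<omega> = Z j d))"
      by blast
  qed
  from choice[OF this] obtain A where A0: "\<forall>n::nat. A n \<in> sets \<mu> \<and> emeasure \<mu> (A n) > ennreal (1 - 1 / real (Suc n)) \<and>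
    (\<forall>\<omega>\<in>A n. \<exists>d. G d \<and> (\<forall>j. Y j \<omega> = Z j d))" ..
  then have A: "A n \<in> sets \<mu>" "emeasure \<mu> (A n) > ennreal (1 - 1 / real (Suc n))"
    "\<And>\<omega>. \<omega> \<in> A n \<Longrightarrow> \<exists>d. G d \<and> (\<forall>j. Y j \<omega> = Z j d)" for n by blast+
  have "Q.prob (\<Union>n. A n) = 1"
  proof (rule antisym)
    have "1 - 1 / real (Suc n) \<le> Q.prob (\<Union>n. A n)" for n
    proof -
      have "1 - 1 / real (Suc n) \<le> Q.prob (A n)"
        using A(2)[of n] unfolding Q.emeasure_eq_measure by (subst (asm) ennreal_less_iff) auto
      also have "\<dots> \<le> Q.prob (\<Union>n. A n)" using A(1) by (intro Q.finite_measure_mono) auto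
      finally show ?thesis .
    qed
    moreover have "(\<lambda>n. 1 - 1 / real (Suc n)) \<longlonglongrightarrow> 1 - 0" by (intro tendsto_diff tendsto_const LIMSEQ_Suc[OF lim_1_over_n])
    ultimately show "1 \<le> Q.prob (\<Union>n. A n)" by (intro LIMSEQ_le_const2[of "\<lambda>n. 1 - 1 / real (Suc n)" 1]) auto
  qed simp
  then have "AE \<omega> in \<mu>. \<omega> \<in> (\<Union>n. A n)" using A(1) by (subst Q.AE_in_set_eq_1) auto
  then show ?thesis by (rule AE_mp) (use A(3) in \<open>auto intro!: AE_I2\<close>)
qed

section \<open>Poisson clouds\<close>

lemma integral_PiM_prod_component:
  fixes f :: "'i \<Rightarrow> 'b \<Rightarrow> complex"
  assumes M: "\<And>i. prob_space (M i)" and J: "finite J" and f: "\<And>j. j \<in> J \<Longrightarrow> integrable (M j) (f j)"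
  shows "(\<integral>x. (\<Prod>j\<in>J. f j (x j)) \<partial>(\<Pi>\<^sub>M i\<in>UNIV. M i)) = (\<Prod>j\<in>J. \<integral>y. f j y \<partial>M j)"
proof -
  interpret P: product_prob_space M UNIV
  proof -
    interpret prob_space "M i" for i by (rule M)
    show "product_prob_space M" by unfold_locales
  qed
  have m: "(\<lambda>x. \<Prod>j\<in>J. f j (x j)) \<in> borel_measurable (Pi\<^sub>M J M)"
    using f by (intro borel_measurable_prod measurable_compose[OF measurable_component_singleton]) auto
  have "(\<Prod>j\<in>J. \<integral>y. f j y \<partial>M j) = (\<integral>x. (\<Prod>j\<in>J. f j (x j)) \<partial>Pi\<^sub>M J M)"
    by (rule P.product_integral_prod[symmetric, OF J f])
  also have "\<dots> = (\<integral>x. (\<Prod>j\<in>J. f j (x j)) \<partial>distr (Pi\<^sub>M UNIV M) (Pi\<^sub>M J M) (\<lambda>x. restrict x J))"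
    by (subst P.distr_PiM_restrict_finite) (use J in auto)
  also have "\<dots> = (\<integral>x. (\<Prod>j\<in>J. f j (restrict x J j)) \<partial>Pi\<^sub>M UNIV M)"
    by (rule integral_distr[OF _ m]) (rule measurable_restrict_subset, simp)
  also have "\<dots> = (\<integral>x. (\<Prod>j\<in>J. f j (x j)) \<partial>Pi\<^sub>M UNIV M)"
    by (intro Bochner_Integration.integral_cong refl prod.cong) auto
  finally show ?thesis ..
qed

lemma nn_integral_PiM_component:
  assumes M: "\<And>i. prob_space (M i)" and f: "f \<in> borel_measurable (M j)"
  shows "(\<integral>\<^sup>+x. f (x j) \<partial>(\<Pi>\<^sub>M i\<in>UNIV. M i)) = (\<integral>\<^sup>+y. f y \<partial>M j)"
proof -
  have "(\<integral>\<^sup>+y. f y \<partial>M j) = (\<integral>\<^sup>+y. f y \<partial>distr (\<Pi>\<^sub>M i\<in>UNIV. M i) (M j) (\<lambda>x. x j))"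
    by (subst distr_PiM_component) (use M in auto)
  also have "\<dots> = (\<integral>\<^sup>+x. f (x j) \<partial>(\<Pi>\<^sub>M i\<in>UNIV. M i))"
    by (rule nn_integral_distr) (use f in auto)
  finally show ?thesis ..
qed

text \<open>A cell of mass 0 leads to the rate 0, where the Poisson law degenerates to the unit mass
  at 0; the formula persists because of 0 ^ 0 = 1.\<close>

lemma poisson_pmf_exists:
  assumes "(m::real) \<ge> 0"
  shows "\<exists>p :: nat pmf. \<forall>k. pmf p k = m ^ k / fact k * exp (- m)"
proof (cases "m = 0")
  case True
  then have "pmf (return_pmf 0) k = m ^ k / fact k * exp (- m)" for k :: nat
    by (cases k) (auto simp: pmf_return)
  then show ?thesis by blast
next
  case False
  then have "m > 0" using assms by simp
  then have "pmf (poisson_pmf m) k = m ^ k / fact k * exp (- m)" for k by simp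
  then show ?thesis by blast
qed

lemma poisson_pgf:
  fixes a :: complex
  assumes p: "\<And>k. pmf p k = m ^ k / fact k * exp (- m)" and a: "cmod a \<le> 1"
  shows "(\<integral>N. a ^ N \<partial>measure_pmf p) = exp (m * (a - 1))"
proof -
  have i: "integrable (measure_pmf p) (\<lambda>N. a ^ N)"
    by (rule measure_pmf.integrable_const_bound[of _ 1]) (auto simp: norm_power power_le_one a)
  have ic: "integrable (count_space UNIV) (\<lambda>N. pmf p N *\<^sub>R a ^ N)"
    using i unfolding measure_pmf_eq_density by (subst (asm) integrable_density) (auto simp: pmf_nonneg)
  have "(\<integral>N. a ^ N \<partial>measure_pmf p) = (\<integral>N. pmf p N *\<^sub>R a ^ N \<partial>count_space UNIV)"
    unfolding measure_pmf_eq_density by (subst integral_density) (auto simp: pmf_nonneg)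
  then have "(\<lambda>N. pmf p N *\<^sub>R a ^ N) sums (\<integral>N. a ^ N \<partial>measure_pmf p)"
    using sums_integral_count_space_nat[OF ic] by simp
  moreover have "(\<lambda>N. pmf p N *\<^sub>R a ^ N) sums (exp (- m) * exp (m * a))"
  proof -
    have "(\<lambda>N. (m * a) ^ N /\<^sub>R fact N) sums exp (m * a)" by (rule exp_converges)
    then have "(\<lambda>N. exp (- m) * ((m * a) ^ N /\<^sub>R fact N)) sums (exp (- m) * exp (m * a))" by (rule sums_mult)
    then show ?thesis by (simp add: p scaleR_conv_of_real power_mult_distrib divide_inverse mult_ac exp_of_real)
  qed
  ultimately have "(\<integral>N. a ^ N \<partial>measure_pmf p) = exp (- m) * exp (m * a)" by (rule sums_unique2)
  then show ?thesis by (simp add: algebra_simps exp_diff exp_minus divide_inverse exp_of_real)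
qed

lemma poisson_mean:
  assumes p: "\<And>k. pmf p k = m ^ k / fact k * exp (- m)" and m: "m \<ge> 0"
  shows "(\<integral>\<^sup>+N. of_nat N \<partial>measure_pmf p) = ennreal m"
proof -
  have s: "(\<lambda>N. real N * pmf p N) sums m"
  proof -
    have "(\<lambda>N. m ^ N /\<^sub>R fact N) sums exp m" by (rule exp_converges)
    then have "(\<lambda>N. m * exp (- m) * (m ^ N /\<^sub>R fact N)) sums (m * exp (- m) * exp m)" by (rule sums_mult)
    moreover have "real (Suc N) * (m ^ Suc N / fact (Suc N) * e) = m * e * (m ^ N /\<^sub>R fact N)" for N e
      by (simp add: divide_inverse del: of_nat_Suc)
    moreover have "m * exp (- m) * exp m = m" by (simp add: exp_minus)
    ultimately have "(\<lambda>N. real (Suc N) * pmf p (Suc N)) sums m" by (simp only: p)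
    then show ?thesis using sums_Suc[of "\<lambda>N. real N * pmf p N" m] by simp
  qed
  have "(\<integral>\<^sup>+N. of_nat N \<partial>measure_pmf p) = (\<Sum>N. ennreal (real N * pmf p N))"
    unfolding nn_integral_measure_pmf nn_integral_count_space_nat
    by (intro suminf_cong) (simp add: ennreal_mult'' ennreal_of_nat_eq_real_of_nat mult.commute)
  also have "\<dots> = ennreal (\<Sum>N. real N * pmf p N)"
    using s by (intro suminf_ennreal2) (auto simp: sums_iff pmf_nonneg)
  finally show ?thesis using s by (simp add: sums_iff)
qed

text \<open>The zero measure has to be covered, since cells of mass 0 occur; the density 0 then
  allows any probability measure, here the unit mass at \<open>w0\<close>.\<close>

lemma finite_measure_normalize:
  assumes fin: "emeasure R (space R) < \<infinity>" and ne: "w0 \<in> space R"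
  shows "\<exists>Q. prob_space Q \<and> sets Q = sets R \<and> R = density Q (\<lambda>_. emeasure R (space R))"
proof (cases "emeasure R (space R) = 0")
  case True
  have "R = density (return R w0) (\<lambda>_. 0)"
  proof (rule measure_eqI)
    fix A assume "A \<in> sets R"
    then have "emeasure R A = 0" using True by (metis emeasure_eq_0 emeasure_space le_zero_eq)
    then show "emeasure R A = emeasure (density (return R w0) (\<lambda>_. 0)) A"
      using \<open>A \<in> sets R\<close> by (simp add: emeasure_density)
  qed simp
  then show ?thesis using prob_space_return[OF ne] True by (intro exI[of _ "return R w0"]) simp
next
  case False
  let ?m = "emeasure R (space R)"
  have m: "1 / ?m * ?m = 1" using False fin
    by (metis divide_ennreal_def ennreal_divide_self ennreal_divide_times infinity_ennreal_def less_irrefl mult.commute mult_1)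
  have "density (density R (\<lambda>_. 1 / ?m)) (\<lambda>_. ?m) = R"
    using m by (simp add: density_density_eq density_1)
  moreover have "prob_space (density R (\<lambda>_. 1 / ?m))"
    by (rule prob_spaceI) (use m in \<open>simp add: emeasure_density\<close>)
  ultimately show ?thesis by (intro exI[of _ "density R (\<lambda>_. 1 / ?m)"]) simp
qed

text \<open>
  The witness is a Poisson number of independent points, padded with the cemetery point \<open>w0\<close>.
\<close>

lemma finite_poisson_cloud:
  fixes R :: "'w measure"
  assumes fin: "emeasure R (space R) < \<infinity>" and w0: "w0 \<in> space R" "{w0} \<in> sets R" "emeasure R {w0} = 0"
  shows "\<exists>D. prob_space D \<and> sets D = sets (\<Pi>\<^sub>M k\<in>(UNIV::nat set). R) \<and>
    (\<forall>g\<in>borel_measurable R. g w0 = 0 \<longrightarrow> (\<integral>\<^sup>+d. (\<Sum>k. g (d k)) \<partial>D) = (\<integral>\<^sup>+w. g w \<partial>R)) \<and>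
    (\<forall>g\<in>borel_measurable R. g w0 = (0::real) \<longrightarrow>
      (\<integral>d. exp (\<i> * complex_of_real (\<Sum>k. g (d k))) \<partial>D) = exp (\<integral>w. exp (\<i> * complex_of_real (g w)) - 1 \<partial>R)) \<and>
    emeasure D {d \<in> space D. d 0 = w0} \<le> ennreal (exp (- measure R (space R)))"
proof -
  define m where "m = measure R (space R)"
  have m0: "m \<ge> 0" by (simp add: m_def)
  have Rm: "emeasure R (space R) = ennreal m" using fin by (simp add: m_def emeasure_eq_ennreal_measure)
  obtain Q where Q: "prob_space Q" "sets Q = sets R" "R = density Q (\<lambda>_. ennreal m)"
    using finite_measure_normalize[OF fin w0(1)] unfolding Rm by blast
  obtain p :: "nat pmf" where p: "\<And>k. pmf p k = m ^ k / fact k * exp (- m)" using poisson_pmf_exists[OF m0] by blast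
  interpret Q: prob_space Q by (rule Q(1))
  have spQ: "space Q = space R" by (rule sets_eq_imp_space_eq[OF Q(2)])
  let ?S = "\<Pi>\<^sub>M k\<in>(UNIV::nat set). Q"
  have sS: "sets (\<Pi>\<^sub>M k\<in>(UNIV::nat set). R) = sets ?S" using Q(2) by (intro sets_PiM_cong) auto
  interpret S: prob_space ?S by (intro prob_space_PiM Q(1))
  interpret pS: pair_prob_space "measure_pmf p" ?S ..
  define T where "T Nx = (\<lambda>k. if k < fst Nx then snd Nx k else w0)" for Nx :: "nat \<times> (nat \<Rightarrow> 'w)"
  have [measurable]: "T \<in> measurable (measure_pmf p \<Otimes>\<^sub>M ?S) ?S"
  proof (rule measurable_PiM_single')
    fix k
    have "(\<lambda>Nx. if k < fst Nx then snd Nx k else w0) \<in> measurable (measure_pmf p \<Otimes>\<^sub>M ?S) Q"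
    proof (rule measurable_If)
      have "(\<lambda>Nx. k < fst Nx) \<in> measurable (measure_pmf p \<Otimes>\<^sub>M ?S) (count_space UNIV)"
        by (rule measurable_compose[OF measurable_fst]) simp
      then show "{x \<in> space (measure_pmf p \<Otimes>\<^sub>M ?S). k < fst x} \<in> sets (measure_pmf p \<Otimes>\<^sub>M ?S)"
        by (simp add: pred_def)
    qed (use w0 spQ in auto)
    then show "(\<lambda>Nx. T Nx k) \<in> measurable (measure_pmf p \<Otimes>\<^sub>M ?S) Q" by (simp add: T_def)
  qed (use w0 spQ in \<open>auto simp: T_def space_pair_measure space_PiM PiE_iff\<close>)
  define D where "D = distr (measure_pmf p \<Otimes>\<^sub>M ?S) ?S T"
  have "prob_space D" unfolding D_def by (rule pS.prob_space_distr) simp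
  moreover have "sets D = sets (\<Pi>\<^sub>M k\<in>(UNIV::nat set). R)" unfolding D_def sS by simp
  moreover have "(\<integral>\<^sup>+d. (\<Sum>k. g (d k)) \<partial>D) = (\<integral>\<^sup>+w. g w \<partial>R)"
    if g: "g \<in> borel_measurable R" and gw: "g w0 = 0" for g
  proof -
    have gQ[measurable]: "g \<in> borel_measurable Q" using g measurable_cong_sets[OF Q(2) refl] by blast
    have "(\<integral>\<^sup>+d. (\<Sum>k. g (d k)) \<partial>D) = (\<integral>\<^sup>+Nx. (\<Sum>k. g (T Nx k)) \<partial>(measure_pmf p \<Otimes>\<^sub>M ?S))"
      unfolding D_def by (rule nn_integral_distr) measurable
    also have "\<dots> = (\<integral>\<^sup>+N. \<integral>\<^sup>+x. (\<Sum>k. g (T (N, x) k)) \<partial>?S \<partial>measure_pmf p)"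
      by (rule S.nn_integral_fst[symmetric]) measurable
    \<comment> \<open>Given the number \<open>N\<close> of points, \<open>g w0 = 0\<close> removes
      the padding, and the series is the sum over the first \<open>N\<close> independent
      points.\<close>
    also have "\<dots> = (\<integral>\<^sup>+N. of_nat N * (\<integral>\<^sup>+w. g w \<partial>Q) \<partial>measure_pmf p)"
    proof (rule nn_integral_cong)
      fix N
      have "(\<Sum>k. g (T (N, x) k)) = (\<Sum>k<N. g (x k))" for x
      proof -
        have "(\<Sum>k. g (T (N, x) k)) = (\<Sum>k<N. g (T (N, x) k))"
          by (rule suminf_finite) (auto simp: T_def gw)
        then show ?thesis by (simp add: T_def)
      qed
      then have "(\<integral>\<^sup>+x. (\<Sum>k. g (T (N, x) k)) \<partial>?S) = (\<integral>\<^sup>+x. (\<Sum>k<N. g (x k)) \<partial>?S)" by simp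
      also have "\<dots> = (\<Sum>k<N. \<integral>\<^sup>+x. g (x k) \<partial>?S)"
        by (rule nn_integral_sum) measurable
      also have "\<dots> = of_nat N * (\<integral>\<^sup>+w. g w \<partial>Q)"
        by (subst nn_integral_PiM_component) (use Q(1) in auto)
      finally show "(\<integral>\<^sup>+x. (\<Sum>k. g (T (N, x) k)) \<partial>?S) = of_nat N * (\<integral>\<^sup>+w. g w \<partial>Q)" .
    qed
    also have "\<dots> = ennreal m * (\<integral>\<^sup>+w. g w \<partial>Q)"
      by (subst nn_integral_multc) (auto simp: poisson_mean[OF p m0])
    also have "\<dots> = (\<integral>\<^sup>+w. g w \<partial>R)"
    proof -
      have "(\<integral>\<^sup>+w. g w \<partial>R) = (\<integral>\<^sup>+w. g w \<partial>density Q (\<lambda>_. ennreal m))"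
        by (rule arg_cong[OF Q(3), of "\<lambda>M. integral\<^sup>N M g"])
      then show ?thesis by (simp add: nn_integral_density nn_integral_cmult)
    qed
    finally show ?thesis .
  qed
  moreover have "(\<integral>d. exp (\<i> * complex_of_real (\<Sum>k. g (d k))) \<partial>D) = exp (\<integral>w. exp (\<i> * complex_of_real (g w)) - 1 \<partial>R)"
    if g: "g \<in> borel_measurable R" and gw: "g w0 = (0::real)" for g
  proof -
    have gQ[measurable]: "g \<in> borel_measurable Q" using g measurable_cong_sets[OF Q(2) refl] by blast
    let ?e = "\<lambda>w. exp (\<i> * complex_of_real (g w))"
    have ie: "integrable Q ?e" by (rule Q.integrable_const_bound[of _ 1]) auto
    let ?a = "\<integral>w. ?e w \<partial>Q"
    have a: "cmod ?a \<le> 1"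
    proof -
      have "cmod ?a \<le> (\<integral>w. cmod (?e w) \<partial>Q)" by (rule integral_norm_bound)
      then show ?thesis by (simp add: Q.prob_space)
    qed
    have "(\<integral>d. exp (\<i> * complex_of_real (\<Sum>k. g (d k))) \<partial>D) =
        (\<integral>Nx. exp (\<i> * complex_of_real (\<Sum>k. g (T Nx k))) \<partial>(measure_pmf p \<Otimes>\<^sub>M ?S))"
      unfolding D_def by (rule integral_distr) measurable
    also have "\<dots> = (\<integral>N. \<integral>x. exp (\<i> * complex_of_real (\<Sum>k. g (T (N, x) k))) \<partial>?S \<partial>measure_pmf p)"
    proof (rule pS.integral_fst'[symmetric])
      show "integrable (measure_pmf p \<Otimes>\<^sub>M ?S) (\<lambda>Nx. exp (\<i> * complex_of_real (\<Sum>k. g (T Nx k))))"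
        by (rule pS.integrable_const_bound[of _ 1]) auto
    qed
    also have "\<dots> = (\<integral>N. ?a ^ N \<partial>measure_pmf p)"
    proof (rule Bochner_Integration.integral_cong[OF refl])
      fix N
      have "exp (\<i> * complex_of_real (\<Sum>k. g (T (N, x) k))) = (\<Prod>k<N. ?e (x k))" for x
      proof -
        have "(\<Sum>k. g (T (N, x) k)) = (\<Sum>k<N. g (T (N, x) k))"
          by (rule suminf_finite) (auto simp: T_def gw)
        also have "\<dots> = (\<Sum>k<N. g (x k))" by (simp add: T_def)
        finally show ?thesis by (simp add: sum_distrib_left exp_sum)
      qed
      then have "(\<integral>x. exp (\<i> * complex_of_real (\<Sum>k. g (T (N, x) k))) \<partial>?S) = (\<integral>x. (\<Prod>k\<in>{..<N}. ?e (x k)) \<partial>?S)" by simp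
      also have "\<dots> = (\<Prod>k\<in>{..<N}. ?a)" by (rule integral_PiM_prod_component) (use Q(1) ie in auto)
      finally show "(\<integral>x. exp (\<i> * complex_of_real (\<Sum>k. g (T (N, x) k))) \<partial>?S) = ?a ^ N" by simp
    qed
    also have "\<dots> = exp (m * (?a - 1))" by (rule poisson_pgf[OF p a])
    \<comment> \<open>As \<open>Q\<close> has mass 1 and \<open>R\<close> is \<open>m\<close> times
      \<open>Q\<close>, the subtracted 1 moves under the integral, which is the form that survives
      infinite total mass.\<close>
    also have "m * (?a - 1) = (\<integral>w. ?e w - 1 \<partial>R)"
    proof -
      have "(\<integral>w. ?e w - 1 \<partial>R) = (\<integral>w. m *\<^sub>R (?e w - 1) \<partial>Q)"
        by (subst Q(3), subst integral_density) (use m0 in auto)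
      also have "\<dots> = m *\<^sub>R (\<integral>w. ?e w - 1 \<partial>Q)" by simp
      also have "(\<integral>w. ?e w - 1 \<partial>Q) = ?a - 1" using ie by (simp add: Q.prob_space)
      finally show ?thesis by (simp add: scaleR_conv_of_real)
    qed
    finally show ?thesis .
  qed
  \<comment> \<open>For \<open>m > 0\<close> the sampled points avoid \<open>w0\<close> almost
    surely, so the first entry is \<open>w0\<close> only if the Poisson number is 0, which has
    probability \<open>exp (- m)\<close>. For \<open>m = 0\<close> the bound is trivial.\<close>
  moreover have "emeasure D {d \<in> space D. d 0 = w0} \<le> ennreal (exp (- measure R (space R)))"
  proof (cases "m = 0")
    case True
    interpret D: prob_space D by fact
    show ?thesis using True D.emeasure_le_1 by (simp flip: m_def)
  next
    case False
    have "emeasure R {w0} = ennreal m * emeasure Q {w0}"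
      by (subst Q(3)) (use w0(2) Q(2) in \<open>simp add: emeasure_density nn_integral_cmult_indicator\<close>)
    then have q0: "emeasure Q {w0} = 0" using w0(3) False m0 by simp
    have sQ: "{w0} \<in> sets Q" using w0(2) Q(2) by simp
    have c0: "(\<lambda>d. d 0) \<in> measurable ?S Q" by (rule measurable_component_singleton) simp
    have s1: "{d \<in> space ?S. d 0 = w0} \<in> sets ?S"
    proof -
      have "(\<lambda>d. d 0) -` {w0} \<inter> space ?S \<in> sets ?S"
        by (rule measurable_sets[OF c0 sQ])
      moreover have "(\<lambda>d. d 0) -` {w0} \<inter> space ?S = {d \<in> space ?S. d 0 = w0}" by auto
      ultimately show ?thesis by simp
    qed
    have e1: "emeasure ?S {d \<in> space ?S. d 0 = w0} = 0"
    proof -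
      have "emeasure (distr ?S Q (\<lambda>d. d 0)) {w0} = emeasure ?S ((\<lambda>d. d 0) -` {w0} \<inter> space ?S)"
        by (rule emeasure_distr[OF c0 sQ])
      moreover have "distr ?S Q (\<lambda>d. d 0) = Q" by (rule distr_PiM_component) (use Q(1) in auto)
      moreover have "(\<lambda>d. d 0) -` {w0} \<inter> space ?S = {d \<in> space ?S. d 0 = w0}" by auto
      ultimately show ?thesis using q0 by simp
    qed
    have spD: "space D = space ?S" by (simp add: D_def)
    let ?B = "measure_pmf p \<Otimes>\<^sub>M ?S"
    have "emeasure D {d \<in> space D. d 0 = w0} = emeasure ?B (T -` {d \<in> space ?S. d 0 = w0} \<inter> space ?B)"
      unfolding spD unfolding D_def by (rule emeasure_distr) (use s1 in auto)
    also have "\<dots> \<le> emeasure ?B ({0} \<times> space ?S \<union> UNIV \<times> {d \<in> space ?S. d 0 = w0})"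
      by (rule emeasure_mono) (use s1 in \<open>auto simp: T_def space_pair_measure split: if_splits\<close>)
    also have "\<dots> \<le> emeasure ?B ({0} \<times> space ?S) + emeasure ?B (UNIV \<times> {d \<in> space ?S. d 0 = w0})"
      by (rule emeasure_subadditive) (use s1 in auto)
    also have "emeasure ?B (UNIV \<times> {d \<in> space ?S. d 0 = w0}) = 0"
      by (subst S.emeasure_pair_measure_Times) (use s1 e1 in auto)
    also have "emeasure ?B ({0} \<times> space ?S) = ennreal (exp (- m))"
      by (subst S.emeasure_pair_measure_Times) (auto simp: S.emeasure_space_1 emeasure_pmf_single p)
    finally show ?thesis by (simp add: m_def)
  qed
  ultimately show ?thesis by blast
qed

text \<open>Superposition of independent clouds over a partition into cells of finite mass. The
  first formula is Campbell's; applied to absolute values it gives the almost sure convergence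
  behind the characteristic functional of an integrable \<open>g\<close>. The last clause excludes
  the empty cloud when the intensity is infinite.\<close>

theorem poisson_cloud:
  fixes R :: "'w measure" and B :: "nat \<Rightarrow> 'w set"
  assumes B: "\<And>i. B i \<in> sets R" "disjoint_family B" "(\<Union>i. B i) = space R" "\<And>i. emeasure R (B i) < \<infinity>"
    and w0: "w0 \<in> space R" "{w0} \<in> sets R" "emeasure R {w0} = 0"
  shows "\<exists>P. prob_space P \<and> sets P = sets (\<Pi>\<^sub>M i\<in>(UNIV::nat set). \<Pi>\<^sub>M k\<in>(UNIV::nat set). R) \<and>
    (\<forall>g\<in>borel_measurable R. g w0 = 0 \<longrightarrow> (\<integral>\<^sup>+d. (\<Sum>i. \<Sum>k. g (d i k)) \<partial>P) = (\<integral>\<^sup>+w. g w \<partial>R)) \<and>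
    (\<forall>g. integrable R g \<longrightarrow> g w0 = (0::real) \<longrightarrow>
      (\<integral>d. exp (\<i> * complex_of_real (\<Sum>i. \<Sum>k. g (d i k))) \<partial>P) = exp (\<integral>w. exp (\<i> * complex_of_real (g w)) - 1 \<partial>R)) \<and>
    (emeasure R (space R) = \<infinity> \<longrightarrow> (AE d in P. \<exists>i k. d i k \<noteq> w0))"
proof -
  \<comment> \<open>A density, not a restriction of the space: in this way \<open>w0\<close> remains
    a point of the space of every cell.\<close>
  define Ri where "Ri i = density R (indicator (B i))" for i
  have sRi: "sets (Ri i) = sets R" "space (Ri i) = space R" for i by (simp_all add: Ri_def)
  have mRi: "borel_measurable (Ri i) = (borel_measurable R :: ('w \<Rightarrow> 'c::topological_space) set)" for i
    by (rule measurable_cong_sets[OF sRi(1) refl])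
  have eRi: "emeasure (Ri i) A = emeasure R (B i \<inter> A)" if "A \<in> sets R" for i A
    unfolding Ri_def using that B(1)[of i]
    by (subst emeasure_density) (auto simp: indicator_inter_arith[symmetric] nn_integral_indicator)
  have fRi: "emeasure (Ri i) (space (Ri i)) = emeasure R (B i)" for i
    unfolding sRi using eRi[OF sets.top] sets.sets_into_space[OF B(1)[of i]] by (simp add: Int_absorb2)
  have "\<forall>i. \<exists>D. prob_space D \<and> sets D = sets (\<Pi>\<^sub>M k\<in>(UNIV::nat set). Ri i) \<and>
    (\<forall>g\<in>borel_measurable (Ri i). g w0 = 0 \<longrightarrow> (\<integral>\<^sup>+d. (\<Sum>k. g (d k)) \<partial>D) = (\<integral>\<^sup>+w. g w \<partial>Ri i)) \<and>
    (\<forall>g\<in>borel_measurable (Ri i). g w0 = (0::real) \<longrightarrow>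
      (\<integral>d. exp (\<i> * complex_of_real (\<Sum>k. g (d k))) \<partial>D) = exp (\<integral>w. exp (\<i> * complex_of_real (g w)) - 1 \<partial>Ri i)) \<and>
    emeasure D {d \<in> space D. d 0 = w0} \<le> ennreal (exp (- measure (Ri i) (space (Ri i))))"
  proof
    fix i
    have "emeasure (Ri i) {w0} \<le> 0"
      using emeasure_mono[of "B i \<inter> {w0}" "{w0}" R] w0 by (simp add: eRi)
    then show "\<exists>D. prob_space D \<and> sets D = sets (\<Pi>\<^sub>M k\<in>(UNIV::nat set). Ri i) \<and>
    (\<forall>g\<in>borel_measurable (Ri i). g w0 = 0 \<longrightarrow> (\<integral>\<^sup>+d. (\<Sum>k. g (d k)) \<partial>D) = (\<integral>\<^sup>+w. g w \<partial>Ri i)) \<and>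
    (\<forall>g\<in>borel_measurable (Ri i). g w0 = (0::real) \<longrightarrow>
      (\<integral>d. exp (\<i> * complex_of_real (\<Sum>k. g (d k))) \<partial>D) = exp (\<integral>w. exp (\<i> * complex_of_real (g w)) - 1 \<partial>Ri i)) \<and>
    emeasure D {d \<in> space D. d 0 = w0} \<le> ennreal (exp (- measure (Ri i) (space (Ri i))))"
      by (intro finite_poisson_cloud) (use w0 B(4) fRi sRi in auto)
  qed
  from choice[OF this] obtain D where D0: "\<forall>i. prob_space (D i) \<and> sets (D i) = sets (\<Pi>\<^sub>M k\<in>(UNIV::nat set). Ri i) \<and>
    (\<forall>g\<in>borel_measurable (Ri i). g w0 = 0 \<longrightarrow> (\<integral>\<^sup>+d. (\<Sum>k. g (d k)) \<partial>D i) = (\<integral>\<^sup>+w. g w \<partial>Ri i)) \<and>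
    (\<forall>g\<in>borel_measurable (Ri i). g w0 = (0::real) \<longrightarrow>
      (\<integral>d. exp (\<i> * complex_of_real (\<Sum>k. g (d k))) \<partial>D i) = exp (\<integral>w. exp (\<i> * complex_of_real (g w)) - 1 \<partial>Ri i)) \<and>
    emeasure (D i) {d \<in> space (D i). d 0 = w0} \<le> ennreal (exp (- measure (Ri i) (space (Ri i))))" ..
  have Dp: "prob_space (D i)" and Ds: "sets (D i) = sets (\<Pi>\<^sub>M k\<in>(UNIV::nat set). Ri i)"
    and Dn: "emeasure (D i) {d \<in> space (D i). d 0 = w0} \<le> ennreal (exp (- measure (Ri i) (space (Ri i))))" for i
    using D0 by simp_all
  have Dnn: "(\<integral>\<^sup>+d. (\<Sum>k. g (d k)) \<partial>D i) = (\<integral>\<^sup>+w. g w \<partial>Ri i)" if "g \<in> borel_measurable R" "g w0 = 0" for g i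
    using D0[THEN spec, of i, THEN conjunct2, THEN conjunct2, THEN conjunct1, THEN bspec, of g] that by (simp add: mRi)
  have Dch: "(\<integral>d. exp (\<i> * complex_of_real (\<Sum>k. g (d k))) \<partial>D i) = exp (\<integral>w. exp (\<i> * complex_of_real (g w)) - 1 \<partial>Ri i)"
    if "g \<in> borel_measurable R" "g w0 = (0::real)" for g i
    using D0[THEN spec, of i, THEN conjunct2, THEN conjunct2, THEN conjunct2, THEN conjunct1, THEN bspec, of g] that by (simp add: mRi)
  have sD: "sets (D i) = sets (\<Pi>\<^sub>M k\<in>(UNIV::nat set). R)" for i
    unfolding Ds using sRi(1) by (intro sets_PiM_cong) auto
  define P where "P = (\<Pi>\<^sub>M i\<in>(UNIV::nat set). D i)"
  have sP: "sets P = sets (\<Pi>\<^sub>M i\<in>(UNIV::nat set). \<Pi>\<^sub>M k\<in>(UNIV::nat set). R)"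
    unfolding P_def using sD by (intro sets_PiM_cong) auto
  have pP: "prob_space P" unfolding P_def by (intro prob_space_PiM Dp)
  interpret P: prob_space P by (rule pP)
  have spD: "space (D i) = space (\<Pi>\<^sub>M k\<in>(UNIV::nat set). R)" for i by (rule sets_eq_imp_space_eq[OF sD])
  have comp[measurable]: "(\<lambda>d. d k) \<in> measurable (D i) R" for i k
    using measurable_component_singleton[of k UNIV "\<lambda>_. R"] measurable_cong_sets[OF sD refl] by blast
  have pc[measurable]: "(\<lambda>d. d i) \<in> measurable P (D i)" for i
    unfolding P_def by (rule measurable_component_singleton) simp
  have nn: "(\<integral>\<^sup>+d. (\<Sum>i. \<Sum>k. g (d i k)) \<partial>P) = (\<integral>\<^sup>+w. g w \<partial>R)"
    if g[measurable]: "g \<in> borel_measurable R" and gw: "g w0 = 0" for g :: "'w \<Rightarrow> ennreal"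
  proof -
    have m: "(\<lambda>d. \<Sum>k. g (d k)) \<in> borel_measurable (D i)" for i by measurable
    have "(\<integral>\<^sup>+d. (\<Sum>i. \<Sum>k. g (d i k)) \<partial>P) = (\<Sum>i. \<integral>\<^sup>+d. (\<Sum>k. g (d i k)) \<partial>P)"
      by (rule nn_integral_suminf) (rule measurable_compose[OF pc m])
    also have "\<dots> = (\<Sum>i. \<integral>\<^sup>+d. (\<Sum>k. g (d k)) \<partial>D i)"
      unfolding P_def by (intro suminf_cong nn_integral_PiM_component[OF Dp m])
    also have "\<dots> = (\<Sum>i. \<integral>\<^sup>+w. indicator (B i) w * g w \<partial>R)"
      unfolding Dnn[OF g gw] unfolding Ri_def using B(1) by (intro suminf_cong nn_integral_density) auto
    also have "\<dots> = (\<integral>\<^sup>+w. (\<Sum>i. indicator (B i) w * g w) \<partial>R)"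
      using B(1) by (intro nn_integral_suminf[symmetric]) auto
    also have "\<dots> = (\<integral>\<^sup>+w. g w \<partial>R)"
    proof (rule nn_integral_cong)
      fix w assume "w \<in> space R"
      have "(\<Sum>i. indicator (B i) w * g w) = (\<Sum>i. indicator (B i) w) * g w" by simp
      also have "(\<Sum>i. indicator (B i) w) = (indicator (\<Union>i. B i) w :: ennreal)"
        by (rule suminf_indicator[OF B(2)])
      finally show "(\<Sum>i. indicator (B i) w * g w) = g w" using \<open>w \<in> space R\<close> B(3) by simp
    qed
    finally show ?thesis .
  qed
  moreover have "(\<integral>d. exp (\<i> * complex_of_real (\<Sum>i. \<Sum>k. g (d i k))) \<partial>P) = exp (\<integral>w. exp (\<i> * complex_of_real (g w)) - 1 \<partial>R)"
    if ig: "integrable R g" and gw: "g w0 = (0::real)" for g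
  proof -
    have g[measurable]: "g \<in> borel_measurable R" using ig by simp
    let ?W = "\<lambda>i d. \<Sum>k. g (d i k)"
    have Wm: "(\<lambda>d. \<Sum>k. g (d k)) \<in> borel_measurable (D i)" for i by measurable
    have Wm'[measurable]: "?W i \<in> borel_measurable P" for i by (rule measurable_compose[OF pc Wm])
    \<comment> \<open>Campbell's formula for the absolute value: the double series converges
      absolutely for almost every cloud, so the functional is the limit of those of finitely many
      cells.\<close>
    have "(\<integral>\<^sup>+d. (\<Sum>i. \<Sum>k. ennreal \<bar>g (d i k)\<bar>) \<partial>P) = (\<integral>\<^sup>+w. ennreal \<bar>g w\<bar> \<partial>R)"
      by (rule nn) (auto simp: gw)
    also have "\<dots> < \<infinity>" using ig by (simp add: integrable_iff_bounded)
    finally have fin: "(\<integral>\<^sup>+d. (\<Sum>i. \<Sum>k. ennreal \<bar>g (d i k)\<bar>) \<partial>P) \<noteq> \<infinity>" by simp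
    have "(\<lambda>d. \<Sum>i. \<Sum>k. ennreal \<bar>g (d i k)\<bar>) \<in> borel_measurable P"
      by (intro borel_measurable_suminf_order measurable_compose[OF pc]) measurable
    then have AEfin: "AE d in P. (\<Sum>i. \<Sum>k. ennreal \<bar>g (d i k)\<bar>) \<noteq> \<infinity>"
      using fin by (rule nn_integral_PInf_AE)
    have AEs: "AE d in P. summable (\<lambda>i. ?W i d)"
      using AEfin
    proof eventually_elim
      case (elim d)
      have a: "ennreal \<bar>?W i d\<bar> \<le> (\<Sum>k. ennreal \<bar>g (d i k)\<bar>)" for i
      proof (cases "(\<Sum>k. ennreal \<bar>g (d i k)\<bar>) = top")
        case False
        then have s: "summable (\<lambda>k. \<bar>g (d i k)\<bar>)" by (intro summable_suminf_not_top) auto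
        then have "\<bar>?W i d\<bar> \<le> (\<Sum>k. \<bar>g (d i k)\<bar>)" by (rule summable_rabs)
        then show ?thesis using s by (subst suminf_ennreal2) (auto intro: ennreal_leI)
      qed simp
      have "(\<Sum>i. ennreal \<bar>?W i d\<bar>) \<le> (\<Sum>i. \<Sum>k. ennreal \<bar>g (d i k)\<bar>)" by (intro suminf_le a) auto
      then have "(\<Sum>i. ennreal \<bar>?W i d\<bar>) \<noteq> top" using elim by (auto simp: top_unique)
      then have "summable (\<lambda>i. \<bar>?W i d\<bar>)" by (intro summable_suminf_not_top) auto
      then show ?case by (rule summable_rabs_cancel)
    qed
    let ?E = "\<lambda>w. exp (\<i> * complex_of_real (g w)) - 1"
    have L: "(\<lambda>n. \<integral>d. exp (\<i> * complex_of_real (\<Sum>i<n. ?W i d)) \<partial>P) \<longlonglongrightarrow> (\<integral>d. exp (\<i> * complex_of_real (\<Sum>i. ?W i d)) \<partial>P)"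
    proof (rule integral_dominated_convergence[where w="\<lambda>_. 1"])
      show "AE d in P. (\<lambda>n. exp (\<i> * complex_of_real (\<Sum>i<n. ?W i d))) \<longlonglongrightarrow> exp (\<i> * complex_of_real (\<Sum>i. ?W i d))"
        using AEs
      proof eventually_elim
        case (elim d)
        then have "(\<lambda>n. \<Sum>i<n. ?W i d) \<longlonglongrightarrow> (\<Sum>i. ?W i d)" by (rule summable_LIMSEQ)
        then show ?case by (intro tendsto_exp tendsto_mult tendsto_const tendsto_of_real)
      qed
    qed auto
    have fin_eq: "(\<integral>d. exp (\<i> * complex_of_real (\<Sum>i<n. ?W i d)) \<partial>P) = exp (\<integral>w. indicator (\<Union>i<n. B i) w *\<^sub>R ?E w \<partial>R)" for n
    proof -
      have iE: "integrable R ?E"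
      proof (rule Bochner_Integration.integrable_bound[OF integrable_abs[OF ig]])
        show "AE w in R. norm (?E w) \<le> norm \<bar>g w\<bar>"
        proof (rule AE_I2)
          fix w
          show "norm (?E w) \<le> norm \<bar>g w\<bar>" using iexp_approx1[of "g w" 0] by simp
        qed
      qed simp
      have "exp (\<i> * complex_of_real (\<Sum>i<n. ?W i d)) = (\<Prod>i\<in>{..<n}. exp (\<i> * complex_of_real (?W i d)))" for d
        by (simp add: sum_distrib_left exp_sum)
      then have "(\<integral>d. exp (\<i> * complex_of_real (\<Sum>i<n. ?W i d)) \<partial>P) = (\<integral>d. (\<Prod>i\<in>{..<n}. exp (\<i> * complex_of_real (?W i d))) \<partial>P)"
        by simp
      also have "\<dots> = (\<Prod>i\<in>{..<n}. \<integral>d. exp (\<i> * complex_of_real (\<Sum>k. g (d k))) \<partial>D i)"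
        unfolding P_def
      proof (rule integral_PiM_prod_component[where f="\<lambda>i d. exp (\<i> * complex_of_real (\<Sum>k. g (d k)))"])
        fix i
        interpret D: prob_space "D i" by (rule Dp)
        show "integrable (D i) (\<lambda>d. exp (\<i> * complex_of_real (\<Sum>k. g (d k))))"
          by (rule D.integrable_const_bound[of _ 1]) auto
      qed (use Dp in auto)
      also have "\<dots> = (\<Prod>i\<in>{..<n}. exp (\<integral>w. indicator (B i) w *\<^sub>R ?E w \<partial>R))"
      proof (rule prod.cong[OF refl])
        fix i
        have "(\<integral>w. ?E w \<partial>Ri i) = (\<integral>w. indicator (B i) w *\<^sub>R ?E w \<partial>R)"
        proof -
          have "Ri i = density R (\<lambda>w. ennreal (indicator (B i) w))"
            unfolding Ri_def by (intro density_cong) (use B(1) in \<open>auto simp: ennreal_indicator\<close>)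
          then show ?thesis using B(1) by (simp only:) (subst integral_density, auto)
        qed
        then show "(\<integral>d. exp (\<i> * complex_of_real (\<Sum>k. g (d k))) \<partial>D i) = exp (\<integral>w. indicator (B i) w *\<^sub>R ?E w \<partial>R)"
          using Dch[OF g gw, of i] by simp
      qed
      also have "\<dots> = exp (\<Sum>i<n. \<integral>w. indicator (B i) w *\<^sub>R ?E w \<partial>R)" by (simp add: exp_sum)
      also have "(\<Sum>i<n. \<integral>w. indicator (B i) w *\<^sub>R ?E w \<partial>R) = (\<integral>w. (\<Sum>i<n. indicator (B i) w *\<^sub>R ?E w) \<partial>R)"
        using B(1) iE by (intro Bochner_Integration.integral_sum[symmetric] integrable_mult_indicator)
      also have "(\<lambda>w. \<Sum>i<n. indicator (B i) w *\<^sub>R ?E w) = (\<lambda>w. indicator (\<Union>i<n. B i) w *\<^sub>R ?E w)"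
      proof
        fix w
        have "indicator (\<Union>i\<in>{..<n}. B i) w = (\<Sum>i<n. indicator (B i) w :: real)"
          using B(2) by (intro indicator_UN_disjoint) (auto simp: disjoint_family_on_def)
        then show "(\<Sum>i<n. indicator (B i) w *\<^sub>R ?E w) = indicator (\<Union>i<n. B i) w *\<^sub>R ?E w"
          by (simp add: scaleR_left.sum)
      qed
      finally show ?thesis .
    qed
    have "(\<lambda>n. \<integral>w. indicator (\<Union>i<n. B i) w *\<^sub>R ?E w \<partial>R) \<longlonglongrightarrow> (\<integral>w. ?E w \<partial>R)"
    proof (rule integral_dominated_convergence[where w="\<lambda>w. \<bar>g w\<bar>"])
      have "(\<Union>i<n. B i) \<in> sets R" for n :: nat using B(1) by auto
      then show "(\<lambda>w. indicator (\<Union>i<n. B i) w *\<^sub>R ?E w) \<in> borel_measurable R" for n by simp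
      show "AE w in R. (\<lambda>n. indicator (\<Union>i<n. B i) w *\<^sub>R ?E w) \<longlonglongrightarrow> ?E w"
      proof (rule AE_I2)
        fix w assume "w \<in> space R"
        then obtain i where "w \<in> B i" using B(3) by blast
        then have "eventually (\<lambda>n. indicator (\<Union>i<n. B i) w *\<^sub>R ?E w = ?E w) sequentially"
          by (intro eventually_sequentiallyI[of "Suc i"]) (auto simp: indicator_def Suc_le_eq)
        then show "(\<lambda>n. indicator (\<Union>i<n. B i) w *\<^sub>R ?E w) \<longlonglongrightarrow> ?E w" by (rule tendsto_eventually)
      qed
      show "AE w in R. norm (indicator (\<Union>i<n. B i) w *\<^sub>R ?E w) \<le> \<bar>g w\<bar>" for n
      proof (rule AE_I2)
        fix w
        have "norm (?E w) \<le> \<bar>g w\<bar>" using iexp_approx1[of "g w" 0] by simp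
        then show "norm (indicator (\<Union>i<n. B i) w *\<^sub>R ?E w) \<le> \<bar>g w\<bar>" by (simp add: indicator_def)
      qed
    qed (use ig in auto)
    then have "(\<lambda>n. exp (\<integral>w. indicator (\<Union>i<n. B i) w *\<^sub>R ?E w \<partial>R)) \<longlonglongrightarrow> exp (\<integral>w. ?E w \<partial>R)"
      by (rule tendsto_exp)
    from LIMSEQ_unique[OF L[unfolded fin_eq] this] show ?thesis .
  qed
  moreover have "AE d in P. \<exists>i k. d i k \<noteq> w0" if inf: "emeasure R (space R) = \<infinity>"
  proof -
    have A: "{d \<in> space (D i). d 0 = w0} \<in> sets (D i)" for i
    proof -
      have "(\<lambda>d. d 0) -` {w0} \<inter> space (D i) \<in> sets (D i)" by (rule measurable_sets[OF comp w0(2)])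
      moreover have "(\<lambda>d. d 0) -` {w0} \<inter> space (D i) = {d \<in> space (D i). d 0 = w0}" by auto
      ultimately show ?thesis by simp
    qed
    \<comment> \<open>The event that the first entry of every cell is \<open>w0\<close>. It is
      measurable and contains the event of an empty cloud; by independence its probability is at
      most the exponential of minus the mass of the first \<open>n\<close> cells, for every
      \<open>n\<close>.\<close>
    let ?N = "\<Inter>n. prod_emb UNIV D {..<n} (\<Pi>\<^sub>E i\<in>{..<n::nat}. {d \<in> space (D i). d 0 = w0})"
    have Nn: "prod_emb UNIV D {..<n} (\<Pi>\<^sub>E i\<in>{..<n}. {d \<in> space (D i). d 0 = w0}) \<in> sets P" for n
      unfolding P_def using A by (intro sets_PiM_I) auto
    then have Nm: "?N \<in> sets P" by auto
    have le: "emeasure P ?N \<le> ennreal (exp (- (\<Sum>i<n. measure (Ri i) (space (Ri i)))))" for n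
    proof -
      have "emeasure P ?N \<le> emeasure P (prod_emb UNIV D {..<n} (\<Pi>\<^sub>E i\<in>{..<n}. {d \<in> space (D i). d 0 = w0}))"
        using Nn by (intro emeasure_mono) auto
      also have "\<dots> = (\<Prod>i<n. emeasure (D i) {d \<in> space (D i). d 0 = w0})"
        unfolding P_def using A Dp by (intro emeasure_PiM_emb) auto
      also have "\<dots> \<le> (\<Prod>i<n. ennreal (exp (- measure (Ri i) (space (Ri i)))))"
        by (intro prod_mono_ennreal Dn)
      also have "\<dots> = ennreal (exp (- (\<Sum>i<n. measure (Ri i) (space (Ri i)))))"
        by (simp add: prod_ennreal exp_sum sum_negf[symmetric])
      finally show ?thesis .
    qed
    have "(\<Sum>i. ennreal (measure (Ri i) (space (Ri i)))) = \<infinity>"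
    proof -
      have "ennreal (measure (Ri i) (space (Ri i))) = emeasure R (B i)" for i
        using B(4)[of i] emeasure_eq_ennreal_measure[of "Ri i" "space (Ri i)"] by (simp add: fRi)
      then have "(\<Sum>i. ennreal (measure (Ri i) (space (Ri i)))) = (\<Sum>i. emeasure R (B i))" by simp
      also have "\<dots> = emeasure R (\<Union>i. B i)" using B by (intro suminf_emeasure) auto
      finally show ?thesis using inf B(3) by simp
    qed
    then have ns: "\<not> summable (\<lambda>i. measure (Ri i) (space (Ri i)))"
      using suminf_ennreal2[of "\<lambda>i. measure (Ri i) (space (Ri i))"] by auto
    have "measure P ?N \<le> e" if e: "e > 0" for e
    proof -
      have "\<exists>n. (\<Sum>i<n. measure (Ri i) (space (Ri i))) > - ln e"
      proof (rule ccontr)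
        assume "\<nexists>n. (\<Sum>i<n. measure (Ri i) (space (Ri i))) > - ln e"
        then have "summable (\<lambda>i. measure (Ri i) (space (Ri i)))"
          by (intro summableI_nonneg_bounded[where x="- ln e"]) (auto simp: not_less)
        then show False using ns by simp
      qed
      then obtain n where n: "(\<Sum>i<n. measure (Ri i) (space (Ri i))) > - ln e" ..
      have "measure P ?N \<le> exp (- (\<Sum>i<n. measure (Ri i) (space (Ri i))))"
        using le[of n] by (simp add: P.emeasure_eq_measure)
      also have "\<dots> \<le> exp (ln e)" using n by simp
      finally show ?thesis using e by simp
    qed
    then have "measure P ?N \<le> 0" by (rule dense_ge)
    then have "measure P ?N = 0" using measure_nonneg[of P ?N] by linarith
    then have "?N \<in> null_sets P" using Nm by (auto simp: P.emeasure_eq_measure intro: null_setsI)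
    moreover have "{d \<in> space P. \<not> (\<exists>i k. d i k \<noteq> w0)} \<subseteq> ?N"
      by (auto simp: prod_emb_def P_def space_PiM PiE_iff)
    ultimately show ?thesis by (rule AE_I')
  qed
  ultimately show ?thesis using pP sP by (intro exI[of _ P] conjI ballI allI impI)
qed

section \<open>Separability of the space of test functions\<close>

text \<open>A type is a description at precision \<open>n\<close> out of a countable stock. Choosing
  one element of \<open>S\<close> for each type that occurs in \<open>S\<close> keeps the dense set
  inside \<open>S\<close>, which matters when \<open>S\<close> prescribes supports.\<close>

lemma countable_dense_from_types:
  fixes R :: "nat \<Rightarrow> 't::countable \<Rightarrow> 'f \<Rightarrow> bool"
  assumes ex: "\<And>n \<phi>. \<phi> \<in> S \<Longrightarrow> \<exists>t. R n t \<phi>"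
    and cl: "\<And>n t \<phi> \<psi>. \<phi> \<in> S \<Longrightarrow> \<psi> \<in> S \<Longrightarrow> R n t \<phi> \<Longrightarrow> R n t \<psi> \<Longrightarrow> close n \<phi> \<psi>"
  obtains D where "countable D" "D \<subseteq> S" "\<And>\<phi> n. \<phi> \<in> S \<Longrightarrow> \<exists>\<psi>\<in>D. close n \<phi> \<psi>"
proof -
  define J where "J = {(n, t). \<exists>\<psi>\<in>S. R n t \<psi>}"
  define pick where "pick = (\<lambda>(n, t). SOME \<psi>. \<psi> \<in> S \<and> R n t \<psi>)"
  have pick: "pick (n, t) \<in> S \<and> R n t (pick (n, t))" if "(n, t) \<in> J" for n t
    using that someI_ex[of "\<lambda>\<psi>. \<psi> \<in> S \<and> R n t \<psi>"] by (auto simp: J_def pick_def)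
  show ?thesis
  proof (rule that[of "pick ` J"])
    show "countable (pick ` J)" by (intro countable_image countableI_type)
    show "pick ` J \<subseteq> S" using pick by auto
    fix \<phi> n assume p: "\<phi> \<in> S"
    obtain t where t: "R n t \<phi>" using ex[OF p] by blast
    then have "(n, t) \<in> J" using p by (auto simp: J_def)
    then show "\<exists>\<psi>\<in>pick ` J. close n \<phi> \<psi>" using pick cl[OF p _ t] by blast
  qed
qed

lemma compact_finite_net_list:
  fixes C :: "'e::metric_space set"
  assumes "compact C" "e > 0"
  shows "\<exists>ps. set ps \<subseteq> C \<and> (\<forall>y\<in>C. \<exists>p\<in>set ps. dist p y < e)"
proof -
  obtain k where k: "finite k" "k \<subseteq> C" "C \<subseteq> (\<Union>x\<in>k. ball x e)"
  proof -
    have "C \<subseteq> (\<Union>x\<in>C. ball x e)" using assms(2) by auto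
    then obtain k where "k \<subseteq> C" "finite k" "C \<subseteq> (\<Union>x\<in>k. ball x e)"
      by (rule compactE_image[OF assms(1), of C "\<lambda>x. ball x e", rotated]) auto
    then show ?thesis using that by blast
  qed
  obtain ps where "set ps = k" using finite_list[OF k(1)] by blast
  moreover have "\<exists>p\<in>k. dist p y < e" if "y \<in> C" for y
    using subsetD[OF k(3) that] unfolding UN_iff mem_ball .
  ultimately show ?thesis using k(2) by blast
qed

text \<open>
  Total boundedness makes \<open>C(K)\<close> separable: up to a given precision, a function is described by a
  modulus of continuity and finitely many integers.
\<close>

lemma countable_dense_uniform:
  fixes D :: "nat \<Rightarrow> 'f \<Rightarrow> 'e::metric_space \<Rightarrow> real" and C :: "nat \<Rightarrow> 'e set"
  assumes C: "\<And>q. compact (C q)" and cont: "\<And>q \<phi>. \<phi> \<in> S \<Longrightarrow> continuous_on (C q) (D q \<phi>)"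
  obtains S0 where "countable S0" "S0 \<subseteq> S"
    "\<And>\<phi> n. \<phi> \<in> S \<Longrightarrow> \<exists>\<psi>\<in>S0. \<forall>q<n. \<forall>y\<in>C q. \<bar>D q \<phi> y - D q \<psi> y\<bar> < 3 / real (Suc n)"
proof -
  have "\<exists>ps. set ps \<subseteq> C q \<and> (\<forall>y\<in>C q. \<exists>p\<in>set ps. dist p y < 1 / real (Suc r))" for q r
    by (rule compact_finite_net_list[OF C]) simp
  then have "\<exists>ps. \<forall>q r. set (ps q r) \<subseteq> C q \<and> (\<forall>y\<in>C q. \<exists>p\<in>set (ps q r). dist p y < 1 / real (Suc r))"
    by (intro choice allI)
  then obtain ps where ps: "\<And>q r. set (ps q r) \<subseteq> C q" "\<And>q r y. y \<in> C q \<Longrightarrow> \<exists>p\<in>set (ps q r). dist p y < 1 / real (Suc r)"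
    by blast
  \<comment> \<open>A type consists of the index of a net adapted to the modulus of continuity and
    of the integer parts of \<open>real (Suc n) * D q \<phi>\<close> on this net. Equal types force
    a difference below 1 / (n + 1) at net points, and moving to a net point costs the same for each
    of the two functions; this is the origin of the constant 3.\<close>
  define Q where "Q q n t \<phi> \<longleftrightarrow> (\<forall>p\<in>C q. \<forall>p'\<in>C q. dist p p' < 1 / real (Suc (fst t)) \<longrightarrow>
      \<bar>D q \<phi> p - D q \<phi> p'\<bar> < 1 / real (Suc n)) \<and>
      snd t = map (\<lambda>p. \<lfloor>real (Suc n) * D q \<phi> p\<rfloor>) (ps q (fst t))"
    for q n \<phi> and t :: "nat \<times> int list"
  have Qex: "\<exists>t. Q q n t \<phi>" if "\<phi> \<in> S" for q n \<phi>
  proof -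
    have "uniformly_continuous_on (C q) (D q \<phi>)"
      by (rule compact_uniformly_continuous[OF cont[OF that] C])
    then obtain d where d: "d > 0" "\<And>p p'. p \<in> C q \<Longrightarrow> p' \<in> C q \<Longrightarrow> dist p' p < d \<Longrightarrow> dist (D q \<phi> p') (D q \<phi> p) < 1 / real (Suc n)"
      using uniformly_continuous_onE[of "C q" "D q \<phi>" "1 / real (Suc n)"] by auto
    obtain r where r: "1 / real (Suc r) < d" using nat_approx_posE[OF d(1)] .
    have "Q q n (r, map (\<lambda>p. \<lfloor>real (Suc n) * D q \<phi> p\<rfloor>) (ps q r)) \<phi>"
      unfolding Q_def using d(2) r by (auto simp: dist_real_def)
    then show ?thesis by blast
  qed
  have Qcl: "\<bar>D q \<phi> y - D q \<psi> y\<bar> < 3 / real (Suc n)"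
    if a: "Q q n t \<phi>" and b: "Q q n t \<psi>" and y: "y \<in> C q" for q n t \<phi> \<psi> y
  proof -
    obtain p where p: "p \<in> set (ps q (fst t))" "dist p y < 1 / real (Suc (fst t))" using ps(2)[OF y] by blast
    have pC: "p \<in> C q" using p(1) ps(1) by blast
    have "map (\<lambda>p. \<lfloor>real (Suc n) * D q \<phi> p\<rfloor>) (ps q (fst t)) = map (\<lambda>p. \<lfloor>real (Suc n) * D q \<psi> p\<rfloor>) (ps q (fst t))"
      using a b unfolding Q_def by simp
    then have "\<lfloor>real (Suc n) * D q \<phi> p\<rfloor> = \<lfloor>real (Suc n) * D q \<psi> p\<rfloor>" using p(1) by (simp only: map_eq_conv)
    then have "\<bar>real (Suc n) * D q \<phi> p - real (Suc n) * D q \<psi> p\<bar> < 1" by linarith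
    then have "real (Suc n) * \<bar>D q \<phi> p - D q \<psi> p\<bar> < 1"
      by (simp only: right_diff_distrib[symmetric] abs_mult abs_of_nat)
    then have 1: "\<bar>D q \<phi> p - D q \<psi> p\<bar> < 1 / real (Suc n)" by (simp add: field_simps)
    have 2: "\<bar>D q \<phi> p - D q \<phi> y\<bar> < 1 / real (Suc n)" "\<bar>D q \<psi> p - D q \<psi> y\<bar> < 1 / real (Suc n)"
      using a b p(2) pC y unfolding Q_def by blast+
    have "3 / real (Suc n) = 1 / real (Suc n) + 1 / real (Suc n) + 1 / real (Suc n)" by simp
    then show ?thesis using 1 2 by linarith
  qed
  define R where "R n ts \<phi> \<longleftrightarrow> length ts = n \<and> (\<forall>q<n. Q q n (ts ! q) \<phi>)"
    for n \<phi> and ts :: "(nat \<times> int list) list"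
  show ?thesis
  proof (rule countable_dense_from_types[where S=S and R=R
        and close="\<lambda>n \<phi> \<psi>. \<forall>q<n. \<forall>y\<in>C q. \<bar>D q \<phi> y - D q \<psi> y\<bar> < 3 / real (Suc n)"])
    fix n \<phi> assume p: "\<phi> \<in> S"
    have "\<exists>t. \<forall>q. Q q n (t q) \<phi>" by (intro choice allI Qex[OF p])
    then obtain t where "\<forall>q. Q q n (t q) \<phi>" ..
    then have "R n (map t [0..<n]) \<phi>" by (simp add: R_def)
    then show "\<exists>ts. R n ts \<phi>" by blast
  next
    fix n ts \<phi> \<psi> assume "R n ts \<phi>" "R n ts \<psi>"
    then show "\<forall>q<n. \<forall>y\<in>C q. \<bar>D q \<phi> y - D q \<psi> y\<bar> < 3 / real (Suc n)"
      using Qcl unfolding R_def by blast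
  qed (use that in blast)
qed

section \<open>Convergent sequences of test functions and continuous functionals\<close>

context
  fixes \<A> :: "('a::{t2_space, second_countable_topology}, 'n::finite) chart set"
  assumes atlas: "oriented_atlas \<A>"
begin

lemma transition_props:
  assumes "c \<in> \<A>" "d \<in> \<A>"
  shows "open (snd c ` (fst c \<inter> fst d))" "smooth_on (snd c ` (fst c \<inter> fst d)) (transition c d)"
    "transition c d ` snd c ` (fst c \<inter> fst d) \<subseteq> chart_img d"
proof -
  show "open (snd c ` (fst c \<inter> fst d))"
    by (rule chart_image_open[OF atlas assms(1)])
       (use open_Int[OF atlas_chart(1)[OF atlas assms(1)] atlas_chart(1)[OF atlas assms(2)]] in auto)
  show "smooth_on (snd c ` (fst c \<inter> fst d)) (transition c d)"
    using atlas assms unfolding oriented_atlas_def by blast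
  show "transition c d ` snd c ` (fst c \<inter> fst d) \<subseteq> chart_img d"
    using atlas_chart(3)[OF atlas assms(1)] by force
qed

text \<open>The seminorms of the topology refer to arbitrary charts of an atlas that may be
  uncountable, whereas approximation takes place in countably many of them. This estimate carries
  smallness from the chart \<open>d\<close> to the chart \<open>c\<close>.\<close>

lemma chart_change_bound:
  assumes c: "c \<in> \<A>" and d: "d \<in> \<A>" and K: "compact K" "K \<subseteq> fst c \<inter> fst d"
  shows "\<exists>C\<ge>0. \<exists>W. finite W \<and> (\<forall>\<phi>\<in>test_functions \<A>. \<forall>B\<ge>0.
    (\<forall>is\<in>W. \<forall>x\<in>K. \<bar>iter_deriv (map (\<lambda>i. axis i 1) is) (\<lambda>y. \<phi> (chart_inv d y)) (snd d x)\<bar> \<le> B) \<longrightarrow>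
    (\<forall>x\<in>K. \<bar>iter_deriv vs (\<lambda>y. \<phi> (chart_inv c y)) (snd c x)\<bar> \<le> C * B))"
proof -
  let ?S = "snd c ` (fst c \<inter> fst d)" and ?T = "transition c d" and ?U = "chart_img d"
  note t = transition_props[OF c d]
  obtain P where P: "chain_op ?S ?T P" "\<And>f x. smooth_on ?U f \<Longrightarrow> x \<in> ?S \<Longrightarrow> iter_deriv vs (\<lambda>x. f (?T x)) x = P f x"
    using iter_deriv_compose[OF t, of vs] by blast
  have KC: "compact (snd c ` K)"
    by (rule compact_continuous_image[OF continuous_on_subset[OF atlas_chart(4)[OF atlas c]] K(1)]) (use K(2) in blast)
  have "snd c ` K \<subseteq> ?S" using K(2) by blast
  from chain_op_bound[OF P(1) KC this] obtain C W where CW: "C \<ge> 0" "finite W"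
    "\<And>f B. B \<ge> 0 \<Longrightarrow> \<forall>is\<in>W. \<forall>x\<in>snd c ` K. \<bar>iter_deriv (map (\<lambda>i. axis i 1) is) f (?T x)\<bar> \<le> B \<Longrightarrow> \<forall>x\<in>snd c ` K. \<bar>P f x\<bar> \<le> C * B"
    by blast
  show ?thesis
  proof (rule exI[of _ C], intro conjI CW(1), rule exI[of _ W], intro conjI CW(2) ballI allI impI)
    fix \<phi> and B :: real and x
    assume p: "\<phi> \<in> test_functions \<A>" and B: "B \<ge> 0" and x: "x \<in> K"
      and bd: "\<forall>is\<in>W. \<forall>x\<in>K. \<bar>iter_deriv (map (\<lambda>i. axis i 1) is) (\<lambda>y. \<phi> (chart_inv d y)) (snd d x)\<bar> \<le> B"
    let ?f = "\<lambda>y. \<phi> (chart_inv d y)"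
    have xS: "snd c x \<in> ?S" using x K(2) by blast
    have "iter_deriv vs (\<lambda>y. \<phi> (chart_inv c y)) (snd c x) = iter_deriv vs (\<lambda>y. ?f (?T y)) (snd c x)"
    proof (rule iter_deriv_cong_open[OF t(1) _ xS])
      fix y assume "y \<in> ?S"
      then obtain z where z: "z \<in> fst c" "z \<in> fst d" "y = snd c z" by blast
      then show "\<phi> (chart_inv c y) = ?f (?T y)"
        by (simp add: atlas_chart(3)[OF atlas c] atlas_chart(3)[OF atlas d])
    qed
    also have "\<dots> = P ?f (snd c x)" by (rule P(2)[OF test_smooth[OF atlas p d] xS])
    finally have eq: "iter_deriv vs (\<lambda>y. \<phi> (chart_inv c y)) (snd c x) = P ?f (snd c x)" .
    have "\<forall>is\<in>W. \<forall>x\<in>snd c ` K. \<bar>iter_deriv (map (\<lambda>i. axis i 1) is) ?f (?T x)\<bar> \<le> B"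
    proof (intro ballI)
      fix "is" y assume i: "is \<in> W" "y \<in> snd c ` K"
      then obtain z where z: "z \<in> K" "y = snd c z" by blast
      then have "z \<in> fst c" using K(2) by blast
      then have "?T y = snd d z" using z atlas_chart(3)[OF atlas c] by simp
      then show "\<bar>iter_deriv (map (\<lambda>i. axis i 1) is) ?f (?T y)\<bar> \<le> B" using bd i z by simp
    qed
    then have "\<bar>P ?f (snd c x)\<bar> \<le> C * B" using CW(3)[OF B, of ?f] x by blast
    then show "\<bar>iter_deriv vs (\<lambda>y. \<phi> (chart_inv c y)) (snd c x)\<bar> \<le> C * B" by (simp only: eq)
  qed
qed

text \<open>This is the usual concrete description of convergent sequences in the inductive limit
  topology. One compact set has to serve the limit and the whole sequence.\<close>

definition test_tendsto :: "(nat \<Rightarrow> 'a \<Rightarrow> real) \<Rightarrow> ('a \<Rightarrow> real) \<Rightarrow> bool" where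
  "test_tendsto \<psi> \<phi> \<longleftrightarrow> (\<exists>K. compact K \<and> (\<forall>x. x \<notin> K \<longrightarrow> \<phi> x = 0) \<and> (\<forall>j x. x \<notin> K \<longrightarrow> \<psi> j x = 0)) \<and>
     (\<forall>c\<in>\<A>. \<forall>L vs e. compact L \<longrightarrow> L \<subseteq> fst c \<longrightarrow> e > 0 \<longrightarrow>
        (\<forall>\<^sub>F j in sequentially. \<forall>x\<in>L. \<bar>iter_deriv vs (\<lambda>y. \<psi> j (chart_inv c y) - \<phi> (chart_inv c y)) (snd c x)\<bar> \<le> e))"

lemma compact_cover_nat:
  fixes L :: "nat \<Rightarrow> 'a set"
  assumes "(\<Union>m. interior (L m)) = UNIV" "compact K"
  obtains N where "K \<subseteq> (\<Union>m<N. L m)"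
proof -
  have "K \<subseteq> \<Union>(range (\<lambda>m. interior (L m)))" using assms(1) by auto
  then obtain F where F: "F \<subseteq> range (\<lambda>m. interior (L m))" "finite F" "K \<subseteq> \<Union>F"
    using compactE[OF assms(2), of "range (\<lambda>m. interior (L m))"] by (metis imageE open_interior)
  obtain J where J: "finite J" "F = (\<lambda>m. interior (L m)) ` J" using finite_subset_image[OF F(2,1)] by blast
  obtain N where N: "\<And>m. m \<in> J \<Longrightarrow> m < N" using J(1) finite_nat_set_iff_bounded by metis
  have "K \<subseteq> (\<Union>m<N. L m)" using F(3) N interior_subset unfolding J(2) by fastforce
  then show ?thesis by (rule that)
qed

text \<open>The test functions are the union of the spaces \<open>S N\<close> with supports in a
  fixed compact set, each of them separable for uniform convergence of all derivatives. Approximants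
  are taken from the \<open>S N\<close> that contains the limit, which provides the common
  support.\<close>

lemma dense_test_sequence:
  obtains \<Phi> :: "nat \<Rightarrow> 'a \<Rightarrow> real" where "\<And>k. \<Phi> k \<in> test_functions \<A>"
    "\<And>\<phi>. \<phi> \<in> test_functions \<A> \<Longrightarrow> \<exists>k. test_tendsto (\<lambda>j. \<Phi> (k j)) \<phi>"
proof -
  from countable_compact_charts[OF atlas] obtain cc L where
    "(\<forall>m. cc m \<in> \<A>) \<and> (\<forall>m. compact (L m)) \<and> (\<forall>m. L m \<subseteq> fst (cc m)) \<and> (\<Union>m::nat. interior (L m)) = UNIV"
    by (elim exE) (rule that)
  then have cL: "\<And>m. cc m \<in> \<A>" "\<And>m. compact (L m)" "\<And>m. L m \<subseteq> fst (cc m)" "(\<Union>m. interior (L m)) = UNIV"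
    by blast+
  define K where "K N = (\<Union>m<N. L m)" for N :: nat
  have K: "compact (K N)" for N unfolding K_def using cL(2) by (intro compact_UN) auto
  define S where "S N = {\<phi> \<in> test_functions \<A>. \<forall>x. x \<notin> K N \<longrightarrow> \<phi> x = 0}" for N
  \<comment> \<open>One number codes both a chart of the countable family and a list of coordinate
    directions, so that all seminorms in question form a single sequence.\<close>
  define idx :: "nat \<Rightarrow> nat \<times> 'n list" where "idx = from_nat"
  have idx: "idx (to_nat p) = p" for p by (simp add: idx_def)
  define C where "C q = snd (cc (fst (idx q))) ` L (fst (idx q))" for q
  define D where "D q \<phi> = iter_deriv (map (\<lambda>i. axis i 1) (snd (idx q))) (\<lambda>y. \<phi> (chart_inv (cc (fst (idx q))) y))"
    for q and \<phi> :: "'a \<Rightarrow> real"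
  have Csub: "C q \<subseteq> chart_img (cc (fst (idx q)))" for q using cL(3) unfolding C_def by blast
  have C: "compact (C q)" for q unfolding C_def
    by (rule compact_continuous_image[OF continuous_on_subset[OF atlas_chart(4)[OF atlas cL(1)] cL(3)] cL(2)])
  have sm: "smooth_on (chart_img (cc (fst (idx q)))) (\<lambda>y. \<phi> (chart_inv (cc (fst (idx q))) y))" if "\<phi> \<in> test_functions \<A>" for \<phi> q
    by (rule test_smooth[OF atlas that cL(1)])
  have cont: "continuous_on (C q) (D q \<phi>)" if "\<phi> \<in> S N" for q N \<phi>
    unfolding D_def
    by (rule continuous_on_subset[OF smooth_on_continuous[OF smooth_on_iter_deriv[OF sm]] Csub]) (use that in \<open>simp add: S_def\<close>)
  have "\<forall>N. \<exists>S0. countable S0 \<and> S0 \<subseteq> S N \<and>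
    (\<forall>\<phi>\<in>S N. \<forall>n. \<exists>\<psi>\<in>S0. \<forall>q<n. \<forall>y\<in>C q. \<bar>D q \<phi> y - D q \<psi> y\<bar> < 3 / real (Suc n))"
  proof
    fix N
    show "\<exists>S0. countable S0 \<and> S0 \<subseteq> S N \<and>
      (\<forall>\<phi>\<in>S N. \<forall>n. \<exists>\<psi>\<in>S0. \<forall>q<n. \<forall>y\<in>C q. \<bar>D q \<phi> y - D q \<psi> y\<bar> < 3 / real (Suc n))"
    proof (rule countable_dense_uniform[where C=C and S="S N" and D=D])
      show "compact (C q)" for q by (rule C)
      show "continuous_on (C q) (D q \<phi>)" if "\<phi> \<in> S N" for q \<phi> using that by (rule cont)
    qed blast
  qed
  then obtain S0 where S0: "\<And>N. countable (S0 N)" "\<And>N. S0 N \<subseteq> S N"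
    "\<And>N \<phi> n. \<phi> \<in> S N \<Longrightarrow> \<exists>\<psi>\<in>S0 N. \<forall>q<n. \<forall>y\<in>C q. \<bar>D q \<phi> y - D q \<psi> y\<bar> < 3 / real (Suc n)"
    by metis
  define E where "E = insert (\<lambda>x. 0) (\<Union>N. S0 N)"
  have E: "countable E" "E \<noteq> {}" unfolding E_def using S0(1) by auto
  define \<Phi> where "\<Phi> = from_nat_into E"
  have rE: "range \<Phi> = E" unfolding \<Phi>_def by (rule range_from_nat_into[OF E(2,1)])
  show ?thesis
  proof (rule that[of \<Phi>])
    have "E \<subseteq> test_functions \<A>" unfolding E_def using S0(2) test_zero[OF atlas] by (auto simp: S_def)
    then show tst: "\<Phi> k \<in> test_functions \<A>" for k using rE by blast
    fix \<phi> assume p: "\<phi> \<in> test_functions \<A>"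
    obtain K0 C0 where K0: "compact K0" "\<And>x. x \<notin> K0 \<Longrightarrow> \<phi> x = 0" "C0 \<ge> 0" "\<And>x. \<bar>\<phi> x\<bar> \<le> C0"
      using test_bounded_support[OF atlas p] by blast
    obtain N where N: "K0 \<subseteq> K N" unfolding K_def using compact_cover_nat[OF cL(4) K0(1)] by blast
    have pN: "\<phi> \<in> S N" using p K0(2) N by (auto simp: S_def)
    have "\<forall>j. \<exists>k. \<Phi> k \<in> S N \<and> (\<forall>q<j. \<forall>y\<in>C q. \<bar>D q \<phi> y - D q (\<Phi> k) y\<bar> < 3 / real (Suc j))"
    proof
      fix j
      obtain \<psi> where psi: "\<psi> \<in> S0 N" "\<forall>q<j. \<forall>y\<in>C q. \<bar>D q \<phi> y - D q \<psi> y\<bar> < 3 / real (Suc j)"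
        using S0(3)[OF pN] by blast
      then have "\<psi> \<in> E" by (auto simp: E_def)
      then obtain k where "\<psi> = \<Phi> k" using rE by blast
      then show "\<exists>k. \<Phi> k \<in> S N \<and> (\<forall>q<j. \<forall>y\<in>C q. \<bar>D q \<phi> y - D q (\<Phi> k) y\<bar> < 3 / real (Suc j))"
        using psi S0(2) by blast
    qed
    then obtain k where k: "\<And>j. \<Phi> (k j) \<in> S N"
      "\<And>j q y. q < j \<Longrightarrow> y \<in> C q \<Longrightarrow> \<bar>D q \<phi> y - D q (\<Phi> (k j)) y\<bar> < 3 / real (Suc j)" by metis
    define \<eta> where "\<eta> j = (\<lambda>x. \<Phi> (k j) x - \<phi> x)" for j
    have chi: "\<eta> j \<in> test_functions \<A>" for j unfolding \<eta>_def by (rule test_diff[OF atlas tst p])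
    have Dchi: "D q (\<eta> j) y = D q (\<Phi> (k j)) y - D q \<phi> y" if y: "y \<in> C q" for q j y
    proof -
      let ?c = "cc (fst (idx q))"
      have U: "open (chart_img ?c)" by (rule atlas_chart(2)[OF atlas cL(1)])
      have yU: "y \<in> chart_img ?c" using y Csub by blast
      have "D q (\<eta> j) y = iter_deriv (map (\<lambda>i. axis i 1) (snd (idx q))) (\<lambda>y. \<Phi> (k j) (chart_inv ?c y) + (-1) * \<phi> (chart_inv ?c y)) y"
        unfolding D_def \<eta>_def by simp
      also have "\<dots> = D q (\<Phi> (k j)) y + iter_deriv (map (\<lambda>i. axis i 1) (snd (idx q))) (\<lambda>y. (-1) * \<phi> (chart_inv ?c y)) y"
        unfolding D_def by (rule iter_deriv_add[OF U sm[OF tst] smooth_on_mult[OF U smooth_on_const[OF U] sm[OF p]] yU])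
      also have "iter_deriv (map (\<lambda>i. axis i 1) (snd (idx q))) (\<lambda>y. (-1) * \<phi> (chart_inv ?c y)) y = (-1) * D q \<phi> y"
        unfolding D_def by (rule iter_deriv_cmult[OF U sm[OF p] yU])
      finally show ?thesis by simp
    qed
    have conv: "\<forall>\<^sub>F j in sequentially. \<forall>y\<in>C q. \<bar>D q (\<eta> j) y\<bar> \<le> e" if "e > 0" for q e
    proof -
      have "\<forall>\<^sub>F j in sequentially. 3 / real (Suc j) < e" using that by real_asymp
      moreover have "\<forall>\<^sub>F j in sequentially. q < j" by (rule eventually_gt_at_top)
      ultimately show ?thesis
      proof eventually_elim
        case (elim j)
        show ?case
        proof
          fix y assume y: "y \<in> C q"
          show "\<bar>D q (\<eta> j) y\<bar> \<le> e" using k(2)[OF elim(2) y] elim(1) unfolding Dchi[OF y] by linarith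
        qed
      qed
    qed
    have "test_tendsto (\<lambda>j. \<Phi> (k j)) \<phi>"
      unfolding test_tendsto_def
    proof (intro conjI ballI allI impI)
      show "\<exists>K. compact K \<and> (\<forall>x. x \<notin> K \<longrightarrow> \<phi> x = 0) \<and> (\<forall>j x. x \<notin> K \<longrightarrow> \<Phi> (k j) x = 0)"
        using K[of N] pN k(1) unfolding S_def by blast
    next
      fix c L' vs and e :: real assume c: "c \<in> \<A>" and L': "compact L'" "L' \<subseteq> fst c" and e: "e > 0"
      obtain M where M: "L' \<subseteq> (\<Union>m<M. L m)" using compact_cover_nat[OF cL(4) L'(1)] .
      have one: "\<forall>\<^sub>F j in sequentially. \<forall>x\<in>L' \<inter> L m. \<bar>iter_deriv vs (\<lambda>y. \<eta> j (chart_inv c y)) (snd c x)\<bar> \<le> e" for m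
      proof -
        have cK: "compact (L' \<inter> L m)" by (rule compact_Int[OF L'(1) cL(2)])
        have "L' \<inter> L m \<subseteq> fst c \<inter> fst (cc m)" using L'(2) cL(3) by blast
        from chart_change_bound[OF c cL(1) cK this, of vs]
        obtain B W where BW: "B \<ge> 0" "finite W" "\<forall>\<phi>\<in>test_functions \<A>. \<forall>b\<ge>0.
          (\<forall>is\<in>W. \<forall>x\<in>L' \<inter> L m. \<bar>iter_deriv (map (\<lambda>i. axis i 1) is) (\<lambda>y. \<phi> (chart_inv (cc m) y)) (snd (cc m) x)\<bar> \<le> b) \<longrightarrow>
          (\<forall>x\<in>L' \<inter> L m. \<bar>iter_deriv vs (\<lambda>y. \<phi> (chart_inv c y)) (snd c x)\<bar> \<le> B * b)"
          by (elim exE conjE) (rule that)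
        define b where "b = e / (B + 1)"
        have b: "b > 0" using e BW(1) by (simp add: b_def)
        have "B * b \<le> e" using e BW(1) by (simp add: b_def field_simps)
        have "\<forall>\<^sub>F j in sequentially. \<forall>is\<in>W. \<forall>y\<in>C (to_nat (m, is)). \<bar>D (to_nat (m, is)) (\<eta> j) y\<bar> \<le> b"
          by (intro eventually_ball_finite BW(2) ballI conv b)
        then show ?thesis
        proof eventually_elim
          case (elim j)
          have "\<forall>is\<in>W. \<forall>x\<in>L' \<inter> L m. \<bar>iter_deriv (map (\<lambda>i. axis i 1) is) (\<lambda>y. \<eta> j (chart_inv (cc m) y)) (snd (cc m) x)\<bar> \<le> b"
            using elim unfolding D_def C_def idx fst_conv snd_conv by blast
          from BW(3)[THEN bspec, OF chi, THEN spec, THEN mp, OF less_imp_le[OF b], THEN mp, OF this] show ?case using \<open>B * b \<le> e\<close> by (meson order_trans)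
        qed
      qed
      have "\<forall>\<^sub>F j in sequentially. \<forall>m\<in>{..<M}. \<forall>x\<in>L' \<inter> L m. \<bar>iter_deriv vs (\<lambda>y. \<eta> j (chart_inv c y)) (snd c x)\<bar> \<le> e"
        by (intro eventually_ball_finite finite_lessThan ballI one)
      then show "\<forall>\<^sub>F j in sequentially. \<forall>x\<in>L'. \<bar>iter_deriv vs (\<lambda>y. \<Phi> (k j) (chart_inv c y) - \<phi> (chart_inv c y)) (snd c x)\<bar> \<le> e"
      proof eventually_elim
        case (elim j)
        then show ?case using M unfolding \<eta>_def by blast
      qed
    qed
    then show "\<exists>k. test_tendsto (\<lambda>j. \<Phi> (k j)) \<phi>" by blast
  qed
qed

text \<open>Functionals are continuous for the topology generated by seminorm balls. Convergence in
  it can be tested on this subbase, where it follows from the triangle inequality as soon as every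
  continuous seminorm of \<open>\<psi> j - \<phi>\<close> tends to 0.\<close>

lemma dual_space_sequential:
  assumes w: "\<omega> \<in> dual_space \<A>" and psi: "\<And>j. \<psi> j \<in> test_functions \<A>" and p: "\<phi> \<in> test_functions \<A>"
    and conv: "test_tendsto \<psi> \<phi>"
  shows "(\<lambda>j. \<omega> (\<psi> j)) \<longlonglongrightarrow> \<omega> \<phi>"
proof -
  have semi: "(\<lambda>j. p (\<lambda>x. \<psi> j x - \<phi> x)) \<longlonglongrightarrow> 0 \<and> (\<forall>\<eta>\<in>test_functions \<A>. p \<eta> \<ge> 0)" if cp: "continuous_seminorm \<A> p" for p
  proof
    have sn: "seminorm_on_tests \<A> p" using cp unfolding continuous_seminorm_def by (rule conjunct1)
    have scale: "p (\<lambda>x. r * \<eta> x) = \<bar>r\<bar> * p \<eta>" if "\<eta> \<in> test_functions \<A>" for r \<eta>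
      using sn that unfolding seminorm_on_tests_def by blast
    have add: "p (\<lambda>x. \<eta> x + \<eta>' x) \<le> p \<eta> + p \<eta>'" if "\<eta> \<in> test_functions \<A>" "\<eta>' \<in> test_functions \<A>" for \<eta> \<eta>'
      using sn that unfolding seminorm_on_tests_def by blast
    have nonneg: "p \<eta> \<ge> 0" if "\<eta> \<in> test_functions \<A>" for \<eta>
    proof -
      have "p (\<lambda>x. 0) = 0" using scale[OF that, of 0] by simp
      moreover have "p (\<lambda>x. \<eta> x + (-1) * \<eta> x) \<le> p \<eta> + p (\<lambda>x. (-1) * \<eta> x)"
        by (rule add[OF that test_scale[OF atlas that]])
      ultimately show ?thesis using scale[OF that, of "-1"] by simp
    qed
    then show "\<forall>\<eta>\<in>test_functions \<A>. p \<eta> \<ge> 0" by blast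
    obtain K where K: "compact K" "\<And>x. x \<notin> K \<Longrightarrow> \<phi> x = 0" "\<And>j x. x \<notin> K \<Longrightarrow> \<psi> j x = 0"
      using conv unfolding test_tendsto_def by blast
    from cp have "\<forall>K. compact K \<longrightarrow> (\<exists>\<Theta> C. finite \<Theta> \<and> (\<forall>(c, L, vs)\<in>\<Theta>. c \<in> \<A> \<and> compact L \<and> L \<subseteq> fst c) \<and>
         (\<forall>\<phi>\<in>test_functions \<A>. \<forall>B\<ge>0. (\<forall>x. x \<notin> K \<longrightarrow> \<phi> x = 0) \<longrightarrow>
           (\<forall>(c, L, vs)\<in>\<Theta>. \<forall>x\<in>L. \<bar>iter_deriv vs (\<lambda>y. \<phi> (chart_inv c y)) (snd c x)\<bar> \<le> B) \<longrightarrow> p \<phi> \<le> C * B))"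
      unfolding continuous_seminorm_def by (rule conjunct2)
    from this[THEN spec, THEN mp, OF K(1)] obtain \<Theta> C where
      T0: "finite \<Theta> \<and> (\<forall>(c, L, vs)\<in>\<Theta>. c \<in> \<A> \<and> compact L \<and> L \<subseteq> fst c) \<and>
         (\<forall>\<phi>\<in>test_functions \<A>. \<forall>B\<ge>0. (\<forall>x. x \<notin> K \<longrightarrow> \<phi> x = 0) \<longrightarrow>
           (\<forall>(c, L, vs)\<in>\<Theta>. \<forall>x\<in>L. \<bar>iter_deriv vs (\<lambda>y. \<phi> (chart_inv c y)) (snd c x)\<bar> \<le> B) \<longrightarrow> p \<phi> \<le> C * B)"
      by (elim exE) (rule that)
    note Th = T0[THEN conjunct1] T0[THEN conjunct2, THEN conjunct1]
      T0[THEN conjunct2, THEN conjunct2, THEN bspec, THEN spec, THEN mp, THEN mp, THEN mp]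
    have chi: "(\<lambda>x. \<psi> j x - \<phi> x) \<in> test_functions \<A>" for j by (rule test_diff[OF atlas psi p])
    show "(\<lambda>j. p (\<lambda>x. \<psi> j x - \<phi> x)) \<longlonglongrightarrow> 0"
    proof (rule LIMSEQ_I)
      fix r :: real assume r: "r > 0"
      define B where "B = r / (\<bar>C\<bar> + 1)"
      have B: "B > 0" using r by (simp add: B_def add_nonneg_pos)
      have CB: "C * B < r"
      proof -
        have "C * B \<le> \<bar>C\<bar> * B" using B by (intro mult_right_mono) auto
        also have "\<dots> < (\<bar>C\<bar> + 1) * B" using B by simp
        also have "\<dots> = r" by (simp add: B_def add_nonneg_pos less_imp_neq[symmetric])
        finally show ?thesis .
      qed
      have "\<forall>\<^sub>F j in sequentially. \<forall>t\<in>\<Theta>. \<forall>x\<in>fst (snd t).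
          \<bar>iter_deriv (snd (snd t)) (\<lambda>y. \<psi> j (chart_inv (fst t) y) - \<phi> (chart_inv (fst t) y)) (snd (fst t) x)\<bar> \<le> B"
      proof (rule eventually_ball_finite[OF Th(1)], rule ballI)
        fix t assume t: "t \<in> \<Theta>"
        have "fst t \<in> \<A>" "compact (fst (snd t))" "fst (snd t) \<subseteq> fst (fst t)"
          using bspec[OF Th(2) t] by (simp_all add: case_prod_beta)
        then show "\<forall>\<^sub>F j in sequentially. \<forall>x\<in>fst (snd t).
          \<bar>iter_deriv (snd (snd t)) (\<lambda>y. \<psi> j (chart_inv (fst t) y) - \<phi> (chart_inv (fst t) y)) (snd (fst t) x)\<bar> \<le> B"
          using conv B unfolding test_tendsto_def by blast
      qed
      then have "\<forall>\<^sub>F j in sequentially. norm (p (\<lambda>x. \<psi> j x - \<phi> x) - 0) < r"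
      proof eventually_elim
        case (elim j)
        have "p (\<lambda>x. \<psi> j x - \<phi> x) \<le> C * B"
          by (rule Th(3)[OF chi less_imp_le[OF B]]) (use K elim in force)+
        then show ?case using nonneg[OF chi[of j]] CB by simp
      qed
      then show "\<exists>no. \<forall>n\<ge>no. norm (p (\<lambda>x. \<psi> n x - \<phi> x) - 0) < r" by (simp add: eventually_sequentially)
    qed
  qed
  have cm: "continuous_map (test_topology \<A>) euclideanreal \<omega>" using w by (simp add: dual_space_def)
  define basis where "basis = {{\<psi>\<in>test_functions \<A>. p (\<lambda>x. \<psi> x - \<phi> x) < e} | p \<phi> e.
        continuous_seminorm \<A> p \<and> \<phi> \<in> test_functions \<A> \<and> e > 0}"
  have tt: "test_topology \<A> = topology_generated_by basis" by (simp add: test_topology_def basis_def)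
  \<comment> \<open>The zero seminorm makes the set of all test functions a member of the subbase,
    which places \<phi> in the underlying set of the topology.\<close>
  have zero: "continuous_seminorm \<A> (\<lambda>_. 0)"
    unfolding continuous_seminorm_def seminorm_on_tests_def
    by (auto intro!: exI[of _ "{}"] exI[of _ 0])
  have ev: "\<forall>\<^sub>F j in sequentially. \<psi> j \<in> b" if "b \<in> basis" "\<phi> \<in> b" for b
  proof -
    obtain q \<phi>' e where b: "b = {\<psi>\<in>test_functions \<A>. q (\<lambda>x. \<psi> x - \<phi>' x) < e}" "continuous_seminorm \<A> q"
      "\<phi>' \<in> test_functions \<A>" "e > 0" using \<open>b \<in> basis\<close> unfolding basis_def by blast
    have "seminorm_on_tests \<A> q" using b(2) unfolding continuous_seminorm_def by (rule conjunct1)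
    then have qadd: "\<forall>\<phi>\<in>test_functions \<A>. \<forall>\<psi>\<in>test_functions \<A>. q (\<lambda>x. \<phi> x + \<psi> x) \<le> q \<phi> + q \<psi>"
      unfolding seminorm_on_tests_def by (rule conjunct1)
    have "q (\<lambda>x. \<phi> x - \<phi>' x) < e" using \<open>\<phi> \<in> b\<close> by (simp add: b(1))
    moreover have "(\<lambda>j. q (\<lambda>x. \<psi> j x - \<phi> x)) \<longlonglongrightarrow> 0" using semi[OF b(2)] by blast
    ultimately have "\<forall>\<^sub>F j in sequentially. q (\<lambda>x. \<psi> j x - \<phi> x) < e - q (\<lambda>x. \<phi> x - \<phi>' x)"
      by (intro order_tendstoD(2)) auto
    then show ?thesis
    proof eventually_elim
      case (elim j)
      have "q (\<lambda>x. (\<psi> j x - \<phi> x) + (\<phi> x - \<phi>' x)) \<le> q (\<lambda>x. \<psi> j x - \<phi> x) + q (\<lambda>x. \<phi> x - \<phi>' x)"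
        using qadd[THEN bspec, OF test_diff[OF atlas psi p], THEN bspec, OF test_diff[OF atlas p b(3)]] .
      then show ?case using elim psi by (simp add: b(1))
    qed
  qed
  have "limitin (test_topology \<A>) \<psi> \<phi> sequentially"
    unfolding limitin_def
  proof (intro conjI allI impI)
    have "{\<psi>\<in>test_functions \<A>. (0::real) < 1} \<in> basis"
      unfolding basis_def using zero p by (intro CollectI exI[of _ "\<lambda>_. 0"] exI[of _ \<phi>] exI[of _ 1]) auto
    then show "\<phi> \<in> topspace (test_topology \<A>)"
      using p by (auto simp: tt topology_generated_by_topspace)
    fix U assume "openin (test_topology \<A>) U \<and> \<phi> \<in> U"
    then have "generate_topology_on basis U" "\<phi> \<in> U" by (auto simp: tt openin_topology_generated_by_iff)
    then show "\<forall>\<^sub>F j in sequentially. \<psi> j \<in> U"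
    proof (induction)
      case (Int a b)
      then show ?case by (auto intro: eventually_conj)
    next
      case (UN K)
      then obtain k where k: "k \<in> K" "\<phi> \<in> k" by blast
      show ?case by (rule eventually_mono[OF UN.IH[OF k]]) (use k in blast)
    qed (use ev in auto)
  qed
  from continuous_map_limit[OF cm this]
  have "limitin euclideanreal (\<lambda>j. \<omega> (\<psi> j)) (\<omega> \<phi>) sequentially" unfolding comp_def .
  then show ?thesis by simp
qed

end

section \<open>Sums of product functions in the extended Fock space\<close>

text \<open>The algebraic tensor product of classes of real functions of one variable, with complex
  scalars. The class may vary with the coordinate: on the manifold all factors are test functions,
  while in a product of charts the factor \<open>i\<close> is smooth on the image of the
  \<open>i\<close>-th chart.\<close>

inductive tensor_sum :: "nat \<Rightarrow> (nat \<Rightarrow> ('b \<Rightarrow> real) \<Rightarrow> bool) \<Rightarrow> ((nat \<Rightarrow> 'b) \<Rightarrow> complex) \<Rightarrow> bool"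
  for n C where
  prod: "(\<And>i. i < n \<Longrightarrow> C i (G i)) \<Longrightarrow> tensor_sum n C (\<lambda>y. z * (\<Prod>i<n. complex_of_real (G i (y i))))"
| add: "tensor_sum n C F \<Longrightarrow> tensor_sum n C H \<Longrightarrow> tensor_sum n C (\<lambda>y. F y + H y)"

lemma tensor_sum_scale: "tensor_sum n C F \<Longrightarrow> tensor_sum n C (\<lambda>y. z * F y)"
proof (induction rule: tensor_sum.induct)
  case (prod G z')
  then show ?case using tensor_sum.prod[of n C G "z * z'"] by (simp add: mult.assoc)
next
  case (add F H)
  then show ?case using tensor_sum.add[of n C "\<lambda>y. z * F y" "\<lambda>y. z * H y"] by (simp add: distrib_left)
qed

lemma tensor_sum_zero:
  assumes "\<And>i. i < n \<Longrightarrow> C i (G i)"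
  shows "tensor_sum n C (\<lambda>y. 0)"
  using tensor_sum.prod[of n C G 0] assms by simp

lemma tensor_sum_sum:
  assumes "finite J" "tensor_sum n C (\<lambda>y. 0)" "\<And>j. j \<in> J \<Longrightarrow> tensor_sum n C (F j)"
  shows "tensor_sum n C (\<lambda>y. \<Sum>j\<in>J. F j y)"
  using assms(1,3)
proof (induction J)
  case empty
  then show ?case using assms(2) by simp
next
  case (insert j J)
  then show ?case using tensor_sum.add[of n C "F j" "\<lambda>y. \<Sum>j\<in>J. F j y"] by simp
qed

lemma tensor_sum_Suc:
  assumes "tensor_sum n C F" "C n g"
  shows "tensor_sum (Suc n) C (\<lambda>y. F y * complex_of_real (g (y n)))"
  using assms(1)
proof (induction rule: tensor_sum.induct)
  case (prod G z)
  have "tensor_sum (Suc n) C (\<lambda>y. z * (\<Prod>i<Suc n. complex_of_real ((G(n := g)) i (y i))))"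
    by (rule tensor_sum.prod) (use prod assms(2) in \<open>auto simp: less_Suc_eq\<close>)
  then show ?case by (simp add: mult.assoc)
next
  case (add F H)
  then show ?case using tensor_sum.add[of "Suc n" C "\<lambda>y. F y * complex_of_real (g (y n))"] by (simp add: distrib_right)
qed

lemma tensor_sum_depends: "tensor_sum n C F \<Longrightarrow> depends_on_first n F"
  by (induction rule: tensor_sum.induct) (auto simp: depends_on_first_def intro!: prod.cong, metis)

lemma tensor_sum_bounded:
  assumes "tensor_sum n C F" "\<And>i g. i < n \<Longrightarrow> C i g \<Longrightarrow> \<exists>B. \<forall>x. \<bar>g x\<bar> \<le> B"
  shows "\<exists>B. \<forall>y. cmod (F y) \<le> B"
  using assms(1)
proof (induction rule: tensor_sum.induct)
  case (prod G z)
  have "\<exists>B. i < n \<longrightarrow> (\<forall>x. \<bar>G i x\<bar> \<le> B)" for i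
    using assms(2)[of i "G i"] prod[of i] by (cases "i < n") simp_all
  then have "\<exists>B. \<forall>i. i < n \<longrightarrow> (\<forall>x. \<bar>G i x\<bar> \<le> B i)" by (intro choice allI)
  then obtain B where "\<forall>i. i < n \<longrightarrow> (\<forall>x. \<bar>G i x\<bar> \<le> B i)" ..
  then have B: "\<And>i x. i < n \<Longrightarrow> \<bar>G i x\<bar> \<le> B i" by simp
  have "cmod (z * (\<Prod>i<n. complex_of_real (G i (y i)))) \<le> cmod z * (\<Prod>i<n. B i)" for y
    unfolding norm_mult prod_norm[symmetric] using B by (intro mult_left_mono prod_mono) auto
  then show ?case by (intro exI allI)
next
  case (add F H)
  from add.IH(1) obtain B where B: "\<forall>y. cmod (F y) \<le> B" ..
  from add.IH(2) obtain B' where B': "\<forall>y. cmod (H y) \<le> B'" ..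
  have "cmod (F y + H y) \<le> B + B'" for y by (rule norm_triangle_mono) (simp_all add: B B')
  then show ?case by (intro exI[of _ "B + B'"] allI)
qed

lemma tensor_sum_support:
  fixes F :: "(nat \<Rightarrow> 'b::topological_space) \<Rightarrow> complex"
  assumes "tensor_sum n C F" "\<And>i g. i < n \<Longrightarrow> C i g \<Longrightarrow> \<exists>K. compact K \<and> (\<forall>x. x \<notin> K \<longrightarrow> g x = 0)"
  shows "\<exists>K. compact K \<and> (\<forall>y. F y \<noteq> 0 \<longrightarrow> (\<forall>i<n. y i \<in> K))"
  using assms(1)
proof (induction rule: tensor_sum.induct)
  case (prod G z)
  have "\<exists>K. i < n \<longrightarrow> compact K \<and> (\<forall>x. x \<notin> K \<longrightarrow> G i x = 0)" for i
    using assms(2)[of i "G i"] prod[of i] by (cases "i < n") simp_all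
  then have "\<exists>K. \<forall>i. i < n \<longrightarrow> compact (K i) \<and> (\<forall>x. x \<notin> K i \<longrightarrow> G i x = 0)"
    by (intro choice allI)
  then obtain K where "\<forall>i. i < n \<longrightarrow> compact (K i) \<and> (\<forall>x. x \<notin> K i \<longrightarrow> G i x = 0)" ..
  then have K: "\<And>i. i < n \<Longrightarrow> compact (K i)" "\<And>i x. i < n \<Longrightarrow> x \<notin> K i \<Longrightarrow> G i x = 0" by simp_all
  have "compact (\<Union>i<n. K i)" using K(1) by (intro compact_UN) auto
  moreover have "y i \<in> (\<Union>i<n. K i)" if "z * (\<Prod>i<n. complex_of_real (G i (y i))) \<noteq> 0" "i < n" for y i
  proof -
    have "G i (y i) \<noteq> 0" using that by auto
    then show ?thesis using K(2)[OF that(2)] that(2) by auto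
  qed
  ultimately show ?case by (intro exI[of _ "\<Union>i<n. K i"] conjI allI impI)
next
  case (add F H)
  from add.IH(1) obtain K where K1: "compact K \<and> (\<forall>y. F y \<noteq> 0 \<longrightarrow> (\<forall>i<n. y i \<in> K))" ..
  from add.IH(2) obtain K' where K2: "compact K' \<and> (\<forall>y. H y \<noteq> 0 \<longrightarrow> (\<forall>i<n. y i \<in> K'))" ..
  have K: "compact K" "compact K'"
    "\<And>y i. F y \<noteq> 0 \<Longrightarrow> i < n \<Longrightarrow> y i \<in> K" "\<And>y i. H y \<noteq> 0 \<Longrightarrow> i < n \<Longrightarrow> y i \<in> K'"
    using K1 K2 by simp_all
  have "y i \<in> K \<union> K'" if "F y + H y \<noteq> 0" "i < n" for y i
    using that K(3,4)[of y i] by (cases "F y = 0") auto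
  then show ?case using compact_Un[OF K(1,2)] by (intro exI[of _ "K \<union> K'"] conjI allI impI)
qed

text \<open>A partial derivative hits a single factor and leaves a product of the same kind; for a
  coordinate beyond \<open>n\<close> it vanishes. So the class is stable under all partial
  derivatives.\<close>

lemma tensor_sum_partial:
  fixes F :: "(nat \<Rightarrow> real ^ 'n::finite) \<Rightarrow> complex"
  assumes "tensor_sum n (\<lambda>i. smooth_on (V i)) F"
  shows "\<exists>H. tensor_sum n (\<lambda>i. smooth_on (V i)) H \<and> (\<forall>y. (\<forall>i<n. y i \<in> V i) \<longrightarrow>
    ((\<lambda>t. F (y(i := y i + t *\<^sub>R v))) has_vector_derivative H y) (at 0))"
  using assms
proof (induction rule: tensor_sum.induct)
  case (prod G z)
  show ?case
  proof (cases "i < n")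
    case False
    have "(\<Prod>j<n. complex_of_real (G j ((y(i := y i + t *\<^sub>R v)) j))) = (\<Prod>j<n. complex_of_real (G j (y j)))" for y t
      using False by (intro prod.cong) auto
    then show ?thesis using tensor_sum.prod[of n "\<lambda>i. smooth_on (V i)" G 0] prod
      by (intro exI[of _ "\<lambda>y. 0"]) auto
  next
    case True
    define G' where "G' = G(i := iter_deriv [v] (G i))"
    have "tensor_sum n (\<lambda>i. smooth_on (V i)) (\<lambda>y. z * (\<Prod>j<n. complex_of_real (G' j (y j))))"
      using prod smooth_on_iter_deriv[of "V i" "G i" "[v]"] True by (intro tensor_sum.prod) (auto simp: G'_def)
    moreover have "((\<lambda>t. z * (\<Prod>j<n. complex_of_real (G j ((y(i := y i + t *\<^sub>R v)) j)))) has_vector_derivative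
        z * (\<Prod>j<n. complex_of_real (G' j (y j)))) (at 0)" if y: "\<forall>i<n. y i \<in> V i" for y
    proof -
      let ?c = "\<Prod>j\<in>{..<n} - {i}. complex_of_real (G j (y j))"
      have split: "(\<Prod>j<n. f j) = f i * (\<Prod>j\<in>{..<n} - {i}. f j)" for f :: "nat \<Rightarrow> complex"
        using True by (intro prod.remove) auto
      have e1: "(\<Prod>j<n. complex_of_real (G j ((y(i := y i + t *\<^sub>R v)) j))) = complex_of_real (G i (y i + t *\<^sub>R v)) * ?c" for t
        unfolding split by (auto intro!: prod.cong)
      have e2: "(\<Prod>j<n. complex_of_real (G' j (y j))) = complex_of_real (frechet_derivative (G i) (at (y i)) v) * ?c"
        unfolding split by (auto simp: G'_def intro!: prod.cong)
      have "(G i has_derivative frechet_derivative (G i) (at (y i))) (at (y i))"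
        using smooth_on_differentiable[OF prod[OF True], of "y i"] y True unfolding frechet_derivative_works by blast
      then have D: "(G i has_derivative frechet_derivative (G i) (at (y i))) (at (y i + 0 *\<^sub>R v))" by simp
      have "((\<lambda>t. y i + t *\<^sub>R v) has_derivative (\<lambda>t. t *\<^sub>R v)) (at 0)" by (auto intro!: derivative_eq_intros)
      from has_derivative_compose[OF this D]
      have "((\<lambda>t. G i (y i + t *\<^sub>R v)) has_derivative (\<lambda>t. frechet_derivative (G i) (at (y i)) (t *\<^sub>R v))) (at 0)" .
      moreover have "frechet_derivative (G i) (at (y i)) (t *\<^sub>R v) = t *\<^sub>R frechet_derivative (G i) (at (y i)) v" for t
        using has_derivative_linear[OF D] by (rule linear_scale)
      ultimately have "((\<lambda>t. G i (y i + t *\<^sub>R v)) has_vector_derivative frechet_derivative (G i) (at (y i)) v) (at 0)"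
        by (simp add: has_vector_derivative_def)
      then have "((\<lambda>t. complex_of_real (G i (y i + t *\<^sub>R v))) has_vector_derivative complex_of_real (frechet_derivative (G i) (at (y i)) v)) (at 0)"
        by (rule bounded_linear.has_vector_derivative[OF bounded_linear_of_real])
      then have "((\<lambda>t. z * (complex_of_real (G i (y i + t *\<^sub>R v)) * ?c)) has_vector_derivative
          z * (complex_of_real (frechet_derivative (G i) (at (y i)) v) * ?c)) (at 0)"
        by (intro has_vector_derivative_mult_right has_vector_derivative_mult_left)
      then show ?thesis unfolding e1 e2 .
    qed
    ultimately show ?thesis by blast
  qed
next
  case (add F H)
  then obtain F' H' where h: "tensor_sum n (\<lambda>i. smooth_on (V i)) F'" "tensor_sum n (\<lambda>i. smooth_on (V i)) H'"
    "\<And>y. (\<forall>i<n. y i \<in> V i) \<Longrightarrow> ((\<lambda>t. F (y(i := y i + t *\<^sub>R v))) has_vector_derivative F' y) (at 0)"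
    "\<And>y. (\<forall>i<n. y i \<in> V i) \<Longrightarrow> ((\<lambda>t. H (y(i := y i + t *\<^sub>R v))) has_vector_derivative H' y) (at 0)"
    by blast
  show ?case
    using tensor_sum.add[OF h(1,2)] has_vector_derivative_add[OF h(3,4)]
    by (intro exI[of _ "\<lambda>y. F' y + H' y"] conjI allI impI)
qed

lemma tensor_sum_continuous:
  fixes F :: "(nat \<Rightarrow> real ^ 'n::finite) \<Rightarrow> complex"
  assumes "tensor_sum n (\<lambda>i. smooth_on (V i)) F"
  shows "continuous_on {y. \<forall>i<n. y i \<in> V i} F"
  using assms
proof (induction rule: tensor_sum.induct)
  case (prod G z)
  have "continuous_on {y. \<forall>i<n. y i \<in> V i} (\<lambda>y. G i (y i))" if "i < n" for i
  proof (rule continuous_on_compose2[OF smooth_on_continuous[OF prod[OF that]]])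
    show "continuous_on {y. \<forall>i<n. y i \<in> V i} (\<lambda>y. y i)"
      by (rule continuous_on_subset[OF continuous_on_product_coordinates]) simp
  qed (use that in auto)
  then show ?case by (intro continuous_intros) auto
next
  case (add F H)
  then show ?case by (intro continuous_intros)
qed

text \<open>Every iterated partial derivative agrees on the product of the \<open>V i\<close> with
  another sum of products, whose continuity and differentiability are known.\<close>

lemma tensor_sum_smooth_multi:
  fixes F :: "(nat \<Rightarrow> real ^ 'n::finite) \<Rightarrow> complex"
  assumes F: "tensor_sum n (\<lambda>i. smooth_on (V i)) F" and V: "\<And>i. open (V i)"
  shows "smooth_multi {y. \<forall>i<n. y i \<in> V i} F"
proof -
  let ?S = "{y. \<forall>i<n. y i \<in> V i}"
  have transfer: "((\<lambda>t. P (y(i := y i + t *\<^sub>R v))) has_vector_derivative D) (at 0)"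
    if eq: "\<And>y. y \<in> ?S \<Longrightarrow> P y = H y" and y: "y \<in> ?S"
      and D: "((\<lambda>t. H (y(i := y i + t *\<^sub>R v))) has_vector_derivative D) (at 0)" for P H y i v D
  proof -
    \<comment> \<open>The parameters for which the shifted point stays in the product of the
      \<open>V i\<close>. They form an open set containing 0, so an identity on \<open>?S\<close>
      may be differentiated.\<close>
    define T where "T = (if i < n then (\<lambda>t. y i + t *\<^sub>R v) -` V i else UNIV)"
    have "open T" unfolding T_def using V[of i] by (auto intro!: open_vimage continuous_intros)
    moreover have "(0::real) \<in> T" using y by (auto simp: T_def)
    moreover have "P (y(i := y i + t *\<^sub>R v)) = H (y(i := y i + t *\<^sub>R v))" if "t \<in> T" for t
      using that y by (intro eq) (auto simp: T_def split: if_splits)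
    ultimately show ?thesis
      using has_vector_derivative_transform_within_open[OF D, of T "\<lambda>t. P (y(i := y i + t *\<^sub>R v))"] by simp
  qed
  have main: "\<exists>H. tensor_sum n (\<lambda>i. smooth_on (V i)) H \<and> (\<forall>y\<in>?S. iter_partial ds F y = H y)" for ds
  proof (induction ds)
    case Nil
    then show ?case using F by auto
  next
    case (Cons d ds)
    obtain i v where d: "d = (i, v)" by (cases d)
    obtain H where H: "tensor_sum n (\<lambda>i. smooth_on (V i)) H" "\<And>y. y \<in> ?S \<Longrightarrow> iter_partial ds F y = H y"
      using Cons by blast
    obtain H' where H': "tensor_sum n (\<lambda>i. smooth_on (V i)) H'"
      "\<And>y. y \<in> ?S \<Longrightarrow> ((\<lambda>t. H (y(i := y i + t *\<^sub>R v))) has_vector_derivative H' y) (at 0)"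
      using tensor_sum_partial[OF H(1), of i v] by blast
    have "iter_partial (d # ds) F y = H' y" if "y \<in> ?S" for y
      unfolding d iter_partial.simps by (rule vector_derivative_at[OF transfer[OF H(2) that H'(2)[OF that]]])
    then show ?case using H'(1) by blast
  qed
  show ?thesis
    unfolding smooth_multi_def
  proof (intro allI conjI ballI)
    fix ds
    obtain H where H: "tensor_sum n (\<lambda>i. smooth_on (V i)) H" "\<And>y. y \<in> ?S \<Longrightarrow> iter_partial ds F y = H y"
      using main by blast
    show "continuous_on ?S (iter_partial ds F)"
      by (rule continuous_on_eq[OF tensor_sum_continuous[OF H(1)]]) (rule H(2)[symmetric])
    fix y i v assume y: "y \<in> ?S"
    obtain H' where H': "((\<lambda>t. H (y(i := y i + t *\<^sub>R v))) has_vector_derivative H' y) (at 0)"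
      using tensor_sum_partial[OF H(1), of i v] y by blast
    show "(\<lambda>t::real. iter_partial ds F (y(i := y i + t *\<^sub>R v))) differentiable (at 0)"
      using transfer[OF H(2) y H'] unfolding has_vector_derivative_def differentiable_def by blast
  qed
qed

section \<open>Loop collections and inner products\<close>

lemma finite_loop_collection:
  assumes "\<alpha> \<in> loop_collections n"
  shows "finite \<alpha>"
proof -
  have "finite {xs. set xs \<subseteq> {..<n} \<and> length xs \<le> n}" by (rule finite_lists_length_le) simp
  moreover have "loops n \<subseteq> (\<lambda>xs. {rotate k xs | k. True}) ` {xs. set xs \<subseteq> {..<n} \<and> length xs \<le> n}"
  proof
    fix \<kappa> assume "\<kappa> \<in> loops n"
    then obtain xs where xs: "\<kappa> = {rotate k xs | k. True}" "distinct xs" "set xs \<subseteq> {..<n}" by (auto simp: loops_def)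
    have "length xs \<le> n" using card_mono[OF _ xs(3)] distinct_card[OF xs(2)] by simp
    then show "\<kappa> \<in> (\<lambda>xs. {rotate k xs | k. True}) ` {xs. set xs \<subseteq> {..<n} \<and> length xs \<le> n}" using xs by blast
  qed
  ultimately have "finite (loops n)" by (meson finite_imageI finite_subset)
  then show ?thesis using assms finite_subset by (auto simp: loop_collections_def)
qed

lemma loop_of_index:
  assumes "\<alpha> \<in> loop_collections n" "i < n"
  shows "(THE \<kappa>. \<kappa> \<in> \<alpha> \<and> i \<in> loop_points \<kappa>) \<in> \<alpha>"
  using assms theI'[of "\<lambda>\<kappa>. \<kappa> \<in> \<alpha> \<and> i \<in> loop_points \<kappa>"] by (auto simp: loop_collections_def)

text \<open>A loop is not empty, so its variable is inserted at some coordinate. This converts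
  compact support in the coordinates into compact support in the loop variables.\<close>

lemma index_of_loop:
  assumes a: "\<alpha> \<in> loop_collections n" and k: "\<kappa> \<in> \<alpha>"
  obtains i where "i < n" "(THE \<kappa>'. \<kappa>' \<in> \<alpha> \<and> i \<in> loop_points \<kappa>') = \<kappa>"
proof -
  have "\<kappa> \<in> loops n" using assms by (auto simp: loop_collections_def)
  then obtain xs where xs: "\<kappa> = {rotate k xs | k. True}" "xs \<noteq> []" "set xs \<subseteq> {..<n}" by (auto simp: loops_def)
  have "rotate 0 xs \<in> \<kappa>" unfolding xs(1) by blast
  then have "hd xs \<in> loop_points \<kappa>" using xs(2) unfolding loop_points_def by (intro UN_I[of xs]) auto
  moreover have n: "hd xs < n" using xs hd_in_set by blast
  moreover have "\<exists>!\<kappa>'. \<kappa>' \<in> \<alpha> \<and> hd xs \<in> loop_points \<kappa>'" using a n by (auto simp: loop_collections_def)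
  ultimately have "(THE \<kappa>'. \<kappa>' \<in> \<alpha> \<and> hd xs \<in> loop_points \<kappa>') = \<kappa>" using k by (intro the1_equality) auto
  then show ?thesis using n that by blast
qed

lemma loop_collections_0: "loop_collections 0 = {{}}"
  by (auto simp: loop_collections_def loops_def)

lemma ext_inner_zero: "ext_inner \<sigma> n (\<lambda>x. 0) g = 0" "ext_inner \<sigma> n f (\<lambda>x. 0) = 0"
  by (simp_all add: ext_inner_def on_loops_def)

lemma fock_dist_self: "fock_dist \<sigma> f f = 0"
  by (simp add: fock_dist_def fock_add_def fock_scale_def fock_inner_def ext_inner_zero)

text \<open>Only the zeroth components meet. There the sole loop collection is empty, and the
  product measure over the empty index set is a point mass.\<close>

lemma fock_inner_vacuum:
  fixes \<sigma> :: "'a measure" and f :: "'a fock"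
  assumes "depends_on_first 0 (f 0)"
  shows "fock_inner \<sigma> vacuum f = f 0 x"
proof -
  have "ext_inner \<sigma> 0 (vacuum 0) (f 0) = f 0 x"
  proof -
    define c where "c = f 0 x"
    have "f 0 y = c" for y using assms unfolding depends_on_first_def c_def by blast
    then have f0: "f 0 = (\<lambda>_. c)" by (rule ext)
    then have "on_loops {} (\<lambda>x. cnj (vacuum 0 x) * f 0 x) = (\<lambda>y. c)"
      by (simp add: on_loops_def vacuum_def)
    then have "ext_inner \<sigma> 0 (vacuum 0) (f 0) = (\<integral>y. c \<partial>(\<Pi>\<^sub>M \<kappa>\<in>({} :: nat list set set). \<sigma>))"
      by (simp add: ext_inner_def loop_collections_0)
    also have "\<dots> = f 0 x"
      by (simp add: PiM_empty lebesgue_integral_count_space_finite f0)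
    finally show ?thesis .
  qed
  moreover have "vacuum n = (\<lambda>x :: nat \<Rightarrow> 'a. 0)" if "n \<noteq> 0" for n
    using that by (auto simp: vacuum_def)
  then have "ext_inner \<sigma> n (vacuum n) (f n) * fact n = 0" if "n \<noteq> 0" for n
    using that by (simp add: ext_inner_zero)
  then have "fock_inner \<sigma> vacuum f = (\<Sum>n\<in>{0}. ext_inner \<sigma> n (vacuum n) (f n) * fact n)"
    unfolding fock_inner_def by (intro suminf_finite) auto
  ultimately show ?thesis by simp
qed

text \<open>Each factor lacks a constant term, so a product of \<open>n\<close> of them begins at
  order \<open>n\<close>. Consequently the \<open>k\<close>-th power vector has no component above
  \<open>k\<close>.\<close>

lemma fps_nth_mult_prod_zero:
  assumes "fps_nth u 0 = 0" "k < n"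
  shows "fps_nth (A * (\<Prod>i<n. fps_rescale (z i) u)) k = 0"
  using assms(2)
proof (induction n arbitrary: k)
  case (Suc n)
  have "fps_nth (A * (\<Prod>i<Suc n. fps_rescale (z i) u)) k =
      (\<Sum>j=0..k. fps_nth (A * (\<Prod>i<n. fps_rescale (z i) u)) j * fps_nth (fps_rescale (z n) u) (k - j))"
    by (simp add: fps_mult_nth flip: mult.assoc)
  also have "\<dots> = 0"
  proof (rule sum.neutral, rule ballI)
    fix j assume j: "j \<in> {0..k}"
    show "fps_nth (A * (\<Prod>i<n. fps_rescale (z i) u)) j * fps_nth (fps_rescale (z n) u) (k - j) = 0"
    proof (cases "j < n")
      case True
      then show ?thesis using Suc.IH by simp
    next
      case False
      then have "k - j = 0" using j Suc.prems by auto
      then show ?thesis using assms(1) by simp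
    qed
  qed
  finally show ?case .
qed simp

section \<open>Membership of the power vectors in the Fock space\<close>

context
  fixes \<A> :: "('a::{t2_space, second_countable_topology}, 'n::finite) chart set" and \<sigma> :: "'a measure"
  assumes atlas: "oriented_atlas \<A>" and radon: "radon_measure \<sigma>"
begin

lemma sets_radon: "sets \<sigma> = sets borel"
  using radon unfolding radon_measure_def by (rule conjunct1)

lemma space_radon: "space \<sigma> = UNIV"
  using sets_eq_imp_space_eq[OF sets_radon] by simp

lemma radon_compact: "compact K \<Longrightarrow> emeasure \<sigma> K < \<infinity>"
  using radon unfolding radon_measure_def by blast

lemma sigma_finite_radon: "sigma_finite_measure \<sigma>"
proof
  from countable_compact_charts[OF atlas] obtain cc L where
    *: "(\<forall>m. cc m \<in> \<A>) \<and> (\<forall>m. compact (L m)) \<and> (\<forall>m. L m \<subseteq> fst (cc m)) \<and> (\<Union>m::nat. interior (L m)) = UNIV"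
    by (elim exE) (rule that)
  then have L: "\<And>m. compact (L m)" "(\<Union>m. interior (L m)) = UNIV" by blast+
  have "(\<Union>m. L m) = UNIV" using L(2) interior_subset by blast
  then show "\<exists>A. countable A \<and> A \<subseteq> sets \<sigma> \<and> \<Union>A = space \<sigma> \<and> (\<forall>a\<in>A. emeasure \<sigma> a \<noteq> \<infinity>)"
    using radon_compact[OF L(1)] compact_imp_closed[OF L(1)]
    by (intro exI[of _ "range L"]) (auto simp: space_radon sets_radon less_top)
qed

lemma test_measurable_radon: "\<phi> \<in> test_functions \<A> \<Longrightarrow> \<phi> \<in> borel_measurable \<sigma>"
  using test_measurable[OF atlas] measurable_cong_sets[OF sets_radon refl] by blast

lemma test_integrable:
  assumes "\<phi> \<in> test_functions \<A>"
  shows "integrable \<sigma> \<phi>"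
proof -
  from test_bounded_support[OF atlas assms] obtain K C where
    K: "compact K \<and> (\<forall>x. x \<notin> K \<longrightarrow> \<phi> x = 0) \<and> C \<ge> 0 \<and> (\<forall>x. \<bar>\<phi> x\<bar> \<le> C)" by (elim exE) (rule that)
  show ?thesis
  proof (rule integrableI_bounded_set[where A=K and B=C])
    show "K \<in> sets \<sigma>" using K compact_imp_closed[of K] by (simp add: sets_radon)
    show "emeasure \<sigma> K < \<infinity>" using K radon_compact by blast
  qed (use K test_measurable_radon[OF assms] in auto)
qed

abbreviation tests :: "nat \<Rightarrow> ('a \<Rightarrow> real) \<Rightarrow> bool" where
  "tests \<equiv> (\<lambda>i g. g \<in> test_functions \<A>)"

lemma tensor_sum_sym_tests:
  assumes F: "tensor_sum n tests F" and sym: "\<And>\<pi> x. \<pi> permutes {..<n} \<Longrightarrow> F (x \<circ> \<pi>) = F x"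
  shows "F \<in> sym_tests \<A> n"
proof -
  have sup: "\<exists>K. compact K \<and> (\<forall>y. F y \<noteq> 0 \<longrightarrow> (\<forall>i<n. y i \<in> K))"
    by (rule tensor_sum_support[OF F]) (use test_bounded_support[OF atlas] in blast)
  have "smooth_multi {y. \<forall>i<n. y i \<in> chart_img (\<kappa> i)} (\<lambda>y. F (\<lambda>i. chart_inv (\<kappa> i) (y i)))"
    if k: "\<forall>i. \<kappa> i \<in> \<A>" for \<kappa> :: "nat \<Rightarrow> ('a, 'n) chart"
  proof (rule tensor_sum_smooth_multi)
    show "open (chart_img (\<kappa> i))" for i by (rule atlas_chart(2)[OF atlas k[rule_format]])
    show "tensor_sum n (\<lambda>i. smooth_on (chart_img (\<kappa> i))) (\<lambda>y. F (\<lambda>i. chart_inv (\<kappa> i) (y i)))"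
      using F
    proof (induction rule: tensor_sum.induct)
      case (prod G z)
      show ?case
        by (rule tensor_sum.prod[where G="\<lambda>i y. G i (chart_inv (\<kappa> i) y)"])
           (rule test_smooth[OF atlas prod k[rule_format]])
    next
      case (add F H)
      then show ?case by (intro tensor_sum.add)
    qed
  qed
  then show ?thesis
    unfolding sym_tests_def mem_Collect_eq using tensor_sum_depends[OF F] sym sup by (intro conjI allI impI)
qed

lemma tensor_sum_on_loops_measurable:
  assumes F: "tensor_sum n tests F" and a: "\<alpha> \<in> loop_collections n"
  shows "on_loops \<alpha> F \<in> borel_measurable (\<Pi>\<^sub>M \<kappa>\<in>\<alpha>. \<sigma>)"
  using F
proof (induction rule: tensor_sum.induct)
  case (prod G z)
  have m: "(\<lambda>y. G i (y (THE \<kappa>. \<kappa> \<in> \<alpha> \<and> i \<in> loop_points \<kappa>))) \<in> borel_measurable (\<Pi>\<^sub>M \<kappa>\<in>\<alpha>. \<sigma>)" if "i < n" for i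
    by (rule measurable_compose[OF measurable_component_singleton[OF loop_of_index[OF a that]]
          test_measurable_radon[OF prod[OF that]]])
  show ?case unfolding on_loops_def
    by (intro borel_measurable_times borel_measurable_const borel_measurable_prod measurable_compose[OF m] borel_measurable_of_real)
       (use m in auto)
next
  case (add F H)
  then show ?case unfolding on_loops_def by simp
qed

text \<open>The function is bounded and vanishes outside a box of compact sides, one for each loop;
  the box has finite measure because the loops are finitely many.\<close>

lemma tensor_sum_L2:
  assumes F: "tensor_sum n tests F" and a: "\<alpha> \<in> loop_collections n"
  shows "on_loops \<alpha> F \<in> L2 (\<Pi>\<^sub>M \<kappa>\<in>\<alpha>. \<sigma>)"
proof -
  interpret sigma_finite_measure \<sigma> by (rule sigma_finite_radon)
  interpret P: product_sigma_finite "\<lambda>_ :: nat list set. \<sigma>" by unfold_locales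
  note m = tensor_sum_on_loops_measurable[OF F a]
  have "\<exists>K. compact K \<and> (\<forall>y. F y \<noteq> 0 \<longrightarrow> (\<forall>i<n. y i \<in> K))"
    by (rule tensor_sum_support[OF F]) (use test_bounded_support[OF atlas] in blast)
  then obtain K where K: "compact K" "\<forall>y. F y \<noteq> 0 \<longrightarrow> (\<forall>i<n. y i \<in> K)" by (elim exE conjE) (rule that)
  have "\<exists>B. \<forall>y. cmod (F y) \<le> B"
    by (rule tensor_sum_bounded[OF F]) (use test_bounded_support[OF atlas] in blast)
  then obtain B where B: "\<forall>y. cmod (F y) \<le> B" ..
  let ?A = "\<Pi>\<^sub>E \<kappa>\<in>\<alpha>. K"
  have KM: "K \<in> sets \<sigma>" using compact_imp_closed[OF K(1)] by (simp add: sets_radon)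
  have "integrable (\<Pi>\<^sub>M \<kappa>\<in>\<alpha>. \<sigma>) (\<lambda>y. (cmod (on_loops \<alpha> F y))\<^sup>2)"
  proof (rule integrableI_bounded_set[where A="?A" and B="B\<^sup>2"])
    show "?A \<in> sets (\<Pi>\<^sub>M \<kappa>\<in>\<alpha>. \<sigma>)" using KM finite_loop_collection[OF a] by (intro sets_PiM_I_finite) auto
    show "(\<lambda>y. (cmod (on_loops \<alpha> F y))\<^sup>2) \<in> borel_measurable (\<Pi>\<^sub>M \<kappa>\<in>\<alpha>. \<sigma>)" using m by measurable
    have "emeasure (\<Pi>\<^sub>M \<kappa>\<in>\<alpha>. \<sigma>) ?A = (\<Prod>\<kappa>\<in>\<alpha>. emeasure \<sigma> K)"
      using KM by (intro P.emeasure_PiM finite_loop_collection[OF a]) auto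
    also have "\<dots> < \<infinity>" using radon_compact[OF K(1)] by (simp add: power_less_top_ennreal)
    finally show "emeasure (\<Pi>\<^sub>M \<kappa>\<in>\<alpha>. \<sigma>) ?A < \<infinity>" .
    show "AE y in \<Pi>\<^sub>M \<kappa>\<in>\<alpha>. \<sigma>. y \<in> ?A \<longrightarrow> norm ((cmod (on_loops \<alpha> F y))\<^sup>2) \<le> B\<^sup>2"
      using B by (intro AE_I2) (auto simp: on_loops_def intro!: power_mono)
    show "AE y in \<Pi>\<^sub>M \<kappa>\<in>\<alpha>. \<sigma>. y \<notin> ?A \<longrightarrow> (cmod (on_loops \<alpha> F y))\<^sup>2 = 0"
    proof (rule AE_I2, rule impI)
      fix y assume y: "y \<in> space (\<Pi>\<^sub>M \<kappa>\<in>\<alpha>. \<sigma>)" and nA: "y \<notin> ?A"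
      then obtain \<kappa> where k: "\<kappa> \<in> \<alpha>" "y \<kappa> \<notin> K" by (auto simp: space_PiM PiE_iff)
      obtain i where i: "i < n" "(THE \<kappa>'. \<kappa>' \<in> \<alpha> \<and> i \<in> loop_points \<kappa>') = \<kappa>"
        using index_of_loop[OF a k(1)] by blast
      have "on_loops \<alpha> F y = 0"
      proof (rule ccontr)
        assume "on_loops \<alpha> F y \<noteq> 0"
        then have "y (THE \<kappa>'. \<kappa>' \<in> \<alpha> \<and> i \<in> loop_points \<kappa>') \<in> K"
          unfolding on_loops_def using K(2)[THEN spec, THEN mp, THEN spec, THEN mp, OF _ i(1)] by blast
        then show False using i(2) k(2) by simp
      qed
      then show "(cmod (on_loops \<alpha> F y))\<^sup>2 = 0" by simp
    qed
  qed
  then show ?thesis unfolding L2_def using m by blast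
qed

lemma tensor_sum_ext_space:
  assumes F: "tensor_sum n tests F" and sym: "\<And>\<pi> x. \<pi> permutes {..<n} \<Longrightarrow> F (x \<circ> \<pi>) = F x"
  shows "F \<in> ext_space \<A> \<sigma> n"
proof -
  have "(\<lambda>k::nat. ext_inner \<sigma> n (\<lambda>x. F x - F x) (\<lambda>x. F x - F x)) \<longlonglongrightarrow> 0"
    by (simp add: ext_inner_zero)
  then have "\<exists>h. (\<forall>k. h k \<in> sym_tests \<A> n) \<and>
        (\<lambda>k. ext_inner \<sigma> n (\<lambda>x. h k x - F x) (\<lambda>x. h k x - F x)) \<longlonglongrightarrow> 0"
    using tensor_sum_sym_tests[OF F sym] by (intro exI[of _ "\<lambda>_. F"]) blast
  then show ?thesis
    unfolding ext_space_def mem_Collect_eq using tensor_sum_depends[OF F] tensor_sum_L2[OF F] by blast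
qed

context
  fixes \<xi> :: "'a \<Rightarrow> real" and u :: "complex fps"
  assumes xi: "\<xi> \<in> test_functions \<A>" and u0: "fps_nth u 0 = 0"
begin

text \<open>Splitting off the last coordinate gives a sum over the exponent of
  \<open>\<xi> (x n)\<close>. The exponent 0 would produce the constant factor 1, which need not be
  a test function; its coefficient vanishes by \<open>u0\<close>.\<close>

lemma particle_coeff_tensor_sum:
  "tensor_sum n tests (\<lambda>x. fps_nth (A * (\<Prod>i<n. fps_rescale (complex_of_real (\<xi> (x i))) u)) k)"
proof (induction n arbitrary: k)
  case 0
  show ?case using tensor_sum.prod[of 0 tests "\<lambda>_. \<xi>" "fps_nth A k"] by simp
next
  case (Suc n)
  let ?P = "\<lambda>n x. A * (\<Prod>i<n. fps_rescale (complex_of_real (\<xi> (x i))) u)"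
  have eq: "fps_nth (?P (Suc n) x) k = (\<Sum>j\<in>{0..k}. fps_nth (?P n x) j * (fps_nth u (k - j) * complex_of_real (\<xi> (x n)) ^ (k - j)))" for x
    by (simp add: fps_mult_nth flip: mult.assoc)
  have z: "tensor_sum (Suc n) tests (\<lambda>x. 0)" by (rule tensor_sum_zero[of _ _ "\<lambda>_. \<xi>"]) (rule xi)
  show ?case
    unfolding eq
  proof (rule tensor_sum_sum[OF _ z])
    fix j assume "j \<in> {0..k}"
    show "tensor_sum (Suc n) tests (\<lambda>x. fps_nth (?P n x) j * (fps_nth u (k - j) * complex_of_real (\<xi> (x n)) ^ (k - j)))"
    proof (cases "k - j")
      case 0
      then show ?thesis using z u0 by simp
    next
      case (Suc q)
      have "tensor_sum (Suc n) tests (\<lambda>x. fps_nth (?P n x) j * complex_of_real (\<xi> (x n) ^ Suc q))"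
        by (rule tensor_sum_Suc[where g="\<lambda>y. \<xi> y ^ Suc q", OF Suc.IH test_power[OF atlas xi]])
      from tensor_sum_scale[OF this, of "fps_nth u (k - j)"] show ?thesis
        unfolding Suc by (simp add: mult_ac)
    qed
  qed simp
qed

lemma particle_fun_tensor_sum: "tensor_sum n tests (particle_fun L u \<xi> k n)"
  unfolding particle_fun_def by (rule tensor_sum_scale[OF particle_coeff_tensor_sum])

lemma particle_fun_symmetric:
  assumes "\<pi> permutes {..<n}"
  shows "particle_fun L u \<xi> k n (x \<circ> \<pi>) = particle_fun L u \<xi> k n x"
proof -
  have "(\<Prod>i<n. fps_rescale (complex_of_real (\<xi> ((x \<circ> \<pi>) i))) u) = (\<Prod>i<n. fps_rescale (complex_of_real (\<xi> (x i))) u)"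
    using prod.permute[OF assms, of "\<lambda>i. fps_rescale (complex_of_real (\<xi> (x i))) u"] by (simp add: comp_def)
  then show ?thesis by (simp add: particle_fun_def)
qed

lemma particle_fun_finite: "k < n \<Longrightarrow> particle_fun L u \<xi> k n = (\<lambda>x. 0)"
  unfolding particle_fun_def by (rule ext) (simp add: fps_nth_mult_prod_zero[OF u0])

lemma particle_fun_fock_fin: "particle_fun L u \<xi> k \<in> fock_fin \<A>"
proof -
  have "{n. particle_fun L u \<xi> k n \<noteq> (\<lambda>_. 0)} \<subseteq> {..k}"
  proof
    fix n assume "n \<in> {n. particle_fun L u \<xi> k n \<noteq> (\<lambda>_. 0)}"
    then show "n \<in> {..k}" using particle_fun_finite[of k n L] by (cases "k < n") simp_all
  qed
  then have "finite {n. particle_fun L u \<xi> k n \<noteq> (\<lambda>_. 0)}" by (rule finite_subset) simp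
  then show ?thesis unfolding fock_fin_def
    using tensor_sum_sym_tests[OF particle_fun_tensor_sum particle_fun_symmetric] by blast
qed

lemma particle_fun_fock_space: "particle_fun L u \<xi> k \<in> fock_space \<A> \<sigma>"
proof -
  have "summable (\<lambda>n. Re (ext_inner \<sigma> n (particle_fun L u \<xi> k n) (particle_fun L u \<xi> k n)) * fact n)"
    by (rule summable_finite[of "{..k}"]) (auto simp: particle_fun_finite ext_inner_zero not_le)
  then show ?thesis unfolding fock_space_def
    using tensor_sum_ext_space[OF particle_fun_tensor_sum particle_fun_symmetric] by blast
qed

lemma particle_fun_0:
  assumes "fps_nth L 0 = 1"
  shows "particle_fun L u \<xi> 0 = vacuum"
proof (intro ext)
  fix n x
  show "particle_fun L u \<xi> 0 n x = vacuum n x"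
    using particle_fun_finite[of 0 n L] assms by (cases "n = 0") (auto simp: vacuum_def particle_fun_def)
qed

end

end

section \<open>The Riccati equation and the action of the Jacobi operators\<close>

context
  fixes \<A> :: "('a::{t2_space, second_countable_topology}, 'n::finite) chart set" and \<sigma> :: "'a measure"
    and \<xi> :: "'a \<Rightarrow> real" and w :: "complex fps" and l c :: real
  assumes atlas: "oriented_atlas \<A>" and radon: "radon_measure \<sigma>" and xi: "\<xi> \<in> test_functions \<A>"
    and w0: "fps_nth w 0 = complex_of_real c" and riccati: "fps_deriv w = w\<^sup>2 + fps_const (complex_of_real (l - 2 * c)) * w"
    and root: "c\<^sup>2 - l * c + 1 = 0"
begin

text \<open>The series u of the overview, recovered from \<open>w\<close>; in the application
  \<open>w\<close> is the expansion of the integral of s e^(ts) against \<open>nu l\<close>.\<close>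

definition ufps :: "complex fps" where "ufps = w - fps_const (complex_of_real c)"

text \<open>The logarithmic derivative of L, that is, the integral of
  \<open>\<xi>(x) w(t \<xi>(x))\<close> taken coefficient by coefficient. Every coefficient
  integrates a positive power of \<xi>, which is a test function.\<close>

definition dV :: "complex fps" where
  "dV = Abs_fps (\<lambda>j. fps_nth w j * complex_of_real (\<integral>z. \<xi> z ^ Suc j \<partial>\<sigma>))"

lemma ufps_0: "fps_nth ufps 0 = 0"
  by (simp add: ufps_def w0)

text \<open>Substituting \<open>w = ufps + c\<close> shifts the linear coefficient from
  \<open>l - 2 * c\<close> to \<open>l\<close> and leaves the constant term c l - c^2, which is 1 by
  \<open>root\<close>.\<close>

lemma ufps_deriv: "fps_deriv ufps = 1 + fps_const (complex_of_real l) * ufps + ufps\<^sup>2"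
proof -
  have r: "complex_of_real c * complex_of_real l = complex_of_real c * complex_of_real c + 1"
  proof -
    have "c * l = c * c + 1" using root by (simp add: power2_eq_square algebra_simps)
    then have "complex_of_real (c * l) = complex_of_real (c * c + 1)" by (rule arg_cong)
    then show ?thesis by (simp only: of_real_mult of_real_add of_real_1)
  qed
  define C K where "C = fps_const (complex_of_real c)" and "K = fps_const (complex_of_real l)"
  have CK: "C * K = C * C + 1"
    by (rule fps_ext) (simp add: C_def K_def r)
  have cl: "fps_const (complex_of_real (l - 2 * c)) = K - (C + C)"
    by (rule fps_ext) (simp add: C_def K_def)
  have w: "ufps + C = w" by (simp add: ufps_def C_def)
  have alg: "(a + C) * (a + C) + (K - (C + C)) * (a + C) = a * a + K * a + (C * K - C * C)" for a
    by (simp add: algebra_simps)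
  have "fps_deriv ufps = fps_deriv w" by (simp add: ufps_def)
  also have "\<dots> = w * w + (K - (C + C)) * w" unfolding cl[symmetric] riccati power2_eq_square ..
  also have "\<dots> = ufps * ufps + K * ufps + (C * K - C * C)" using alg[of ufps] unfolding w .
  also have "\<dots> = 1 + K * ufps + ufps\<^sup>2" unfolding CK by (simp add: power2_eq_square)
  finally show ?thesis unfolding K_def .
qed

text \<open>The first annihilation operator integrates one factor \<open>ufps\<close>, and the
  scalar term of the operator supplies the constant coefficient \<open>c\<close> by which
  \<open>ufps\<close> differs from \<open>w\<close>. Together they act as multiplication by
  \<open>dV\<close>.\<close>

lemma integral_rescale:
  "(\<integral>z. complex_of_real (\<xi> z) * fps_nth (A * fps_rescale (complex_of_real (\<xi> z)) ufps) k \<partial>\<sigma>) +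
    complex_of_real (c * (\<integral>z. \<xi> z \<partial>\<sigma>)) * fps_nth A k = fps_nth (A * dV) k"
proof -
  have i: "integrable \<sigma> (\<lambda>z. complex_of_real (\<xi> z ^ Suc j))" for j
    using test_integrable[OF atlas radon test_power[OF atlas xi]] by (rule integrable_of_real)
  have "(\<integral>z. complex_of_real (\<xi> z) * fps_nth (A * fps_rescale (complex_of_real (\<xi> z)) ufps) k \<partial>\<sigma>) =
      (\<integral>z. (\<Sum>j=0..k. (fps_nth A j * fps_nth ufps (k - j)) * complex_of_real (\<xi> z ^ Suc (k - j))) \<partial>\<sigma>)"
    by (rule Bochner_Integration.integral_cong[OF refl]) (simp add: fps_mult_nth sum_distrib_left mult_ac)
  also have "\<dots> = (\<Sum>j=0..k. (fps_nth A j * fps_nth ufps (k - j)) * complex_of_real (\<integral>z. \<xi> z ^ Suc (k - j) \<partial>\<sigma>))"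
    using i by (subst Bochner_Integration.integral_sum) (simp_all only: integrable_mult_right Bochner_Integration.integral_mult_right_zero integral_complex_of_real)
  also have "\<dots> = fps_nth (A * dV) k - (\<Sum>j=0..k. fps_nth A j * (fps_nth (fps_const (complex_of_real c)) (k - j) * complex_of_real (\<integral>z. \<xi> z ^ Suc (k - j) \<partial>\<sigma>)))"
    by (simp add: fps_mult_nth dV_def ufps_def sum_subtractf algebra_simps)
  also have "(\<Sum>j=0..k. fps_nth A j * (fps_nth (fps_const (complex_of_real c)) (k - j) * complex_of_real (\<integral>z. \<xi> z ^ Suc (k - j) \<partial>\<sigma>))) =
      (\<Sum>j\<in>{k}. fps_nth A j * (complex_of_real c * complex_of_real (\<integral>z. \<xi> z \<partial>\<sigma>)))"
    by (rule sum.mono_neutral_cong_right) auto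
  finally show ?thesis by (simp add: mult_ac)
qed

text \<open>Each operator alters the factor of one particle: creation adds a particle with \<xi> in
  place of \<open>U\<close>, the neutral operator multiplies a factor by \<xi>, and the second
  annihilation merges two factors into a square. The combinatorial factors of the operators and of
  symmetrization are absorbed by the division by the factorial of the particle number.\<close>

lemma jacobi_particle_fun:
  assumes L: "fps_deriv L = L * dV" and c: "c_coeff l = c"
  shows "jacobi_op \<sigma> l \<xi> (particle_fun L ufps \<xi> k) = particle_fun L ufps \<xi> (Suc k)"
proof (intro ext)
  fix n and x :: "nat \<Rightarrow> 'a"
  define U where "U z = fps_rescale (complex_of_real (\<xi> z)) ufps" for z
  define P where "P = (\<Prod>i<n. U (x i))"
  have pf: "particle_fun L ufps \<xi> k m y = fact k / fact m * fps_nth (L * (\<Prod>i<m. U (y i))) k" for m y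
    by (simp add: particle_fun_def U_def)
  have cre: "(case n of 0 \<Rightarrow> 0 | Suc m \<Rightarrow> creation \<xi> m (particle_fun L ufps \<xi> k m) x) = fact k / fact n *
      fps_nth (\<Sum>i<n. L * (fps_const (\<xi> (x i)) * 1 * (\<Prod>j\<in>{..<n} - {i}. U (x j)))) k"
  proof (cases n)
    case (Suc m)
    define T where "T g = fact k / fact m * fps_nth (L * g) k" for g
    have "creation \<xi> m (particle_fun L ufps \<xi> k m) x =
        symmetrize (Suc m) (\<lambda>x. T (fps_const (complex_of_real (\<xi> (x 0))) * (\<Prod>i\<in>{1..<Suc m}. U (x i)))) x"
    proof -
      have "complex_of_real (\<xi> (y 0)) * particle_fun L ufps \<xi> k m (\<lambda>i. y (Suc i)) =
          T (fps_const (complex_of_real (\<xi> (y 0))) * (\<Prod>i\<in>{1..<Suc m}. U (y i)))" for y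
      proof -
        have "(\<Prod>i\<in>{1..<Suc m}. U (y i)) = (\<Prod>i<m. U (y (Suc i)))"
          using prod.shift_bounds_Suc_ivl[of "\<lambda>i. U (y i)" 0 m] by (simp add: lessThan_atLeast0)
        then show ?thesis by (simp add: pf T_def mult.left_commute[of L])
      qed
      then show ?thesis unfolding creation_def by simp
    qed
    also have "\<dots> = (\<Sum>i<Suc m. T (fps_const (complex_of_real (\<xi> (x i))) * (\<Prod>j\<in>{..<Suc m} - {i}. U (x j)))) / of_nat (Suc m)"
      by (rule symmetrize_product) simp
    finally show ?thesis unfolding Suc T_def by (simp add: fps_sum_nth sum_distrib_left sum_divide_distrib field_simps del: sum.lessThan_Suc)
  qed simp
  have sym: "of_nat n * symmetrize n (\<lambda>x. T (B (x 0) * (\<Prod>i\<in>{1..<n}. U (x i)))) x = (\<Sum>i<n. T (B (x i) * (\<Prod>j\<in>{..<n} - {i}. U (x j))))"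
    if "n > 0" for T B
    unfolding symmetrize_product[OF that] using that by simp
  have first: "(\<Prod>i<n. U (y i)) = U (y 0) * (\<Prod>i\<in>{1..<n}. U (y i))" if "n > 0" for y
  proof -
    have "{..<n} = insert 0 {1..<n}" using that by auto
    then show ?thesis by simp
  qed
  have neu: "neutral \<xi> n (particle_fun L ufps \<xi> k n) x = fact k / fact n *
      fps_nth (\<Sum>i<n. L * (fps_const (\<xi> (x i)) * U (x i) * (\<Prod>j\<in>{..<n} - {i}. U (x j)))) k"
  proof (cases "n = 0")
    case False
    define T where "T g = fact k / fact n * fps_nth (L * g) k" for g
    have "(\<lambda>y. complex_of_real (\<xi> (y 0)) * particle_fun L ufps \<xi> k n y) =
        (\<lambda>y. T (fps_const (complex_of_real (\<xi> (y 0))) * U (y 0) * (\<Prod>i\<in>{1..<n}. U (y i))))"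
      using first False by (auto simp: pf T_def mult.assoc mult.left_commute[of L])
    then have "neutral \<xi> n (particle_fun L ufps \<xi> k n) x = (\<Sum>i<n. T (fps_const (complex_of_real (\<xi> (x i))) * U (x i) * (\<Prod>j\<in>{..<n} - {i}. U (x j))))"
      unfolding neutral_def using sym[of T "\<lambda>a. fps_const (complex_of_real (\<xi> a)) * U a"] False by simp
    then show ?thesis by (simp add: T_def fps_sum_nth sum_distrib_left mult.assoc)
  qed (simp add: neutral_def)
  have ann2: "annihilation2 \<xi> (Suc n) (particle_fun L ufps \<xi> k (Suc n)) x = fact k / fact n *
      fps_nth (\<Sum>i<n. L * (fps_const (\<xi> (x i)) * (U (x i))\<^sup>2 * (\<Prod>j\<in>{..<n} - {i}. U (x j)))) k"
  proof (cases "n = 0")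
    case False
    define T where "T g = fact k / fact (Suc n) * fps_nth (L * g) k" for g
    have "complex_of_real (\<xi> (y 0)) * particle_fun L ufps \<xi> k (Suc n) (case_nat (y 0) y) =
        T (fps_const (complex_of_real (\<xi> (y 0))) * (U (y 0))\<^sup>2 * (\<Prod>i\<in>{1..<n}. U (y i)))" for y
    proof -
      have "(\<Prod>i<Suc n. U (case_nat (y 0) y i)) = U (y 0) * (\<Prod>i<n. U (y i))"
        by (subst prod.lessThan_Suc_shift) simp
      also have "\<dots> = (U (y 0))\<^sup>2 * (\<Prod>i\<in>{1..<n}. U (y i))"
        using first[of y] False by (simp add: power2_eq_square mult.assoc)
      finally show ?thesis by (simp add: pf T_def mult.assoc mult.left_commute[of L])
    qed
    then have "annihilation2 \<xi> (Suc n) (particle_fun L ufps \<xi> k (Suc n)) x =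
        of_nat (Suc n * n) * symmetrize n (\<lambda>y. T (fps_const (complex_of_real (\<xi> (y 0))) * (U (y 0))\<^sup>2 * (\<Prod>i\<in>{1..<n}. U (y i)))) x"
      unfolding annihilation2_def by simp
    also have "\<dots> = of_nat (Suc n) * (of_nat n * symmetrize n (\<lambda>y. T (fps_const (complex_of_real (\<xi> (y 0))) * (U (y 0))\<^sup>2 * (\<Prod>i\<in>{1..<n}. U (y i)))) x)"
      by (simp only: of_nat_mult mult.assoc)
    also have "\<dots> = of_nat (Suc n) * (\<Sum>i<n. T (fps_const (complex_of_real (\<xi> (x i))) * (U (x i))\<^sup>2 * (\<Prod>j\<in>{..<n} - {i}. U (x j))))"
      using sym[of T "\<lambda>a. fps_const (complex_of_real (\<xi> a)) * (U a)\<^sup>2"] False by simp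
    also have "\<dots> = (\<Sum>i<n. fact k / fact n * fps_nth (L * (fps_const (\<xi> (x i)) * (U (x i))\<^sup>2 * (\<Prod>j\<in>{..<n} - {i}. U (x j)))) k)"
    proof -
      have "of_nat (Suc n) * T g = fact k / fact n * fps_nth (L * g) k" for g
        by (simp add: T_def del: of_nat_Suc)
      then show ?thesis by (simp only: sum_distrib_left)
    qed
    finally show ?thesis by (simp only: fps_sum_nth sum_distrib_left)
  qed (simp add: annihilation2_def)
  have ann1: "annihilation1 \<sigma> \<xi> (Suc n) (particle_fun L ufps \<xi> k (Suc n)) x =
      fact k / fact n * (\<integral>z. complex_of_real (\<xi> z) * fps_nth (L * P * U z) k \<partial>\<sigma>)"
  proof -
    have "complex_of_real (\<xi> z) * particle_fun L ufps \<xi> k (Suc n) (case_nat z x) =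
        fact k / fact (Suc n) * (complex_of_real (\<xi> z) * fps_nth (L * P * U z) k)" for z
    proof -
      have "(\<Prod>i<Suc n. U (case_nat z x i)) = U z * P"
        unfolding P_def by (subst prod.lessThan_Suc_shift) simp
      then have "L * (\<Prod>i<Suc n. U (case_nat z x i)) = L * P * U z" by (simp only: mult_ac)
      then show ?thesis by (simp only: pf mult.left_commute)
    qed
    then have "annihilation1 \<sigma> \<xi> (Suc n) (particle_fun L ufps \<xi> k (Suc n)) x =
        of_nat (Suc n) * (fact k / fact (Suc n)) * (\<integral>z. complex_of_real (\<xi> z) * fps_nth (L * P * U z) k \<partial>\<sigma>)"
      unfolding annihilation1_def by (simp only: Bochner_Integration.integral_mult_right_zero mult.assoc)
    moreover have "of_nat (Suc n) * (fact k / fact (Suc n)) = (fact k / fact n :: complex)"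
      by (simp del: of_nat_Suc)
    ultimately show ?thesis by (simp only:)
  qed
  have "jacobi_op \<sigma> l \<xi> (particle_fun L ufps \<xi> k) n x = fact k / fact n *
     (((\<integral>z. complex_of_real (\<xi> z) * fps_nth (L * P * U z) k \<partial>\<sigma>) + complex_of_real (c * (\<integral>z. \<xi> z \<partial>\<sigma>)) * fps_nth (L * P) k) +
      fps_nth (\<Sum>i<n. L * (fps_const (\<xi> (x i)) * 1 * (\<Prod>j\<in>{..<n} - {i}. U (x j)))) k +
      complex_of_real l * fps_nth (\<Sum>i<n. L * (fps_const (\<xi> (x i)) * U (x i) * (\<Prod>j\<in>{..<n} - {i}. U (x j)))) k +
      fps_nth (\<Sum>i<n. L * (fps_const (\<xi> (x i)) * (U (x i))\<^sup>2 * (\<Prod>j\<in>{..<n} - {i}. U (x j)))) k)"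
    unfolding jacobi_op_def cre neu ann1 ann2 c pf P_def by (simp only: distrib_left mult.left_commute ac_simps)
  also have "(\<integral>z. complex_of_real (\<xi> z) * fps_nth (L * P * U z) k \<partial>\<sigma>) + complex_of_real (c * (\<integral>z. \<xi> z \<partial>\<sigma>)) * fps_nth (L * P) k
      = fps_nth (L * dV * (\<Prod>i<n. U (x i))) k"
    using integral_rescale[of "L * P" k] by (simp only: U_def P_def mult.assoc mult.commute[of dV])
  also have "fact k / fact n * (fps_nth (L * dV * (\<Prod>i<n. U (x i))) k +
      fps_nth (\<Sum>i<n. L * (fps_const (\<xi> (x i)) * 1 * (\<Prod>j\<in>{..<n} - {i}. U (x j)))) k +
      complex_of_real l * fps_nth (\<Sum>i<n. L * (fps_const (\<xi> (x i)) * U (x i) * (\<Prod>j\<in>{..<n} - {i}. U (x j)))) k +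
      fps_nth (\<Sum>i<n. L * (fps_const (\<xi> (x i)) * (U (x i))\<^sup>2 * (\<Prod>j\<in>{..<n} - {i}. U (x j)))) k) =
      particle_fun L ufps \<xi> (Suc k) n x"
    unfolding U_def by (rule particle_fun_Suc[OF L ufps_deriv, symmetric])
  finally show "jacobi_op \<sigma> l \<xi> (particle_fun L ufps \<xi> k) n x = particle_fun L ufps \<xi> (Suc k) n x" .
qed

text \<open>Consecutive power vectors form a pair in the graph, as constant approximating sequences
  show; hence \<open>I\<close> maps the \<open>k\<close>-th vector to the monomial of degree
  \<open>k\<close>. Its square integrability gives the even moments and thereby all of them, and the
  inner product with the vacuum evaluates them.\<close>

lemma spectral_moments:
  assumes sp: "spectral_pair \<A> \<sigma> l \<mu> I" and L: "fps_deriv L = L * dV" "fps_nth L 0 = 1" and c: "c_coeff l = c"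
  shows "(\<lambda>\<omega>. \<omega> \<xi>) \<in> borel_measurable \<mu>" "integrable \<mu> (\<lambda>\<omega>. \<omega> \<xi> ^ k)"
    "complex_of_real (\<integral>\<omega>. \<omega> \<xi> ^ k \<partial>\<mu>) = fact k * fps_nth L k"
proof -
  let ?f = "particle_fun L ufps \<xi>"
  note sp' = sp[unfolded spectral_pair_def]
  have prob: "prob_space \<mu>" using sp' by blast
  interpret prob_space \<mu> by (rule prob)
  have sets: "sets \<mu> = sets (cylinder_algebra \<A>)" using sp' by blast
  have un: "fock_unitary \<A> \<sigma> \<mu> I" using sp' by blast
  have vac: "AE \<omega> in \<mu>. I vacuum \<omega> = 1" using sp' by blast
  have graph: "(f, g) \<in> jacobi_closure \<A> \<sigma> l \<xi> \<longleftrightarrow> (AE \<omega> in \<mu>. I g \<omega> = complex_of_real (\<omega> \<xi>) * I f \<omega>)"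
    if "f \<in> fock_space \<A> \<sigma>" "g \<in> fock_space \<A> \<sigma>" for f g
    using sp' xi that by blast
  show m[measurable]: "(\<lambda>\<omega>. \<omega> \<xi>) \<in> borel_measurable \<mu>"
  proof (subst measurable_cong_sets[OF sets refl], rule borel_measurableI)
    fix S :: "real set" assume "open S"
    then have "{\<omega> \<in> dual_space \<A>. \<omega> \<xi> \<in> S} \<in> sets (cylinder_algebra \<A>)"
      unfolding cylinder_algebra_def using xi
      by (subst sets_measure_of) (auto intro!: sigma_sets.Basic exI[of _ \<xi>] exI[of _ S] \<open>open S\<close>)
    moreover have "(\<lambda>\<omega>. \<omega> \<xi>) -` S \<inter> space (cylinder_algebra \<A>) = {\<omega> \<in> dual_space \<A>. \<omega> \<xi> \<in> S}"
      unfolding cylinder_algebra_def by (subst space_measure_of) auto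
    ultimately show "(\<lambda>\<omega>. \<omega> \<xi>) -` S \<inter> space (cylinder_algebra \<A>) \<in> sets (cylinder_algebra \<A>)" by simp
  qed
  have fs: "?f k \<in> fock_space \<A> \<sigma>" for k
    by (rule particle_fun_fock_space[OF atlas radon xi ufps_0])
  have f0: "?f 0 = vacuum" by (rule particle_fun_0[OF atlas radon xi ufps_0 L(2)])
  have AEk: "AE \<omega> in \<mu>. I (?f k) \<omega> = complex_of_real (\<omega> \<xi> ^ k)" for k
  proof (induction k)
    case 0
    then show ?case using vac by (simp add: f0)
  next
    case (Suc k)
    have "(?f k, ?f (Suc k)) \<in> jacobi_closure \<A> \<sigma> l \<xi>"
    proof -
      have "(\<forall>j::nat. ?f k \<in> fock_fin \<A>) \<and> (\<lambda>j. fock_dist \<sigma> (?f k) (?f k)) \<longlonglongrightarrow> 0 \<and>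
          (\<lambda>j. fock_dist \<sigma> (jacobi_op \<sigma> l \<xi> (?f k)) (?f (Suc k))) \<longlonglongrightarrow> 0"
        unfolding jacobi_particle_fun[OF L(1) c] fock_dist_self
        using particle_fun_fock_fin[OF atlas radon xi ufps_0] by simp
      then show ?thesis unfolding jacobi_closure_def using fs
        by (intro CollectI case_prodI conjI exI[of _ "\<lambda>_. ?f k"]) simp_all
    qed
    then have "AE \<omega> in \<mu>. I (?f (Suc k)) \<omega> = complex_of_real (\<omega> \<xi>) * I (?f k) \<omega>"
      using graph[OF fs fs] by blast
    then show ?case using Suc by eventually_elim simp
  qed
  have even_int: "integrable \<mu> (\<lambda>\<omega>. \<omega> \<xi> ^ (2 * k))" for k
  proof -
    have "I (?f k) \<in> L2 \<mu>" using un fs unfolding fock_unitary_def by blast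
    then have "integrable \<mu> (\<lambda>\<omega>. (cmod (I (?f k) \<omega>))\<^sup>2)" unfolding L2_def by blast
    moreover have "(\<lambda>\<omega>. \<omega> \<xi> ^ (2 * k)) \<in> borel_measurable \<mu>" by measurable
    moreover have "AE \<omega> in \<mu>. (cmod (I (?f k) \<omega>))\<^sup>2 = \<omega> \<xi> ^ (2 * k)"
      using AEk[of k] by eventually_elim (simp add: norm_power power_mult[symmetric] mult.commute[of k] power_even_abs)
    ultimately show ?thesis by (rule integrable_cong_AE_imp)
  qed
  show "integrable \<mu> (\<lambda>\<omega>. \<omega> \<xi> ^ k)" for k
  proof (rule Bochner_Integration.integrable_bound[where f="\<lambda>\<omega>. 1 + \<omega> \<xi> ^ (2 * k)"])
    show "integrable \<mu> (\<lambda>\<omega>. 1 + \<omega> \<xi> ^ (2 * k))" using even_int by simp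
    show "AE \<omega> in \<mu>. norm (\<omega> \<xi> ^ k) \<le> norm (1 + \<omega> \<xi> ^ (2 * k))"
    proof (rule AE_I2)
      fix \<omega> :: "('a \<Rightarrow> real) \<Rightarrow> real"
      have "0 \<le> (\<bar>\<omega> \<xi> ^ k\<bar> - 1 / 2)\<^sup>2" by simp
      then have "\<bar>\<omega> \<xi> ^ k\<bar> \<le> 1 + (\<omega> \<xi> ^ k)\<^sup>2" by (simp add: power2_eq_square algebra_simps)
      also have "(\<omega> \<xi> ^ k)\<^sup>2 = \<omega> \<xi> ^ (2 * k)" by (simp add: power_mult[symmetric] mult.commute)
      finally show "norm (\<omega> \<xi> ^ k) \<le> norm (1 + \<omega> \<xi> ^ (2 * k))" by simp
    qed
  qed simp
  have "(\<integral>\<omega>. cnj (I vacuum \<omega>) * I (?f k) \<omega> \<partial>\<mu>) = fock_inner \<sigma> vacuum (?f k)"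
    using un fs[of k] fs[of 0] unfolding fock_unitary_def f0 by blast
  moreover have "(\<integral>\<omega>. cnj (I vacuum \<omega>) * I (?f k) \<omega> \<partial>\<mu>) = (\<integral>\<omega>. complex_of_real (\<omega> \<xi> ^ k) \<partial>\<mu>)"
  proof (rule integral_cong_AE)
    have "I vacuum \<in> L2 \<mu>" "I (?f k) \<in> L2 \<mu>" using un fs[of 0] fs[of k] unfolding fock_unitary_def f0 by blast+
    then have [measurable]: "I vacuum \<in> borel_measurable \<mu>" "I (?f k) \<in> borel_measurable \<mu>" by (auto simp: L2_def)
    have [measurable]: "(\<lambda>\<omega>. cnj (I vacuum \<omega>)) \<in> borel_measurable \<mu>"
      by (rule borel_measurable_continuous_on[where f=cnj]) (auto intro: continuous_intros)
    show "(\<lambda>\<omega>. cnj (I vacuum \<omega>) * I (?f k) \<omega>) \<in> borel_measurable \<mu>" by measurable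
    show "AE \<omega> in \<mu>. cnj (I vacuum \<omega>) * I (?f k) \<omega> = complex_of_real (\<omega> \<xi> ^ k)"
      using vac AEk[of k] by eventually_elim simp
  qed measurable
  moreover have "fock_inner \<sigma> vacuum (?f k) = ?f k 0 (\<lambda>_. undefined)"
    by (rule fock_inner_vacuum) (rule tensor_sum_depends[OF particle_fun_tensor_sum[OF atlas radon xi ufps_0]])
  moreover have "?f k 0 (\<lambda>_. undefined) = fact k * fps_nth L k" by (simp add: particle_fun_def)
  ultimately show "complex_of_real (\<integral>\<omega>. \<omega> \<xi> ^ k \<partial>\<mu>) = fact k * fps_nth L k" by (simp only: integral_complex_of_real)
qed

end

section \<open>The measures \<open>nu l\<close>\<close>

text \<open>All of this rests on (l + D) (l - D) = 4 with D = sqrt (l^2 - 4): c is the smaller root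
  of c^2 - l c + 1 = 0, and p = c^2. The last identity says that D p / (1 - p), the first moment of
  \<open>nu l\<close>, equals c.\<close>

lemma p_coeff_bounds:
  assumes "l > 2"
  shows "0 < p_coeff l" "p_coeff l < 1" "sqrt (l\<^sup>2 - 4) > 0"
    "c_coeff l = (l - sqrt (l\<^sup>2 - 4)) / 2"
    "p_coeff l * sqrt (l\<^sup>2 - 4) = c_coeff l * (1 - p_coeff l)"
proof -
  define D where "D = sqrt (l\<^sup>2 - 4)"
  have l4: "l\<^sup>2 > 4" using assms power_strict_mono[of 2 l 2] by simp
  have D: "D > 0" "D\<^sup>2 = l\<^sup>2 - 4" unfolding D_def using l4 by simp_all
  have "D\<^sup>2 < l\<^sup>2" unfolding D(2) by simp
  then have Dl: "D < l" by (rule power2_less_imp_less) (use assms in linarith)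
  have pD: "p_coeff l = (l - D) / (l + D)" by (simp add: p_coeff_def D_def)
  have cD: "c_coeff l = 2 / (l + D)" using assms by (simp add: c_coeff_def D_def)
  have lD: "l + D > 0" "l - D > 0" using D Dl assms by auto
  show "0 < p_coeff l" unfolding pD using lD by (intro divide_pos_pos)
  show "p_coeff l < 1" unfolding pD using lD D(1) by (subst divide_less_eq_1_pos) simp_all
  show "sqrt (l\<^sup>2 - 4) > 0" using D(1) unfolding D_def .
  have "(l + D) * (l - D) = 4" using D(2) by (simp add: algebra_simps power2_eq_square)
  then have c: "c_coeff l = (l - D) / 2"
    unfolding cD using lD by (subst frac_eq_eq) (auto simp: mult.commute)
  then show "c_coeff l = (l - sqrt (l\<^sup>2 - 4)) / 2" by (simp add: D_def)
  have "1 - p_coeff l = 2 * D / (l + D)" unfolding pD using lD by (simp add: diff_divide_eq_iff)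
  then show "p_coeff l * sqrt (l\<^sup>2 - 4) = c_coeff l * (1 - p_coeff l)"
    unfolding c by (simp add: pD flip: D_def)
qed

lemma c_coeff_root:
  assumes "l \<ge> 2"
  shows "(c_coeff l)\<^sup>2 - l * c_coeff l + 1 = 0"
proof (cases "l = 2")
  case True
  then show ?thesis by (simp add: c_coeff_def)
next
  case False
  then have l: "l > 2" using assms by simp
  define D where "D = sqrt (l\<^sup>2 - 4)"
  have "l\<^sup>2 - 4 \<ge> 0" using assms power_mono[of 2 l 2] by simp
  then have D: "D\<^sup>2 = l\<^sup>2 - 4" by (simp add: D_def)
  have "((l - D) / 2)\<^sup>2 - l * ((l - D) / 2) + 1 = (D\<^sup>2 - l\<^sup>2) / 4 + 1"
    by (simp add: power2_eq_square field_simps)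
  then show ?thesis unfolding p_coeff_bounds(4)[OF l] D_def[symmetric] using D by simp
qed

lemma sets_nu: "sets (nu l) = sets borel_pos"
  by (simp add: nu_def dirac_series_def sets_restrict_space)

lemma space_nu: "space (nu l) = {0<..}"
  using sets_eq_imp_space_eq[OF sets_nu] by (simp add: space_restrict_space)

lemma measurable_nu:
  assumes "f \<in> borel_measurable borel"
  shows "f \<in> borel_measurable (nu l)"
  unfolding measurable_cong_sets[OF sets_nu refl] by (rule measurable_restrict_space1[OF assms])

lemma nn_integral_nu_2:
  assumes [measurable]: "f \<in> borel_measurable borel"
  shows "(\<integral>\<^sup>+s. f s \<partial>nu 2) = (\<integral>\<^sup>+s. ennreal (exp (- s) / s) * f s * indicator {0<..} s \<partial>lborel)"
proof -
  have m: "(\<lambda>s. ennreal (exp (- s) / s)) \<in> borel_measurable (restrict_space lborel {0<..})"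
    "f \<in> borel_measurable (restrict_space lborel {0<..})"
    by (rule measurable_restrict_space1, simp)+
  have "(\<integral>\<^sup>+s. f s \<partial>nu 2) = (\<integral>\<^sup>+s. ennreal (exp (- s) / s) * f s \<partial>restrict_space lborel {0<..})"
    unfolding nu_def by (subst if_P[OF refl]) (rule nn_integral_density[OF m])
  also have "\<dots> = (\<integral>\<^sup>+s. ennreal (exp (- s) / s) * f s * indicator {0<..} s \<partial>lborel)"
    by (rule nn_integral_restrict_space) simp
  finally show ?thesis .
qed

lemma nn_integral_nu_gt2:
  assumes l: "l > 2" and [measurable]: "f \<in> borel_measurable borel"
  shows "(\<integral>\<^sup>+s. f s \<partial>nu l) = (\<Sum>k. ennreal (p_coeff l ^ Suc k / real (Suc k)) * f (sqrt (l\<^sup>2 - 4) * real (Suc k)))"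
proof -
  let ?D = "density (count_space UNIV) (\<lambda>k. ennreal (p_coeff l ^ Suc k / real (Suc k)))"
  have m: "(\<lambda>k. sqrt (l\<^sup>2 - 4) * real (Suc k)) \<in> measurable ?D borel_pos"
    using p_coeff_bounds(3)[OF l] by (simp add: measurable_def space_restrict_space)
  have f: "f \<in> borel_measurable borel_pos" by (rule measurable_restrict_space1) measurable
  have "(\<integral>\<^sup>+s. f s \<partial>nu l) = (\<integral>\<^sup>+k. f (sqrt (l\<^sup>2 - 4) * real (Suc k)) \<partial>?D)"
    using l unfolding nu_def dirac_series_def by (subst if_not_P) (simp, rule nn_integral_distr[OF m], simp add: f)
  also have "\<dots> = (\<integral>\<^sup>+k. ennreal (p_coeff l ^ Suc k / real (Suc k)) * f (sqrt (l\<^sup>2 - 4) * real (Suc k)) \<partial>count_space UNIV)"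
    by (rule nn_integral_density) simp_all
  finally show ?thesis by (simp only: nn_integral_count_space_nat)
qed

declare measurable_nu [measurable]

lemma nu_2_moment: "(\<integral>s. s ^ Suc j \<partial>nu 2) = fact j"
proof -
  have "(\<integral>\<^sup>+s. ennreal (s ^ Suc j) \<partial>nu 2) = (\<integral>\<^sup>+s. ennreal (s ^ j * exp (- s)) * indicator {0..} s \<partial>lborel)"
  proof (subst nn_integral_nu_2, simp, rule nn_integral_cong_AE)
    have "AE s in lborel. s \<noteq> (0::real)" by (rule AE_lborel_singleton)
    then show "AE s in lborel. ennreal (exp (- s) / s) * ennreal (s ^ Suc j) * indicator {0<..} s =
        ennreal (s ^ j * exp (- s)) * indicator {0..} s"
      by eventually_elim (auto simp: indicator_def field_simps simp flip: ennreal_mult)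
  qed
  also have "\<dots> = ennreal (fact j)" using nn_intergal_power_times_exp_Ici[of j] by (simp add: mult_ac)
  finally have "(\<integral>\<^sup>+s. ennreal (s ^ Suc j) \<partial>nu 2) = ennreal (fact j)" .
  moreover have "AE s in nu 2. 0 \<le> s ^ Suc j" by (rule AE_I2) (auto simp: space_nu)
  ultimately show ?thesis by (subst integral_eq_nn_integral) auto
qed

text \<open>Against the decay e^(-s) of the density, any exponential rate below 1 is admissible; 1/2
  is one choice.\<close>

lemma nu_2_exp_moment: "(\<integral>\<^sup>+s. ennreal (s * exp (1 / 2 * s)) \<partial>nu 2) < \<infinity>"
proof -
  have "(\<integral>\<^sup>+s. ennreal (s * exp (1 / 2 * s)) \<partial>nu 2) \<le> (\<integral>\<^sup>+s. ennreal (exp (- (1 / 2 * s))) * indicator {0..} s \<partial>lborel)"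
  proof (subst nn_integral_nu_2, simp, rule nn_integral_mono)
    fix s :: real
    have "exp (- s) / s * (s * exp (s / 2)) = exp (- (s / 2))" if "s > 0"
      using that by (simp flip: exp_add)
    then show "ennreal (exp (- s) / s) * ennreal (s * exp (1 / 2 * s)) * indicator {0<..} s \<le>
        ennreal (exp (- (1 / 2 * s))) * indicator {0..} s"
      by (auto simp: indicator_def simp flip: ennreal_mult)
  qed
  also have "\<dots> = ennreal (0 - (- 2 * exp (- (1 / 2 * 0))))"
  proof (rule nn_integral_FTC_atLeast)
    show "((\<lambda>s::real. - 2 * exp (- (1 / 2 * s))) \<longlongrightarrow> 0) at_top" by real_asymp
  qed (auto intro!: derivative_eq_intros)
  finally show ?thesis by (rule order.strict_trans1) simp
qed

text \<open>The mass accumulates at 0: on [1 / (n + 1), 1] the density is at least e^(-1) / s, whose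
  integral is e^(-1) ln (n + 1).\<close>

lemma nu_2_infinite: "emeasure (nu 2) (space (nu 2)) = \<infinity>"
proof (rule ccontr)
  assume fin: "emeasure (nu 2) (space (nu 2)) \<noteq> \<infinity>"
  have "ennreal (exp (- 1) * ln (real (Suc n))) \<le> emeasure (nu 2) (space (nu 2))" for n
  proof -
    have "ennreal (exp (- 1) * ln (real (Suc n))) = ennreal (exp (- 1) * ln 1 - exp (- 1) * ln (1 / real (Suc n)))"
      by (simp add: ln_div)
    also have "\<dots> = (\<integral>\<^sup>+s. ennreal (exp (- 1) / s) * indicator {1 / real (Suc n)..1} s \<partial>lborel)"
    proof (rule nn_integral_FTC_Icc[symmetric, where F="\<lambda>s. exp (- 1) * ln s"])
      fix s :: real assume "s \<in> {1 / real (Suc n)..1}"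
      then have s: "1 / real (Suc n) \<le> s" by simp
      have "s > 0" by (intro less_le_trans[of 0 "1 / real (Suc n)" s]) (use s in simp_all)
      then show "((\<lambda>s. exp (- 1) * ln s) has_real_derivative exp (- 1) / s) (at s)" "0 \<le> exp (- 1) / s"
        by (auto intro!: derivative_eq_intros)
    qed (auto simp: field_simps)
    also have "\<dots> \<le> (\<integral>\<^sup>+s. ennreal (exp (- s) / s) * 1 * indicator {0<..} s \<partial>lborel)"
    proof (rule nn_integral_mono)
      fix s :: real
      have "s > 0" "exp (- 1) / s \<le> exp (- s) / s" if "1 / real (Suc n) \<le> s" "s \<le> 1"
      proof -
        show "s > 0" using that by (intro less_le_trans[of 0 "1 / real (Suc n)" s]) simp_all
        then show "exp (- 1) / s \<le> exp (- s) / s" using that by (intro divide_right_mono) auto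
      qed
      then show "ennreal (exp (- 1) / s) * indicator {1 / real (Suc n)..1} s \<le> ennreal (exp (- s) / s) * 1 * indicator {0<..} s"
        by (auto simp: indicator_def intro!: ennreal_leI)
    qed
    also have "\<dots> = (\<integral>\<^sup>+s. 1 \<partial>nu 2)" by (rule nn_integral_nu_2[symmetric]) simp
    finally show ?thesis by simp
  qed
  moreover obtain r where r: "r \<ge> 0" "emeasure (nu 2) (space (nu 2)) = ennreal r" using fin by (cases "emeasure (nu 2) (space (nu 2))") auto
  ultimately have "exp (- 1) * ln (real (Suc n)) \<le> r" for n by (metis ennreal_le_iff)
  moreover have "eventually (\<lambda>n. exp (- 1) * ln (real (Suc n)) > r) at_top" by real_asymp
  ultimately show False by (meson eventually_at_top_linorder le_refl linorder_not_le)
qed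

lemma nu_nonzero:
  assumes "l \<ge> 2"
  shows "emeasure (nu l) (space (nu l)) \<noteq> 0"
proof (cases "l = 2")
  case True
  then show ?thesis using nu_2_infinite by simp
next
  case False
  then have l: "l > 2" using assms by simp
  have "emeasure (nu l) (space (nu l)) = (\<integral>\<^sup>+s. 1 \<partial>nu l)" by simp
  also have "\<dots> = (\<Sum>k. ennreal (p_coeff l ^ Suc k / real (Suc k)))" using nn_integral_nu_gt2[OF l, of "\<lambda>_. 1"] by simp
  also have "\<dots> \<noteq> 0" using p_coeff_bounds(1)[OF l]
    by (auto simp: suminf_eq_zero_iff intro!: exI[of _ 0])
  finally show ?thesis .
qed

lemma nu_gt2_exp_moment:
  assumes l: "l > 2"
  obtains d where "d > 0" "(\<integral>\<^sup>+s. ennreal (s * exp (d * s)) \<partial>nu l) < \<infinity>"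
proof -
  let ?p = "p_coeff l" and ?D = "sqrt (l\<^sup>2 - 4)"
  note p = p_coeff_bounds[OF l]
  \<comment> \<open>Chosen so that p e^(dD) is the square root of p, hence less than 1; a convergent
    geometric series remains.\<close>
  define d where "d = - ln ?p / (2 * ?D)"
  have d: "d > 0" using p by (simp add: d_def field_simps)
  define q where "q = ?p * exp (d * ?D)"
  have "d * ?D = - ln ?p / 2" using p by (simp add: d_def)
  then have "q = exp (ln ?p) * exp (- ln ?p / 2)" using p by (simp add: q_def)
  also have "\<dots> = exp (ln ?p / 2)" by (simp flip: exp_add)
  finally have q: "0 \<le> q" "q < 1" using p by auto
  have "(\<integral>\<^sup>+s. ennreal (s * exp (d * s)) \<partial>nu l) = (\<Sum>k. ennreal (?D * q ^ Suc k))"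
  proof -
    have "ennreal (?p ^ Suc k / real (Suc k)) * ennreal (?D * real (Suc k) * exp (d * (?D * real (Suc k)))) = ennreal (?D * q ^ Suc k)" for k
    proof -
      have "d * (?D * real (Suc k)) = real (Suc k) * (d * ?D)" by (simp only: mult_ac)
      then have "exp (d * (?D * real (Suc k))) = exp (d * ?D) ^ Suc k" by (simp only: exp_of_nat_mult)
      then show ?thesis using p
        by (subst ennreal_mult[symmetric]) (auto simp: q_def power_mult_distrib simp del: power_Suc of_nat_Suc)
    qed
    then show ?thesis by (subst nn_integral_nu_gt2[OF l]) (auto simp del: power_Suc of_nat_Suc)
  qed
  also have "\<dots> = ennreal (\<Sum>k. ?D * q ^ Suc k)"
    using q p by (intro suminf_ennreal2 summable_mult) (auto intro!: summable_mult summable_geometric)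
  finally show ?thesis using d that[of d] by simp
qed

text \<open>One factor \<open>real (Suc k)\<close> of the jump cancels the denominator of its
  weight. This makes the generating series of the moments geometric in p e^(Dt).\<close>

lemma nu_gt2_moment:
  assumes l: "l > 2"
  shows "(\<lambda>k. p_coeff l ^ Suc k * sqrt (l\<^sup>2 - 4) * (sqrt (l\<^sup>2 - 4) * real (Suc k)) ^ j) sums (\<integral>s. s ^ Suc j \<partial>nu l)"
proof -
  let ?p = "p_coeff l" and ?D = "sqrt (l\<^sup>2 - 4)"
  note p = p_coeff_bounds[OF l]
  let ?a = "\<lambda>k. ?p ^ Suc k * ?D * (?D * real (Suc k)) ^ j"
  have a0: "?a k \<ge> 0" for k using p by (intro mult_nonneg_nonneg zero_le_power) auto
  obtain d where d: "d > 0" "(\<integral>\<^sup>+s. ennreal (s * exp (d * s)) \<partial>nu l) < \<infinity>" using nu_gt2_exp_moment[OF l] .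
  have nn: "(\<integral>\<^sup>+s. ennreal (s ^ Suc j) \<partial>nu l) = (\<Sum>k. ennreal (?a k))"
  proof -
    have "ennreal (?p ^ Suc k / real (Suc k)) * ennreal ((?D * real (Suc k)) ^ Suc j) = ennreal (?a k)" for k
      using p by (subst ennreal_mult[symmetric]) (auto simp: field_simps)
    then show ?thesis by (subst nn_integral_nu_gt2[OF l]) (auto simp del: power_Suc of_nat_Suc)
  qed
  have "(\<integral>\<^sup>+s. ennreal (s ^ Suc j) \<partial>nu l) \<le> (\<integral>\<^sup>+s. ennreal (fact j / d ^ j) * ennreal (s * exp (d * s)) \<partial>nu l)"
  proof (rule nn_integral_mono)
    fix s assume "s \<in> space (nu l)"
    then have s: "s > 0" by (simp add: space_nu)
    have "(\<lambda>k. (d * s) ^ k / fact k) sums exp (d * s)"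
      using exp_converges[of "d * s"] by (simp add: divide_inverse mult_ac)
    from sum_le_suminf[OF sums_summable[OF this], of "{j}"] sums_unique[OF this]
    have "(d * s) ^ j / fact j \<le> exp (d * s)" using d s by simp
    then have "s ^ j \<le> fact j / d ^ j * exp (d * s)" using d by (simp add: power_mult_distrib field_simps)
    then have "s * s ^ j \<le> s * (fact j / d ^ j * exp (d * s))" using s by (intro mult_left_mono) auto
    then show "ennreal (s ^ Suc j) \<le> ennreal (fact j / d ^ j) * ennreal (s * exp (d * s))"
      using d s by (subst ennreal_mult[symmetric]) (auto intro!: ennreal_leI simp: mult_ac)
  qed
  also have "\<dots> < \<infinity>" using d by (subst nn_integral_cmult) (auto simp: ennreal_mult_less_top)
  finally have "(\<Sum>k. ennreal (?a k)) \<noteq> top" using nn by simp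
  then have sm: "summable ?a" using a0 by (intro summable_suminf_not_top) auto
  have "AE s in nu l. 0 \<le> s ^ Suc j" by (rule AE_I2) (auto simp: space_nu)
  then have "(\<integral>s. s ^ Suc j \<partial>nu l) = enn2real (\<Sum>k. ennreal (?a k))"
    by (subst integral_eq_nn_integral) (auto simp: nn[simplified])
  also have "\<dots> = suminf ?a" using a0 sm by (subst suminf_ennreal2[OF a0 sm]) (intro enn2real_ennreal suminf_nonneg sm a0)
  finally show ?thesis using summable_sums[OF sm] by (simp only:)
qed

text \<open>For \<open>l = 2\<close> the series is 1 / (1 - t). For \<open>l > 2\<close> it is D
  times the sum of the positive powers of q = p e^(Dt); multiplication by q shifts the summation,
  which gives w (1 - q) = D q. Differentiating this relation and cancelling 1 - q yields the
  equation.\<close>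

lemma nu_riccati:
  assumes l: "l \<ge> 2"
  defines "w \<equiv> Abs_fps (\<lambda>j. complex_of_real ((\<integral>s. s ^ Suc j \<partial>nu l) / fact j))"
  shows "fps_nth w 0 = c_coeff l" "fps_deriv w = w\<^sup>2 + fps_const (complex_of_real (l - 2 * c_coeff l)) * w"
proof -
  have "fps_nth w 0 = c_coeff l \<and> fps_deriv w = w\<^sup>2 + fps_const (complex_of_real (l - 2 * c_coeff l)) * w"
  proof (cases "l = 2")
    case True
    have w: "w = Abs_fps (\<lambda>_. 1)" by (rule fps_ext) (simp add: w_def True nu_2_moment del: power_Suc)
    have "fps_deriv w = w\<^sup>2"
      by (rule fps_ext) (simp add: w power2_eq_square fps_mult_nth)
    then show ?thesis by (simp add: True c_coeff_def w)
  next
    case False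
    with l have l: "l > 2" by simp
    note p = p_coeff_bounds[OF l]
    let ?p = "p_coeff l" and ?D = "sqrt (l\<^sup>2 - 4)"
    define E where "E = fps_exp (complex_of_real ?D)"
    define pE where "pE = fps_const (complex_of_real ?p) * E"
    have S: "(\<lambda>k. complex_of_real (?p ^ Suc k * ?D) * fps_nth (fps_exp (complex_of_real (?D * real (Suc k)))) j) sums fps_nth w j" for j
    proof -
      have "(\<lambda>k. complex_of_real (?p ^ Suc k * ?D * (?D * real (Suc k)) ^ j / fact j)) sums fps_nth w j"
        unfolding w_def fps_nth_Abs_fps by (intro sums_of_real sums_divide nu_gt2_moment[OF l])
      then show ?thesis by (simp add: mult_ac del: power_Suc of_nat_Suc)
    qed
    have key: "pE * w = w - fps_const (complex_of_real ?D) * pE"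
    proof (rule fps_ext)
      fix n
      have *: "E * fps_exp (complex_of_real (?D * real (Suc k))) = fps_exp (complex_of_real (?D * real (Suc (Suc k))))" for k
        unfolding E_def by (simp add: fps_exp_add_mult[symmetric] algebra_simps)
      have "(\<lambda>k. \<Sum>i=0..n. fps_nth E i * (complex_of_real (?p ^ Suc k * ?D) * fps_nth (fps_exp (complex_of_real (?D * real (Suc k)))) (n - i)))
          sums fps_nth (E * w) n"
        unfolding fps_mult_nth by (intro sums_sum sums_mult S)
      also have "(\<lambda>k. \<Sum>i=0..n. fps_nth E i * (complex_of_real (?p ^ Suc k * ?D) * fps_nth (fps_exp (complex_of_real (?D * real (Suc k)))) (n - i)))
         = (\<lambda>k. complex_of_real (?p ^ Suc k * ?D) * fps_nth (fps_exp (complex_of_real (?D * real (Suc (Suc k))))) n)"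
        unfolding *[symmetric] by (simp add: fps_mult_nth sum_distrib_left mult_ac del: power_Suc of_nat_Suc)
      finally have "(\<lambda>k. complex_of_real ?p * (complex_of_real (?p ^ Suc k * ?D) * fps_nth (fps_exp (complex_of_real (?D * real (Suc (Suc k))))) n)) sums (complex_of_real ?p * fps_nth (E * w) n)"
        by (rule sums_mult)
      then have "(\<lambda>k. complex_of_real (?p ^ Suc (Suc k) * ?D) * fps_nth (fps_exp (complex_of_real (?D * real (Suc (Suc k))))) n) sums fps_nth (pE * w) n"
        unfolding pE_def mult.assoc[of "fps_const (complex_of_real ?p)"] fps_mult_left_const_nth by (simp add: mult_ac)
      moreover have "(\<lambda>k. complex_of_real (?p ^ Suc (Suc k) * ?D) * fps_nth (fps_exp (complex_of_real (?D * real (Suc (Suc k))))) n) sums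
          (fps_nth w n - complex_of_real (?p ^ Suc 0 * ?D) * fps_nth (fps_exp (complex_of_real (?D * real (Suc 0)))) n)"
        by (subst sums_Suc_iff[where f="\<lambda>k. complex_of_real (?p ^ Suc k * ?D) * fps_nth (fps_exp (complex_of_real (?D * real (Suc k)))) n"])
           (use S[of n] in simp)
      ultimately have "fps_nth (pE * w) n = fps_nth w n - complex_of_real (?p ^ Suc 0 * ?D) * fps_nth (fps_exp (complex_of_real (?D * real (Suc 0)))) n"
        by (rule sums_unique2)
      then show "fps_nth (pE * w) n = fps_nth (w - fps_const (complex_of_real ?D) * pE) n"
        by (simp add: pE_def E_def)
    qed
    have dpE: "fps_deriv pE = fps_const (complex_of_real ?D) * pE"
      by (simp add: pE_def E_def mult_ac)
    \<comment> \<open>Cancellation is possible because \<open>1 - pE\<close> has the constant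
      coefficient 1 - p, which differs from 0.\<close>
    have p0: "1 - pE \<noteq> 0"
    proof
      assume "1 - pE = 0"
      then have "fps_nth (1 - pE) 0 = 0" by simp
      then show False using p by (simp add: pE_def E_def)
    qed
    let ?c = "fps_const (complex_of_real ?D)"
    have "fps_deriv (pE * w) = fps_deriv (w - ?c * pE)" using key by simp
    then have d1: "pE * fps_deriv w + ?c * pE * w = fps_deriv w - ?c * (?c * pE)"
      by (simp add: dpE algebra_simps)
    have k1: "w * (1 - pE) = ?c * pE" using key by (simp add: algebra_simps)
    have "fps_deriv w * (1 - pE) = ?c * pE * w + ?c * (?c * pE)" using d1 by (simp add: algebra_simps)
    also have "\<dots> = w * (w * (1 - pE)) + ?c * (w * (1 - pE))" unfolding k1 by (simp add: algebra_simps)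
    also have "\<dots> = (w\<^sup>2 + ?c * w) * (1 - pE)" by (simp add: algebra_simps power2_eq_square)
    finally have "fps_deriv w = w\<^sup>2 + ?c * w" using p0 by simp
    moreover have "l - 2 * c_coeff l = ?D" using p by simp
    moreover have "fps_nth w 0 = c_coeff l"
    proof -
      have "fps_nth (w * (1 - pE)) 0 = fps_nth (?c * pE) 0" using k1 by simp
      then have "fps_nth w 0 * (1 - ?p) = ?D * ?p" by (simp add: pE_def E_def)
      also have "\<dots> = complex_of_real (c_coeff l * (1 - ?p))" using p(5) by (simp add: mult_ac flip: of_real_mult)
      finally have "fps_nth w 0 * complex_of_real (1 - ?p) = complex_of_real (c_coeff l) * complex_of_real (1 - ?p)" by simp
      then show ?thesis using p by (metis less_irrefl mult_right_cancel of_real_eq_0_iff right_minus_eq)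
    qed
    ultimately show ?thesis by simp
  qed
  then show "fps_nth w 0 = c_coeff l" "fps_deriv w = w\<^sup>2 + fps_const (complex_of_real (l - 2 * c_coeff l)) * w"
    by blast+
qed

lemma nu_exp_moment:
  assumes "l \<ge> 2"
  obtains d where "d > 0" "(\<integral>\<^sup>+s. ennreal (s * exp (d * s)) \<partial>nu l) < \<infinity>"
proof (cases "l = 2")
  case True
  then show ?thesis using nu_2_exp_moment that[of "1/2"] by simp
next
  case False
  then show ?thesis using assms nu_gt2_exp_moment[of l] that by force
qed

lemma levy_nu:
  assumes "l \<ge> 2"
  shows "(\<integral>\<^sup>+s. ennreal s \<partial>nu l) < \<infinity>" "levy_measure (nu l)"
proof -
  obtain d where d: "d > 0" "(\<integral>\<^sup>+s. ennreal (s * exp (d * s)) \<partial>nu l) < \<infinity>"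
    using nu_exp_moment[OF assms] .
  have "(\<integral>\<^sup>+s. ennreal s \<partial>nu l) \<le> (\<integral>\<^sup>+s. ennreal (s * exp (d * s)) \<partial>nu l)"
  proof (rule nn_integral_mono, rule ennreal_leI)
    fix s assume "s \<in> space (nu l)"
    then have "s > 0" by (simp add: space_nu)
    then show "s \<le> s * exp (d * s)" using d by simp
  qed
  then show 1: "(\<integral>\<^sup>+s. ennreal s \<partial>nu l) < \<infinity>" using d(2) by (rule le_less_trans)
  have "(\<integral>\<^sup>+s. ennreal (min 1 s) \<partial>nu l) \<le> (\<integral>\<^sup>+s. ennreal s \<partial>nu l)"
    by (intro nn_integral_mono ennreal_leI) simp
  then have "(\<integral>\<^sup>+s. ennreal (min 1 s) \<partial>nu l) < \<infinity>" using 1 by (rule le_less_trans)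
  then show "levy_measure (nu l)" by (simp add: levy_measure_def sets_nu)
qed

lemma nu_tail_finite:
  assumes "l \<ge> 2" "t > 0"
  shows "emeasure (nu l) {s \<in> space (nu l). s \<ge> t} < \<infinity>"
proof -
  have "emeasure (nu l) {s \<in> space (nu l). 1 \<le> ennreal (1 / t) * ennreal s} \<le> ennreal (1 / t) * (\<integral>\<^sup>+s. ennreal s * indicator (space (nu l)) s \<partial>nu l)"
    by (rule nn_integral_Markov_inequality) auto
  also have "(\<integral>\<^sup>+s. ennreal s * indicator (space (nu l)) s \<partial>nu l) = (\<integral>\<^sup>+s. ennreal s \<partial>nu l)"
    by (rule nn_integral_cong) simp
  also have "ennreal (1 / t) * (\<integral>\<^sup>+s. ennreal s \<partial>nu l) < \<infinity>"
    using levy_nu(1)[OF assms(1)] by (simp add: ennreal_mult_less_top)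
  also have "{s \<in> space (nu l). 1 \<le> ennreal (1 / t) * ennreal s} = {s \<in> space (nu l). s \<ge> t}"
  proof -
    have "1 \<le> ennreal (1 / t) * ennreal s \<longleftrightarrow> s \<ge> t" for s
      using assms(2) by (simp flip: ennreal_mult' ennreal_1 add: ennreal_le_iff2 le_divide_eq) auto
    then show ?thesis by auto
  qed
  finally show ?thesis .
qed

lemma sigma_finite_nu:
  assumes "l \<ge> 2"
  shows "sigma_finite_measure (nu l)"
proof
  let ?A = "\<lambda>n::nat. {s \<in> space (nu l). s \<ge> 1 / real (Suc n)}"
  have "?A n \<in> sets (nu l)" for n
  proof -
    have "(\<lambda>s. s) \<in> borel_measurable (nu l)" by measurable
    then show ?thesis by measurable
  qed
  moreover have "(\<Union>n. ?A n) = space (nu l)"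
  proof
    show "space (nu l) \<subseteq> (\<Union>n. ?A n)"
    proof
      fix s assume s: "s \<in> space (nu l)"
      then have "s > 0" by (simp add: space_nu)
      then obtain n where "1 / real (Suc n) < s" using nat_approx_posE by blast
      then show "s \<in> (\<Union>n. ?A n)" using s by (auto intro!: less_imp_le)
    qed
  qed auto
  moreover have "emeasure (nu l) (?A n) \<noteq> \<infinity>" for n using nu_tail_finite[OF assms, of "1 / real (Suc n)"] by simp
  ultimately show "\<exists>A. countable A \<and> A \<subseteq> sets (nu l) \<and> \<Union>A = space (nu l) \<and> (\<forall>a\<in>A. emeasure (nu l) a \<noteq> \<infinity>)"
    by (intro exI[of _ "range ?A"]) auto
qed

section \<open>The intensity of the jumps and its moments\<close>

context
  fixes \<A> :: "('a::{t2_space, second_countable_topology}, 'n::finite) chart set" and \<sigma> :: "'a measure" and l :: real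
  assumes atlas: "oriented_atlas \<A>" and radon: "radon_measure \<sigma>" and l: "l \<ge> 2"
begin

lemma pair_sigma_finite_radon_nu: "pair_sigma_finite \<sigma> (nu l)"
  by (intro pair_sigma_finite.intro sigma_finite_radon[OF atlas radon] sigma_finite_nu[OF l])

lemma measurable_jump:
  assumes "\<xi> \<in> test_functions \<A>"
  shows "(\<lambda>z. snd z * \<xi> (fst z)) \<in> borel_measurable (\<sigma> \<Otimes>\<^sub>M nu l)"
proof -
  have "(\<lambda>z. \<xi> (fst z)) \<in> borel_measurable (\<sigma> \<Otimes>\<^sub>M nu l)"
    by (rule measurable_compose[OF measurable_fst test_measurable_radon[OF atlas radon assms]])
  moreover have "(\<lambda>z. snd z) \<in> borel_measurable (\<sigma> \<Otimes>\<^sub>M nu l)"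
    by (rule measurable_compose[OF measurable_snd measurable_nu]) simp
  ultimately show ?thesis by (intro borel_measurable_times)
qed

lemma integrable_jump_exp:
  assumes xi: "\<xi> \<in> test_functions \<A>"
  shows "\<exists>e>0. integrable (\<sigma> \<Otimes>\<^sub>M nu l) (\<lambda>z. \<bar>snd z * \<xi> (fst z)\<bar> * exp (e * \<bar>snd z * \<xi> (fst z)\<bar>))"
proof -
  interpret pair_sigma_finite \<sigma> "nu l" by (rule pair_sigma_finite_radon_nu)
  obtain d where d: "d > 0" "(\<integral>\<^sup>+s. ennreal (s * exp (d * s)) \<partial>nu l) < \<infinity>" using nu_exp_moment[OF l] .
  from test_bounded_support[OF atlas xi] obtain K C where
    KC0: "compact K \<and> (\<forall>x. x \<notin> K \<longrightarrow> \<xi> x = 0) \<and> C \<ge> 0 \<and> (\<forall>x. \<bar>\<xi> x\<bar> \<le> C)" by (elim exE) (rule that)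
  have KC: "compact K" "\<And>x. x \<notin> K \<Longrightarrow> \<xi> x = 0" "C \<ge> 0" "\<And>x. \<bar>\<xi> x\<bar> \<le> C" using KC0 by blast+
  \<comment> \<open>Since |\<xi>| is at most \<open>C\<close>, the requirement is
    \<open>e * C \<le> d\<close>; the added 1 covers \<open>C = 0\<close>.\<close>
  define e where "e = d / (C + 1)"
  have C1: "C + 1 > 0" using KC(3) by linarith
  have e: "e > 0" using d C1 by (simp add: e_def)
  have eC: "e * C \<le> d"
  proof -
    have "e * C \<le> e * (C + 1)" using e by simp
    also have "\<dots> = d" using C1 by (simp add: e_def)
    finally show ?thesis .
  qed
  let ?g = "\<lambda>z. snd z * \<xi> (fst z)"
  note m = measurable_jump[OF xi]
  have KM[measurable]: "K \<in> sets \<sigma>" using compact_imp_closed[OF KC(1)] by (simp add: sets_radon[OF atlas radon])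
  have mf: "(\<lambda>z. indicator K (fst z)) \<in> borel_measurable (\<sigma> \<Otimes>\<^sub>M nu l)"
    by (rule measurable_compose[OF measurable_fst]) simp
  have ms: "(\<lambda>s. ennreal (s * exp (d * s))) \<in> borel_measurable (nu l)" by measurable
  have "(\<integral>\<^sup>+z. ennreal (\<bar>?g z\<bar> * exp (e * \<bar>?g z\<bar>)) \<partial>(\<sigma> \<Otimes>\<^sub>M nu l)) \<le>
      (\<integral>\<^sup>+z. ennreal C * indicator K (fst z) * ennreal (snd z * exp (d * snd z)) \<partial>(\<sigma> \<Otimes>\<^sub>M nu l))"
  proof (rule nn_integral_mono)
    fix z assume "z \<in> space (\<sigma> \<Otimes>\<^sub>M nu l)"
    then have s: "snd z > 0" by (auto simp: space_pair_measure space_nu)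
    show "ennreal (\<bar>?g z\<bar> * exp (e * \<bar>?g z\<bar>)) \<le> ennreal C * indicator K (fst z) * ennreal (snd z * exp (d * snd z))"
    proof (cases "fst z \<in> K")
      case True
      have gb: "\<bar>?g z\<bar> \<le> C * snd z"
        using KC(4)[of "fst z"] s by (simp add: abs_mult mult.commute mult_right_mono)
      have "e * \<bar>?g z\<bar> \<le> e * (C * snd z)" using gb e by (intro mult_left_mono) auto
      also have "\<dots> \<le> d * snd z" using eC s by (simp add: mult_right_mono flip: mult.assoc)
      finally have "\<bar>?g z\<bar> * exp (e * \<bar>?g z\<bar>) \<le> (C * snd z) * exp (d * snd z)"
        using gb KC(3) s by (intro mult_mono) auto
      then have "ennreal (\<bar>?g z\<bar> * exp (e * \<bar>?g z\<bar>)) \<le> ennreal (C * (snd z * exp (d * snd z)))"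
        by (intro ennreal_leI) (simp add: mult.assoc)
      also have "\<dots> = ennreal C * ennreal (snd z * exp (d * snd z))" using KC(3) s by (intro ennreal_mult) auto
      finally show ?thesis using True by simp
    next
      case False
      then show ?thesis using KC(2) by simp
    qed
  qed
  also have "\<dots> = (\<integral>\<^sup>+x. \<integral>\<^sup>+s. ennreal C * indicator K x * ennreal (s * exp (d * s)) \<partial>nu l \<partial>\<sigma>)"
  proof (subst M2.nn_integral_fst[symmetric])
    have "(\<lambda>z. ennreal (snd z * exp (d * snd z))) \<in> borel_measurable (\<sigma> \<Otimes>\<^sub>M nu l)"
      by (rule measurable_compose[OF measurable_snd ms])
    then show "(\<lambda>z. ennreal C * indicator K (fst z) * ennreal (snd z * exp (d * snd z))) \<in> borel_measurable (\<sigma> \<Otimes>\<^sub>M nu l)"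
      using mf by (intro borel_measurable_times_ennreal borel_measurable_const)
  qed simp
  also have "\<dots> = (\<integral>\<^sup>+x. ennreal C * indicator K x * (\<integral>\<^sup>+s. ennreal (s * exp (d * s)) \<partial>nu l) \<partial>\<sigma>)"
    by (intro nn_integral_cong nn_integral_cmult ms)
  also have "\<dots> = ennreal C * (\<integral>\<^sup>+s. ennreal (s * exp (d * s)) \<partial>nu l) * emeasure \<sigma> K"
  proof -
    have "(\<lambda>x. ennreal C * indicator K x * (\<integral>\<^sup>+s. ennreal (s * exp (d * s)) \<partial>nu l)) =
        (\<lambda>x. (ennreal C * (\<integral>\<^sup>+s. ennreal (s * exp (d * s)) \<partial>nu l)) * indicator K x)"
      by (rule ext) (simp only: mult_ac)
    then show ?thesis by (simp only: nn_integral_cmult_indicator[OF KM])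
  qed
  also have "\<dots> < \<infinity>"
    using d(2) radon_compact[OF atlas radon KC(1)] by (simp add: ennreal_mult_less_top)
  finally have "(\<integral>\<^sup>+z. ennreal (norm (\<bar>?g z\<bar> * exp (e * \<bar>?g z\<bar>))) \<partial>(\<sigma> \<Otimes>\<^sub>M nu l)) < \<infinity>" by simp
  moreover have "(\<lambda>t. \<bar>t\<bar> * exp (e * \<bar>t\<bar>)) \<in> borel_measurable borel" by measurable
  ultimately have "integrable (\<sigma> \<Otimes>\<^sub>M nu l) (\<lambda>z. \<bar>?g z\<bar> * exp (e * \<bar>?g z\<bar>))"
    by (rule integrableI_bounded[OF measurable_compose[OF m], rotated])
  then show ?thesis using e by blast
qed

lemma jump_moment:
  assumes xi: "\<xi> \<in> test_functions \<A>"
  shows "(\<integral>z. (snd z * \<xi> (fst z)) ^ Suc n \<partial>(\<sigma> \<Otimes>\<^sub>M nu l)) = (\<integral>s. s ^ Suc n \<partial>nu l) * (\<integral>x. \<xi> x ^ Suc n \<partial>\<sigma>)"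
proof -
  interpret pair_sigma_finite \<sigma> "nu l" by (rule pair_sigma_finite_radon_nu)
  obtain e where e: "e > 0" "integrable (\<sigma> \<Otimes>\<^sub>M nu l) (\<lambda>z. \<bar>snd z * \<xi> (fst z)\<bar> * exp (e * \<bar>snd z * \<xi> (fst z)\<bar>))"
    using integrable_jump_exp[OF xi] by blast
  have "integrable (\<sigma> \<Otimes>\<^sub>M nu l) (\<lambda>z. (snd z * \<xi> (fst z)) ^ Suc n)"
    by (rule integrable_power_of_exp[OF measurable_jump[OF xi] e(2,1)])
  from integral_fst'[OF this, symmetric]
  have "(\<integral>z. (snd z * \<xi> (fst z)) ^ Suc n \<partial>(\<sigma> \<Otimes>\<^sub>M nu l)) = (\<integral>x. \<integral>s. s ^ Suc n * \<xi> x ^ Suc n \<partial>nu l \<partial>\<sigma>)"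
    by (simp only: fst_conv snd_conv power_mult_distrib)
  also have "\<dots> = (\<integral>s. s ^ Suc n \<partial>nu l) * (\<integral>x. \<xi> x ^ Suc n \<partial>\<sigma>)"
    by (simp only: Bochner_Integration.integral_mult_left_zero Bochner_Integration.integral_mult_right_zero)
  finally show ?thesis .
qed

text \<open>The coefficients of \<open>V\<close> are the jump moments divided by factorials, so
  \<open>V\<close> generates the cumulants of the compound Poisson law. These moments factor into a
  moment of \<open>nu l\<close> and an integral of a power of \<xi>, so the derivative of
  \<open>V\<close> is \<open>dV\<close>; hence the exponential of \<open>V\<close> has the
  logarithmic derivative that generates the moments under \<mu>.\<close>

theorem spectral_levy_khintchine:
  assumes sp: "spectral_pair \<A> \<sigma> l \<mu> I"
  shows "levy_khintchine \<A> \<sigma> (nu l) \<mu>" "\<And>\<xi>. \<xi> \<in> test_functions \<A> \<Longrightarrow> (\<lambda>\<omega>. \<omega> \<xi>) \<in> borel_measurable \<mu>"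
proof -
  define w where "w = Abs_fps (\<lambda>j. complex_of_real ((\<integral>s. s ^ Suc j \<partial>nu l) / fact j))"
  note ric = nu_riccati[OF l, folded w_def]
  have prob: "prob_space \<mu>" using sp unfolding spectral_pair_def by (rule conjunct1)
  have main: "(\<lambda>\<omega>. \<omega> \<xi>) \<in> borel_measurable \<mu> \<and>
      (\<integral>\<omega>. exp (\<i> * complex_of_real (\<omega> \<xi>)) \<partial>\<mu>) = exp (\<integral>z. exp (\<i> * complex_of_real (snd z * \<xi> (fst z))) - 1 \<partial>(\<sigma> \<Otimes>\<^sub>M nu l))"
    if xi: "\<xi> \<in> test_functions \<A>" for \<xi>
  proof -
    define V where "V = Abs_fps (\<lambda>n. if n = 0 then 0 else complex_of_real (\<integral>z. (snd z * \<xi> (fst z)) ^ n \<partial>(\<sigma> \<Otimes>\<^sub>M nu l)) / fact n)"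
    define L where "L = fps_exp 1 oo V"
    have dV: "fps_deriv V = dV \<sigma> \<xi> w"
    proof (rule fps_ext)
      fix j
      have "fps_nth (fps_deriv V) j = of_nat (Suc j) * (complex_of_real ((\<integral>s. s ^ Suc j \<partial>nu l) * (\<integral>x. \<xi> x ^ Suc j \<partial>\<sigma>)) / fact (Suc j))"
        unfolding V_def using jump_moment[OF xi, of j] by simp
      also have "\<dots> = fps_nth (dV \<sigma> \<xi> w) j"
        unfolding dV_def[OF atlas radon xi ric c_coeff_root[OF l]] by (simp add: w_def del: power_Suc of_nat_Suc)
      finally show "fps_nth (fps_deriv V) j = fps_nth (dV \<sigma> \<xi> w) j" .
    qed
    have L': "fps_deriv L = L * dV \<sigma> \<xi> w"
      unfolding L_def dV[symmetric] by (subst fps_compose_deriv) (simp_all add: V_def)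
    have L0: "fps_nth L 0 = 1" unfolding L_def by (simp add: V_def)
    note mom = spectral_moments[OF atlas radon xi ric c_coeff_root[OF l] sp L' L0 refl]
    obtain e where e: "e > 0" "integrable (\<sigma> \<Otimes>\<^sub>M nu l) (\<lambda>z. \<bar>snd z * \<xi> (fst z)\<bar> * exp (e * \<bar>snd z * \<xi> (fst z)\<bar>))"
      using integrable_jump_exp[OF xi] by blast
    have "(\<integral>\<omega>. exp (\<i> * complex_of_real (\<omega> \<xi>)) \<partial>\<mu>) = exp (\<integral>z. exp (\<i> * complex_of_real (snd z * \<xi> (fst z))) - 1 \<partial>(\<sigma> \<Otimes>\<^sub>M nu l))"
      by (rule fourier_transform_from_moments[OF prob mom(1,2) measurable_jump[OF xi] e, folded V_def, folded L_def, OF mom(3)])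
    then show ?thesis using mom(1) by blast
  qed
  then show "levy_khintchine \<A> \<sigma> (nu l) \<mu>" unfolding levy_khintchine_def by blast
  show "(\<lambda>\<omega>. \<omega> \<xi>) \<in> borel_measurable \<mu>" if "\<xi> \<in> test_functions \<A>" for \<xi> using main[OF that] by blast
qed

end

declare measurable_nu [measurable del]

section \<open>Concentration on discrete measures\<close>

text \<open>
  The manifold is a measurable retract of \<open>real ^ 'n \<times> real\<close>, hence Polish spaces of codes can replace
  it when inner regularity is applied.
\<close>

lemma measurable_chart_coding:
  fixes \<A> :: "('a::{t2_space, second_countable_topology}, 'n::finite) chart set"
  assumes atlas: "oriented_atlas \<A>"
  shows "\<exists>(cc :: nat \<Rightarrow> ('a, 'n) chart) L (e :: 'a \<Rightarrow> (real ^ 'n) \<times> real) d.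
    (\<forall>m. cc m \<in> \<A>) \<and> (\<forall>m. compact (L m)) \<and> (\<forall>m. L m \<subseteq> fst (cc m)) \<and> (\<Union>m. interior (L m)) = UNIV \<and>
    e \<in> borel_measurable borel \<and> d \<in> borel_measurable borel \<and> (\<forall>x. d (e x) = x)"
proof -
  from countable_compact_charts[OF atlas] obtain cc L where
    cL0: "(\<forall>m. cc m \<in> \<A>) \<and> (\<forall>m. compact (L m)) \<and> (\<forall>m. L m \<subseteq> fst (cc m)) \<and> (\<Union>m::nat. interior (L m)) = UNIV"
    by (elim exE) (rule that)
  then have cL: "\<And>m. cc m \<in> \<A>" "\<And>m. compact (L m)" "\<And>m. L m \<subseteq> fst (cc m)" "(\<Union>m. interior (L m)) = UNIV"
    by blast+
  have UL: "\<exists>m. x \<in> L m" for x using cL(4) interior_subset by blast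
  \<comment> \<open>Taking the least index is a choice of chart that is constant on each of
    countably many Borel sets; on such a piece \<open>e\<close> is the continuous coordinate map
    together with the chart number.\<close>
  define ix where "ix x = (LEAST m. x \<in> L m)" for x
  have ixL: "x \<in> L (ix x)" for x unfolding ix_def using UL by (rule LeastI_ex)
  define e where "e x = (snd (cc (ix x)) x, real (ix x))" for x
  \<comment> \<open>The decoder has to be total: an arbitrary real number is rounded to a chart
    number, and points outside the chart image receive a default value.\<close>
  define d where "d p = (if fst p \<in> chart_img (cc (nat \<lfloor>snd p\<rfloor>)) then chart_inv (cc (nat \<lfloor>snd p\<rfloor>)) (fst p) else undefined)"
    for p :: "(real ^ 'n) \<times> real"
  have "d (e x) = x" for x
  proof -
    have "x \<in> fst (cc (ix x))" using ixL cL(3) by blast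
    then show ?thesis using atlas_chart(3)[OF atlas cL(1)] by (simp add: d_def e_def)
  qed
  moreover have "e \<in> borel_measurable borel"
  proof (rule measurable_piecewise_restrict[where C="range (\<lambda>m. {x. ix x = m})"])
    have Lb: "L m \<in> sets borel" for m using compact_imp_closed[OF cL(2)] by auto
    have ixset: "{x. ix x = m} \<in> sets borel" for m
    proof -
      have "{x. ix x = m} = L m - (\<Union>k<m. L k)"
      proof (intro set_eqI iffI)
        fix x assume "x \<in> {x. ix x = m}"
        then have ixm: "(LEAST m. x \<in> L m) = m" by (simp add: ix_def)
        have "x \<in> L m" using LeastI_ex[OF UL[of x]] unfolding ixm .
        moreover have "x \<notin> L k" if "k < m" for k
          by (rule not_less_Least) (simp only: ixm that)
        ultimately show "x \<in> L m - (\<Union>k<m. L k)" by blast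
      next
        fix x assume x: "x \<in> L m - (\<Union>k<m. L k)"
        have "(LEAST m. x \<in> L m) = m"
        proof (rule Least_equality)
          show "m \<le> k" if "x \<in> L k" for k using x that by (cases "m \<le> k") (auto simp: not_le)
        qed (use x in blast)
        then show "x \<in> {x. ix x = m}" by (simp add: ix_def)
      qed
      then show ?thesis using Lb by auto
    qed
    fix Om assume "Om \<in> range (\<lambda>m. {x. ix x = m})"
    then obtain m where Om: "Om = {x. ix x = m}" by blast
    show "Om \<inter> space borel \<in> sets borel" using ixset by (simp add: Om)
    have "Om \<subseteq> fst (cc m)" using ixL cL(3) unfolding Om by blast
    then have "continuous_on Om (snd (cc m))" by (rule continuous_on_subset[OF atlas_chart(4)[OF atlas cL(1)]])
    then have "continuous_on Om (\<lambda>x. (snd (cc m) x, real m))" by (intro continuous_on_Pair continuous_on_const)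
    then have "(\<lambda>x. (snd (cc m) x, real m)) \<in> borel_measurable (restrict_space borel Om)"
      by (rule borel_measurable_continuous_on_restrict)
    then show "e \<in> borel_measurable (restrict_space borel Om)"
      by (rule measurable_cong[THEN iffD1, rotated]) (auto simp: e_def Om space_restrict_space)
  qed auto
  moreover have "d \<in> borel_measurable borel"
  proof (rule measurable_piecewise_restrict[where C="range (\<lambda>m. {p :: (real ^ 'n) \<times> real. nat \<lfloor>snd p\<rfloor> = m})"])
    fix Om assume "Om \<in> range (\<lambda>m. {p :: (real ^ 'n) \<times> real. nat \<lfloor>snd p\<rfloor> = m})"
    then obtain m where Om: "Om = {p. nat \<lfloor>snd p\<rfloor> = m}" by blast
    have sm: "(\<lambda>p :: (real ^ 'n) \<times> real. snd p) \<in> borel_measurable borel" by (intro borel_measurable_continuous_onI continuous_intros)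
    have fm: "(\<lambda>p :: (real ^ 'n) \<times> real. fst p) \<in> borel_measurable borel" by (intro borel_measurable_continuous_onI continuous_intros)
    have "{p :: (real ^ 'n) \<times> real. nat \<lfloor>snd p\<rfloor> = m} \<in> sets borel"
    proof -
      have "(\<lambda>t::real. nat \<lfloor>t\<rfloor>) \<in> measurable borel (count_space UNIV)" by measurable
      from measurable_sets[OF measurable_compose[OF sm this], of "{m}"] show ?thesis by (simp add: vimage_def)
    qed
    then show "Om \<inter> space borel \<in> sets borel" by (simp add: Om)
    define h where "h y = (if y \<in> chart_img (cc m) then chart_inv (cc m) y else undefined)" for y
    have "h \<in> borel_measurable borel"
      unfolding h_def
    proof (subst measurable_restrict_space_iff[symmetric])
      show "chart_img (cc m) \<inter> space borel \<in> sets borel" using atlas_chart(2)[OF atlas cL(1)[of m]] by simp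
      show "chart_inv (cc m) \<in> borel_measurable (restrict_space borel (chart_img (cc m)))"
        by (rule borel_measurable_continuous_on_restrict[OF atlas_chart(5)[OF atlas cL(1)]])
    qed simp
    from measurable_restrict_space1[OF measurable_compose[OF fm this]]
    have "(\<lambda>p. h (fst p)) \<in> borel_measurable (restrict_space borel Om)" .
    then show "d \<in> borel_measurable (restrict_space borel Om)"
      by (rule measurable_cong[THEN iffD1, rotated]) (auto simp: d_def h_def Om space_restrict_space)
  qed auto
  ultimately show ?thesis using cL0 by (intro exI[of _ cc] exI[of _ L] exI[of _ e] exI[of _ d]) simp
qed

section \<open>Integration of test functions against a locally finite measure\<close>

context
  fixes \<A> :: "('a::{t2_space, second_countable_topology}, 'n::finite) chart set"
    and cc :: "nat \<Rightarrow> ('a, 'n) chart" and L :: "nat \<Rightarrow> 'a set" and M :: "'a measure"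
  assumes atlas: "oriented_atlas \<A>" and cc: "\<And>m. cc m \<in> \<A>" and L: "\<And>m. compact (L m)" "\<And>m. L m \<subseteq> fst (cc m)"
    "(\<Union>m. interior (L m)) = UNIV"
    and M: "sets M = sets borel" "\<And>N. emeasure M (\<Union>m<N. L m) \<noteq> \<infinity>"
begin

lemma exhaustion_measurable: "(\<Union>m<N. L m) \<in> sets M"
  using compact_imp_closed[OF L(1)] by (auto simp: M(1))

lemma finite_on_compact:
  assumes "compact K"
  shows "emeasure M K < \<infinity>"
proof -
  obtain N where "K \<subseteq> (\<Union>m<N. L m)" using compact_cover_nat[OF atlas L(3) assms] .
  then have "emeasure M K \<le> emeasure M (\<Union>m<N. L m)" by (intro emeasure_mono exhaustion_measurable)
  then show ?thesis using M(2)[of N] by (simp add: less_top[symmetric] top_unique) (metis top_unique)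
qed

lemma integrable_test_exhausted:
  assumes p: "\<phi> \<in> test_functions \<A>"
  shows "integrable M \<phi>"
proof -
  from test_bounded_support[OF atlas p] obtain K C where
    "compact K \<and> (\<forall>x. x \<notin> K \<longrightarrow> \<phi> x = 0) \<and> C \<ge> 0 \<and> (\<forall>x. \<bar>\<phi> x\<bar> \<le> C)" by (elim exE) (rule that)
  then have K: "compact K" "\<And>x. x \<notin> K \<Longrightarrow> \<phi> x = 0" "\<And>x. \<bar>\<phi> x\<bar> \<le> C" by blast+
  show ?thesis
  proof (rule integrableI_bounded_set[where A=K and B=C])
    show "K \<in> sets M" using compact_imp_closed[OF K(1)] by (simp add: M(1))
    show "\<phi> \<in> borel_measurable M" using test_measurable[OF atlas p] measurable_cong_sets[OF M(1) refl] by blast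
    show "emeasure M K < \<infinity>" by (rule finite_on_compact[OF K(1)])
  qed (simp_all add: K)
qed

text \<open>All supports lie in one set of finite measure, on which convergence is uniform; the
  latter is read off from the empty list of directions in the charts \<open>cc m\<close>.\<close>

lemma test_integral_tendsto:
  assumes psi: "\<And>j. \<psi> j \<in> test_functions \<A>" and p: "\<phi> \<in> test_functions \<A>" and conv: "test_tendsto \<A> \<psi> \<phi>"
  shows "(\<lambda>j. \<integral>x. \<psi> j x \<partial>M) \<longlonglongrightarrow> (\<integral>x. \<phi> x \<partial>M)"
proof -
  note conv' = conv[unfolded test_tendsto_def[OF atlas]]
  from conjunct1[OF conv'] obtain K where
    K: "compact K" "\<forall>x. x \<notin> K \<longrightarrow> \<phi> x = 0" "\<forall>j x. x \<notin> K \<longrightarrow> \<psi> j x = 0" by (elim exE conjE) (rule that)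
  obtain N where N: "K \<subseteq> (\<Union>m<N. L m)" using compact_cover_nat[OF atlas L(3) K(1)] .
  let ?K = "\<Union>m<N. L m"
  have unif: "\<forall>\<^sub>F j in sequentially. \<forall>x\<in>?K. \<bar>\<psi> j x - \<phi> x\<bar> \<le> e" if e: "e > 0" for e
  proof -
    have "\<forall>\<^sub>F j in sequentially. \<forall>x\<in>L m. \<bar>\<psi> j x - \<phi> x\<bar> \<le> e" for m
    proof -
      have "\<forall>\<^sub>F j in sequentially. \<forall>x\<in>L m. \<bar>iter_deriv [] (\<lambda>y. \<psi> j (chart_inv (cc m) y) - \<phi> (chart_inv (cc m) y)) (snd (cc m) x)\<bar> \<le> e"
        using conjunct2[OF conv', THEN bspec, OF cc[of m], THEN spec, THEN spec, THEN spec, THEN mp, OF L(1)[of m],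
            THEN mp, OF L(2)[of m], THEN mp, OF e] .
      then show ?thesis
      proof eventually_elim
        case (elim j)
        show ?case
        proof
          fix x assume x: "x \<in> L m"
          then have "x \<in> fst (cc m)" using L(2) by blast
          then have "chart_inv (cc m) (snd (cc m) x) = x" by (rule atlas_chart(3)[OF atlas cc])
          then show "\<bar>\<psi> j x - \<phi> x\<bar> \<le> e" using bspec[OF elim x] by simp
        qed
      qed
    qed
    then have "\<forall>\<^sub>F j in sequentially. \<forall>m\<in>{..<N}. \<forall>x\<in>L m. \<bar>\<psi> j x - \<phi> x\<bar> \<le> e"
      by (intro eventually_ball_finite[OF finite_lessThan] ballI)
    then show ?thesis
    proof eventually_elim
      case (elim j)
      show ?case
      proof
        fix x assume "x \<in> ?K"
        then obtain m where m: "m \<in> {..<N}" "x \<in> L m" by blast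
        show "\<bar>\<psi> j x - \<phi> x\<bar> \<le> e" using bspec[OF bspec[OF elim m(1)] m(2)] .
      qed
    qed
  qed
  have Km: "?K \<in> sets M" by (rule exhaustion_measurable)
  have bd: "\<bar>(\<integral>x. \<psi> j x \<partial>M) - (\<integral>x. \<phi> x \<partial>M)\<bar> \<le> e * measure M ?K" if "\<forall>x\<in>?K. \<bar>\<psi> j x - \<phi> x\<bar> \<le> e" for j e
  proof -
    have "(\<integral>x. \<psi> j x \<partial>M) - (\<integral>x. \<phi> x \<partial>M) = (\<integral>x. \<psi> j x - \<phi> x \<partial>M)"
      by (rule Bochner_Integration.integral_diff[symmetric]) (intro integrable_test_exhausted psi p)+
    also have "\<bar>\<dots>\<bar> \<le> (\<integral>x. \<bar>\<psi> j x - \<phi> x\<bar> \<partial>M)" by (rule integral_abs_bound)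
    also have "\<dots> \<le> (\<integral>x. e * indicator ?K x \<partial>M)"
    proof (rule integral_mono)
      show "integrable M (\<lambda>x. \<bar>\<psi> j x - \<phi> x\<bar>)"
        using integrable_test_exhausted[OF test_diff[OF atlas psi p]] by (rule integrable_abs)
      show "integrable M (\<lambda>x. e * indicator ?K x)"
        using M(2)[of N] Km by (intro integrable_mult_right integrable_real_indicator) (auto simp: less_top)
      fix x
      show "\<bar>\<psi> j x - \<phi> x\<bar> \<le> e * indicator ?K x"
      proof (cases "x \<in> ?K")
        case True
        then show ?thesis using bspec[OF that True] by (simp only: indicator_simps mult_1_right)
      next
        case False
        then have "x \<notin> K" using N by blast
        then have "\<phi> x = 0" "\<psi> j x = 0" using K(2,3) by blast+
        moreover have "indicator ?K x = (0::real)" by (rule indicator_simps(2)[OF False])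
        ultimately show ?thesis by (simp only: mult_zero_right diff_zero abs_zero order_refl)
      qed
    qed
    also have "\<dots> = e * measure M ?K" using sets.sets_into_space[OF Km] by (simp add: Int_absorb2)
    finally show ?thesis .
  qed
  show ?thesis
  proof (rule LIMSEQ_I)
    fix r :: real assume r: "r > 0"
    define e where "e = r / (measure M ?K + 1)"
    have m1: "measure M ?K + 1 > 0" by (simp add: add_nonneg_pos)
    have e: "e > 0" using r m1 by (simp add: e_def)
    have "e * measure M ?K < e * (measure M ?K + 1)" using e by simp
    also have "\<dots> = r" using m1 by (simp add: e_def)
    finally have er: "e * measure M ?K < r" .
    from unif[OF e] have "\<forall>\<^sub>F j in sequentially. norm ((\<integral>x. \<psi> j x \<partial>M) - (\<integral>x. \<phi> x \<partial>M)) < r"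
    proof eventually_elim
      case (elim j)
      show ?case using bd[OF elim] er by simp
    qed
    then show "\<exists>no. \<forall>n\<ge>no. norm ((\<integral>x. \<psi> n x \<partial>M) - (\<integral>x. \<phi> x \<partial>M)) < r" by (simp add: eventually_sequentially)
  qed
qed

text \<open>Both functionals are sequentially continuous, so agreement on the dense sequence spreads
  to all test functions; extensionality settles the remaining arguments.\<close>

lemma dual_eq_functional_of_measure:
  assumes w: "\<omega> \<in> dual_space \<A>" and Phi: "\<And>k. \<Phi> k \<in> test_functions \<A>"
    and dense: "\<And>\<phi>. \<phi> \<in> test_functions \<A> \<Longrightarrow> \<exists>k. test_tendsto \<A> (\<lambda>j. \<Phi> (k j)) \<phi>"
    and eq: "\<And>j. \<omega> (\<Phi> j) = (\<integral>x. \<Phi> j x \<partial>M)"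
  shows "\<omega> = functional_of_measure \<A> M"
proof -
  have "\<omega> \<phi> = (\<integral>x. \<phi> x \<partial>M)" if p: "\<phi> \<in> test_functions \<A>" for \<phi>
  proof -
    obtain k where k: "test_tendsto \<A> (\<lambda>j. \<Phi> (k j)) \<phi>" using dense[OF p] ..
    have "(\<lambda>j. \<omega> (\<Phi> (k j))) \<longlonglongrightarrow> \<omega> \<phi>" by (rule dual_space_sequential[OF atlas w Phi p k])
    moreover have "(\<lambda>j. \<omega> (\<Phi> (k j))) \<longlonglongrightarrow> (\<integral>x. \<phi> x \<partial>M)"
      unfolding eq by (rule test_integral_tendsto[OF Phi p k])
    ultimately show ?thesis by (rule LIMSEQ_unique)
  qed
  moreover have "\<omega> \<in> extensional (test_functions \<A>)" using w unfolding dual_space_def by blast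
  ultimately show ?thesis unfolding functional_of_measure_def
    by (intro extensionalityI[of _ "test_functions \<A>"]) auto
qed

end

lemma dual_space_sum:
  fixes \<A> :: "('a::{t2_space, second_countable_topology}, 'n::finite) chart set"
    and \<Phi> :: "nat \<Rightarrow> 'a \<Rightarrow> real"
  assumes atlas: "oriented_atlas \<A>" and w: "\<omega> \<in> dual_space \<A>" and Phi: "\<And>k. \<Phi> k \<in> test_functions \<A>"
  shows "(\<Sum>j<m. t j * \<omega> (\<Phi> j)) = \<omega> (\<lambda>x. \<Sum>j<m. t j * \<Phi> j x)"
proof -
  have add: "\<omega> (\<lambda>x. \<phi> x + \<psi> x) = \<omega> \<phi> + \<omega> \<psi>" if "\<phi> \<in> test_functions \<A>" "\<psi> \<in> test_functions \<A>" for \<phi> \<psi>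
    using w that unfolding dual_space_def by blast
  have scale: "\<omega> (\<lambda>x. r * \<phi> x) = r * \<omega> \<phi>" if "\<phi> \<in> test_functions \<A>" for r \<phi>
    using w that unfolding dual_space_def by blast
  show ?thesis
  proof (induction m)
    case 0
    show ?case using scale[OF Phi[of 0], of 0] by simp
  next
    case (Suc m)
    have "\<omega> (\<lambda>x. (\<Sum>j<m. t j * \<Phi> j x) + t m * \<Phi> m x) = \<omega> (\<lambda>x. \<Sum>j<m. t j * \<Phi> j x) + \<omega> (\<lambda>x. t m * \<Phi> m x)"
      by (rule add[OF test_sum[OF atlas] test_scale[OF atlas]]) (intro test_scale[OF atlas] Phi)+
    then show ?case using Suc scale[OF Phi] by simp
  qed
qed

section \<open>Clouds of jumps in the space of codes\<close>

context
  fixes \<A> :: "('a::{t2_space, second_countable_topology}, 'n::finite) chart set"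
    and \<sigma> :: "'a measure" and l :: real and L :: "nat \<Rightarrow> 'a set"
    and e :: "'a \<Rightarrow> (real ^ 'n) \<times> real" and d :: "(real ^ 'n) \<times> real \<Rightarrow> 'a"
  assumes atlas: "oriented_atlas \<A>" and radon: "radon_measure \<sigma>" and l: "l \<ge> 2"
    and L: "\<And>m. compact (L m)" "(\<Union>m. interior (L m)) = UNIV"
    and e: "e \<in> borel_measurable borel" and d: "d \<in> borel_measurable borel" and de: "\<And>x. d (e x) = x"
begin

text \<open>A jump is a pair of a point and a size. The cemetery is the code 0, which has size 0 and
  thus contributes no mass. Codes fill a whole vector space, in which the size coordinate may be
  negative; hence the truncation in \<open>jump_size\<close>.\<close>

definition "jump_code z = (e (fst z), snd z)"
definition "jump_size w = max 0 (snd w)" for w :: "((real ^ 'n) \<times> real) \<times> real"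
definition "jump_point w = d (fst w)" for w :: "((real ^ 'n) \<times> real) \<times> real"

lemma measurable_jump_code: "jump_code \<in> borel_measurable (\<sigma> \<Otimes>\<^sub>M nu l)"
proof -
  have "e \<in> borel_measurable \<sigma>" using e measurable_cong_sets[OF sets_radon[OF atlas radon] refl] by blast
  then have "(\<lambda>z. e (fst z)) \<in> borel_measurable (\<sigma> \<Otimes>\<^sub>M nu l)" by (rule measurable_compose[OF measurable_fst])
  moreover have "(\<lambda>z. snd z) \<in> borel_measurable (\<sigma> \<Otimes>\<^sub>M nu l)"
    by (rule measurable_compose[OF measurable_snd measurable_nu]) simp
  ultimately show ?thesis unfolding jump_code_def[abs_def] by (rule borel_measurable_Pair)
qed

lemma measurable_jump_size: "jump_size \<in> borel_measurable borel"
  unfolding jump_size_def[abs_def]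
  by (intro borel_measurable_continuous_onI continuous_on_max continuous_on_const continuous_on_snd continuous_on_id)

lemma measurable_jump_point: "jump_point \<in> borel_measurable borel"
proof -
  have "(\<lambda>w :: ((real ^ 'n) \<times> real) \<times> real. fst w) \<in> borel_measurable borel"
    by (intro borel_measurable_continuous_onI continuous_on_fst continuous_on_id)
  from measurable_compose[OF this d] show ?thesis unfolding jump_point_def[abs_def] .
qed

lemma jump_code_simps:
  assumes "z \<in> space (\<sigma> \<Otimes>\<^sub>M nu l)"
  shows "snd z > 0" "jump_size (jump_code z) = snd z" "jump_point (jump_code z) = fst z" "snd (jump_code z) = snd z"
  using assms by (auto simp: space_pair_measure space_nu jump_size_def jump_point_def jump_code_def de)

lemma exhaustion_sets: "(\<Union>m<N. L m) \<in> sets borel" "L m \<in> sets borel"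
  using compact_imp_closed[OF L(1)] by auto

text \<open>The cloud is built for the image of the intensity under the coding, so that its
  realizations form a Polish space whose Borel sets are those of the product. All formulas are then
  pulled back to the intensity itself.\<close>

lemma jump_cloud:
  "\<exists>P :: (nat \<Rightarrow> nat \<Rightarrow> ((real ^ 'n) \<times> real) \<times> real) measure. prob_space P \<and> sets P = sets borel \<and>
    (\<forall>g\<in>borel_measurable borel. g 0 = 0 \<longrightarrow>
      (\<integral>\<^sup>+c. (\<Sum>i. \<Sum>k. g (c i k)) \<partial>P) = (\<integral>\<^sup>+z. g (jump_code z) \<partial>(\<sigma> \<Otimes>\<^sub>M nu l))) \<and>
    (\<forall>g\<in>borel_measurable borel. integrable (\<sigma> \<Otimes>\<^sub>M nu l) (\<lambda>z. g (jump_code z)) \<longrightarrow> g 0 = (0::real) \<longrightarrow>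
      (\<integral>c. exp (\<i> * complex_of_real (\<Sum>i. \<Sum>k. g (c i k))) \<partial>P) =
        exp (\<integral>z. exp (\<i> * complex_of_real (g (jump_code z))) - 1 \<partial>(\<sigma> \<Otimes>\<^sub>M nu l))) \<and>
    (emeasure (\<sigma> \<Otimes>\<^sub>M nu l) (space (\<sigma> \<Otimes>\<^sub>M nu l)) = \<infinity> \<longrightarrow> (AE c in P. \<exists>i k. c i k \<noteq> 0))"
proof -
  interpret pair_sigma_finite \<sigma> "nu l" by (rule pair_sigma_finite_radon_nu[OF atlas radon l])
  note code = measurable_jump_code
  define R where "R = distr (\<sigma> \<Otimes>\<^sub>M nu l) borel jump_code"
  have sR: "sets R = sets borel" and spR: "space R = UNIV" by (simp_all add: R_def)
  have mR: "borel_measurable R = (borel_measurable borel :: (_ \<Rightarrow> 'c::topological_space) set)"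
    by (rule measurable_cong_sets[OF sR refl])
  have eR: "emeasure R A = emeasure (\<sigma> \<Otimes>\<^sub>M nu l) (jump_code -` A \<inter> space (\<sigma> \<Otimes>\<^sub>M nu l))" if "A \<in> sets borel" for A
    unfolding R_def by (rule emeasure_distr[OF code that])
  \<comment> \<open>Cells are labelled by a piece of the exhaustion and by the integer part
    \<open>j\<close> of the inverse size. A jump in such a cell lies over a compact set and exceeds
    1 / (j + 1), so the mass is finite even if small jumps have infinite total mass.\<close>
  define B where "B q = {w. jump_point w \<in> disjointed L (fst (prod_decode q)) \<and> nat \<lfloor>1 / snd w\<rfloor> = snd (prod_decode q)}" for q
  have dL: "disjointed L m \<in> sets borel" for m
    using sets.range_disjointed_sets[of L borel] exhaustion_sets(2) by blast
  have B: "B q \<in> sets borel" for q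
  proof -
    have "(\<lambda>w :: ((real ^ 'n) \<times> real) \<times> real. snd w) \<in> borel_measurable borel"
      by (intro borel_measurable_continuous_onI continuous_on_snd continuous_on_id)
    moreover have "(\<lambda>t::real. nat \<lfloor>1 / t\<rfloor>) \<in> measurable borel (count_space UNIV)" by measurable
    ultimately have "(\<lambda>w :: ((real ^ 'n) \<times> real) \<times> real. nat \<lfloor>1 / snd w\<rfloor>) \<in> measurable borel (count_space UNIV)"
      by (rule measurable_compose)
    from measurable_sets[OF this, of "{snd (prod_decode q)}"] measurable_sets[OF measurable_jump_point dL, of "fst (prod_decode q)"]
    have "jump_point -` disjointed L (fst (prod_decode q)) \<inter> (\<lambda>w. nat \<lfloor>1 / snd w\<rfloor>) -` {snd (prod_decode q)} \<in> sets borel"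
      by (simp only: space_borel Int_UNIV_right sets.Int sets_count_space Pow_UNIV UNIV_I)
    then show ?thesis by (simp add: B_def vimage_def Int_def)
  qed
  have UL: "(\<Union>m. L m) = UNIV" using L(2) interior_subset by blast
  have "disjoint_family B"
    unfolding disjoint_family_on_def
  proof (intro ballI impI)
    fix p q :: nat assume "p \<noteq> q"
    then have "prod_decode p \<noteq> prod_decode q" using inj_prod_decode[of UNIV] by (simp add: inj_on_eq_iff)
    then consider "fst (prod_decode p) \<noteq> fst (prod_decode q)" | "snd (prod_decode p) \<noteq> snd (prod_decode q)"
      by (auto simp: prod_eq_iff)
    then show "B p \<inter> B q = {}"
    proof cases
      case 1
      then have "disjointed L (fst (prod_decode p)) \<inter> disjointed L (fst (prod_decode q)) = {}"
        using disjoint_family_disjointed[of L] by (simp add: disjoint_family_on_def)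
      then show ?thesis by (auto simp: B_def)
    qed (auto simp: B_def)
  qed
  moreover have "(\<Union>q. B q) = space R"
  proof -
    have "w \<in> (\<Union>q. B q)" for w
    proof -
      have "jump_point w \<in> (\<Union>m. disjointed L m)" unfolding UN_disjointed_eq UL by simp
      then obtain m where "jump_point w \<in> disjointed L m" by blast
      then have "w \<in> B (prod_encode (m, nat \<lfloor>1 / snd w\<rfloor>))" by (simp add: B_def)
      then show ?thesis by blast
    qed
    then show ?thesis using spR by blast
  qed
  moreover have "emeasure R (B q) < \<infinity>" for q
  proof -
    obtain m j where q: "prod_decode q = (m, j)" by (cases "prod_decode q")
    let ?T = "{s \<in> space (nu l). s \<ge> 1 / real (Suc j)}"
    have T: "?T \<in> sets (nu l)"
    proof -
      have "{1 / real (Suc j)..} \<inter> {0<..} \<in> sets (nu l)" unfolding sets_nu by (auto simp: sets_restrict_space)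
      moreover have "{1 / real (Suc j)..} \<inter> {0<..} = ?T" by (auto simp: space_nu)
      ultimately show ?thesis by (simp only:)
    qed
    have Lm: "L m \<in> sets \<sigma>" using exhaustion_sets(2) by (simp add: sets_radon[OF atlas radon])
    have "emeasure R (B q) = emeasure (\<sigma> \<Otimes>\<^sub>M nu l) (jump_code -` B q \<inter> space (\<sigma> \<Otimes>\<^sub>M nu l))" by (rule eR[OF B])
    also have "\<dots> \<le> emeasure (\<sigma> \<Otimes>\<^sub>M nu l) (L m \<times> ?T)"
    proof (rule emeasure_mono)
      show "jump_code -` B q \<inter> space (\<sigma> \<Otimes>\<^sub>M nu l) \<subseteq> L m \<times> ?T"
      proof
        fix z assume z: "z \<in> jump_code -` B q \<inter> space (\<sigma> \<Otimes>\<^sub>M nu l)"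
        then have zs: "z \<in> space (\<sigma> \<Otimes>\<^sub>M nu l)" by blast
        note c = jump_code_simps[OF zs]
        have "fst z \<in> disjointed L m" and j: "nat \<lfloor>1 / snd z\<rfloor> = j" using z by (simp_all add: B_def q c)
        then have "fst z \<in> L m" using disjointed_subset[of L m] by blast
        moreover have "1 / snd z < real (Suc j)"
        proof -
          have "1 / snd z < of_int \<lfloor>1 / snd z\<rfloor> + 1" by (rule floor_correct[THEN conjunct2, simplified])
          also have "of_int \<lfloor>1 / snd z\<rfloor> = real j" using c(1) by (simp flip: j)
          finally show ?thesis by simp
        qed
        then have "1 / real (Suc j) \<le> snd z" using c(1) by (simp add: field_simps)
        moreover have "snd z \<in> space (nu l)" using zs by (auto simp: space_pair_measure)
        ultimately show "z \<in> L m \<times> ?T" by (simp add: mem_Times_iff)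
      qed
    qed (rule pair_measureI[OF Lm T])
    also have "\<dots> = emeasure \<sigma> (L m) * emeasure (nu l) ?T" by (rule M2.emeasure_pair_measure_Times[OF Lm T])
    also have "\<dots> < \<infinity>"
      using radon_compact[OF atlas radon L(1)[of m]] nu_tail_finite[OF l, of "1 / real (Suc j)"] by (simp add: ennreal_mult_less_top)
    finally show ?thesis .
  qed
  \<comment> \<open>Jumps have positive size, so none of them is coded by the cemetery point
    0.\<close>
  moreover have "emeasure R {0} = 0"
  proof -
    have "jump_code -` {0} \<inter> space (\<sigma> \<Otimes>\<^sub>M nu l) = {}"
    proof (rule equals0I)
      fix z assume z: "z \<in> jump_code -` {0} \<inter> space (\<sigma> \<Otimes>\<^sub>M nu l)"
      then have "snd (jump_code z) = 0" by simp
      then show False using jump_code_simps(1,4)[of z] z by simp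
    qed
    then show ?thesis by (subst eR) auto
  qed
  ultimately have "\<exists>P. prob_space P \<and> sets P = sets (\<Pi>\<^sub>M i\<in>(UNIV::nat set). \<Pi>\<^sub>M k\<in>(UNIV::nat set). R) \<and>
    (\<forall>g\<in>borel_measurable R. g 0 = 0 \<longrightarrow> (\<integral>\<^sup>+d. (\<Sum>i. \<Sum>k. g (d i k)) \<partial>P) = (\<integral>\<^sup>+w. g w \<partial>R)) \<and>
    (\<forall>g. integrable R g \<longrightarrow> g 0 = (0::real) \<longrightarrow>
      (\<integral>d. exp (\<i> * complex_of_real (\<Sum>i. \<Sum>k. g (d i k))) \<partial>P) = exp (\<integral>w. exp (\<i> * complex_of_real (g w)) - 1 \<partial>R)) \<and>
    (emeasure R (space R) = \<infinity> \<longrightarrow> (AE d in P. \<exists>i k. d i k \<noteq> 0))"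
    by (intro poisson_cloud[of B]) (use B sR spR in auto)
  then obtain P where P: "prob_space P" "sets P = sets (\<Pi>\<^sub>M i\<in>(UNIV::nat set). \<Pi>\<^sub>M k\<in>(UNIV::nat set). R)"
    and C: "\<forall>g\<in>borel_measurable R. g 0 = 0 \<longrightarrow> (\<integral>\<^sup>+d. (\<Sum>i. \<Sum>k. g (d i k)) \<partial>P) = (\<integral>\<^sup>+w. g w \<partial>R)"
    and F: "\<forall>g. integrable R g \<longrightarrow> g 0 = (0::real) \<longrightarrow>
      (\<integral>d. exp (\<i> * complex_of_real (\<Sum>i. \<Sum>k. g (d i k))) \<partial>P) = exp (\<integral>w. exp (\<i> * complex_of_real (g w)) - 1 \<partial>R)"
    and N: "emeasure R (space R) = \<infinity> \<longrightarrow> (AE d in P. \<exists>i k. d i k \<noteq> 0)"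
    by (elim exE conjE) (rule that)
  have "sets P = sets (\<Pi>\<^sub>M i\<in>(UNIV::nat set). (borel :: (nat \<Rightarrow> ((real ^ 'n) \<times> real) \<times> real) measure))"
    unfolding P(2)
  proof (intro sets_PiM_cong refl)
    fix i :: nat
    have "sets (\<Pi>\<^sub>M k\<in>(UNIV::nat set). R) = sets (\<Pi>\<^sub>M k\<in>(UNIV::nat set). (borel :: (((real ^ 'n) \<times> real) \<times> real) measure))"
      using sR by (intro sets_PiM_cong) auto
    then show "sets (\<Pi>\<^sub>M k\<in>(UNIV::nat set). R) = sets (borel :: (nat \<Rightarrow> ((real ^ 'n) \<times> real) \<times> real) measure)"
      by (simp only: sets_PiM_equal_borel)
  qed
  then have "sets P = sets borel" by (simp only: sets_PiM_equal_borel)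
  moreover have "(\<integral>\<^sup>+c. (\<Sum>i. \<Sum>k. g (c i k)) \<partial>P) = (\<integral>\<^sup>+z. g (jump_code z) \<partial>(\<sigma> \<Otimes>\<^sub>M nu l))"
    if g: "g \<in> borel_measurable borel" "g 0 = 0" for g
  proof -
    have "(\<integral>\<^sup>+c. (\<Sum>i. \<Sum>k. g (c i k)) \<partial>P) = (\<integral>\<^sup>+w. g w \<partial>R)"
      using C[THEN bspec, of g, THEN mp, OF _ g(2)] g(1) mR by blast
    also have "\<dots> = (\<integral>\<^sup>+z. g (jump_code z) \<partial>(\<sigma> \<Otimes>\<^sub>M nu l))"
      unfolding R_def by (rule nn_integral_distr[OF code]) (simp add: g(1))
    finally show ?thesis .
  qed
  moreover have "(\<integral>c. exp (\<i> * complex_of_real (\<Sum>i. \<Sum>k. g (c i k))) \<partial>P) =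
        exp (\<integral>z. exp (\<i> * complex_of_real (g (jump_code z))) - 1 \<partial>(\<sigma> \<Otimes>\<^sub>M nu l))"
    if g: "g \<in> borel_measurable borel" "integrable (\<sigma> \<Otimes>\<^sub>M nu l) (\<lambda>z. g (jump_code z))" "g 0 = 0" for g :: "_ \<Rightarrow> real"
  proof -
    have "integrable R g" unfolding R_def using g(2) by (subst integrable_distr_eq[OF code g(1)])
    from F[THEN spec, THEN mp, OF this, THEN mp, OF g(3)]
    have "(\<integral>c. exp (\<i> * complex_of_real (\<Sum>i. \<Sum>k. g (c i k))) \<partial>P) = exp (\<integral>w. exp (\<i> * complex_of_real (g w)) - 1 \<partial>R)" .
    also have "(\<integral>w. exp (\<i> * complex_of_real (g w)) - 1 \<partial>R) = (\<integral>z. exp (\<i> * complex_of_real (g (jump_code z))) - 1 \<partial>(\<sigma> \<Otimes>\<^sub>M nu l))"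
      unfolding R_def
    proof (rule integral_distr[OF code])
      note [measurable] = g(1)
      show "(\<lambda>w. exp (\<i> * complex_of_real (g w)) - 1) \<in> borel_measurable borel" by measurable
    qed
    finally show ?thesis .
  qed
  moreover have "emeasure R (space R) = emeasure (\<sigma> \<Otimes>\<^sub>M nu l) (space (\<sigma> \<Otimes>\<^sub>M nu l))"
    unfolding spR by (subst eR) auto
  ultimately show ?thesis using P(1) N by (intro exI[of _ P]) simp
qed

end

text \<open>Each cloud \<open>c\<close> defines a measure \<open>M c\<close>, and equal Fourier
  transforms give its pairings with a dense sequence the law of those of \<omega>. Therefore almost
  every \<omega> agrees on the sequence with some locally finite cloud, and then everywhere. The
  clause on infinite mass records that such a cloud can be chosen with a positive weight.\<close>

lemma levy_khintchine_concentration: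
  fixes \<A> :: "('a::{t2_space, second_countable_topology}, 'n::finite) chart set" and \<sigma> :: "'a measure" and l :: real
  assumes atlas: "oriented_atlas \<A>" and radon: "radon_measure \<sigma>" and l: "l \<ge> 2"
    and prob: "prob_space \<mu>" and dual: "space \<mu> \<subseteq> dual_space \<A>" and lk: "levy_khintchine \<A> \<sigma> (nu l) \<mu>"
    and eval_meas: "\<forall>\<xi>\<in>test_functions \<A>. (\<lambda>\<omega>. \<omega> \<xi>) \<in> borel_measurable \<mu>"
  shows "AE \<omega> in \<mu>. \<exists>(a :: nat \<times> nat \<Rightarrow> real) x. (\<forall>i. a i \<ge> 0) \<and>
    (emeasure (\<sigma> \<Otimes>\<^sub>M nu l) (space (\<sigma> \<Otimes>\<^sub>M nu l)) = \<infinity> \<longrightarrow> (\<exists>i. a i > 0)) \<and>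
    (\<forall>K. compact K \<longrightarrow> emeasure (weighted_diracs a x) K < \<infinity>) \<and> \<omega> = functional_of_measure \<A> (weighted_diracs a x)"
proof -
  interpret pair_sigma_finite \<sigma> "nu l" by (rule pair_sigma_finite_radon_nu[OF atlas radon l])
  note meas = bspec[OF eval_meas]
  from measurable_chart_coding[OF atlas] obtain cc :: "nat \<Rightarrow> ('a, 'n) chart" and L and e :: "'a \<Rightarrow> (real ^ 'n) \<times> real" and d where
    "(\<forall>m. cc m \<in> \<A>) \<and> (\<forall>m. compact (L m)) \<and> (\<forall>m. L m \<subseteq> fst (cc m)) \<and> (\<Union>m. interior (L m)) = UNIV \<and>
    e \<in> borel_measurable borel \<and> d \<in> borel_measurable borel \<and> (\<forall>x. d (e x) = x)"
    by (elim exE) (rule that)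
  then have cL: "\<And>m. cc m \<in> \<A>" "\<And>m. compact (L m)" "\<And>m. L m \<subseteq> fst (cc m)" "(\<Union>m. interior (L m)) = UNIV"
    and e: "e \<in> borel_measurable borel" and d: "d \<in> borel_measurable borel" and de: "\<And>x. d (e x) = x"
    by blast+
  note ctx = atlas radon l cL(2,4) e d de
  define code where "code = (jump_code e :: 'a \<times> real \<Rightarrow> _)"
  define sz where "sz = (jump_size :: ((real ^ 'n) \<times> real) \<times> real \<Rightarrow> real)"
  define pt where "pt = (jump_point d :: ((real ^ 'n) \<times> real) \<times> real \<Rightarrow> 'a)"
  have szm: "sz \<in> borel_measurable borel" unfolding sz_def by (rule measurable_jump_size[OF ctx])
  have ptm: "pt \<in> borel_measurable borel" unfolding pt_def by (rule measurable_jump_point[OF ctx])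
  have codez: "snd z > 0" "sz (code z) = snd z" "pt (code z) = fst z" "snd (code z) = snd z"
    if "z \<in> space (\<sigma> \<Otimes>\<^sub>M nu l)" for z
    unfolding sz_def pt_def code_def using jump_code_simps[OF ctx that] by simp_all
  have sz0: "sz 0 = 0" by (simp add: sz_def jump_size_def[OF ctx])
  have sz_nonneg: "sz w \<ge> 0" for w by (simp add: sz_def jump_size_def[OF ctx])
  from jump_cloud[OF ctx, folded code_def] obtain P :: "(nat \<Rightarrow> nat \<Rightarrow> ((real ^ 'n) \<times> real) \<times> real) measure" where
    P: "prob_space P" "sets P = sets borel" and
    C: "\<forall>g\<in>borel_measurable borel. g 0 = 0 \<longrightarrow>
      (\<integral>\<^sup>+c. (\<Sum>i. \<Sum>k. g (c i k)) \<partial>P) = (\<integral>\<^sup>+z. g (code z) \<partial>(\<sigma> \<Otimes>\<^sub>M nu l))" and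
    F: "\<forall>g\<in>borel_measurable borel. integrable (\<sigma> \<Otimes>\<^sub>M nu l) (\<lambda>z. g (code z)) \<longrightarrow> g 0 = (0::real) \<longrightarrow>
      (\<integral>c. exp (\<i> * complex_of_real (\<Sum>i. \<Sum>k. g (c i k))) \<partial>P) =
        exp (\<integral>z. exp (\<i> * complex_of_real (g (code z))) - 1 \<partial>(\<sigma> \<Otimes>\<^sub>M nu l))" and
    N: "emeasure (\<sigma> \<Otimes>\<^sub>M nu l) (space (\<sigma> \<Otimes>\<^sub>M nu l)) = \<infinity> \<longrightarrow> (AE c in P. \<exists>i k. c i k \<noteq> 0)"
    by (elim exE conjE) (rule that)
  interpret P: prob_space P by (rule P(1))
  have coord: "(\<lambda>c. c i k) \<in> measurable P borel" for i k
  proof -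
    have "continuous_on UNIV (\<lambda>c :: nat \<Rightarrow> nat \<Rightarrow> ((real ^ 'n) \<times> real) \<times> real. c i k)"
      by (rule continuous_on_product_then_coordinatewise, rule continuous_on_product_coordinates)
    then have "(\<lambda>c :: nat \<Rightarrow> nat \<Rightarrow> ((real ^ 'n) \<times> real) \<times> real. c i k) \<in> borel_measurable borel"
      by (rule borel_measurable_continuous_onI)
    then show ?thesis using measurable_cong_sets[OF P(2) refl] by blast
  qed
  define a where "a c p = sz (c (fst p) (snd p))" for c :: "nat \<Rightarrow> nat \<Rightarrow> ((real ^ 'n) \<times> real) \<times> real" and p :: "nat \<times> nat"
  define y where "y c p = pt (c (fst p) (snd p))" for c :: "nat \<Rightarrow> nat \<Rightarrow> ((real ^ 'n) \<times> real) \<times> real" and p :: "nat \<times> nat"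
  define M where "M c = weighted_diracs (a c) (y c)" for c
  have sM: "sets (M c) = sets borel" for c by (simp add: M_def)
  have a_nonneg: "a c p \<ge> 0" for c p by (simp add: a_def sz_nonneg)
  define fin where "fin c \<longleftrightarrow> (\<forall>N. emeasure (M c) (\<Union>m<N. L m) \<noteq> \<infinity>)" for c
  have Lb: "(\<Union>m<N. L m) \<in> sets borel" for N using compact_imp_closed[OF cL(2)] by auto
  have AE_fin: "AE c in P. fin c"
  proof -
    have "AE c in P. emeasure (M c) (\<Union>m<N. L m) \<noteq> \<infinity>" for N
    proof -
      let ?K = "\<Union>m<N. L m"
      define f where "f w = ennreal (sz w) * indicator ?K (pt w)" for w
      have fm: "f \<in> borel_measurable borel"
        unfolding f_def by (intro borel_measurable_times_ennreal measurable_compose[OF szm measurable_ennreal]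
            measurable_compose[OF ptm borel_measurable_indicator] Lb)
      have f0: "f 0 = 0" by (simp add: f_def sz0)
      have K: "?K \<in> sets \<sigma>" using Lb by (simp add: sets_radon[OF atlas radon])
      have eM: "emeasure (M c) ?K = (\<Sum>i. \<Sum>k. f (c i k))" for c
        unfolding M_def emeasure_weighted_diracs[OF Lb] nn_integral_count_space_nat_nat by (simp add: f_def a_def y_def)
      have "(\<integral>\<^sup>+c. (\<Sum>i. \<Sum>k. f (c i k)) \<partial>P) = (\<integral>\<^sup>+z. f (code z) \<partial>(\<sigma> \<Otimes>\<^sub>M nu l))"
        by (rule C[THEN bspec, OF fm, THEN mp, OF f0])
      also have "\<dots> = (\<integral>\<^sup>+z. indicator ?K (fst z) * ennreal (snd z) \<partial>(\<sigma> \<Otimes>\<^sub>M nu l))"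
        by (rule nn_integral_cong) (simp add: f_def codez mult.commute)
      also have "\<dots> = (\<integral>\<^sup>+x. \<integral>\<^sup>+s. indicator ?K x * ennreal s \<partial>nu l \<partial>\<sigma>)"
      proof -
        have "(\<lambda>z. indicator ?K (fst z) * ennreal (snd z)) \<in> borel_measurable (\<sigma> \<Otimes>\<^sub>M nu l)"
          by (intro borel_measurable_times_ennreal measurable_compose[OF measurable_fst borel_measurable_indicator] K
              measurable_compose[OF measurable_snd] measurable_nu) simp
        from M2.nn_integral_fst[OF this] show ?thesis by simp
      qed
      also have "\<dots> = (\<integral>\<^sup>+x. indicator ?K x * (\<integral>\<^sup>+s. ennreal s \<partial>nu l) \<partial>\<sigma>)"
        by (intro nn_integral_cong nn_integral_cmult measurable_nu) simp
      also have "\<dots> = emeasure \<sigma> ?K * (\<integral>\<^sup>+s. ennreal s \<partial>nu l)"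
        by (subst nn_integral_multc[OF borel_measurable_indicator[OF K]]) (simp only: nn_integral_indicator[OF K])
      also have "\<dots> < \<infinity>"
      proof -
        have "compact ?K" using cL(2) by (intro compact_UN) auto
        from radon_compact[OF atlas radon this] show ?thesis using levy_nu(1)[OF l] by (simp add: ennreal_mult_less_top)
      qed
      finally have fi: "(\<integral>\<^sup>+c. (\<Sum>i. \<Sum>k. f (c i k)) \<partial>P) \<noteq> \<infinity>" by simp
      have "(\<lambda>c. \<Sum>i. \<Sum>k. f (c i k)) \<in> borel_measurable P"
        by (intro borel_measurable_suminf_order measurable_compose[OF coord fm])
      from nn_integral_PInf_AE[OF this fi] show ?thesis by (simp add: eM)
    qed
    then show ?thesis unfolding fin_def by (rule AE_all_countable[THEN iffD2, OF allI])
  qed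
  \<comment> \<open>The iterated series is measurable in the cloud without restriction, but it is
    known to be the integral against \<open>M c\<close> only if \<open>fin c\<close> holds, which is
    the case almost surely.\<close>
  define Z where "Z \<phi> c = (\<Sum>i. \<Sum>k. sz (c i k) * \<phi> (pt (c i k)))" for \<phi> c
  have jm: "(\<lambda>w. sz w * \<phi> (pt w)) \<in> borel_measurable borel" if "\<phi> \<in> test_functions \<A>" for \<phi>
    by (intro borel_measurable_times szm measurable_compose[OF ptm test_measurable[OF atlas that]])
  have Zm: "Z \<phi> \<in> borel_measurable P" if "\<phi> \<in> test_functions \<A>" for \<phi>
    unfolding Z_def[abs_def] by (intro borel_measurable_suminf measurable_compose[OF coord jm[OF that]])
  have ZM: "Z \<phi> c = (\<integral>x. \<phi> x \<partial>M c)" "integrable (M c) \<phi>" if p: "\<phi> \<in> test_functions \<A>" and c: "fin c" for \<phi> c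
  proof -
    note pm = test_measurable[OF atlas p]
    show i: "integrable (M c) \<phi>"
      by (rule integrable_test_exhausted[OF atlas cL sM c[unfolded fin_def, THEN spec] p])
    then have "integrable (count_space UNIV) (\<lambda>p. a c p * \<phi> (y c p))"
      unfolding M_def by (simp only: integral_weighted_diracs(2)[OF pm a_nonneg])
    from integral_count_space_nat_nat[OF this] integral_weighted_diracs(1)[where a="a c" and x="y c", OF pm a_nonneg]
    show "Z \<phi> c = (\<integral>x. \<phi> x \<partial>M c)" by (simp add: Z_def M_def a_def y_def)
  qed
  have char: "(\<integral>c. exp (\<i> * complex_of_real (Z \<phi> c)) \<partial>P) = (\<integral>\<omega>. exp (\<i> * complex_of_real (\<omega> \<phi>)) \<partial>\<mu>)"
    if p: "\<phi> \<in> test_functions \<A>" for \<phi>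
  proof -
    obtain \<epsilon> where eps: "\<epsilon> > 0" "integrable (\<sigma> \<Otimes>\<^sub>M nu l) (\<lambda>z. \<bar>snd z * \<phi> (fst z)\<bar> * exp (\<epsilon> * \<bar>snd z * \<phi> (fst z)\<bar>))"
      using integrable_jump_exp[OF atlas radon l p] by blast
    have "integrable (\<sigma> \<Otimes>\<^sub>M nu l) (\<lambda>z. (snd z * \<phi> (fst z)) ^ Suc 0)"
      by (rule integrable_power_of_exp[OF measurable_jump[OF atlas radon l p] eps(2,1)])
    then have i: "integrable (\<sigma> \<Otimes>\<^sub>M nu l) (\<lambda>z. snd z * \<phi> (fst z))" by (simp only: power_Suc0_right)
    have "integrable (\<sigma> \<Otimes>\<^sub>M nu l) (\<lambda>z. sz (code z) * \<phi> (pt (code z)))"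
      by (rule Bochner_Integration.integrable_cong[THEN iffD1, OF refl _ i]) (simp add: codez)
    from F[THEN bspec, OF jm[OF p], THEN mp, OF this]
    have "(\<integral>c. exp (\<i> * complex_of_real (Z \<phi> c)) \<partial>P) =
        exp (\<integral>z. exp (\<i> * complex_of_real (sz (code z) * \<phi> (pt (code z)))) - 1 \<partial>(\<sigma> \<Otimes>\<^sub>M nu l))"
      unfolding Z_def using sz0 by simp
    also have "\<dots> = exp (\<integral>z. exp (\<i> * complex_of_real (snd z * \<phi> (fst z))) - 1 \<partial>(\<sigma> \<Otimes>\<^sub>M nu l))"
      by (intro arg_cong[where f=exp] Bochner_Integration.integral_cong refl) (simp add: codez)
    also have "\<dots> = (\<integral>\<omega>. exp (\<i> * complex_of_real (\<omega> \<phi>)) \<partial>\<mu>)"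
      using lk[unfolded levy_khintchine_def, THEN bspec, OF p] by (rule sym)
    finally show ?thesis .
  qed
  obtain \<Phi> :: "nat \<Rightarrow> 'a \<Rightarrow> real" where Phi: "\<And>k. \<Phi> k \<in> test_functions \<A>"
    and dense: "\<And>\<phi>. \<phi> \<in> test_functions \<A> \<Longrightarrow> \<exists>k. test_tendsto \<A> (\<lambda>j. \<Phi> (k j)) \<phi>"
  proof (rule dense_test_sequence[OF atlas])
    fix \<Psi> :: "nat \<Rightarrow> 'a \<Rightarrow> real"
    assume "\<And>k. \<Psi> k \<in> test_functions \<A>"
      and "\<And>\<phi>. \<phi> \<in> test_functions \<A> \<Longrightarrow> \<exists>k. test_tendsto \<A> (\<lambda>j. \<Psi> (k j)) \<phi>"
    then show thesis by (rule that)
  qed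
  have comb: "(\<lambda>x. \<Sum>j<m. t j * \<Phi> j x) \<in> test_functions \<A>" for t m
    by (rule test_sum[OF atlas]) (rule test_scale[OF atlas Phi])
  have law: "distr P (\<Pi>\<^sub>M j\<in>UNIV. borel) (\<lambda>c j. Z (\<Phi> j) c) = distr \<mu> (\<Pi>\<^sub>M j\<in>UNIV. borel) (\<lambda>\<omega> j. \<omega> (\<Phi> j))"
  proof (rule fourier_unique_sequence[OF P(1) prob Zm[OF Phi] meas[OF Phi]])
    fix m and t :: "nat \<Rightarrow> real"
    let ?\<phi> = "\<lambda>x. \<Sum>j<m. t j * \<Phi> j x"
    \<comment> \<open>Rearranging the series requires integrability, so linearity in the test
      function is available for almost every cloud; for \<omega> it holds identically.\<close>
    have lin: "AE c in P. (\<Sum>j<m. t j * Z (\<Phi> j) c) = Z ?\<phi> c"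
      using AE_fin
    proof eventually_elim
      case (elim c)
      have "(\<Sum>j<m. t j * Z (\<Phi> j) c) = (\<Sum>j<m. \<integral>x. t j * \<Phi> j x \<partial>M c)" by (simp add: ZM(1)[OF Phi elim])
      also have "\<dots> = (\<integral>x. ?\<phi> x \<partial>M c)"
        by (rule Bochner_Integration.integral_sum[symmetric]) (intro integrable_mult_right ZM(2)[OF Phi elim])
      also have "\<dots> = Z ?\<phi> c" by (rule ZM(1)[OF comb elim, symmetric])
      finally show ?case .
    qed
    have "(\<integral>c. exp (\<i> * complex_of_real (\<Sum>j<m. t j * Z (\<Phi> j) c)) \<partial>P) = (\<integral>c. exp (\<i> * complex_of_real (Z ?\<phi> c)) \<partial>P)"
    proof (rule integral_cong_AE)
      note [measurable] = Zm[OF Phi] Zm[OF comb]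
      show "(\<lambda>c. exp (\<i> * complex_of_real (\<Sum>j<m. t j * Z (\<Phi> j) c))) \<in> borel_measurable P" by measurable
      show "(\<lambda>c. exp (\<i> * complex_of_real (Z ?\<phi> c))) \<in> borel_measurable P" by measurable
      show "AE c in P. exp (\<i> * complex_of_real (\<Sum>j<m. t j * Z (\<Phi> j) c)) = exp (\<i> * complex_of_real (Z ?\<phi> c))"
        using lin by eventually_elim simp
    qed
    also have "\<dots> = (\<integral>\<omega>. exp (\<i> * complex_of_real (\<omega> ?\<phi>)) \<partial>\<mu>)" by (rule char[OF comb])
    also have "\<dots> = (\<integral>\<omega>. exp (\<i> * complex_of_real (\<Sum>j<m. t j * \<omega> (\<Phi> j))) \<partial>\<mu>)"
    proof (rule Bochner_Integration.integral_cong[OF refl])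
      fix \<omega> assume "\<omega> \<in> space \<mu>"
      then have "\<omega> \<in> dual_space \<A>" using dual by blast
      from dual_space_sum[OF atlas this Phi, where m=m and t=t]
      show "exp (\<i> * complex_of_real (\<omega> ?\<phi>)) = exp (\<i> * complex_of_real (\<Sum>j<m. t j * \<omega> (\<Phi> j)))" by simp
    qed
    finally show "(\<integral>c. exp (\<i> * complex_of_real (\<Sum>j<m. t j * Z (\<Phi> j) c)) \<partial>P) =
      (\<integral>\<omega>. exp (\<i> * complex_of_real (\<Sum>j<m. t j * \<omega> (\<Phi> j))) \<partial>\<mu>)" .
  qed
  define infinite_mass where "infinite_mass \<longleftrightarrow> emeasure (\<sigma> \<Otimes>\<^sub>M nu l) (space (\<sigma> \<Otimes>\<^sub>M nu l)) = \<infinity>"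
  have "AE c in P. infinite_mass \<longrightarrow> (\<exists>i. a c i > 0)"
  proof (cases infinite_mass)
    case True
    \<comment> \<open>An entry other than 0 might still have size at most 0, hence weight 0.
      Campbell's formula for the indicator of such codes excludes them almost surely, because the
      intensity lives on positive sizes.\<close>
    define f :: "((real ^ 'n) \<times> real) \<times> real \<Rightarrow> ennreal" where "f = indicator {w. w \<noteq> 0 \<and> snd w \<le> 0}"
    have "{w :: ((real ^ 'n) \<times> real) \<times> real. w \<noteq> 0 \<and> snd w \<le> 0} = {w. snd w \<le> 0} - {0}" by auto
    moreover have "closed {w :: ((real ^ 'n) \<times> real) \<times> real. snd w \<le> 0}"
      by (intro closed_Collect_le continuous_on_snd continuous_on_id continuous_on_const)
    ultimately have "{w :: ((real ^ 'n) \<times> real) \<times> real. w \<noteq> 0 \<and> snd w \<le> 0} \<in> sets borel" by auto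
    then have fm: "f \<in> borel_measurable borel" unfolding f_def by simp
    have f0: "f 0 = 0" by (simp add: f_def)
    have "(\<integral>\<^sup>+c. (\<Sum>i. \<Sum>k. f (c i k)) \<partial>P) = (\<integral>\<^sup>+z. f (code z) \<partial>(\<sigma> \<Otimes>\<^sub>M nu l))"
      by (rule C[THEN bspec, OF fm, THEN mp, OF f0])
    also have "\<dots> = (\<integral>\<^sup>+z. 0 \<partial>(\<sigma> \<Otimes>\<^sub>M nu l))"
      by (rule nn_integral_cong) (auto simp: f_def codez indicator_def not_le)
    finally have fi: "(\<integral>\<^sup>+c. (\<Sum>i. \<Sum>k. f (c i k)) \<partial>P) = 0" by simp
    have "(\<lambda>c. \<Sum>i. \<Sum>k. f (c i k)) \<in> borel_measurable P"
      by (intro borel_measurable_suminf_order measurable_compose[OF coord fm])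
    then have "AE c in P. (\<Sum>i. \<Sum>k. f (c i k)) = 0" using fi by (simp add: nn_integral_0_iff_AE)
    moreover have "AE c in P. \<exists>i k. c i k \<noteq> 0" using N True by (simp add: infinite_mass_def)
    ultimately show ?thesis
    proof eventually_elim
      case (elim c)
      obtain i k where ik: "c i k \<noteq> 0" using elim(2) by blast
      have "f (c i k) = 0" using elim(1) by (simp add: suminf_eq_zero_iff)
      then have "snd (c i k) > 0" using ik by (simp add: f_def indicator_def not_le split: if_splits)
      then have "a c (i, k) > 0" by (simp add: a_def sz_def jump_size_def[OF ctx])
      then show ?case by blast
    qed
  qed simp
  then have "AE c in P. fin c \<and> (infinite_mass \<longrightarrow> (\<exists>i. a c i > 0))" using AE_fin by eventually_elim blast
  from AE_exists_of_equal_law[OF P Zm[OF Phi] prob meas[OF Phi] this law]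
  have "AE \<omega> in \<mu>. \<exists>c. (fin c \<and> (infinite_mass \<longrightarrow> (\<exists>i. a c i > 0))) \<and> (\<forall>j. \<omega> (\<Phi> j) = Z (\<Phi> j) c)" .
  then have "AE \<omega> in \<mu>. \<exists>(a :: nat \<times> nat \<Rightarrow> real) x. (\<forall>i. a i \<ge> 0) \<and>
    (infinite_mass \<longrightarrow> (\<exists>i. a i > 0)) \<and>
    (\<forall>K. compact K \<longrightarrow> emeasure (weighted_diracs a x) K < \<infinity>) \<and> \<omega> = functional_of_measure \<A> (weighted_diracs a x)"
  proof (rule AE_mp[OF _ AE_I2], intro impI)
    fix \<omega> assume w: "\<omega> \<in> space \<mu>" and "\<exists>c. (fin c \<and> (infinite_mass \<longrightarrow> (\<exists>i. a c i > 0))) \<and> (\<forall>j. \<omega> (\<Phi> j) = Z (\<Phi> j) c)"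
    then obtain c where c: "fin c" "infinite_mass \<longrightarrow> (\<exists>i. a c i > 0)" "\<forall>j. \<omega> (\<Phi> j) = Z (\<Phi> j) c" by (elim exE conjE) (rule that)
    have eq: "\<omega> (\<Phi> j) = (\<integral>x. \<Phi> j x \<partial>M c)" for j using c(3) ZM(1)[OF Phi c(1)] by simp
    have wd: "\<omega> \<in> dual_space \<A>" using w dual by blast
    have "\<omega> = functional_of_measure \<A> (M c)"
      by (rule dual_eq_functional_of_measure[OF atlas cL sM c(1)[unfolded fin_def, THEN spec] wd Phi dense eq])
    moreover have "emeasure (M c) K < \<infinity>" if "compact K" for K
      by (rule finite_on_compact[OF atlas cL sM c(1)[unfolded fin_def, THEN spec] that])
    ultimately show "\<exists>(a :: nat \<times> nat \<Rightarrow> real) x. (\<forall>i. a i \<ge> 0) \<and> (infinite_mass \<longrightarrow> (\<exists>i. a i > 0)) \<and>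
      (\<forall>K. compact K \<longrightarrow> emeasure (weighted_diracs a x) K < \<infinity>) \<and> \<omega> = functional_of_measure \<A> (weighted_diracs a x)"
      using c(2) a_nonneg unfolding M_def by (intro exI[of _ "a c"] exI[of _ "y c"] conjI allI impI) simp_all
  qed
  then show ?thesis by (simp only: infinite_mass_def)
qed

theorem corollary2p3:
  fixes \<A> :: "('a::{t2_space, second_countable_topology}, 'n::finite) chart set"
    and G :: "('a, 'n) chart \<Rightarrow> 'a \<Rightarrow> real ^ 'n \<Rightarrow> real ^ 'n \<Rightarrow> real"
    and \<sigma> :: "'a measure"
    and l :: real
    and \<mu> :: "(('a \<Rightarrow> real) \<Rightarrow> real) measure"
    and I :: "'a fock \<Rightarrow> (('a \<Rightarrow> real) \<Rightarrow> real) \<Rightarrow> complex"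
  assumes "oriented_atlas \<A>"
    and "riemannian_metric \<A> G" and "riemannian_complete \<A> G"
    and "connected (UNIV :: 'a set)" and "\<not> compact (UNIV :: 'a set)"
    and "radon_measure \<sigma>" and "non_atomic \<sigma>" and "non_degenerate \<sigma>"
    and "l \<ge> 2"
    and "spectral_pair \<A> \<sigma> l \<mu> I"
  shows "compound_poisson \<A> \<sigma> \<mu> \<and> levy_measure (nu l) \<and> levy_khintchine \<A> \<sigma> (nu l) \<mu> \<and>
    (AE \<omega> in \<mu>. \<omega> \<in> insert (\<lambda>\<phi>\<in>test_functions \<A>. 0) (discrete_radon \<A>)) \<and>
    (l = 2 \<or> emeasure \<sigma> UNIV = \<infinity> \<longrightarrow> (AE \<omega> in \<mu>. \<omega> \<in> discrete_radon \<A>))"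
proof -
  note atlas = assms(1) and radon = assms(6) and l = assms(9) and sp = assms(10)
  interpret pair_sigma_finite \<sigma> "nu l" by (rule pair_sigma_finite_radon_nu[OF atlas radon l])
  have prob: "prob_space \<mu>" and sets: "sets \<mu> = sets (cylinder_algebra \<A>)"
    using sp unfolding spectral_pair_def by (rule conjunct1, rule conjunct1[OF conjunct2])
  note lk = spectral_levy_khintchine(1)[OF atlas radon l sp]
  have meas: "\<forall>\<xi>\<in>test_functions \<A>. (\<lambda>\<omega>. \<omega> \<xi>) \<in> borel_measurable \<mu>"
    using spectral_levy_khintchine(2)[OF atlas radon l sp] by (rule ballI)
  have cp: "compound_poisson \<A> \<sigma> \<mu>"
    unfolding compound_poisson_def using prob sets levy_nu(2)[OF l] lk by (intro conjI exI[of _ "nu l"])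
  have dual: "space \<mu> \<subseteq> dual_space \<A>"
    unfolding sets_eq_imp_space_eq[OF sets] cylinder_algebra_def by (simp add: space_measure_of_conv)
  note conc = levy_khintchine_concentration[OF atlas radon l prob dual lk meas]
  have discrete: "functional_of_measure \<A> (weighted_diracs a x) \<in> discrete_radon \<A>"
    if a: "\<And>i. a i \<ge> 0" "a j > 0" and fin: "\<And>K. compact K \<Longrightarrow> emeasure (weighted_diracs a x) K < \<infinity>"
    for a :: "nat \<times> nat \<Rightarrow> real" and x :: "nat \<times> nat \<Rightarrow> 'a" and j
  proof -
    obtain s y where sy: "\<forall>n. s n > 0" "weighted_diracs a x = dirac_series borel s y"
      using weighted_diracs_eq_dirac_series[of a j x, OF a] by blast
    have "radon_measure (dirac_series borel s y)" by (rule radon_dirac_series) (rule fin[unfolded sy(2)])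
    then show ?thesis unfolding discrete_radon_def sy(2) using sy(1) by blast
  qed
  have zero: "functional_of_measure \<A> (weighted_diracs a x) = (\<lambda>\<phi>\<in>test_functions \<A>. 0)"
    if a: "\<And>i. a i = 0" for a :: "nat \<times> nat \<Rightarrow> real" and x :: "nat \<times> nat \<Rightarrow> 'a"
    unfolding functional_of_measure_def
  proof (rule restrict_ext)
    fix \<phi> assume "\<phi> \<in> test_functions \<A>"
    then have "\<phi> \<in> borel_measurable borel" by (rule test_measurable[OF atlas])
    from integral_weighted_diracs(1)[OF this, of a x] show "(\<integral>x'. \<phi> x' \<partial>weighted_diracs a x) = 0" by (simp add: a)
  qed
  \<comment> \<open>A cloud without positive weights represents the zero measure, which accounts for
    the inserted functional.\<close>
  have 1: "AE \<omega> in \<mu>. \<omega> \<in> insert (\<lambda>\<phi>\<in>test_functions \<A>. 0) (discrete_radon \<A>)"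
    using conc
  proof (rule AE_mp[OF _ AE_I2], intro impI, elim exE conjE)
    fix \<omega> and a :: "nat \<times> nat \<Rightarrow> real" and x :: "nat \<times> nat \<Rightarrow> 'a"
    assume h: "\<forall>i. a i \<ge> 0" "\<forall>K. compact K \<longrightarrow> emeasure (weighted_diracs a x) K < \<infinity>"
      "\<omega> = functional_of_measure \<A> (weighted_diracs a x)"
    show "\<omega> \<in> insert (\<lambda>\<phi>\<in>test_functions \<A>. 0) (discrete_radon \<A>)"
    proof (cases "\<exists>j. a j > 0")
      case True
      then obtain j where "a j > 0" ..
      then have "\<omega> \<in> discrete_radon \<A>" unfolding h(3) by (rule discrete[OF h(1)[THEN spec] _ h(2)[THEN spec, THEN mp]])
      then show ?thesis by (rule insertI2)
    next
      case False
      have "a i = 0" for i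
      proof (rule antisym)
        have "\<not> a i > 0" using False by (intro notI) (erule notE, rule exI)
        then show "a i \<le> 0" by (simp only: not_less)
        show "0 \<le> a i" using h(1) by (rule spec)
      qed
      then have "\<omega> = (\<lambda>\<phi>\<in>test_functions \<A>. 0)" unfolding h(3) by (rule zero)
      then show ?thesis by (rule ssubst) (rule insertI1)
    qed
  qed
  have 2: "AE \<omega> in \<mu>. \<omega> \<in> discrete_radon \<A>" if "l = 2 \<or> emeasure \<sigma> UNIV = \<infinity>"
  proof -
    \<comment> \<open>With 0 times infinity being 0, the finite factor must be kept away from 0:
      non-degeneracy does this for \<sigma> when \<open>l = 2\<close>, and \<open>nu_nonzero\<close>
      does it for \<open>nu l\<close> when \<sigma> is infinite.\<close>
    have "emeasure \<sigma> UNIV > 0" using assms(8) unfolding non_degenerate_def by simp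
    then have s: "emeasure \<sigma> (space \<sigma>) \<noteq> 0" by (simp add: space_radon[OF atlas radon])
    have "emeasure (\<sigma> \<Otimes>\<^sub>M nu l) (space (\<sigma> \<Otimes>\<^sub>M nu l)) = emeasure \<sigma> (space \<sigma>) * emeasure (nu l) (space (nu l))"
      unfolding space_pair_measure by (rule M2.emeasure_pair_measure_Times) (rule sets.top)+
    also have "\<dots> = \<infinity>"
      using that
    proof
      assume "l = 2"
      then show ?thesis using nu_2_infinite s by (simp add: ennreal_mult_top)
    next
      assume "emeasure \<sigma> UNIV = \<infinity>"
      then show ?thesis using nu_nonzero[OF l] by (simp add: space_radon[OF atlas radon] ennreal_top_mult)
    qed
    finally have inf: "emeasure (\<sigma> \<Otimes>\<^sub>M nu l) (space (\<sigma> \<Otimes>\<^sub>M nu l)) = \<infinity>" .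
    show ?thesis
      using conc
    proof (rule AE_mp[OF _ AE_I2], intro impI, elim exE conjE)
      fix \<omega> and a :: "nat \<times> nat \<Rightarrow> real" and x :: "nat \<times> nat \<Rightarrow> 'a"
      assume h: "\<forall>i. a i \<ge> 0" "\<forall>K. compact K \<longrightarrow> emeasure (weighted_diracs a x) K < \<infinity>"
        "\<omega> = functional_of_measure \<A> (weighted_diracs a x)"
        "emeasure (\<sigma> \<Otimes>\<^sub>M nu l) (space (\<sigma> \<Otimes>\<^sub>M nu l)) = \<infinity> \<longrightarrow> (\<exists>i. a i > 0)"
      obtain j where "a j > 0" using mp[OF h(4) inf] ..
      then show "\<omega> \<in> discrete_radon \<A>" unfolding h(3) by (rule discrete[OF h(1)[THEN spec] _ h(2)[THEN spec, THEN mp]])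
    qed
  qed
  show ?thesis using cp levy_nu(2)[OF l] lk 1 2 by (intro conjI impI)
qed

end
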